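(* Consider the sequence of $GI/GI/1+GI$ queues described in the context, and assume that conditions (A1)–(A5) stated there hold, with $p\in(2,\infty)$ the exponent in (A1). For large enough $n$, let $\pi^n$ denote the stationary distribution of the diffusion-scaled process $\widetilde{\mathbb X}^n=(\widetilde\tau^n,\widetilde V^n)=(\sqrt n\,\tau^n,\sqrt n\,V^n)$, let $\pi_0^n(A)=\pi^n(\mathbb R_+\times A)$, $A\in\mathcal B(\mathbb R_+)$, be its marginal on the second coordinate, and let $\widetilde V^n(\infty)$ be a random variable with distribution $\pi^n_0$. Let $V(\infty)$ be a random variable with density $$f(x)=M\exp\left(\frac{2}{\sigma^2}\left(\frac{\theta}{\lambda}x-\int_0^x H(s)\,ds\right)\right),\quad x\ge0,$$ where $\sigma^2=\lambda^{-1}(\operatorname{var}(u_2)+\operatorname{var}(v_2))$ and $M\in(0,\infty)$ is such that $\int_0^\infty f(x)\,dx=1$. Then: (a) $\widetilde V^n(\infty)$ converges in distribution to $V(\infty)$ as $n\to\infty$. (b) For any $m\in(0,p-1)$, $\mathbb E[(\widetilde V^n(\infty))^m]\to\mathbb E[(V(\infty))^m]$ as $n\to\infty$.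
   Context: Model. $\mathbb N=\{1,2,\dots\}$, $\mathbb N_0=\mathbb N\cup\{0\}$, $\mathbb R_+=[0,\infty)$. For each $n\in\mathbb N$ consider a single-server first-in-first-out queue with customer abandonment. On a common probability space there are i.i.d. sequences of nonnegative random variables with unit mean, $\{u_i\}_{i\ge 2}$ and $\{v_i\}_{i\ge 1}$, and for each $n$ an i.i.d. sequence of nonnegative patience times $\{d_i^n\}_{i\ge1}$ with right-continuous distribution function $F^n$; for each $n$ the three sequences $\{u_i\},\{v_i\},\{d^n_i\}$ are mutually independent. Let $\lambda^n,\mu^n>0$. In the $n$-th system the interarrival times are $u_j^n=u_j/\lambda^n$ ($j\ge2$) and the service times are $v_j^n=v_j/\mu^n$ ($j\ge1$). Given an initial state $(\tau_0,v_0)\in\mathbb S=\mathbb R_+\times\mathbb R_+$ (remaining time to the first arrival, and initial offered waiting time), the arrival times are $t_1^n=\tau_0$ and $t_i^n=\tau_0+\sum_{j=2}^i u_j^n$ for $i\ge2$; $t_0^n\le 0$ denotes the time of the last arrival at or before time $0$. Let $A^n(t)=\max\{i\in\mathbb N_0: t_i^n\le t\}$. The $i$-th customer abandons without service if its processing does not begin by time $t_i^n+d_i^n$. The offered waiting time process $V^n$ is the nonnegative process satisfying $$V^n(t)=v_0+\sum_{j=1}^{A^n(t)} v_j^n\,\mathbf 1_{[V^n(t_j^n-)<d_j^n]}-\int_0^t \mathbf 1_{[V^n(s)>0]}\,ds\ \ge 0,\qquad t\ge0$$ (if $t_1^n=0$, $V^n(t_1^n-)$ is read as $v_0$). The remaining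 arrival time is $\tau^n(t)=t_{j+1}^n-t$ for $t\in[t_j^n,t_{j+1}^n)$, $j\in\mathbb N_0$. The process $\mathbb X^n=\{(\tau^n(t),V^n(t)):t\ge0\}$ is a strong Markov process with state space $\mathbb S$. Under (A1)–(A5) below, for all sufficiently large $n$ the process $\mathbb X^n$, hence also $\widetilde{\mathbb X}^n$, has a unique stationary probability distribution. Assumptions. (A1) For some $p\in(2,\infty)$, $\mathbb E[u_2^p+v_2^p]<\infty$. (A2) $\lambda^n=n\lambda$ with $\lambda\in(0,\infty)$, $\lim_{n\to\infty}\mu^n/n=\lambda$, and $\lim_{n\to\infty}\sqrt n\,(\lambda-\mu^n/n)=\theta\in\mathbb R$. (A3) $F^n(0)=0$ for all $n$, and there is a nonnegative continuously differentiable function $H$ on $\mathbb R_+$ such that for each $K>0$, $\lim_{n\to\infty}\sup_{x\in[0,K]}\left|\sqrt n F^n(x/\sqrt n)-H(x)\right|=0$. (A4) $\lim_{x\to\infty}H(x)>\theta/\lambda$. (A5) The interarrival times are unbounded: $\mathbb P(u_2\ge u)>0$ for every $u>0$. *)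

theory Defs
  imports "HOL-Probability.Probability"
begin

section \<open>Sample paths of a single queue\<close>

text \<open>
  The arguments \<open>a\<close>, \<open>s\<close>, \<open>d\<close> are the realised interarrival, service and patience times,
  and \<open>(\<tau>0, v0)\<close> is the initial state. Interarrival times are indexed from 2, the other
  sequences from 1.
\<close>

text \<open>Only the values at \<open>i \<ge> 1\<close> are meaningful. The time of the last arrival at or before time 0
  is never needed; it only serves to put index 0 into the set below.\<close>

definition arrival_time :: "real \<Rightarrow> (nat \<Rightarrow> real) \<Rightarrow> nat \<Rightarrow> real" where
  "arrival_time \<tau>0 a i = \<tau>0 + (\<Sum>j=2..i. a j)"

text \<open>The set is finite for every \<open>t\<close> unless arrivals accumulate, which is a null event
  in the model below.\<close>

definition arrival_count :: "real \<Rightarrow> (nat \<Rightarrow> real) \<Rightarrow> real \<Rightarrow> nat" where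
  "arrival_count \<tau>0 a t = Max ({0} \<union> {i. 1 \<le> i \<and> arrival_time \<tau>0 a i \<le> t})"

text \<open>If \<open>t\<close> lies in \<open>[t_j, t_{j+1})\<close>, then \<open>j\<close> is the arrival count at \<open>t\<close>.\<close>

definition remaining_arrival_time :: "real \<Rightarrow> (nat \<Rightarrow> real) \<Rightarrow> real \<Rightarrow> real" where
  "remaining_arrival_time \<tau>0 a t = arrival_time \<tau>0 a (arrival_count \<tau>0 a t + 1) - t"

text \<open>The left limit \<open>W(t-)\<close>, read as the initial value \<open>v0\<close> at time 0.\<close>

definition left_value :: "real \<Rightarrow> (real \<Rightarrow> real) \<Rightarrow> real \<Rightarrow> real" where
  "left_value v0 W t = (if t = 0 then v0 else Lim (at_left t) W)"

definition offered_waiting_path ::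
  "real \<Rightarrow> real \<Rightarrow> (nat \<Rightarrow> real) \<Rightarrow> (nat \<Rightarrow> real) \<Rightarrow> (nat \<Rightarrow> real) \<Rightarrow> (real \<Rightarrow> real) \<Rightarrow> bool" where
  "offered_waiting_path \<tau>0 v0 a s d W \<longleftrightarrow>
     (\<forall>t\<ge>0. W t = v0
          + (\<Sum>j=1..arrival_count \<tau>0 a t. s j * of_bool (left_value v0 W (arrival_time \<tau>0 a j) < d j))
          - (LBINT r:{0..t}. of_bool (W r > 0))
        \<and> W t \<ge> 0)"


section \<open>The sequence of queues\<close>

definition state_space :: "(real \<times> real) set" where
  "state_space = {0..} \<times> {0..}"

text \<open>
  \<open>V n x t\<close> is the offered waiting time at time \<open>t\<close> in the \<open>n\<close>-th system started from the
  deterministic state \<open>x\<close>; the path equation determines it up to null sets.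
  The independence assumption is on the joint family of all \<open>u i\<close>, \<open>v i\<close>, \<open>d n i\<close> for fixed \<open>n\<close>,
  i.e. each sequence is independent and the three sequences are mutually independent.
\<close>

locale abandonment_queues = prob_space M
  for M :: "'a measure" +
  fixes u v :: "nat \<Rightarrow> 'a \<Rightarrow> real"
    and d :: "nat \<Rightarrow> nat \<Rightarrow> 'a \<Rightarrow> real"
    and F :: "nat \<Rightarrow> real \<Rightarrow> real"
    and \<Lambda> \<mu> :: "nat \<Rightarrow> real"
    and V :: "nat \<Rightarrow> real \<times> real \<Rightarrow> real \<Rightarrow> 'a \<Rightarrow> real"
  assumes u_measurable: "\<And>i. 2 \<le> i \<Longrightarrow> random_variable borel (u i)"
    and v_measurable: "\<And>i. 1 \<le> i \<Longrightarrow> random_variable borel (v i)"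
    and d_measurable: "\<And>n i. 1 \<le> n \<Longrightarrow> 1 \<le> i \<Longrightarrow> random_variable borel (d n i)"
    and u_nonneg: "\<And>i. 2 \<le> i \<Longrightarrow> AE \<omega> in M. 0 \<le> u i \<omega>"
    and v_nonneg: "\<And>i. 1 \<le> i \<Longrightarrow> AE \<omega> in M. 0 \<le> v i \<omega>"
    and d_nonneg: "\<And>n i. 1 \<le> n \<Longrightarrow> 1 \<le> i \<Longrightarrow> AE \<omega> in M. 0 \<le> d n i \<omega>"
    and u_ident: "\<And>i. 2 \<le> i \<Longrightarrow> distr M borel (u i) = distr M borel (u 2)"
    and v_ident: "\<And>i. 1 \<le> i \<Longrightarrow> distr M borel (v i) = distr M borel (v 1)"
    and d_cdf: "\<And>n i. 1 \<le> n \<Longrightarrow> 1 \<le> i \<Longrightarrow> cdf (distr M borel (d n i)) = F n"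
    and u_mean: "integrable M (u 2)" "expectation (u 2) = 1"
    and v_mean: "integrable M (v 1)" "expectation (v 1) = 1"
    and indep: "\<And>n. 1 \<le> n \<Longrightarrow>
      indep_vars (\<lambda>_. borel) (case_sum u (case_sum v (d n))) ({2..} <+> {1..} <+> {1..})"
    and rates_pos: "\<And>n. 1 \<le> n \<Longrightarrow> 0 < \<Lambda> n" "\<And>n. 1 \<le> n \<Longrightarrow> 0 < \<mu> n"
    and V_measurable: "\<And>n x t. 1 \<le> n \<Longrightarrow> x \<in> state_space \<Longrightarrow> 0 \<le> t \<Longrightarrow>
      random_variable borel (V n x t)"
    and V_path: "\<And>n x. 1 \<le> n \<Longrightarrow> x \<in> state_space \<Longrightarrow> AE \<omega> in M.
      offered_waiting_path (fst x) (snd x)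
        (\<lambda>j. u j \<omega> / \<Lambda> n) (\<lambda>j. v j \<omega> / \<mu> n) (\<lambda>j. d n j \<omega>) (\<lambda>t. V n x t \<omega>)"

definition queue_state ::
  "(nat \<Rightarrow> 'a \<Rightarrow> real) \<Rightarrow> (nat \<Rightarrow> real) \<Rightarrow> (nat \<Rightarrow> real \<times> real \<Rightarrow> real \<Rightarrow> 'a \<Rightarrow> real)
    \<Rightarrow> nat \<Rightarrow> real \<times> real \<Rightarrow> real \<Rightarrow> 'a \<Rightarrow> real \<times> real" where
  "queue_state u \<Lambda> V n x t \<omega> =
     (remaining_arrival_time (fst x) (\<lambda>j. u j \<omega> / \<Lambda> n) t, V n x t \<omega>)"

text \<open>The scaled process started from \<open>x\<close> is \<open>sqrt n\<close> times the original process started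
  from \<open>x / sqrt n\<close>.\<close>

definition scaled_queue_state ::
  "(nat \<Rightarrow> 'a \<Rightarrow> real) \<Rightarrow> (nat \<Rightarrow> real) \<Rightarrow> (nat \<Rightarrow> real \<times> real \<Rightarrow> real \<Rightarrow> 'a \<Rightarrow> real)
    \<Rightarrow> nat \<Rightarrow> real \<times> real \<Rightarrow> real \<Rightarrow> 'a \<Rightarrow> real \<times> real" where
  "scaled_queue_state u \<Lambda> V n x t \<omega> =
     sqrt (real n) *\<^sub>R queue_state u \<Lambda> V n (x /\<^sub>R sqrt (real n)) t \<omega>"

text \<open>
  \<open>X x t\<close> is the state at time \<open>t\<close> of a Markov process started from \<open>x\<close>, so the transition
  kernel is \<open>P_t(x, B) = P(X x t \<in> B)\<close>; stationarity is invariance under all \<open>P_t\<close>.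
\<close>

definition stationary_distribution ::
  "'a measure \<Rightarrow> (real \<times> real \<Rightarrow> real \<Rightarrow> 'a \<Rightarrow> real \<times> real) \<Rightarrow> (real \<times> real) measure \<Rightarrow> bool" where
  "stationary_distribution M X P \<longleftrightarrow>
     prob_space P \<and> sets P = sets borel \<and> emeasure P state_space = 1 \<and>
     (\<forall>t\<ge>0. \<forall>B\<in>sets borel.
        emeasure P B = (\<integral>\<^sup>+x. emeasure M {\<omega> \<in> space M. X x t \<omega> \<in> B} \<partial>P))"


section \<open>The limiting density\<close>

definition limit_density :: "real \<Rightarrow> real \<Rightarrow> real \<Rightarrow> real \<Rightarrow> (real \<Rightarrow> real) \<Rightarrow> real \<Rightarrow> real" where
  "limit_density C \<sigma>2 \<theta> lam H x =
     C * exp (2 / \<sigma>2 * (\<theta> / lam * x - (LBINT s:{0..x}. H s)))"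

end

theory Submission
  imports Defs
begin

text \<open>
  The proof observes the queue at arrival epochs.  Let \<open>\<pi>\<close> be a stationary law of the scaled process
  \<open>(\<tau>, V)\<close>.  The work that arriving customers find is a Markov chain with independent, identically
  distributed inputs, and the expected counting measure of the states found up to a fixed time is
  invariant for that chain: between two times the process \<open>(V - \<tau>)\<^sup>+\<close> changes from the state found
  by the next customer to the state found by a later one, and its law at the two times is the same
  (\<open>visits_invariant\<close>).  Counting the time between arrivals in the same manner gives Palm inversion:
  \<open>\<pi>\<close> is the average of the state over the interarrival time that follows an arrival
  (\<open>visits_inversion\<close>).  With the mean interarrival time as horizon the counting measure is a
  probability measure \<open>\<nu>\<close>.  In this way stationarity in continuous time, with the residual arrival
  time as a second coordinate, becomes the invariance of a one-step recursion
  (\<open>stationary_found_law\<close>).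

  In the scaling of the theorem a step of the chain moves the work by \<open>\<epsilon> = 1 / (\<lambda> \<surd>n)\<close> times a
  centred variable of variance close to \<open>var u + var v\<close>, plus a drift of size \<open>\<epsilon>\<^sup>2 B\<close> with
  \<open>B x = \<theta> - \<lambda> H x\<close>, reflected at 0.  Below, \<open>\<sigma>\<^sup>2\<close> stands for \<open>var u + var v\<close>.  Three facts about
  the invariant laws \<open>\<nu>\<close> identify their limit.
  \<^item> The drift is negative beyond some \<open>x0\<close>, so that the Lyapunov function \<open>y\<^sup>r\<close>, \<open>2 < r \<le> p\<close>, bounds
    the moment of order \<open>r - 1\<close> uniformly (\<open>uniform_moment_bound\<close>).  This is where the range
    \<open>m < p - 1\<close> comes from, and it prevents mass from escaping to infinity.
  \<^item> The mass of \<open>[0, \<eta>]\<close> is \<open>O(\<eta>)\<close>, because a convex corner in a test function would otherwise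
    produce more than invariance allows (\<open>no_boundary_mass\<close>); no mass escapes to 0.
  \<^item> For smooth \<open>f\<close> that are constant outside a compact part of \<open>(0, \<infinity>)\<close>, Taylor expansion of the
    invariance equation yields \<open>\<integral> (B f' + \<sigma>\<^sup>2/2 f'') d\<nu> \<longlonglongrightarrow> 0\<close> (\<open>generator_limit\<close>).

  The last equation determines the limit.  The density \<open>e\<^sup>\<beta>\<close> with \<open>\<beta>' = 2 B / \<sigma>\<^sup>2\<close> satisfies
  \<open>B f' + \<sigma>\<^sup>2/2 f'' = \<sigma>\<^sup>2/2 e\<^sup>-\<^sup>\<beta> (e\<^sup>\<beta> f')'\<close>, so every continuous \<open>k\<close> with compact support in
  \<open>(0, \<infinity>)\<close> and \<open>\<integral> k e\<^sup>\<beta> = 0\<close> has the form of the right-hand side, with \<open>f\<close> found by integrating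
  twice; hence \<open>\<integral> k d\<nu> \<longlonglongrightarrow> 0\<close> (\<open>test_function_limit\<close>).  Together with the two mass estimates this
  gives weak convergence of \<open>\<nu>\<close> (\<open>found_limit\<close>).

  Finally the work during an interarrival time differs from the work found at its beginning by
  \<open>O(\<epsilon>)\<close>, so Palm inversion transfers the limit and the moment bounds from \<open>\<nu>\<close> to the
  time-stationary law, and bounded moments of an order above \<open>m\<close> turn weak convergence into
  convergence of the \<open>m\<close>-th moments (\<open>stationary_limit\<close>).

  One complication runs through the whole proof: interarrival times may vanish with positive
  probability.  All customers of a batch of simultaneous arrivals compare their patience with the
  same left limit of \<open>V\<close>, while the work already grows inside the batch.  The state of the chain is
  therefore a pair \<open>(z, y)\<close> of the left value \<open>z\<close> and the work \<open>y \<ge> z\<close>; the drift depends on \<open>z\<close>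
  and the displacement acts on \<open>y\<close>.  The mean of \<open>y - z\<close> is \<open>O(\<epsilon>)\<close> (\<open>batch_bound\<close>), so the
  difference disappears in the limit.
\<close>

section \<open>Sample paths\<close>

text \<open>A step from the pair (left value, work) seen by one customer to the pair seen by the next, who
  arrives \<open>a\<close> later.  The left value is kept when \<open>a = 0\<close>, because a batch of simultaneous arrivals
  shares one left limit.\<close>

definition next_wait :: "real \<Rightarrow> real \<Rightarrow> real \<Rightarrow> real \<times> real \<Rightarrow> real \<times> real" where
  "next_wait a s d \<zeta> =
     (let y = max 0 (snd \<zeta> + s * of_bool (fst \<zeta> < d) - a) in (if a = 0 then fst \<zeta> else y, y))"

text \<open>The counter \<open>j\<close> belongs to customer \<open>j + 1\<close>; interarrival times are indexed from 2, whence the shift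
  by 2.  The first customer arrives at time \<open>fst x\<close> and finds what is left of \<open>snd x\<close>.\<close>

primrec waits ::
  "real \<times> real \<Rightarrow> (nat \<Rightarrow> real) \<Rightarrow> (nat \<Rightarrow> real) \<Rightarrow> (nat \<Rightarrow> real) \<Rightarrow> nat \<Rightarrow> real \<times> real" where
  "waits x a s d 0 = (max 0 (snd x - fst x), max 0 (snd x - fst x))"
| "waits x a s d (Suc j) = next_wait (a (j + 2)) (s (j + 1)) (d (j + 1)) (waits x a s d j)"

definition work_after ::
  "real \<times> real \<Rightarrow> (nat \<Rightarrow> real) \<Rightarrow> (nat \<Rightarrow> real) \<Rightarrow> (nat \<Rightarrow> real) \<Rightarrow> nat \<Rightarrow> real" where
  "work_after x a s d j = (case j of 0 \<Rightarrow> snd x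
     | Suc i \<Rightarrow> snd (waits x a s d i) + s j * of_bool (fst (waits x a s d i) < d j))"

text \<open>The process starts afresh at time 0 and at each arrival, hence the value 0 at index 0.\<close>

definition epoch :: "real \<Rightarrow> (nat \<Rightarrow> real) \<Rightarrow> nat \<Rightarrow> real" where
  "epoch \<tau>0 a j = (if j = 0 then 0 else arrival_time \<tau>0 a j)"

definition explicit_state ::
  "real \<times> real \<Rightarrow> (nat \<Rightarrow> real) \<Rightarrow> (nat \<Rightarrow> real) \<Rightarrow> (nat \<Rightarrow> real) \<Rightarrow> real \<Rightarrow> real \<times> real" where
  "explicit_state x a s d t =
     (remaining_arrival_time (fst x) a t,
      max 0 (work_after x a s d (arrival_count (fst x) a t)
             - (t - epoch (fst x) a (arrival_count (fst x) a t))))"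

definition regular_inputs :: "(nat \<Rightarrow> real) \<Rightarrow> (nat \<Rightarrow> real) \<Rightarrow> bool" where
  "regular_inputs a s \<longleftrightarrow> (\<forall>j\<ge>2. 0 \<le> a j) \<and> (\<forall>j\<ge>1. 0 \<le> s j)
     \<and> (\<forall>t. finite {i. (\<Sum>j=2..i. a j) \<le> t})"

lemma epoch_0 [simp]: "epoch \<tau>0 a 0 = 0"
  by (simp add: epoch_def)

lemma epoch_Suc: "epoch \<tau>0 a (Suc j) = epoch \<tau>0 a j + (if j = 0 then \<tau>0 else a (Suc j))"
  by (cases j) (simp_all add: epoch_def arrival_time_def numeral_2_eq_2)

lemma arrival_time_eq_epoch: "1 \<le> j \<Longrightarrow> arrival_time \<tau>0 a j = epoch \<tau>0 a j"
  by (simp add: epoch_def)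

lemma waits_nonneg_le:
  assumes "\<And>j::nat. 1 \<le> j \<Longrightarrow> 0 \<le> s j"
  shows "0 \<le> fst (waits x a s d j) \<and> fst (waits x a s d j) \<le> snd (waits x a s d j)"
proof (induction j)
  case (Suc j)
  moreover have "0 \<le> s (j + 1)" using assms by simp
  ultimately show ?case by (auto simp: next_wait_def Let_def)
qed simp

lemma work_after_nonneg:
  assumes "\<And>j::nat. 1 \<le> j \<Longrightarrow> 0 \<le> s j" "0 \<le> snd x"
  shows "0 \<le> work_after x a s d j"
proof (cases j)
  case (Suc i)
  have "0 \<le> snd (waits x a s d i)"
    using waits_nonneg_le[where s=s and x=x and a=a and d=d and j=i] assms(1) by auto
  then show ?thesis using Suc assms(1)[of j] by (simp add: work_after_def)
qed (use assms in \<open>simp add: work_after_def\<close>)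

locale queue_input =
  fixes \<tau>0 v0 :: real and a s d :: "nat \<Rightarrow> real"
  assumes \<tau>0: "0 \<le> \<tau>0" and v0: "0 \<le> v0" and regular: "regular_inputs a s"
begin

abbreviation "T \<equiv> epoch \<tau>0 a"
abbreviation "A \<equiv> arrival_count \<tau>0 a"
abbreviation "Y \<equiv> waits (\<tau>0, v0) a s d"
abbreviation "U \<equiv> work_after (\<tau>0, v0) a s d"
abbreviation "X \<equiv> explicit_state (\<tau>0, v0) a s d"

lemma a_nonneg: "2 \<le> j \<Longrightarrow> 0 \<le> a j" and s_nonneg: "1 \<le> j \<Longrightarrow> 0 \<le> s j"
  using regular by (auto simp: regular_inputs_def)

lemma T_mono: "i \<le> j \<Longrightarrow> T i \<le> T j"
  by (rule lift_Suc_mono_le[of T]) (auto simp: epoch_Suc \<tau>0 intro: a_nonneg)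

lemma T_nonneg: "0 \<le> T j"
  using T_mono[of 0 j] by simp

lemma finite_epochs: "finite {i. T i \<le> t}"
proof -
  have "finite {i. (\<Sum>j=2..i. a j) \<le> t}"
    using regular by (auto simp: regular_inputs_def)
  moreover have "{i. T i \<le> t} \<subseteq> insert 0 {i. (\<Sum>j=2..i. a j) \<le> t}"
    using \<tau>0 by (auto simp: epoch_def arrival_time_def split: if_splits)
  ultimately show ?thesis by (meson finite_insert finite_subset)
qed

lemma count_set: "{0} \<union> {i. 1 \<le> i \<and> arrival_time \<tau>0 a i \<le> t} = {i. T i \<le> t}" if "0 \<le> t"
  using that by (auto simp: epoch_def)

lemma count_le_iff: "j \<le> A t \<longleftrightarrow> T j \<le> t" if t: "0 \<le> t"
proof -
  have A: "A t = Max {i. T i \<le> t}"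
    unfolding arrival_count_def count_set[OF t] ..
  have ne: "{i. T i \<le> t} \<noteq> {}" using t by (auto intro!: exI[of _ 0])
  have "T (A t) \<le> t"
    using Max_in[OF finite_epochs ne] A by simp
  then show ?thesis
    using Max_ge[OF finite_epochs, of j t] T_mono[of j "A t"] A by auto
qed

lemma count_eqI: "T j \<le> t \<Longrightarrow> t < T (Suc j) \<Longrightarrow> A t = j"
proof -
  assume h: "T j \<le> t" "t < T (Suc j)"
  then have "0 \<le> t" using T_nonneg[of j] by simp
  then show ?thesis
    using h count_le_iff[of t j] count_le_iff[of t "Suc j"] by simp
qed

lemma T_count_le: "0 \<le> t \<Longrightarrow> T (A t) \<le> t" and less_T_Suc_count: "0 \<le> t \<Longrightarrow> t < T (Suc (A t))"
  using count_le_iff[of t "A t"] count_le_iff[of t "Suc (A t)"] by simp_all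

lemma mono_count: "mono_on {0..} A"
  by (rule mono_onI) (use T_count_le count_le_iff order_trans in \<open>fastforce\<close>)

lemma U_nonneg: "0 \<le> U j"
  using s_nonneg v0 by (intro work_after_nonneg) auto

lemma waits_eq_work_after: "snd (Y j) = max 0 (U j - (if j = 0 then \<tau>0 else a (Suc j)))"
  by (cases j) (simp_all add: work_after_def next_wait_def Let_def)

lemma explicit_state_on:
  assumes "T j \<le> t" "t < T (Suc j)"
  shows "X t = (T (Suc j) - t, max 0 (U j - (t - T j)))"
  unfolding explicit_state_def remaining_arrival_time_def
  using count_eqI[OF assms] by (simp add: arrival_time_eq_epoch)

text \<open>The process \<open>V - \<tau>\<close>, cut off at 0, is the wait that the next customer will find; it is
  constant between arrivals.  At a fixed time the next arrival lies strictly in the future, so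
  no batch is in progress and the next customer's left value and workload coincide.\<close>

lemma waits_at_count:
  assumes "0 \<le> t"
  shows "Y (A t) = (let y = max 0 (snd (X t) - fst (X t)) in (y, y))"
proof -
  define j where "j = A t"
  have j: "T j \<le> t" "t < T (Suc j)" using assms T_count_le less_T_Suc_count by (auto simp: j_def)
  have eq: "snd (Y j) = max 0 (snd (X t) - fst (X t))"
    using j \<tau>0 by (auto simp: explicit_state_on[OF j] waits_eq_work_after epoch_Suc split: if_splits)
  have "fst (Y j) = snd (Y j)"
  proof (cases j)
    case (Suc i)
    then have "a (Suc j) > 0" using j by (simp add: epoch_Suc)
    then show ?thesis using Suc by (simp add: next_wait_def Let_def)
  qed simp
  then show ?thesis using eq by (simp add: j_def[symmetric] Let_def prod_eq_iff)
qed

end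

subsection \<open>The path equation determines the workload\<close>

text \<open>The busy time in the path equation has a value even for a path whose busy set is not
  measurable, namely 0 by convention.  Such a path does not exist: beyond the
  infimum \<open>b\<close> of the times at which measurability fails, it would be 0 and \<open>W\<close> a function
  of the monotone counter alone, whose busy set is measurable.\<close>

lemma busy_set_measurable:
  fixes W c :: "real \<Rightarrow> real" and N :: "real \<Rightarrow> nat" and g :: "nat \<Rightarrow> real"
  assumes N: "mono_on {0..} N"
    and W: "\<And>t. 0 \<le> t \<Longrightarrow> W t = g (N t) - (LBINT r:{0..t}. of_bool (W r > 0))"
  shows "{r\<in>{0..t}. W r > 0} \<in> sets borel"
proof -
  define S where "S t = {r\<in>{0..t}. W r > 0}" for t
  have down: "S s \<in> sets borel" if "S t \<in> sets borel" "s \<le> t" for s t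
  proof -
    have "S s = S t \<inter> {..s}" using that by (auto simp: S_def)
    then show ?thesis using that by simp
  qed
  have LB0: "(LBINT r:{0..t}. of_bool (W r > 0)) = (0::real)" if "S t \<notin> sets borel" for t
  proof -
    have "\<not> set_integrable lborel {0..t} (\<lambda>r. of_bool (W r > 0) :: real)"
    proof
      assume "set_integrable lborel {0..t} (\<lambda>r. of_bool (W r > 0) :: real)"
      then have m: "(\<lambda>r. indicator {0..t} r *\<^sub>R of_bool (W r > 0) :: real) \<in> borel_measurable lborel"
        unfolding set_integrable_def by auto
      have "S t = (\<lambda>r. indicator {0..t} r *\<^sub>R of_bool (W r > 0) :: real) -` {1} \<inter> space lborel"
        by (auto simp: S_def indicator_def of_bool_def split: if_splits)
      also have "\<dots> \<in> sets lborel" by (rule measurable_sets[OF m]) auto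
      finally show False using that by simp
    qed
    then show ?thesis
      unfolding set_lebesgue_integral_def set_integrable_def by (rule not_integrable_integral_eq)
  qed
  have "S t \<in> sets borel"
  proof (rule ccontr)
    assume bad: "S t \<notin> sets borel"
    define B where "B = {r. 0 \<le> r \<and> S r \<notin> sets borel}"
    have t0: "0 \<le> t"
    proof (rule ccontr)
      assume "\<not> 0 \<le> t"
      then have "S t = {}" by (auto simp: S_def)
      then show False using bad by simp
    qed
    have Bne: "t \<in> B" using bad t0 by (simp add: B_def)
    have bb: "bdd_below B" by (rule bdd_belowI[of _ 0]) (simp add: B_def)
    define b where "b = Inf B"
    have b0: "0 \<le> b" unfolding b_def using Bne by (intro cInf_greatest) (auto simp: B_def)
    have below: "S r \<in> sets borel" if "r < b" for r
    proof (cases "0 \<le> r")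
      case True
      then show ?thesis using that cInf_lower[OF _ bb, of r] by (auto simp: b_def B_def)
    next
      case False then have "S r = {}" by (auto simp: S_def)
      then show ?thesis by simp
    qed
    have above: "S r \<notin> sets borel" if br: "b < r" for r
    proof -
      obtain q where "q \<in> B" "q < r" using br Bne cInf_less_iff[OF _ bb, of r] unfolding b_def by blast
      then show ?thesis using down[of r q] by (auto simp: B_def)
    qed
    have 1: "{r\<in>{0..<b}. W r > 0} \<in> sets borel"
    proof -
      have "{r\<in>{0..<b}. W r > 0} = (\<Union>k::nat. S (b - 1 / Suc k))"
      proof (intro equalityI subsetI)
        fix r assume r: "r \<in> {r\<in>{0..<b}. W r > 0}"
        then obtain k where "inverse (real (Suc k)) < b - r"
          using reals_Archimedean[of "b - r"] by auto
        then show "r \<in> (\<Union>k::nat. S (b - 1 / Suc k))"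
          using r by (auto simp: S_def inverse_eq_divide intro!: exI[of _ k])
      next
        fix r assume "r \<in> (\<Union>k::nat. S (b - 1 / Suc k))"
        then obtain k :: nat where "0 \<le> r" "r \<le> b - 1 / Suc k" "W r > 0" by (auto simp: S_def)
        moreover have "0 < 1 / real (Suc k)" by simp
        ultimately have "r < b" by linarith
        then show "r \<in> {r\<in>{0..<b}. W r > 0}" using \<open>0 \<le> r\<close> \<open>W r > 0\<close> by simp
      qed
      moreover have "\<dots> \<in> sets borel" by (intro sets.countable_UN) (auto intro!: below)
      ultimately show ?thesis by simp
    qed
    have 2: "{r\<in>{b<..b+1}. W r > 0} \<in> sets borel"
    proof -
      have W': "W r = g (N r)" if "b < r" for r
        using W[of r] LB0[OF above[OF that]] that b0 by simp
      have "(\<lambda>r. real (N r)) \<in> borel_measurable (restrict_space borel {b<..b+1})"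
        by (rule borel_measurable_mono_on_fnc)
           (use N b0 in \<open>auto intro!: mono_onI simp: mono_on_def\<close>)
      then have "(\<lambda>r. nat \<lfloor>real (N r)\<rfloor>) \<in> measurable (restrict_space borel {b<..b+1}) (count_space UNIV)"
        by measurable
      then have NM: "N \<in> measurable (restrict_space borel {b<..b+1}) (count_space UNIV)" by simp
      have "N -` {n. g n > 0} \<inter> space (restrict_space borel {b<..b+1})
          \<in> sets (restrict_space borel {b<..b+1})"
        by (rule measurable_sets[OF NM]) auto
      moreover have "N -` {n. g n > 0} \<inter> space (restrict_space borel {b<..b+1})
          = {r\<in>{b<..b+1}. W r > 0}"
        using W' by (auto simp: space_restrict_space)
      ultimately have "{r\<in>{b<..b+1}. W r > 0} \<in> sets (restrict_space borel {b<..b+1})"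
        by (simp only:)
      then show ?thesis
        by (subst (asm) sets_restrict_space_iff) simp_all
    qed
    have "S (b + 1) = {r\<in>{0..<b}. W r > 0} \<union> ({b} \<inter> {r. W r > 0}) \<union> {r\<in>{b<..b+1}. W r > 0}"
      using b0 by (auto simp: S_def)
    moreover have "{b} \<inter> {r. W r > 0} \<in> sets borel" by (cases "W b > 0") auto
    ultimately have "S (b + 1) \<in> sets borel" using 1 2 by (simp only: sets.Un)
    then show False using above[of "b + 1"] by simp
  qed
  then show ?thesis by (simp add: S_def)
qed

text \<open>A nonnegative function that decreases at rate 1 while it is positive is a truncated line.\<close>

lemma drain_eq:
  fixes w :: "real \<Rightarrow> real"
  assumes eq: "\<And>t. \<alpha> \<le> t \<Longrightarrow> t < \<beta> \<Longrightarrow> w t = w0 - (B t - B \<alpha>)"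
    and nonneg: "\<And>t. \<alpha> \<le> t \<Longrightarrow> t < \<beta> \<Longrightarrow> 0 \<le> w t"
    and B: "\<And>r t. \<alpha> \<le> r \<Longrightarrow> r \<le> t \<Longrightarrow> B r \<le> B t \<and> B t - B r \<le> t - r"
    and full: "\<And>t. \<alpha> \<le> t \<Longrightarrow> t < \<beta> \<Longrightarrow> (\<And>r. \<alpha> \<le> r \<Longrightarrow> r \<le> t \<Longrightarrow> 0 < w r) \<Longrightarrow> B t - B \<alpha> = t - \<alpha>"
    and t: "\<alpha> \<le> t" "t < \<beta>"
  shows "w t = max 0 (w0 - (t - \<alpha>))"
proof (cases "w t > 0")
  case True
  have "0 < w r" if "\<alpha> \<le> r" "r \<le> t" for r
    using that eq[of r] eq[OF t] B[OF that] True t by auto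
  then have "B t - B \<alpha> = t - \<alpha>" by (rule full[OF t])
  then show ?thesis using eq[OF t] True by simp
next
  case False
  then show ?thesis using eq[OF t] nonneg[OF t] B[OF order_refl t(1)] by auto
qed

context queue_input
begin

text \<open>Induction on the arrivals: on \<open>[T j, T (Suc j))\<close> the path drains from its value just after the
  \<open>j\<close>-th arrival, and the left limit at \<open>T (Suc j)\<close> is read off from the truncated line.  If
  \<open>T (Suc j) = T j\<close>, the interval is empty and the left value is the one of the previous customer.\<close>

lemma path_eq_explicit:
  assumes W: "offered_waiting_path \<tau>0 v0 a s d W" and t: "0 \<le> t"
  shows "W t = snd (X t)"
proof -
  define lv where "lv j = left_value v0 W (T j)" for j
  define c where "c j = v0 + (\<Sum>i=1..j. s i * of_bool (lv i < d i))" for j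
  define B where "B t = (LBINT r:{0..t}. of_bool (W r > 0) :: real)" for t
  have c_eq: "v0 + (\<Sum>i=1..j. s i * of_bool (left_value v0 W (arrival_time \<tau>0 a i) < d i)) = c j" for j
    unfolding c_def lv_def by (intro arg_cong2[where f="(+)"] sum.cong) (auto simp: arrival_time_eq_epoch)
  have Weq: "W t = c (A t) - B t" and W0: "0 \<le> W t" if "0 \<le> t" for t
    using W that unfolding offered_waiting_path_def B_def c_eq by blast+
  have meas: "{r\<in>{0..t}. W r > 0} \<in> sets borel" for t
    by (rule busy_set_measurable[OF mono_count, of W c]) (rule Weq[unfolded B_def])
  have B_meas: "B t = measure lborel {r\<in>{0..t}. W r > 0}" for t
  proof -
    have "B t = (LINT r|lborel. indicator {r\<in>{0..t}. W r > 0} r)"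
      unfolding B_def set_lebesgue_integral_def by (intro Bochner_Integration.integral_cong) (auto simp: indicator_def)
    then show ?thesis by simp
  qed
  have fin: "emeasure lborel {r\<in>{0..t}. W r > 0} < \<infinity>" for t
    by (rule order.strict_trans1[OF emeasure_mono[of _ "{0..t}"]]) (auto simp: emeasure_lborel_Icc_eq)
  have B_diff: "B t - B r = measure lborel {q\<in>{r<..t}. W q > 0}" if "0 \<le> r" "r \<le> t" for r t
  proof -
    have "{q\<in>{r<..t}. W q > 0} = {r\<in>{0..t}. W r > 0} - {q\<in>{0..r}. W q > 0}"
      using that by auto
    moreover have "measure lborel ({q\<in>{0..t}. W q > 0} - {q\<in>{0..r}. W q > 0})
        = measure lborel {q\<in>{0..t}. W q > 0} - measure lborel {q\<in>{0..r}. W q > 0}"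
    proof (rule measure_Diff)
      show "{q\<in>{0..r}. W q > 0} \<subseteq> {q\<in>{0..t}. W q > 0}" using that by auto
      show "emeasure lborel {q\<in>{0..t}. W q > 0} \<noteq> \<infinity>" using fin[of t] by (metis less_irrefl)
    qed (simp_all only: sets_lborel meas)
    ultimately show ?thesis by (simp only: B_meas)
  qed
  have busy_Ioc: "{q\<in>{r<..t}. W q > 0} \<in> sets borel" if "0 \<le> r" "r \<le> t" for r t
  proof -
    have "{q\<in>{r<..t}. W q > 0} = {r\<in>{0..t}. W r > 0} - {q\<in>{0..r}. W q > 0}"
      using that by auto
    then show ?thesis using sets.Diff[OF meas[of t] meas[of r]] by (simp only:)
  qed
  have B_mono: "B r \<le> B t \<and> B t - B r \<le> t - r" if "0 \<le> r" "r \<le> t" for r t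
  proof -
    have fm: "{r<..t} \<in> fmeasurable lborel"
      using that by (intro fmeasurableI) (simp_all add: emeasure_lborel_Ioc)
    have "measure lborel {q\<in>{r<..t}. W q > 0} \<le> measure lborel {r<..t}"
      by (rule measure_mono_fmeasurable[OF _ _ fm]) (use busy_Ioc[OF that] in \<open>auto simp only: sets_lborel\<close>)
    moreover have "measure lborel {r<..t} = t - r" by (rule measure_lborel_Ioc[OF that(2)])
    moreover have "0 \<le> measure lborel {q\<in>{r<..t}. W q > 0}" by (rule measure_nonneg)
    ultimately show ?thesis using B_diff[OF that] by linarith
  qed
  have B_full: "B t - B r = t - r" if "0 \<le> r" "r \<le> t" "\<And>q. r \<le> q \<Longrightarrow> q \<le> t \<Longrightarrow> 0 < W q" for r t
  proof -
    have "{q\<in>{r<..t}. W q > 0} = {r<..t}" using that by auto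
    then show ?thesis using B_diff[OF that(1,2)] measure_lborel_Ioc[OF that(2)] by (simp only:)
  qed
  have drain: "W t = max 0 (U j - (t - T j))"
    if cj: "c j - B (T j) = U j" and t: "T j \<le> t" "t < T (Suc j)" for j t
  proof (rule drain_eq[where w = W and \<alpha> = "T j" and \<beta> = "T (Suc j)" and B = B and t = t])
    show "W t = U j - (B t - B (T j))" if "T j \<le> t" "t < T (Suc j)" for t
      using Weq[of t] count_eqI[OF that] that T_nonneg[of j] cj by simp
    show "0 \<le> W t" if "T j \<le> t" for t
      using that T_nonneg[of j] by (intro W0) simp
    show "B r \<le> B t \<and> B t - B r \<le> t - r" if "T j \<le> r" "r \<le> t" for r t
      using that T_nonneg[of j] by (intro B_mono) auto
    show "B t - B (T j) = t - T j" if "T j \<le> t" "\<And>r. T j \<le> r \<Longrightarrow> r \<le> t \<Longrightarrow> 0 < W r" for t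
      using that T_nonneg[of j] by (intro B_full) auto
  qed (simp_all only: t)
  define Z where "Z j = (case j of 0 \<Rightarrow> v0 | Suc i \<Rightarrow> fst (Y i))" for j
  have main: "lv j = Z j \<and> c j - B (T j) = U j" for j
  proof (induction j)
    case 0
    have "0 \<le> B 0" unfolding B_meas by (rule measure_nonneg)
    moreover have "B 0 \<le> 0"
    proof -
      have "{r\<in>{0..0}. W r > 0} = (if W 0 > 0 then {0::real} else {})" by auto
      then have "B 0 = measure lborel (if W 0 > 0 then {0::real} else {})" by (simp only: B_meas)
      also have "\<dots> = 0" by simp
      finally show ?thesis by simp
    qed
    ultimately have "B 0 = 0" by linarith
    then show ?case by (simp add: lv_def left_value_def Z_def c_def work_after_def)
  next
    case (Suc j)
    define \<alpha> where "\<alpha> = (if j = 0 then \<tau>0 else a (Suc j))"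
    have \<alpha>0: "0 \<le> \<alpha>" using \<tau>0 a_nonneg by (simp add: \<alpha>_def)
    have TS: "T (Suc j) = T j + \<alpha>" by (simp add: epoch_Suc \<alpha>_def)
    have Yj: "snd (Y j) = max 0 (U j - \<alpha>)" by (simp add: waits_eq_work_after \<alpha>_def)
    have Z_Suc: "Z (Suc j) = (if \<alpha> = 0 then Z j else max 0 (U j - \<alpha>))"
    proof (cases j)
      case 0 then show ?thesis using v0 by (auto simp: Z_def \<alpha>_def work_after_def)
    next
      case (Suc i) then show ?thesis
        by (auto simp: Z_def \<alpha>_def next_wait_def Let_def work_after_def)
    qed
    have *: "lv (Suc j) = Z (Suc j) \<and> c j - B (T (Suc j)) = max 0 (U j - \<alpha>)"
    proof (cases "\<alpha> = 0")
      case True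
      then show ?thesis using Suc U_nonneg[of j] by (simp add: Z_Suc TS lv_def)
    next
      case False
      then have pos: "0 < \<alpha>" using \<alpha>0 by simp
      have Wd: "W t = max 0 (U j - (t - T j))" if "T j \<le> t" "t < T (Suc j)" for t
        using Suc that by (intro drain) auto
      have ev: "eventually (\<lambda>t. t \<in> {T j<..<T (Suc j)}) (at_left (T (Suc j)))"
        using pos TS by (intro eventually_at_left_field[THEN iffD2] exI[of _ "T j"]) auto
      have lim1: "(W \<longlongrightarrow> max 0 (U j - \<alpha>)) (at_left (T (Suc j)))"
      proof (rule Lim_transform_eventually)
        show "((\<lambda>t. max 0 (U j - (t - T j))) \<longlongrightarrow> max 0 (U j - \<alpha>)) (at_left (T (Suc j)))"
          using TS by (auto intro!: tendsto_eq_intros)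
        show "\<forall>\<^sub>F t in at_left (T (Suc j)). max 0 (U j - (t - T j)) = W t"
          using ev by eventually_elim (use Wd in auto)
      qed
      have limB: "(B \<longlongrightarrow> B (T (Suc j))) (at_left (T (Suc j)))"
      proof (rule tendsto_sandwich)
        show "\<forall>\<^sub>F t in at_left (T (Suc j)). B (T (Suc j)) - (T (Suc j) - t) \<le> B t"
          using ev
        proof eventually_elim
          case (elim t)
          then show ?case using B_mono[of t "T (Suc j)"] T_nonneg[of j] by auto
        qed
        show "\<forall>\<^sub>F t in at_left (T (Suc j)). B t \<le> B (T (Suc j))"
          using ev
        proof eventually_elim
          case (elim t)
          then show ?case using B_mono[of t "T (Suc j)"] T_nonneg[of j] by auto
        qed
      qed (auto intro!: tendsto_eq_intros)
      have lim2: "(W \<longlongrightarrow> c j - B (T (Suc j))) (at_left (T (Suc j)))"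
      proof (rule Lim_transform_eventually)
        show "((\<lambda>t. c j - B t) \<longlongrightarrow> c j - B (T (Suc j))) (at_left (T (Suc j)))"
          by (intro tendsto_intros limB)
        show "\<forall>\<^sub>F t in at_left (T (Suc j)). c j - B t = W t"
          using ev
        proof eventually_elim
          case (elim t)
          then show ?case using Weq[of t] count_eqI[of j t] T_nonneg[of j] by auto
        qed
      qed
      have nt: "at_left (T (Suc j)) \<noteq> bot" by simp
      have "T (Suc j) \<noteq> 0" using pos TS T_nonneg[of j] by simp
      then have "lv (Suc j) = max 0 (U j - \<alpha>)"
        unfolding lv_def left_value_def using tendsto_Lim[OF nt lim1] by simp
      moreover have "c j - B (T (Suc j)) = max 0 (U j - \<alpha>)"
        by (rule tendsto_unique[OF nt lim2 lim1])
      ultimately show ?thesis using False by (simp add: Z_Suc)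
    qed
    have "c (Suc j) = c j + s (Suc j) * of_bool (lv (Suc j) < d (Suc j))"
      by (simp add: c_def)
    then have "c (Suc j) - B (T (Suc j)) = snd (Y j) + s (Suc j) * of_bool (fst (Y j) < d (Suc j))"
      using * Yj by (simp add: Z_def)
    then show ?case using * by (simp add: work_after_def)
  qed
  have "T (A t) \<le> t" "t < T (Suc (A t))" using t T_count_le less_T_Suc_count by auto
  then show ?thesis using drain main explicit_state_on by simp
qed

end

section \<open>Measurability of the explicit process\<close>

abbreviation borel2 :: "(real \<times> real) measure" where
  "borel2 \<equiv> borel \<Otimes>\<^sub>M borel"

abbreviation borel3 :: "(real \<times> real \<times> real) measure" where
  "borel3 \<equiv> borel \<Otimes>\<^sub>M (borel \<Otimes>\<^sub>M borel)"

lemma measurable_next_wait [measurable (raw)]: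
  assumes [measurable]: "f \<in> borel_measurable N" "g \<in> borel_measurable N" "h \<in> borel_measurable N"
    "z \<in> N \<rightarrow>\<^sub>M borel2"
  shows "(\<lambda>\<omega>. next_wait (f \<omega>) (g \<omega>) (h \<omega>) (z \<omega>)) \<in> N \<rightarrow>\<^sub>M borel2"
  unfolding next_wait_def Let_def by measurable

lemma measurable_waits:
  assumes [measurable]: "x \<in> N \<rightarrow>\<^sub>M borel2"
    and a: "\<And>i. 2 \<le> i \<Longrightarrow> i \<le> Suc k \<Longrightarrow> (\<lambda>\<omega>. a \<omega> i) \<in> borel_measurable N"
    and s: "\<And>i. 1 \<le> i \<Longrightarrow> i \<le> k \<Longrightarrow> (\<lambda>\<omega>. s \<omega> i) \<in> borel_measurable N"
    and d: "\<And>i. 1 \<le> i \<Longrightarrow> i \<le> k \<Longrightarrow> (\<lambda>\<omega>. d \<omega> i) \<in> borel_measurable N"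
  shows "(\<lambda>\<omega>. waits (x \<omega>) (a \<omega>) (s \<omega>) (d \<omega>) k) \<in> N \<rightarrow>\<^sub>M borel2"
  using a s d
proof (induction k)
  case (Suc k)
  have [measurable]: "(\<lambda>\<omega>. a \<omega> (k + 2)) \<in> borel_measurable N" by (rule Suc.prems) auto
  have [measurable]: "(\<lambda>\<omega>. s \<omega> (k + 1)) \<in> borel_measurable N" by (rule Suc.prems) auto
  have [measurable]: "(\<lambda>\<omega>. d \<omega> (k + 1)) \<in> borel_measurable N" by (rule Suc.prems) auto
  have [measurable]: "(\<lambda>\<omega>. waits (x \<omega>) (a \<omega>) (s \<omega>) (d \<omega>) k) \<in> N \<rightarrow>\<^sub>M borel2"
    by (rule Suc.IH) (auto intro: Suc.prems)
  show ?case unfolding waits.simps by measurable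
qed simp

lemma measurable_arrival_time:
  assumes [measurable]: "\<tau> \<in> borel_measurable N"
    and a: "\<And>i. 2 \<le> i \<Longrightarrow> i \<le> k \<Longrightarrow> (\<lambda>\<omega>. a \<omega> i) \<in> borel_measurable N"
  shows "(\<lambda>\<omega>. arrival_time (\<tau> \<omega>) (a \<omega>) k) \<in> borel_measurable N"
  unfolding arrival_time_def
  by (intro borel_measurable_add borel_measurable_sum assms) auto

lemma measurable_epoch:
  assumes "\<tau> \<in> borel_measurable N"
    and "\<And>i. 2 \<le> i \<Longrightarrow> i \<le> k \<Longrightarrow> (\<lambda>\<omega>. a \<omega> i) \<in> borel_measurable N"
  shows "(\<lambda>\<omega>. epoch (\<tau> \<omega>) (a \<omega>) k) \<in> borel_measurable N"
  unfolding epoch_def using measurable_arrival_time[OF assms] by (cases "k = 0") auto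

lemma measurable_arrival_count:
  assumes \<tau> [measurable]: "\<tau> \<in> borel_measurable N" and t [measurable]: "t \<in> borel_measurable N"
    and a: "\<And>i. 2 \<le> i \<Longrightarrow> (\<lambda>\<omega>. a \<omega> i) \<in> borel_measurable N"
  shows "(\<lambda>\<omega>. arrival_count (\<tau> \<omega>) (a \<omega>) (t \<omega>)) \<in> N \<rightarrow>\<^sub>M count_space UNIV"
proof -
  have [measurable]: "(\<lambda>\<omega>. arrival_time (\<tau> \<omega>) (a \<omega>) k) \<in> borel_measurable N" for k
    by (intro measurable_arrival_time a) auto
  have eq: "{0} \<union> {i. 1 \<le> i \<and> P i} = {i::nat. i = 0 \<or> (1 \<le> i \<and> P i)}" for P by auto
  show ?thesis unfolding arrival_count_def eq by measurable
qed

lemma measurable_explicit_state: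
  assumes x [measurable]: "x \<in> N \<rightarrow>\<^sub>M borel2" and t [measurable]: "t \<in> borel_measurable N"
    and a: "\<And>i. 2 \<le> i \<Longrightarrow> (\<lambda>\<omega>. a \<omega> i) \<in> borel_measurable N"
    and s: "\<And>i. 1 \<le> i \<Longrightarrow> (\<lambda>\<omega>. s \<omega> i) \<in> borel_measurable N"
    and d: "\<And>i. 1 \<le> i \<Longrightarrow> (\<lambda>\<omega>. d \<omega> i) \<in> borel_measurable N"
  shows "(\<lambda>\<omega>. explicit_state (x \<omega>) (a \<omega>) (s \<omega>) (d \<omega>) (t \<omega>)) \<in> N \<rightarrow>\<^sub>M borel2"
proof -
  have fx [measurable]: "(\<lambda>\<omega>. fst (x \<omega>)) \<in> borel_measurable N" by measurable
  have sx [measurable]: "(\<lambda>\<omega>. snd (x \<omega>)) \<in> borel_measurable N" by measurable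
  have N: "(\<lambda>\<omega>. arrival_count (fst (x \<omega>)) (a \<omega>) (t \<omega>)) \<in> N \<rightarrow>\<^sub>M count_space UNIV"
    by (intro measurable_arrival_count a fx t)
  have T [measurable]: "(\<lambda>\<omega>. arrival_time (fst (x \<omega>)) (a \<omega>) k) \<in> borel_measurable N" for k
    by (intro measurable_arrival_time a fx) auto
  have E [measurable]: "(\<lambda>\<omega>. epoch (fst (x \<omega>)) (a \<omega>) k) \<in> borel_measurable N" for k
    by (intro measurable_epoch a fx) auto
  have U [measurable]: "(\<lambda>\<omega>. work_after (x \<omega>) (a \<omega>) (s \<omega>) (d \<omega>) k) \<in> borel_measurable N" for k
  proof (cases k)
    case (Suc i)
    have [measurable]: "(\<lambda>\<omega>. waits (x \<omega>) (a \<omega>) (s \<omega>) (d \<omega>) i) \<in> N \<rightarrow>\<^sub>M borel2"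
      by (intro measurable_waits a s d x)
    have [measurable]: "(\<lambda>\<omega>. s \<omega> (Suc i)) \<in> borel_measurable N" "(\<lambda>\<omega>. d \<omega> (Suc i)) \<in> borel_measurable N"
      by (intro s d; simp)+
    show ?thesis unfolding Suc work_after_def nat.case by measurable
  qed (simp add: work_after_def)
  have "(\<lambda>\<omega>. (arrival_time (fst (x \<omega>)) (a \<omega>) (k + 1) - t \<omega>,
      max 0 (work_after (x \<omega>) (a \<omega>) (s \<omega>) (d \<omega>) k - (t \<omega> - epoch (fst (x \<omega>)) (a \<omega>) k))))
      \<in> N \<rightarrow>\<^sub>M borel2" for k
    by measurable
  from measurable_compose_countable[OF this N] show ?thesis
    unfolding explicit_state_def remaining_arrival_time_def by simp
qed

text \<open>The next two lemmas express that the past of customer \<open>k + 1\<close> involves only the inputs up to that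
  customer; independence of the next inputs rests on them.\<close>

lemma waits_cong:
  assumes "\<And>i. 2 \<le> i \<Longrightarrow> i \<le> Suc k \<Longrightarrow> a i = a' i"
    and "\<And>i. 1 \<le> i \<Longrightarrow> i \<le> k \<Longrightarrow> s i = s' i" "\<And>i. 1 \<le> i \<Longrightarrow> i \<le> k \<Longrightarrow> d i = d' i"
  shows "waits x a s d k = waits x a' s' d' k"
  using assms by (induction k) (simp_all del: One_nat_def)

lemma epoch_cong:
  assumes "\<And>i. 2 \<le> i \<Longrightarrow> i \<le> k \<Longrightarrow> a i = a' i"
  shows "epoch \<tau> a k = epoch \<tau> a' k"
  using assms by (auto simp: epoch_def arrival_time_def intro!: sum.cong)

section \<open>Independent inputs\<close>

context prob_space
begin

text \<open>Fubini for independent blocks: the second block may be integrated against an independent copy.\<close>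

lemma nn_integral_indep_blocks:
  fixes X :: "'i \<Rightarrow> 'a \<Rightarrow> 'b"
  assumes ind: "indep_vars N X I" and AB: "A \<inter> B = {}" "A \<subseteq> I" "B \<subseteq> I"
    and f [measurable]: "f \<in> PiM A N \<rightarrow>\<^sub>M N1" and g [measurable]: "g \<in> PiM B N \<rightarrow>\<^sub>M N2"
    and h [measurable]: "h \<in> borel_measurable (N1 \<Otimes>\<^sub>M N2)"
  defines "XA \<equiv> \<lambda>\<omega>. restrict (\<lambda>i. X i \<omega>) A" and "XB \<equiv> \<lambda>\<omega>. restrict (\<lambda>i. X i \<omega>) B"
  shows "(\<integral>\<^sup>+\<omega>. h (f (XA \<omega>), g (XB \<omega>)) \<partial>M) = (\<integral>\<^sup>+\<omega>. (\<integral>\<^sup>+\<omega>'. h (f (XA \<omega>), g (XB \<omega>')) \<partial>M) \<partial>M)"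
proof -
  have iv: "indep_var (PiM A N) XA (PiM B N) XB"
    unfolding XA_def XB_def by (rule indep_var_restrict[OF ind AB])
  have [measurable]: "XA \<in> M \<rightarrow>\<^sub>M PiM A N" "XB \<in> M \<rightarrow>\<^sub>M PiM B N"
    using indep_var_rv1[OF iv] indep_var_rv2[OF iv] by auto
  interpret c: prob_space "distr M (PiM B N) XB" by (rule prob_space_distr) simp
  have "(\<integral>\<^sup>+\<omega>. h (f (XA \<omega>), g (XB \<omega>)) \<partial>M)
      = (\<integral>\<^sup>+y. h (f (fst y), g (snd y)) \<partial>distr M (PiM A N \<Otimes>\<^sub>M PiM B N) (\<lambda>\<omega>. (XA \<omega>, XB \<omega>)))"
    by (subst nn_integral_distr) auto
  also have "distr M (PiM A N \<Otimes>\<^sub>M PiM B N) (\<lambda>\<omega>. (XA \<omega>, XB \<omega>))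
      = distr M (PiM A N) XA \<Otimes>\<^sub>M distr M (PiM B N) XB"
    using iv by (simp add: indep_var_distribution_eq)
  also have "(\<integral>\<^sup>+y. h (f (fst y), g (snd y)) \<partial>\<dots>)
      = (\<integral>\<^sup>+y. (\<integral>\<^sup>+z. h (f y, g z) \<partial>distr M (PiM B N) XB) \<partial>distr M (PiM A N) XA)"
    by (subst c.nn_integral_fst[symmetric]) simp_all
  also have "\<dots> = (\<integral>\<^sup>+\<omega>. (\<integral>\<^sup>+\<omega>'. h (f (XA \<omega>), g (XB \<omega>')) \<partial>M) \<partial>M)"
    by (subst nn_integral_distr, simp, simp) (auto simp: nn_integral_distr intro!: nn_integral_cong)
  finally show ?thesis .
qed

lemma nn_integral_indep_triple:
  fixes X :: "'i \<Rightarrow> 'a \<Rightarrow> real"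
  assumes ind: "indep_vars (\<lambda>_. borel) X I"
    and I: "i \<in> I" "j \<in> I" "k \<in> I" "i \<noteq> j" "i \<noteq> k" "j \<noteq> k"
    and h [measurable]: "h \<in> borel_measurable borel3"
  shows "(\<integral>\<^sup>+\<omega>. h (X i \<omega>, X j \<omega>, X k \<omega>) \<partial>M)
    = (\<integral>\<^sup>+x. (\<integral>\<^sup>+y. (\<integral>\<^sup>+z. h (x, y, z) \<partial>distr M borel (X k)) \<partial>distr M borel (X j)) \<partial>distr M borel (X i))"
proof -
  have [measurable]: "X i \<in> borel_measurable M" "X j \<in> borel_measurable M" "X k \<in> borel_measurable M"
    using ind I unfolding indep_vars_def by auto
  interpret k: prob_space "distr M borel (X k)" by (rule prob_space_distr) simp
  have "(\<integral>\<^sup>+\<omega>. h (X i \<omega>, X j \<omega>, X k \<omega>) \<partial>M)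
      = (\<integral>\<^sup>+\<omega>. (\<integral>\<^sup>+\<omega>'. h (X i \<omega>, X j \<omega>', X k \<omega>') \<partial>M) \<partial>M)"
    using nn_integral_indep_blocks[OF ind, of "{i}" "{j, k}" "\<lambda>r. r i" borel "\<lambda>r. (r j, r k)" borel2 h] I
    by simp
  also have "\<dots> = (\<integral>\<^sup>+\<omega>. (\<integral>\<^sup>+\<omega>'. (\<integral>\<^sup>+\<omega>''. h (X i \<omega>, X j \<omega>', X k \<omega>'') \<partial>M) \<partial>M) \<partial>M)"
  proof (rule nn_integral_cong)
    fix \<omega>
    show "(\<integral>\<^sup>+\<omega>'. h (X i \<omega>, X j \<omega>', X k \<omega>') \<partial>M)
        = (\<integral>\<^sup>+\<omega>'. (\<integral>\<^sup>+\<omega>''. h (X i \<omega>, X j \<omega>', X k \<omega>'') \<partial>M) \<partial>M)"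
      using nn_integral_indep_blocks[OF ind, of "{j}" "{k}" "\<lambda>r. r j" borel "\<lambda>r. r k" borel
          "\<lambda>p. h (X i \<omega>, fst p, snd p)"] I
      by simp
  qed
  also have "\<dots> = (\<integral>\<^sup>+x. (\<integral>\<^sup>+y. (\<integral>\<^sup>+z. h (x, y, z) \<partial>distr M borel (X k))
      \<partial>distr M borel (X j)) \<partial>distr M borel (X i))"
  proof -
    interpret j: prob_space "distr M borel (X j)" by (rule prob_space_distr) simp
    have [measurable]: "(\<lambda>x. \<integral>\<^sup>+y. (\<integral>\<^sup>+z. h (x, y, z) \<partial>distr M borel (X k)) \<partial>distr M borel (X j))
        \<in> borel_measurable borel"
      by measurable
    show ?thesis
      by (subst nn_integral_distr, simp, simp)
        (auto simp: nn_integral_distr intro!: nn_integral_cong)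
  qed
  finally show ?thesis .
qed

end

text \<open>Interarrival, service and patience times of one queue, already scaled; the numbering starts at 2, 1
  and 1.\<close>

locale queue_primitives = prob_space M
  for M :: "'a measure" +
  fixes a s d :: "nat \<Rightarrow> 'a \<Rightarrow> real"
  assumes a_rv: "\<And>i. 2 \<le> i \<Longrightarrow> random_variable borel (a i)"
    and s_rv: "\<And>i. 1 \<le> i \<Longrightarrow> random_variable borel (s i)"
    and d_rv: "\<And>i. 1 \<le> i \<Longrightarrow> random_variable borel (d i)"
    and a_nonneg: "\<And>i. 2 \<le> i \<Longrightarrow> AE \<omega> in M. 0 \<le> a i \<omega>"
    and s_nonneg: "\<And>i. 1 \<le> i \<Longrightarrow> AE \<omega> in M. 0 \<le> s i \<omega>"
    and a_ident: "\<And>i. 2 \<le> i \<Longrightarrow> distr M borel (a i) = distr M borel (a 2)"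
    and s_ident: "\<And>i. 1 \<le> i \<Longrightarrow> distr M borel (s i) = distr M borel (s 1)"
    and d_ident: "\<And>i. 1 \<le> i \<Longrightarrow> distr M borel (d i) = distr M borel (d 1)"
    and indep: "indep_vars (\<lambda>_. borel) (case_sum a (case_sum s d)) ({2..} <+> {1..} <+> {1..})"
    and a_integrable: "integrable M (a 2)" and a_mean_pos: "0 < expectation (a 2)"
begin

lemma a2_measurable [measurable]: "random_variable borel (a 2)"
  and s1_measurable [measurable]: "random_variable borel (s 1)" "random_variable borel (s (Suc 0))"
  and d1_measurable [measurable]: "random_variable borel (d 1)" "random_variable borel (d (Suc 0))"
  using a_rv s_rv d_rv by auto

abbreviation customer :: "nat \<Rightarrow> 'a \<Rightarrow> real \<times> real \<times> real" where
  "customer j \<omega> \<equiv> (a (j + 2) \<omega>, s (j + 1) \<omega>, d (j + 1) \<omega>)"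

lemma customer_measurable: "customer j \<in> M \<rightarrow>\<^sub>M borel3"
  by (intro measurable_Pair a_rv s_rv d_rv) auto

lemma nn_integral_customer:
  assumes [measurable]: "h \<in> borel_measurable borel3"
  shows "(\<integral>\<^sup>+\<omega>. h (customer j \<omega>) \<partial>M) = (\<integral>\<^sup>+\<omega>. h (customer 0 \<omega>) \<partial>M)"
proof -
  have "(\<integral>\<^sup>+\<omega>. h (customer j \<omega>) \<partial>M) = (\<integral>\<^sup>+x. (\<integral>\<^sup>+y. (\<integral>\<^sup>+z. h (x, y, z)
      \<partial>distr M borel (d 1)) \<partial>distr M borel (s 1)) \<partial>distr M borel (a 2))" for j
  proof -
    let ?X = "case_sum a (case_sum s d)"
    have e: "distr M borel (?X (Inl (j + 2))) = distr M borel (a 2)"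
        "distr M borel (?X (Inr (Inl (j + 1)))) = distr M borel (s 1)"
        "distr M borel (?X (Inr (Inr (j + 1)))) = distr M borel (d 1)"
      using a_ident[of "j + 2"] s_ident[of "j + 1"] d_ident[of "j + 1"] by simp_all
    have I: "Inl (j + 2) \<in> {2..} <+> {1..} <+> {1..}"
        "Inr (Inl (j + 1)) \<in> {2..} <+> {1..} <+> {1..}" "Inr (Inr (j + 1)) \<in> {2..} <+> {1..} <+> {1..}"
      by (intro InlI InrI; simp)+
    have "(\<integral>\<^sup>+\<omega>. h (?X (Inl (j + 2)) \<omega>, ?X (Inr (Inl (j + 1))) \<omega>, ?X (Inr (Inr (j + 1))) \<omega>) \<partial>M)
      = (\<integral>\<^sup>+x. (\<integral>\<^sup>+y. (\<integral>\<^sup>+z. h (x, y, z)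
      \<partial>distr M borel (d 1)) \<partial>distr M borel (s 1)) \<partial>distr M borel (a 2))"
      by (subst nn_integral_indep_triple[OF indep I _ _ _ assms]) (simp_all only: e, simp_all)
    then show ?thesis by (simp only: sum.case)
  qed
  from this[of j] this[of 0] show ?thesis by (rule trans[OF _ sym])
qed

text \<open>The state found by customer \<open>j + 1\<close> and the arrival time of this customer are functions of
  earlier inputs.\<close>

lemma nn_integral_fresh_customer:
  fixes x :: "real \<times> real" and j :: nat
  assumes [measurable]: "h \<in> borel_measurable ((borel \<Otimes>\<^sub>M borel2) \<Otimes>\<^sub>M borel3)"
  defines "past \<equiv> (\<lambda>\<omega>. (epoch (fst x) (\<lambda>i. a i \<omega>) (Suc j),
      waits x (\<lambda>i. a i \<omega>) (\<lambda>i. s i \<omega>) (\<lambda>i. d i \<omega>) j))"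
  shows "(\<integral>\<^sup>+\<omega>. h (past \<omega>, customer j \<omega>) \<partial>M) = (\<integral>\<^sup>+\<omega>. (\<integral>\<^sup>+\<omega>'. h (past \<omega>, customer 0 \<omega>') \<partial>M) \<partial>M)"
proof -
  let ?X = "case_sum a (case_sum s d)"
  define PA :: "(nat + nat + nat) set" where "PA = {2..Suc j} <+> {1..j} <+> {1..j}"
  define PB :: "(nat + nat + nat) set" where "PB = {j + 2} <+> {j + 1} <+> {j + 1}"
  define f where "f r = (epoch (fst x) (\<lambda>i. r (Inl i)) (Suc j),
      waits x (\<lambda>i. r (Inl i)) (\<lambda>i. r (Inr (Inl i))) (\<lambda>i. r (Inr (Inr i))) j)"
    for r :: "nat + nat + nat \<Rightarrow> real"
  define g where "g r = (r (Inl (j + 2)), r (Inr (Inl (j + 1))), r (Inr (Inr (j + 1))))"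
    for r :: "nat + nat + nat \<Rightarrow> real"
  have f [measurable]: "f \<in> PiM PA (\<lambda>_. borel) \<rightarrow>\<^sub>M borel \<Otimes>\<^sub>M borel2"
    unfolding f_def
    by (intro measurable_Pair measurable_epoch measurable_waits measurable_const
          measurable_component_singleton) (auto simp: PA_def space_pair_measure)
  have g [measurable]: "g \<in> PiM PB (\<lambda>_. borel) \<rightarrow>\<^sub>M borel3"
    unfolding g_def by (intro measurable_Pair measurable_component_singleton) (auto simp: PB_def)
  have fX: "f (restrict (\<lambda>i. ?X i \<omega>) PA) = past \<omega>" for \<omega>
    unfolding f_def past_def prod.inject
    by (intro conjI epoch_cong waits_cong) (auto simp: PA_def)
  have gX: "g (restrict (\<lambda>i. ?X i \<omega>) PB) = customer j \<omega>" for \<omega>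
    by (auto simp: g_def PB_def)
  have [measurable]: "past \<in> M \<rightarrow>\<^sub>M borel \<Otimes>\<^sub>M borel2"
    unfolding past_def
    by (intro measurable_Pair measurable_epoch measurable_waits measurable_const a_rv s_rv d_rv)
      (auto simp: space_pair_measure)
  have "(\<integral>\<^sup>+\<omega>. h (past \<omega>, customer j \<omega>) \<partial>M)
      = (\<integral>\<^sup>+\<omega>. (\<integral>\<^sup>+\<omega>'. h (past \<omega>, customer j \<omega>') \<partial>M) \<partial>M)"
    by (rule nn_integral_indep_blocks[OF indep, of PA PB f "borel \<Otimes>\<^sub>M borel2" g borel3 h, unfolded fX gX])
      (use f g in \<open>auto simp: PA_def PB_def\<close>)
  also have "\<dots> = (\<integral>\<^sup>+\<omega>. (\<integral>\<^sup>+\<omega>'. h (past \<omega>, customer 0 \<omega>') \<partial>M) \<partial>M)"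
  proof (rule nn_integral_cong)
    fix \<omega> assume "\<omega> \<in> space M"
    show "(\<integral>\<^sup>+\<omega>'. h (past \<omega>, customer j \<omega>') \<partial>M) = (\<integral>\<^sup>+\<omega>'. h (past \<omega>, customer 0 \<omega>') \<partial>M)"
      by (rule nn_integral_customer[where h = "\<lambda>c. h (past \<omega>, c)"])
        (rule measurable_compose[OF measurable_Pair1' assms(1)], simp add: space_pair_measure)
  qed
  finally show ?thesis .
qed

text \<open>Arrivals do not accumulate: \<open>E exp(- (a 2 + ... + a j))\<close> decays geometrically.\<close>

lemma AE_regular_inputs: "AE \<omega> in M. regular_inputs (\<lambda>i. a i \<omega>) (\<lambda>i. s i \<omega>)"
proof -
  define q where "q = (\<integral>\<^sup>+\<omega>. ennreal (exp (- a 2 \<omega>)) \<partial>M)"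
  have q1: "q < 1"
  proof (rule ccontr)
    assume "\<not> q < 1"
    have int: "integrable M (\<lambda>\<omega>. exp (- a 2 \<omega>))"
      by (rule integrable_const_bound[where B=1]) (use a_nonneg[of 2] in auto)
    have le: "AE \<omega> in M. exp (- a 2 \<omega>) \<le> 1" using a_nonneg[of 2] by auto
    have "q = ennreal (expectation (\<lambda>\<omega>. exp (- a 2 \<omega>)))"
      unfolding q_def by (rule nn_integral_eq_integral[OF int]) simp
    then have "1 \<le> expectation (\<lambda>\<omega>. exp (- a 2 \<omega>))"
      using \<open>\<not> q < 1\<close> by (simp add: not_less)
    then have "expectation (\<lambda>\<omega>. 1 - exp (- a 2 \<omega>)) \<le> 0"
      using int by (simp add: prob_space)
    moreover have "0 \<le> expectation (\<lambda>\<omega>. 1 - exp (- a 2 \<omega>))"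
      by (rule integral_nonneg_AE) (use le in auto)
    ultimately have "expectation (\<lambda>\<omega>. 1 - exp (- a 2 \<omega>)) = 0" by simp
    then have "AE \<omega> in M. 1 - exp (- a 2 \<omega>) = 0"
      by (subst (asm) integral_nonneg_eq_0_iff_AE) (use int le in auto)
    then have "AE \<omega> in M. a 2 \<omega> = 0" by auto
    then have "expectation (a 2) = 0" by (simp add: integral_eq_zero_AE)
    then show False using a_mean_pos by simp
  qed
  have qi: "(\<integral>\<^sup>+\<omega>. ennreal (exp (- a i \<omega>)) \<partial>M) = q" if "2 \<le> i" for i
  proof -
    have "(\<integral>\<^sup>+\<omega>. ennreal (exp (- a i \<omega>)) \<partial>M) = (\<integral>\<^sup>+y. ennreal (exp (- y)) \<partial>distr M borel (a i))"
      using that by (subst nn_integral_distr) (auto intro: a_rv)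
    then show ?thesis
      unfolding a_ident[OF that] q_def by (simp add: nn_integral_distr)
  qed
  have prodq: "(\<integral>\<^sup>+\<omega>. ennreal (exp (- (\<Sum>i=2..j. a i \<omega>))) \<partial>M) = q ^ (j - 1)" for j
  proof -
    let ?J = "Inl ` {2..j} :: (nat + nat + nat) set"
    have "indep_vars (\<lambda>_. borel) (\<lambda>i \<omega>. ennreal (exp (- case_sum a (case_sum s d) i \<omega>))) ?J"
      by (intro indep_vars_compose2[where Y = "\<lambda>_ y. ennreal (exp (- y))" and M' = "\<lambda>_. borel"]
          indep_vars_subset[OF indep]) auto
    then have "(\<integral>\<^sup>+\<omega>. (\<Prod>i\<in>?J. ennreal (exp (- case_sum a (case_sum s d) i \<omega>))) \<partial>M)
        = (\<Prod>i\<in>?J. \<integral>\<^sup>+\<omega>. ennreal (exp (- case_sum a (case_sum s d) i \<omega>)) \<partial>M)"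
      by (intro indep_vars_nn_integral) auto
    also have "\<dots> = (\<Prod>i=2..j. q)"
      by (subst prod.reindex) (auto simp: qi intro!: prod.cong)
    finally have "(\<integral>\<^sup>+\<omega>. (\<Prod>i=2..j. ennreal (exp (- (a i \<omega>)))) \<partial>M) = q ^ (j - 1)"
      by (simp add: prod.reindex Suc_diff_Suc)
    moreover have "(\<Prod>i=2..j. ennreal (exp (- (a i \<omega>)))) = ennreal (exp (- (\<Sum>i=2..j. a i \<omega>)))" for \<omega>
      by (simp add: prod_ennreal exp_sum[symmetric] sum_negf)
    ultimately show ?thesis by simp
  qed
  have am [measurable]: "(\<lambda>\<omega>. \<Sum>i=2..j. a i \<omega>) \<in> borel_measurable M" for j
    by (intro borel_measurable_sum a_rv) auto
  have nn: "AE \<omega> in M. (\<forall>i\<in>{2..}. 0 \<le> a i \<omega>) \<and> (\<forall>i\<in>{1..}. 0 \<le> s i \<omega>)"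
    using a_nonneg s_nonneg by (intro AE_conjI AE_ball_countable[THEN iffD2]) auto
  have unb: "AE \<omega> in M. \<exists>j. real n < (\<Sum>i=2..j. a i \<omega>)" for n :: nat
  proof -
    define E where "E = {\<omega> \<in> space M. \<forall>j. (\<Sum>i=2..j. a i \<omega>) \<le> real n}"
    have [measurable]: "E \<in> sets M" unfolding E_def by measurable
    have "emeasure M E \<le> ennreal (exp n) * q ^ (j - 1)" for j
    proof -
      have "emeasure M E = (\<integral>\<^sup>+\<omega>. indicator E \<omega> \<partial>M)" by simp
      also have "\<dots> \<le> (\<integral>\<^sup>+\<omega>. ennreal (exp n) * ennreal (exp (- (\<Sum>i=2..j. a i \<omega>))) \<partial>M)"
        by (intro nn_integral_mono)
           (auto simp: indicator_def E_def ennreal_mult[symmetric] exp_add[symmetric])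
      also have "\<dots> = ennreal (exp n) * q ^ (j - 1)"
        by (simp add: nn_integral_cmult prodq)
      finally show ?thesis .
    qed
    then have *: "emeasure M E \<le> ennreal (exp n) * q ^ j" for j
      using diff_Suc_1 by metis
    have "q \<noteq> \<top>" using q1 by auto
    then obtain r where r: "q = ennreal r" "0 \<le> r" by (cases q) auto
    have "(\<lambda>j. ennreal (exp n) * q ^ j) \<longlonglongrightarrow> ennreal (exp n) * ennreal 0"
    proof (rule tendsto_mult_ennreal[OF tendsto_const])
      have "(\<lambda>j. ennreal (r ^ j)) \<longlonglongrightarrow> ennreal 0"
        using r q1 by (intro tendsto_ennrealI LIMSEQ_realpow_zero) auto
      then show "(\<lambda>j. q ^ j) \<longlonglongrightarrow> ennreal 0" using r by (simp only: ennreal_power)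
    qed auto
    then have "emeasure M E \<le> 0"
      using * by (intro LIMSEQ_le_const[where X="\<lambda>j. ennreal (exp n) * q ^ j"]) auto
    then have "E \<in> null_sets M" by auto
    then show ?thesis by (rule AE_I'[where N=E]) (auto simp: E_def not_less)
  qed
  have "AE \<omega> in M. \<forall>n::nat. \<exists>j. real n < (\<Sum>i=2..j. a i \<omega>)"
    using unb by (simp add: AE_all_countable)
  with nn show ?thesis
  proof eventually_elim
    case (elim \<omega>)
    have "finite {i. (\<Sum>j=2..i. a j \<omega>) \<le> t}" for t
    proof -
      obtain n :: nat where n: "t \<le> real n" using real_arch_simple by blast
      obtain j where j: "real n < (\<Sum>i=2..j. a i \<omega>)" using elim by blast
      have "{i. (\<Sum>j=2..i. a j \<omega>) \<le> t} \<subseteq> {..<j}"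
      proof
        fix i assume "i \<in> {i. (\<Sum>j=2..i. a j \<omega>) \<le> t}"
        then have i: "(\<Sum>j=2..i. a j \<omega>) \<le> t" by simp
        show "i \<in> {..<j}"
        proof (rule ccontr)
          assume "i \<notin> {..<j}"
          then have "(\<Sum>i=2..j. a i \<omega>) \<le> (\<Sum>j=2..i. a j \<omega>)"
            using elim by (intro sum_mono2) auto
          then show False using i n j by simp
        qed
      qed
      then show ?thesis by (rule finite_subset) simp
    qed
    then show ?case using elim by (auto simp: regular_inputs_def)
  qed
qed

end

section \<open>The state found by arriving customers\<close>

text \<open>The integral of \<open>G\<close> along the path from a state up to the next arrival.\<close>

definition segment_integral :: "(real \<times> real \<Rightarrow> ennreal) \<Rightarrow> real \<times> real \<Rightarrow> ennreal" where
  "segment_integral G x =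
     (\<integral>\<^sup>+r. G (fst x - r, max 0 (snd x - r)) * indicator {0..<fst x} r \<partial>lborel)"

lemma segment_integral_shift:
  assumes [measurable]: "G \<in> borel_measurable borel2"
    and Z: "\<And>r. \<alpha> \<le> r \<Longrightarrow> r < \<beta> \<Longrightarrow> Z r = (\<beta> - r, max 0 (w - (r - \<alpha>)))"
  shows "(\<integral>\<^sup>+r. G (Z r) * indicator {\<alpha>..<\<beta>} r \<partial>lborel) = segment_integral G (\<beta> - \<alpha>, w)"
proof -
  have "(\<integral>\<^sup>+r. G (Z r) * indicator {\<alpha>..<\<beta>} r \<partial>lborel)
      = (\<integral>\<^sup>+r. G (\<beta> - r, max 0 (w - (r - \<alpha>))) * indicator {\<alpha>..<\<beta>} r \<partial>lborel)"
    by (intro nn_integral_cong) (auto simp: Z indicator_def)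
  also have "\<dots> = (\<integral>\<^sup>+r. G (\<beta> - (\<alpha> + r), max 0 (w - (\<alpha> + r - \<alpha>))) * indicator {\<alpha>..<\<beta>} (\<alpha> + r) \<partial>lborel)"
    by (subst nn_integral_real_affine[where c = 1 and t = \<alpha>]) auto
  also have "\<dots> = segment_integral G (\<beta> - \<alpha>, w)"
    unfolding segment_integral_def by (intro nn_integral_cong) (auto simp: indicator_def diff_diff_eq)
  finally show ?thesis .
qed

context queue_input
begin

lemma suminf_arrivals_upto:
  assumes "0 \<le> t"
  shows "(\<Sum>k. indicator {..t} (T (Suc k)) * f k) = (\<Sum>k<A t. f k :: ennreal)"
proof -
  have iff: "T (Suc k) \<le> t \<longleftrightarrow> k < A t" for k
    using count_le_iff[OF assms, of "Suc k"] by (simp add: Suc_le_eq)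
  have "(\<Sum>k. indicator {..t} (T (Suc k)) * f k) = (\<Sum>k<A t. indicator {..t} (T (Suc k)) * f k)"
    by (intro suminf_finite) (auto simp: indicator_def iff)
  also have "\<dots> = (\<Sum>k<A t. f k)"
    by (intro sum.cong) (auto simp: indicator_def iff)
  finally show ?thesis .
qed

text \<open>Time integrals up to \<open>t\<close> split into complete interarrival segments.  The segments in progress at
  times 0 and \<open>t\<close> are completed to segment integrals of the state at these times, which have the same
  mean under stationarity.\<close>

lemma occupation_identity:
  assumes G [measurable]: "G \<in> borel_measurable borel2" and t: "0 \<le> t"
  shows "(\<integral>\<^sup>+r. G (X r) * indicator {0..<t} r \<partial>lborel) + segment_integral G (X t)
    = segment_integral G (\<tau>0, v0)
      + (\<Sum>k<A t. segment_integral G (a (k + 2), snd (Y k) + s (k + 1) * of_bool (fst (Y k) < d (k + 1))))"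
proof -
  have [measurable]: "X \<in> borel \<rightarrow>\<^sub>M borel2"
    by (rule measurable_explicit_state) auto
  have split: "(\<integral>\<^sup>+r. G (X r) * indicator {0..<\<beta>} r \<partial>lborel)
      = (\<integral>\<^sup>+r. G (X r) * indicator {0..<\<alpha>} r \<partial>lborel) + (\<integral>\<^sup>+r. G (X r) * indicator {\<alpha>..<\<beta>} r \<partial>lborel)"
    if "0 \<le> \<alpha>" "\<alpha> \<le> \<beta>" for \<alpha> \<beta>
  proof -
    have "(\<integral>\<^sup>+r. G (X r) * indicator {0..<\<beta>} r \<partial>lborel)
        = (\<integral>\<^sup>+r. G (X r) * indicator {0..<\<alpha>} r + G (X r) * indicator {\<alpha>..<\<beta>} r \<partial>lborel)"
      using that by (intro nn_integral_cong) (auto simp: indicator_def)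
    then show ?thesis by (simp add: nn_integral_add)
  qed
  have upto: "(\<integral>\<^sup>+r. G (X r) * indicator {0..<T j} r \<partial>lborel)
      = (\<Sum>i<j. segment_integral G (T (Suc i) - T i, U i))" for j
  proof (induction j)
    case (Suc j)
    have "(\<integral>\<^sup>+r. G (X r) * indicator {T j..<T (Suc j)} r \<partial>lborel)
        = segment_integral G (T (Suc j) - T j, U j)"
      by (rule segment_integral_shift[OF G]) (rule explicit_state_on)
    then show ?case
      using split[of "T j" "T (Suc j)"] T_nonneg[of j] T_mono[of j "Suc j"] Suc by simp
  qed simp
  define n where "n = A t"
  have n: "T n \<le> t" "t < T (Suc n)" using T_count_le less_T_Suc_count t by (auto simp: n_def)
  have Xt: "X t = (T (Suc n) - t, max 0 (U n - (t - T n)))" by (rule explicit_state_on[OF n])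
  have "(\<integral>\<^sup>+r. G (X r) * indicator {t..<T (Suc n)} r \<partial>lborel)
      = segment_integral G (T (Suc n) - t, max 0 (U n - (t - T n)))"
  proof (rule segment_integral_shift[OF G])
    fix r assume r: "t \<le> r" "r < T (Suc n)"
    then show "X r = (T (Suc n) - r, max 0 (max 0 (U n - (t - T n)) - (r - t)))"
      using n by (subst explicit_state_on[of n]) auto
  qed
  then have "(\<integral>\<^sup>+r. G (X r) * indicator {0..<t} r \<partial>lborel) + segment_integral G (X t)
      = (\<integral>\<^sup>+r. G (X r) * indicator {0..<T (Suc n)} r \<partial>lborel)"
    using split[of t "T (Suc n)"] t n Xt by simp
  also have "\<dots> = segment_integral G (T (Suc 0) - T 0, U 0)
      + (\<Sum>k<n. segment_integral G (T (Suc (Suc k)) - T (Suc k), U (Suc k)))"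
    unfolding upto by (rule sum.lessThan_Suc_shift)
  finally show ?thesis
    by (simp add: n_def epoch_Suc work_after_def)
qed

end

lemma AE_pair_fst:
  assumes "prob_space N" "AE x in M. P x"
  shows "AE p in M \<Otimes>\<^sub>M N. P (fst p)"
proof -
  interpret N: prob_space N by fact
  from assms(2) obtain E where E: "{x \<in> space M. \<not> P x} \<subseteq> E" "emeasure M E = 0" "E \<in> sets M"
    by (rule AE_E)
  show ?thesis
  proof (rule AE_I)
    show "{p \<in> space (M \<Otimes>\<^sub>M N). \<not> P (fst p)} \<subseteq> E \<times> space N"
      using E by (auto simp: space_pair_measure)
    show "emeasure (M \<Otimes>\<^sub>M N) (E \<times> space N) = 0"
      using E by (simp add: N.emeasure_pair_measure_Times)
    show "E \<times> space N \<in> sets (M \<Otimes>\<^sub>M N)" using E by auto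
  qed
qed

lemma AE_pair_snd:
  assumes "prob_space N" "AE x in N. P x"
  shows "AE p in M \<Otimes>\<^sub>M N. P (snd p)"
proof -
  interpret N: prob_space N by fact
  from assms(2) obtain E where E: "{x \<in> space N. \<not> P x} \<subseteq> E" "emeasure N E = 0" "E \<in> sets N"
    by (rule AE_E)
  show ?thesis
  proof (rule AE_I)
    show "{p \<in> space (M \<Otimes>\<^sub>M N). \<not> P (snd p)} \<subseteq> space M \<times> E"
      using E by (auto simp: space_pair_measure)
    show "emeasure (M \<Otimes>\<^sub>M N) (space M \<times> E) = 0"
      using E by (simp add: N.emeasure_pair_measure_Times)
    show "space M \<times> E \<in> sets (M \<Otimes>\<^sub>M N)" using E by auto
  qed
qed

text \<open>Stationarity is stated for the explicit process, so that all measurability questions concern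
  functions of the primitive inputs and of the initial state.\<close>

locale stationary_queue = queue_primitives M a s d
  for M :: "'a measure" and a s d :: "nat \<Rightarrow> 'a \<Rightarrow> real" +
  fixes \<pi> :: "(real \<times> real) measure"
  assumes prob_\<pi>: "prob_space \<pi>" and sets_\<pi>: "sets \<pi> = sets borel2"
    and \<pi>_state: "emeasure \<pi> state_space = 1"
    and invariant: "\<And>t B. 0 \<le> t \<Longrightarrow> B \<in> sets borel2 \<Longrightarrow> emeasure \<pi> B = (\<integral>\<^sup>+x. emeasure M
      {\<omega> \<in> space M. explicit_state x (\<lambda>i. a i \<omega>) (\<lambda>i. s i \<omega>) (\<lambda>i. d i \<omega>) t \<in> B} \<partial>\<pi>)"
begin

declare sets_\<pi> [measurable_cong, simp]

sublocale \<pi>: prob_space \<pi> by (rule prob_\<pi>)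
sublocale PQ: pair_prob_space \<pi> M ..

abbreviation "Q \<equiv> \<pi> \<Otimes>\<^sub>M M"

definition state_at :: "real \<Rightarrow> (real \<times> real) \<times> 'a \<Rightarrow> real \<times> real" where
  "state_at t p = explicit_state (fst p) (\<lambda>i. a i (snd p)) (\<lambda>i. s i (snd p)) (\<lambda>i. d i (snd p)) t"

definition found :: "nat \<Rightarrow> (real \<times> real) \<times> 'a \<Rightarrow> real \<times> real" where
  "found k p = waits (fst p) (\<lambda>i. a i (snd p)) (\<lambda>i. s i (snd p)) (\<lambda>i. d i (snd p)) k"

definition found_time :: "nat \<Rightarrow> (real \<times> real) \<times> 'a \<Rightarrow> real" where
  "found_time k p = epoch (fst (fst p)) (\<lambda>i. a i (snd p)) (Suc k)"

lemma inputs_measurable: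
  "2 \<le> i \<Longrightarrow> (\<lambda>p. a i (snd p)) \<in> borel_measurable (\<pi> \<Otimes>\<^sub>M M)"
  "1 \<le> i \<Longrightarrow> (\<lambda>p. s i (snd p)) \<in> borel_measurable (\<pi> \<Otimes>\<^sub>M M)"
  "1 \<le> i \<Longrightarrow> (\<lambda>p. d i (snd p)) \<in> borel_measurable (\<pi> \<Otimes>\<^sub>M M)"
  by (rule measurable_compose[OF measurable_snd], simp add: a_rv s_rv d_rv)+

lemma fst_Q_measurable: "fst \<in> \<pi> \<Otimes>\<^sub>M M \<rightarrow>\<^sub>M borel2"
  using measurable_fst[of \<pi> M] measurable_cong_sets[OF refl sets_\<pi>] by blast

lemma state_at_measurable [measurable]: "state_at t \<in> Q \<rightarrow>\<^sub>M borel2"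
  unfolding state_at_def
  by (intro measurable_explicit_state inputs_measurable fst_Q_measurable) auto

lemma state_at_jointly_measurable: "(\<lambda>(p, t). state_at t p) \<in> Q \<Otimes>\<^sub>M borel \<rightarrow>\<^sub>M borel2"
  unfolding state_at_def case_prod_beta
  by (intro measurable_explicit_state measurable_compose[OF measurable_fst fst_Q_measurable]
        measurable_compose[OF measurable_fst inputs_measurable(1)]
        measurable_compose[OF measurable_fst inputs_measurable(2)]
        measurable_compose[OF measurable_fst inputs_measurable(3)] measurable_snd)

lemma found_measurable [measurable]: "found k \<in> Q \<rightarrow>\<^sub>M borel2"
  unfolding found_def by (intro measurable_waits inputs_measurable fst_Q_measurable)

lemma found_time_measurable [measurable]: "found_time k \<in> borel_measurable Q"
  unfolding found_time_def
  by (intro measurable_epoch inputs_measurable measurable_compose[OF fst_Q_measurable measurable_fst])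

lemma AE_queue_input: "AE p in Q. queue_input (fst (fst p)) (snd (fst p)) (\<lambda>i. a i (snd p)) (\<lambda>i. s i (snd p))"
proof -
  have S: "state_space \<in> sets \<pi>"
    unfolding sets_\<pi> state_space_def by (rule pair_measureI) auto
  have "AE x in \<pi>. x \<in> state_space"
    using S \<pi>_state by (intro \<pi>.AE_prob_1) (simp add: \<pi>.emeasure_eq_measure)
  then have "AE p in Q. fst p \<in> state_space"
    by (rule AE_pair_fst[OF prob_space_axioms])
  moreover have "AE p in Q. regular_inputs (\<lambda>i. a i (snd p)) (\<lambda>i. s i (snd p))"
    by (rule AE_pair_snd[OF prob_space_axioms AE_regular_inputs])
  ultimately show ?thesis
    by eventually_elim (auto simp: queue_input_def state_space_def)
qed

lemma nn_integral_Q: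
  assumes [measurable]: "f \<in> borel_measurable Q"
  shows "(\<integral>\<^sup>+p. f p \<partial>Q) = (\<integral>\<^sup>+x. (\<integral>\<^sup>+\<omega>. f (x, \<omega>) \<partial>M) \<partial>\<pi>)"
  by (rule nn_integral_fst[symmetric]) fact

lemma distr_state_at: "0 \<le> t \<Longrightarrow> distr Q borel2 (state_at t) = \<pi>"
proof (rule measure_eqI)
  fix B assume t: "0 \<le> t" and "B \<in> sets (distr Q borel2 (state_at t))"
  then have B [measurable]: "B \<in> sets borel2" by simp
  have "emeasure (distr Q borel2 (state_at t)) B = (\<integral>\<^sup>+p. indicator B (state_at t p) \<partial>Q)"
    by (subst nn_integral_indicator[symmetric], simp, subst nn_integral_distr) auto
  also have "\<dots> = (\<integral>\<^sup>+x. (\<integral>\<^sup>+\<omega>. indicator B (state_at t (x, \<omega>)) \<partial>M) \<partial>\<pi>)"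
    by (rule nn_integral_Q) measurable
  also have "\<dots> = (\<integral>\<^sup>+x. emeasure M {\<omega> \<in> space M. explicit_state x (\<lambda>i. a i \<omega>) (\<lambda>i. s i \<omega>) (\<lambda>i. d i \<omega>) t \<in> B} \<partial>\<pi>)"
  proof (rule nn_integral_cong)
    fix x assume x: "x \<in> space \<pi>"
    have "(\<lambda>\<omega>. state_at t (x, \<omega>)) \<in> M \<rightarrow>\<^sub>M borel2"
      using x by (intro measurable_compose[OF measurable_Pair1' state_at_measurable])
    then have "{\<omega> \<in> space M. state_at t (x, \<omega>) \<in> B} \<in> sets M" by measurable
    then have "emeasure M {\<omega> \<in> space M. state_at t (x, \<omega>) \<in> B}
        = (\<integral>\<^sup>+\<omega>. indicator {\<omega> \<in> space M. state_at t (x, \<omega>) \<in> B} \<omega> \<partial>M)" by simp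
    also have "\<dots> = (\<integral>\<^sup>+\<omega>. indicator B (state_at t (x, \<omega>)) \<partial>M)"
      by (intro nn_integral_cong) (auto simp: indicator_def)
    finally show "(\<integral>\<^sup>+\<omega>. indicator B (state_at t (x, \<omega>)) \<partial>M)
        = emeasure M {\<omega> \<in> space M. explicit_state x (\<lambda>i. a i \<omega>) (\<lambda>i. s i \<omega>) (\<lambda>i. d i \<omega>) t \<in> B}"
      by (simp add: state_at_def)
  qed
  also have "\<dots> = emeasure \<pi> B" by (rule invariant[OF t B, symmetric])
  finally show "emeasure (distr Q borel2 (state_at t)) B = emeasure \<pi> B" .
qed simp

lemma nn_integral_state_at:
  assumes "0 \<le> t" and [measurable]: "f \<in> borel_measurable borel2"
  shows "(\<integral>\<^sup>+p. f (state_at t p) \<partial>Q) = (\<integral>\<^sup>+x. f x \<partial>\<pi>)"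
  by (subst distr_state_at[OF assms(1), symmetric], subst nn_integral_distr) simp_all

lemma nn_integral_initial:
  assumes [measurable]: "f \<in> borel_measurable borel2"
  shows "(\<integral>\<^sup>+p. f (fst p) \<partial>Q) = (\<integral>\<^sup>+x. f x \<partial>\<pi>)"
  by (subst nn_integral_Q) (simp_all add: emeasure_space_1)

text \<open>Whether customer \<open>j + 1\<close> arrives before \<open>t\<close>, and what this customer finds, is decided by earlier
  inputs; the inputs of the following step may therefore be replaced by a fresh copy.\<close>

lemma nn_integral_found_fresh:
  assumes [measurable]: "k \<in> borel_measurable (borel2 \<Otimes>\<^sub>M borel3)"
  shows "(\<integral>\<^sup>+p. indicator {..t} (found_time j p) * k (found j p, customer j (snd p)) \<partial>Q)
    = (\<integral>\<^sup>+p. indicator {..t} (found_time j p) * (\<integral>\<^sup>+\<omega>. k (found j p, customer 0 \<omega>) \<partial>M) \<partial>Q)"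
proof -
  have [measurable]: "(\<lambda>p. customer j (snd p)) \<in> Q \<rightarrow>\<^sub>M borel3" for j
    by (rule measurable_compose[OF measurable_snd customer_measurable])
  have [measurable]: "(\<lambda>p. customer 0 (snd p)) \<in> Q \<Otimes>\<^sub>M M \<rightarrow>\<^sub>M borel3"
    by (rule measurable_compose[OF measurable_snd customer_measurable])
  have 1: "(\<lambda>p. \<integral>\<^sup>+\<omega>. k (found j p, customer 0 \<omega>) \<partial>M) \<in> borel_measurable Q"
  proof -
    have "(\<lambda>(p, \<omega>). k (found j p, customer 0 \<omega>)) \<in> borel_measurable (Q \<Otimes>\<^sub>M M)"
      unfolding case_prod_beta by measurable
    then show ?thesis by (rule borel_measurable_nn_integral)
  qed
  have 2: "(\<lambda>p. indicator {..t} (found_time j p) * k (found j p, customer j (snd p))) \<in> borel_measurable Q"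
    by measurable
  have 3: "(\<lambda>p. indicator {..t} (found_time j p) * (\<integral>\<^sup>+\<omega>. k (found j p, customer 0 \<omega>) \<partial>M)) \<in> borel_measurable Q"
    by (intro borel_measurable_times_ennreal 1) measurable
  have "(\<integral>\<^sup>+p. indicator {..t} (found_time j p) * k (found j p, customer j (snd p)) \<partial>Q)
      = (\<integral>\<^sup>+x. (\<integral>\<^sup>+\<omega>. indicator {..t} (found_time j (x, \<omega>)) * k (found j (x, \<omega>), customer j \<omega>) \<partial>M) \<partial>\<pi>)"
    by (simp only: nn_integral_Q[OF 2] snd_conv)
  also have "\<dots> = (\<integral>\<^sup>+x. (\<integral>\<^sup>+\<omega>. (\<integral>\<^sup>+\<omega>'. indicator {..t} (found_time j (x, \<omega>))
      * k (found j (x, \<omega>), customer 0 \<omega>') \<partial>M) \<partial>M) \<partial>\<pi>)"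
  proof (rule nn_integral_cong)
    fix x
    have "(\<lambda>y. indicator {..t} (fst (fst y)) * k (snd (fst y), snd y))
        \<in> borel_measurable ((borel \<Otimes>\<^sub>M borel2) \<Otimes>\<^sub>M borel3)"
      by measurable
    from nn_integral_fresh_customer[OF this, of x j]
    show "(\<integral>\<^sup>+\<omega>. indicator {..t} (found_time j (x, \<omega>)) * k (found j (x, \<omega>), customer j \<omega>) \<partial>M)
      = (\<integral>\<^sup>+\<omega>. (\<integral>\<^sup>+\<omega>'. indicator {..t} (found_time j (x, \<omega>)) * k (found j (x, \<omega>), customer 0 \<omega>') \<partial>M) \<partial>M)"
      by (simp only: found_time_def found_def fst_conv snd_conv)
  qed
  also have "\<dots> = (\<integral>\<^sup>+x. (\<integral>\<^sup>+\<omega>. indicator {..t} (found_time j (x, \<omega>))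
      * (\<integral>\<^sup>+\<omega>'. k (found j (x, \<omega>), customer 0 \<omega>') \<partial>M) \<partial>M) \<partial>\<pi>)"
    by (intro nn_integral_cong nn_integral_cmult measurable_compose[OF customer_measurable])
      (auto intro!: measurable_compose[OF measurable_Pair1' assms] simp: space_pair_measure)
  also have "\<dots> = (\<integral>\<^sup>+p. indicator {..t} (found_time j p) * (\<integral>\<^sup>+\<omega>. k (found j p, customer 0 \<omega>) \<partial>M) \<partial>Q)"
    by (simp only: nn_integral_Q[OF 3])
  finally show ?thesis .
qed

text \<open>The states found by the arrivals up to time \<open>t\<close>, counted with expected multiplicity.\<close>

definition visits :: "real \<Rightarrow> (real \<times> real) measure" where
  "visits t = distr (density (Q \<Otimes>\<^sub>M count_space UNIV) (\<lambda>y. indicator {..t} (found_time (snd y) (fst y))))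
     borel2 (\<lambda>y. found (snd y) (fst y))"

lemma sets_visits [simp, measurable_cong]: "sets (visits t) = sets borel2"
  by (simp add: visits_def)

lemma nn_integral_visits:
  assumes h [measurable]: "h \<in> borel_measurable borel2"
  shows "(\<integral>\<^sup>+\<zeta>. h \<zeta> \<partial>visits t) = (\<Sum>k. \<integral>\<^sup>+p. indicator {..t} (found_time k p) * h (found k p) \<partial>Q)"
proof -
  interpret N: sigma_finite_measure "count_space (UNIV :: nat set)"
    by (rule sigma_finite_measure_count_space)
  have snd: "snd \<in> Q \<Otimes>\<^sub>M count_space (UNIV :: nat set) \<rightarrow>\<^sub>M count_space UNIV" by measurable
  have [measurable]: "(\<lambda>y. found (snd y) (fst y)) \<in> Q \<Otimes>\<^sub>M count_space UNIV \<rightarrow>\<^sub>M borel2"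
    by (rule measurable_compose_countable[OF _ snd]) measurable
  have [measurable]: "(\<lambda>y. found_time (snd y) (fst y)) \<in> borel_measurable (Q \<Otimes>\<^sub>M count_space UNIV)"
    by (rule measurable_compose_countable[OF _ snd]) measurable
  have "(\<integral>\<^sup>+\<zeta>. h \<zeta> \<partial>visits t) = (\<integral>\<^sup>+y. indicator {..t} (found_time (snd y) (fst y)) * h (found (snd y) (fst y))
      \<partial>(Q \<Otimes>\<^sub>M count_space UNIV))"
    unfolding visits_def by (simp add: nn_integral_distr nn_integral_density)
  also have "\<dots> = (\<integral>\<^sup>+p. (\<integral>\<^sup>+k. indicator {..t} (found_time k p) * h (found k p) \<partial>count_space UNIV) \<partial>Q)"
    by (subst N.nn_integral_fst[symmetric]) simp_all
  also have "\<dots> = (\<integral>\<^sup>+p. (\<Sum>k. indicator {..t} (found_time k p) * h (found k p)) \<partial>Q)"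
    by (simp add: nn_integral_count_space_nat)
  also have "\<dots> = (\<Sum>k. \<integral>\<^sup>+p. indicator {..t} (found_time k p) * h (found k p) \<partial>Q)"
    by (rule nn_integral_suminf) measurable
  finally show ?thesis .
qed

abbreviation step :: "real \<times> real \<Rightarrow> 'a \<Rightarrow> real \<times> real" where
  "step \<zeta> \<omega> \<equiv> next_wait (a 2 \<omega>) (s 1 \<omega>) (d 1 \<omega>) \<zeta>"

lemma nn_integral_visits_customer:
  assumes k [measurable]: "k \<in> borel_measurable (borel2 \<Otimes>\<^sub>M borel3)"
  shows "(\<integral>\<^sup>+\<zeta>. (\<integral>\<^sup>+\<omega>. k (\<zeta>, a 2 \<omega>, s 1 \<omega>, d 1 \<omega>) \<partial>M) \<partial>visits t)
    = (\<integral>\<^sup>+p. (\<Sum>j. indicator {..t} (found_time j p) * k (found j p, customer j (snd p))) \<partial>Q)"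
proof -
  have [measurable]: "(\<lambda>p. customer j (snd p)) \<in> Q \<rightarrow>\<^sub>M borel3" for j
    by (rule measurable_compose[OF measurable_snd customer_measurable])
  have m: "(\<lambda>\<zeta>. \<integral>\<^sup>+\<omega>. k (\<zeta>, a 2 \<omega>, s 1 \<omega>, d 1 \<omega>) \<partial>M) \<in> borel_measurable borel2"
    by measurable
  have "(\<integral>\<^sup>+\<zeta>. (\<integral>\<^sup>+\<omega>. k (\<zeta>, a 2 \<omega>, s 1 \<omega>, d 1 \<omega>) \<partial>M) \<partial>visits t)
      = (\<Sum>j. \<integral>\<^sup>+p. indicator {..t} (found_time j p) * (\<integral>\<^sup>+\<omega>. k (found j p, customer 0 \<omega>) \<partial>M) \<partial>Q)"
    unfolding add_0 by (rule nn_integral_visits[OF m])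
  also have "\<dots> = (\<Sum>j. \<integral>\<^sup>+p. indicator {..t} (found_time j p) * k (found j p, customer j (snd p)) \<partial>Q)"
    by (simp only: nn_integral_found_fresh[OF k])
  also have "\<dots> = (\<integral>\<^sup>+p. (\<Sum>j. indicator {..t} (found_time j p) * k (found j p, customer j (snd p))) \<partial>Q)"
    by (rule nn_integral_suminf[symmetric]) measurable
  finally show ?thesis .
qed

text \<open>The sums of \<open>h\<close> over the states found by customers \<open>1, ..., A t\<close> and by their successors telescope
  up to the first and the last term.  These are functions of \<open>(V - \<tau>)\<^sup>+\<close> at times 0 and \<open>t\<close>, so they
  have equal means; boundedness of \<open>h\<close> allows them to be cancelled.\<close>

lemma visits_invariant:
  assumes t: "0 \<le> t" and h [measurable]: "h \<in> borel_measurable borel2"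
    and c: "\<And>\<zeta>. h \<zeta> \<le> c" "c < \<infinity>"
  shows "(\<integral>\<^sup>+\<zeta>. h \<zeta> \<partial>visits t) = (\<integral>\<^sup>+\<zeta>. (\<integral>\<^sup>+\<omega>. h (step \<zeta> \<omega>) \<partial>M) \<partial>visits t)"
proof -
  define \<psi> :: "real \<times> real \<Rightarrow> real \<times> real"
    where "\<psi> x = (let y = max 0 (snd x - fst x) in (y, y))" for x
  have \<psi> [measurable]: "\<psi> \<in> borel2 \<rightarrow>\<^sub>M borel2" unfolding \<psi>_def Let_def by measurable
  have h\<psi>: "(\<lambda>x. h (\<psi> x)) \<in> borel_measurable borel2" by measurable
  define S where "S p = (\<Sum>k. indicator {..t} (found_time k p) * h (found k p))" for p
  define S' where "S' p = (\<Sum>k. indicator {..t} (found_time k p) * h (found (Suc k) p))" for p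
  have [measurable]: "S \<in> borel_measurable Q" "S' \<in> borel_measurable Q"
    unfolding S_def S'_def by measurable
  have fin: "(\<integral>\<^sup>+x. h (\<psi> x) \<partial>\<pi>) \<noteq> \<top>"
  proof -
    have "(\<integral>\<^sup>+x. h (\<psi> x) \<partial>\<pi>) \<le> (\<integral>\<^sup>+x. c \<partial>\<pi>)" by (intro nn_integral_mono c)
    then show ?thesis using c(2) by (auto simp: \<pi>.emeasure_space_1 top_unique)
  qed
  have "AE p in Q. S p + h (\<psi> (state_at t p)) = S' p + h (\<psi> (fst p))"
    using AE_queue_input
  proof eventually_elim
    case (elim p)
    interpret q: queue_input "fst (fst p)" "snd (fst p)" "\<lambda>i. a i (snd p)" "\<lambda>i. s i (snd p)" "\<lambda>i. d i (snd p)"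
      by (rule elim)
    define n where "n = arrival_count (fst (fst p)) (\<lambda>i. a i (snd p)) t"
    have S: "S p = (\<Sum>k<n. h (found k p))" and S': "S' p = (\<Sum>k<n. h (found (Suc k) p))"
      unfolding S_def S'_def n_def found_time_def by (rule q.suminf_arrivals_upto[OF t])+
    have "found n p = \<psi> (state_at t p)"
      using q.waits_at_count[OF t] by (simp add: found_def n_def \<psi>_def state_at_def)
    moreover have "found 0 p = \<psi> (fst p)" by (simp add: found_def \<psi>_def Let_def)
    moreover have "(\<Sum>k<n. h (found k p)) + h (found n p) = (\<Sum>k<n. h (found (Suc k) p)) + h (found 0 p)"
      using sum.lessThan_Suc_shift[of "\<lambda>k. h (found k p)" n] by (simp add: add.commute)
    ultimately show ?case unfolding S S' by simp
  qed
  then have "(\<integral>\<^sup>+p. S p + h (\<psi> (state_at t p)) \<partial>Q) = (\<integral>\<^sup>+p. S' p + h (\<psi> (fst p)) \<partial>Q)"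
    by (rule nn_integral_cong_AE)
  then have "(\<integral>\<^sup>+p. S p \<partial>Q) + (\<integral>\<^sup>+x. h (\<psi> x) \<partial>\<pi>) = (\<integral>\<^sup>+p. S' p \<partial>Q) + (\<integral>\<^sup>+x. h (\<psi> x) \<partial>\<pi>)"
    by (simp add: nn_integral_add nn_integral_state_at[OF t h\<psi>] nn_integral_initial[OF h\<psi>]
          measurable_compose[OF fst_Q_measurable h\<psi>])
  then have "(\<integral>\<^sup>+p. S p \<partial>Q) = (\<integral>\<^sup>+p. S' p \<partial>Q)"
    using fin by (simp add: ennreal_add_left_cancel add.commute[of _ "\<integral>\<^sup>+x. h (\<psi> x) \<partial>\<pi>"])
  moreover have "(\<integral>\<^sup>+p. S p \<partial>Q) = (\<integral>\<^sup>+\<zeta>. h \<zeta> \<partial>visits t)"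
    unfolding nn_integral_visits[OF h] S_def by (rule nn_integral_suminf) measurable
  moreover have "(\<integral>\<^sup>+p. S' p \<partial>Q) = (\<integral>\<^sup>+\<zeta>. (\<integral>\<^sup>+\<omega>. h (step \<zeta> \<omega>) \<partial>M) \<partial>visits t)"
  proof -
    define k where "k y = h (next_wait (fst (snd y)) (fst (snd (snd y))) (snd (snd (snd y))) (fst y))"
      for y :: "(real \<times> real) \<times> real \<times> real \<times> real"
    have "k \<in> borel_measurable (borel2 \<Otimes>\<^sub>M borel3)" unfolding k_def by measurable
    from nn_integral_visits_customer[OF this, of t]
    have "(\<integral>\<^sup>+\<zeta>. (\<integral>\<^sup>+\<omega>. h (step \<zeta> \<omega>) \<partial>M) \<partial>visits t)
        = (\<integral>\<^sup>+p. (\<Sum>j. indicator {..t} (found_time j p) * k (found j p, customer j (snd p))) \<partial>Q)"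
      by (simp only: k_def fst_conv snd_conv)
    also have "\<dots> = (\<integral>\<^sup>+p. S' p \<partial>Q)"
      unfolding S'_def by (simp only: k_def fst_conv snd_conv found_def waits.simps)
    finally show ?thesis by simp
  qed
  ultimately show ?thesis by simp
qed

lemma segment_integral_measurable:
  assumes [measurable]: "G \<in> borel_measurable borel2"
  shows "segment_integral G \<in> borel_measurable borel2"
proof -
  have eq: "indicator {0..<fst x} r = (if 0 \<le> r \<and> r < fst x then 1 else 0 :: ennreal)" for x :: "real \<times> real" and r
    by (simp add: indicator_def)
  have "(\<lambda>x. \<integral>\<^sup>+r. G (fst x - r, max 0 (snd x - r)) * indicator {0..<fst x} r \<partial>lborel) \<in> borel_measurable borel2"
    unfolding eq by measurable
  then show ?thesis by (simp add: segment_integral_def[abs_def])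
qed

text \<open>The occupation identity integrated over the stationary law; the two incomplete segments cancel.\<close>

lemma visits_occupation:
  assumes t: "0 \<le> t" and G [measurable]: "G \<in> borel_measurable borel2"
    and fin: "(\<integral>\<^sup>+x. segment_integral G x \<partial>\<pi>) \<noteq> \<top>"
  shows "ennreal t * (\<integral>\<^sup>+x. G x \<partial>\<pi>) = (\<integral>\<^sup>+\<zeta>. (\<integral>\<^sup>+\<omega>.
    segment_integral G (a 2 \<omega>, snd \<zeta> + s 1 \<omega> * of_bool (fst \<zeta> < d 1 \<omega>)) \<partial>M) \<partial>visits t)"
proof -
  have sG [measurable]: "segment_integral G \<in> borel_measurable borel2"
    by (rule segment_integral_measurable[OF G])
  define k where "k y = segment_integral G (fst (snd y),
      snd (fst y) + fst (snd (snd y)) * of_bool (fst (fst y) < snd (snd (snd y))))"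
    for y :: "(real \<times> real) \<times> real \<times> real \<times> real"
  have k: "k \<in> borel_measurable (borel2 \<Otimes>\<^sub>M borel3)" unfolding k_def by measurable
  define S where "S p = (\<Sum>j. indicator {..t} (found_time j p) * k (found j p, customer j (snd p)))" for p
  have cm [measurable]: "(\<lambda>p. customer j (snd p)) \<in> Q \<rightarrow>\<^sub>M borel3" for j
    by (rule measurable_compose[OF measurable_snd customer_measurable])
  have kc: "(\<lambda>p. k (found j p, customer j (snd p))) \<in> borel_measurable Q" for j
    by (rule measurable_compose[OF _ k]) measurable
  have [measurable]: "S \<in> borel_measurable Q"
    unfolding S_def
    by (intro borel_measurable_suminf_order borel_measurable_times_ennreal kc) measurable
  define J where "J p = (\<integral>\<^sup>+r. G (state_at r p) * indicator {0..<t} r \<partial>lborel)" for p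
  have Gj: "(\<lambda>y. G (state_at (snd y) (fst y))) \<in> borel_measurable (Q \<Otimes>\<^sub>M borel)"
    using measurable_compose[OF state_at_jointly_measurable G] by (simp add: case_prod_beta)
  have Gj': "(\<lambda>(p, r). G (state_at r p) * indicator {0..<t} r) \<in> borel_measurable (Q \<Otimes>\<^sub>M lborel)"
    unfolding case_prod_beta
    by (intro borel_measurable_times_ennreal) (use Gj in \<open>simp_all cong: measurable_cong_sets\<close>)
  have [measurable]: "J \<in> borel_measurable Q"
    unfolding J_def using lborel.borel_measurable_nn_integral[OF Gj'] .
  have "AE p in Q. J p + segment_integral G (state_at t p) = segment_integral G (fst p) + S p"
    using AE_queue_input
  proof eventually_elim
    case (elim p)
    interpret q: queue_input "fst (fst p)" "snd (fst p)" "\<lambda>i. a i (snd p)" "\<lambda>i. s i (snd p)" "\<lambda>i. d i (snd p)"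
      by (rule elim)
    have "S p = (\<Sum>j<arrival_count (fst (fst p)) (\<lambda>i. a i (snd p)) t. k (found j p, customer j (snd p)))"
      unfolding S_def found_time_def by (rule q.suminf_arrivals_upto[OF t])
    then show ?case
      using q.occupation_identity[OF G t]
      by (simp only: J_def state_at_def found_def k_def fst_conv snd_conv prod.collapse)
  qed
  then have "(\<integral>\<^sup>+p. J p + segment_integral G (state_at t p) \<partial>Q) = (\<integral>\<^sup>+p. segment_integral G (fst p) + S p \<partial>Q)"
    by (rule nn_integral_cong_AE)
  then have "(\<integral>\<^sup>+p. J p \<partial>Q) + (\<integral>\<^sup>+x. segment_integral G x \<partial>\<pi>)
      = (\<integral>\<^sup>+x. segment_integral G x \<partial>\<pi>) + (\<integral>\<^sup>+p. S p \<partial>Q)"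
    by (simp add: nn_integral_add nn_integral_state_at[OF t sG] nn_integral_initial[OF sG]
          measurable_compose[OF fst_Q_measurable sG])
  then have "(\<integral>\<^sup>+p. J p \<partial>Q) = (\<integral>\<^sup>+p. S p \<partial>Q)"
    using fin by (simp add: ennreal_add_left_cancel add.commute[of _ "\<integral>\<^sup>+x. segment_integral G x \<partial>\<pi>"])
  moreover have "(\<integral>\<^sup>+p. J p \<partial>Q) = ennreal t * (\<integral>\<^sup>+x. G x \<partial>\<pi>)"
  proof -
    interpret QL: pair_sigma_finite Q lborel ..
    have "(\<integral>\<^sup>+p. J p \<partial>Q) = (\<integral>\<^sup>+r. (\<integral>\<^sup>+p. G (state_at r p) * indicator {0..<t} r \<partial>Q) \<partial>lborel)"
      unfolding J_def using QL.Fubini'[OF Gj'] by simp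
    also have "\<dots> = (\<integral>\<^sup>+r. (\<integral>\<^sup>+x. G x \<partial>\<pi>) * indicator {0..<t} r \<partial>lborel)"
      by (intro nn_integral_cong) (auto simp: indicator_def nn_integral_state_at[OF _ G])
    also have "\<dots> = ennreal t * (\<integral>\<^sup>+x. G x \<partial>\<pi>)"
      using t by (subst nn_integral_cmult_indicator) (auto simp: mult.commute)
    finally show ?thesis .
  qed
  moreover have "(\<integral>\<^sup>+p. S p \<partial>Q) = (\<integral>\<^sup>+\<zeta>. (\<integral>\<^sup>+\<omega>. k (\<zeta>, a 2 \<omega>, s 1 \<omega>, d 1 \<omega>) \<partial>M) \<partial>visits t)"
    unfolding S_def by (rule nn_integral_visits_customer[OF k, symmetric])
  ultimately show ?thesis by (simp only: k_def fst_conv snd_conv)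
qed

text \<open>Palm inversion: the time-stationary law is recovered by averaging over the interarrival time
  that follows an arrival.  The truncation by \<open>n\<close> keeps the boundary terms at times 0 and \<open>t\<close>
  finite, so that they cancel by stationarity.\<close>

lemma visits_inversion:
  assumes t: "0 \<le> t" and g [measurable]: "g \<in> borel_measurable borel"
  shows "ennreal t * (\<integral>\<^sup>+x. g (snd x) \<partial>\<pi>) = (\<integral>\<^sup>+\<zeta>. (\<integral>\<^sup>+\<omega>. (\<integral>\<^sup>+r.
    g (max 0 (snd \<zeta> + s 1 \<omega> * of_bool (fst \<zeta> < d 1 \<omega>) - r)) * indicator {0..<a 2 \<omega>} r \<partial>lborel) \<partial>M) \<partial>visits t)"
proof -
  define G where "G n x = min (g (snd x)) (of_nat n) * indicator {..<real n} (fst x)"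
    for n :: nat and x :: "real \<times> real"
  have G [measurable]: "G n \<in> borel_measurable borel2" for n unfolding G_def by measurable
  define R where "R n \<zeta> \<omega> r = G n (a 2 \<omega> - r, max 0 (snd \<zeta> + s 1 \<omega> * of_bool (fst \<zeta> < d 1 \<omega>) - r))
      * indicator {0..<a 2 \<omega>} r" for n and \<zeta> :: "real \<times> real" and \<omega> r
  have incG: "G m x \<le> G n x" if "m \<le> n" for m n x
    using that unfolding G_def
    by (intro mult_mono min.mono) (auto simp: indicator_def)
  have supG: "(SUP n. G n x) = g (snd x)" for x
  proof (rule antisym)
    show "(SUP n. G n x) \<le> g (snd x)"
      by (rule SUP_least) (auto simp: G_def indicator_def)
    obtain m where m: "fst x < real m" using reals_Archimedean2 by blast
    show "g (snd x) \<le> (SUP n. G n x)"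
    proof (rule ccontr)
      assume "\<not> g (snd x) \<le> (SUP n. G n x)"
      then have less: "(SUP n. G n x) < g (snd x)" by simp
      then have "(SUP n. G n x) < \<top>" using top_greatest by (rule order.strict_trans2)
      then obtain n :: nat where n: "(SUP n. G n x) < of_nat n"
        using ennreal_Ex_less_of_nat by blast
      have "G (max m n) x \<le> (SUP n. G n x)" by (rule SUP_upper) simp
      moreover have "G (max m n) x = min (g (snd x)) (of_nat (max m n))"
        using m by (simp add: G_def indicator_def)
      moreover have "min (g (snd x)) (of_nat n) \<le> min (g (snd x)) (of_nat (max m n))"
        by (intro min.mono) simp_all
      moreover have "(SUP n. G n x) < min (g (snd x)) (of_nat n)" using less n by simp
      ultimately show False by (metis leD order_trans)
    qed
  qed
  have eq: "ennreal t * (\<integral>\<^sup>+x. G n x \<partial>\<pi>) = (\<integral>\<^sup>+\<zeta>. (\<integral>\<^sup>+\<omega>. (\<integral>\<^sup>+r. R n \<zeta> \<omega> r \<partial>lborel) \<partial>M) \<partial>visits t)" for n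
  proof -
    have "segment_integral (G n) x \<le> of_nat n * ennreal (real n)" for x
    proof -
      have "segment_integral (G n) x \<le> (\<integral>\<^sup>+r. of_nat n * indicator {fst x - real n..fst x} r \<partial>lborel)"
        unfolding segment_integral_def by (intro nn_integral_mono) (auto simp: G_def indicator_def)
      also have "\<dots> = of_nat n * ennreal (real n)"
        by (subst nn_integral_cmult_indicator) auto
      finally show ?thesis .
    qed
    then have "(\<integral>\<^sup>+x. segment_integral (G n) x \<partial>\<pi>) \<le> (\<integral>\<^sup>+x. of_nat n * ennreal (real n) \<partial>\<pi>)"
      by (intro nn_integral_mono)
    also have "\<dots> < \<top>" by (simp add: \<pi>.emeasure_space_1 ennreal_mult_less_top of_nat_less_top)
    finally have "(\<integral>\<^sup>+x. segment_integral (G n) x \<partial>\<pi>) \<noteq> \<top>" by simp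
    from visits_occupation[OF t G this] show ?thesis
      by (simp only: segment_integral_def R_def fst_conv snd_conv)
  qed
  have Rm3: "(\<lambda>(y, r). R n (fst y) (snd y) r) \<in> borel_measurable ((borel2 \<Otimes>\<^sub>M M) \<Otimes>\<^sub>M lborel)" for n
  proof -
    have eq: "indicator {0..<z} r = (if 0 \<le> r \<and> r < z then 1 else 0 :: ennreal)" for z r :: real
      by (simp add: indicator_def)
    show ?thesis unfolding R_def case_prod_beta eq by measurable
  qed
  have Rm2: "(\<lambda>(\<zeta>, \<omega>). \<integral>\<^sup>+r. R n \<zeta> \<omega> r \<partial>lborel) \<in> borel_measurable (borel2 \<Otimes>\<^sub>M M)" for n
    using lborel.borel_measurable_nn_integral[OF Rm3[of n]] by (simp only: split_beta')
  have Rm1: "(\<lambda>\<zeta>. \<integral>\<^sup>+\<omega>. (\<integral>\<^sup>+r. R n \<zeta> \<omega> r \<partial>lborel) \<partial>M) \<in> borel_measurable borel2" for n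
    using borel_measurable_nn_integral[OF Rm2] .
  have incR: "R m \<zeta> \<omega> r \<le> R n \<zeta> \<omega> r" if "m \<le> n" for m n \<zeta> \<omega> r
    unfolding R_def by (intro mult_right_mono incG that) simp
  have supR: "(SUP n. R n \<zeta> \<omega> r) = g (max 0 (snd \<zeta> + s 1 \<omega> * of_bool (fst \<zeta> < d 1 \<omega>) - r)) * indicator {0..<a 2 \<omega>} r"
    for \<zeta> \<omega> r
    unfolding R_def by (subst SUP_mult_right_ennreal[symmetric]) (simp add: supG)
  have "ennreal t * (\<integral>\<^sup>+x. g (snd x) \<partial>\<pi>) = ennreal t * (SUP n. \<integral>\<^sup>+x. G n x \<partial>\<pi>)"
    unfolding supG[symmetric]
    by (subst nn_integral_monotone_convergence_SUP) (auto simp: incseq_def le_fun_def incG)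
  also have "\<dots> = (SUP n. ennreal t * (\<integral>\<^sup>+x. G n x \<partial>\<pi>))"
    by (rule SUP_mult_left_ennreal)
  also have "\<dots> = (SUP n. \<integral>\<^sup>+\<zeta>. (\<integral>\<^sup>+\<omega>. (\<integral>\<^sup>+r. R n \<zeta> \<omega> r \<partial>lborel) \<partial>M) \<partial>visits t)"
    by (simp only: eq)
  also have "\<dots> = (\<integral>\<^sup>+\<zeta>. (SUP n. \<integral>\<^sup>+\<omega>. (\<integral>\<^sup>+r. R n \<zeta> \<omega> r \<partial>lborel) \<partial>M) \<partial>visits t)"
    by (rule nn_integral_monotone_convergence_SUP[symmetric])
      (auto simp: incseq_def le_fun_def Rm1 cong: measurable_cong_sets intro!: nn_integral_mono incR)
  also have "\<dots> = (\<integral>\<^sup>+\<zeta>. (\<integral>\<^sup>+\<omega>. (SUP n. \<integral>\<^sup>+r. R n \<zeta> \<omega> r \<partial>lborel) \<partial>M) \<partial>visits t)"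
  proof (rule nn_integral_cong)
    fix \<zeta> assume "\<zeta> \<in> space (visits t)"
    show "(SUP n. \<integral>\<^sup>+\<omega>. (\<integral>\<^sup>+r. R n \<zeta> \<omega> r \<partial>lborel) \<partial>M) = (\<integral>\<^sup>+\<omega>. (SUP n. \<integral>\<^sup>+r. R n \<zeta> \<omega> r \<partial>lborel) \<partial>M)"
      using measurable_compose[OF measurable_Pair1' Rm2]
      by (intro nn_integral_monotone_convergence_SUP[symmetric])
        (auto simp: incseq_def le_fun_def space_pair_measure intro!: nn_integral_mono incR)
  qed
  also have "\<dots> = (\<integral>\<^sup>+\<zeta>. (\<integral>\<^sup>+\<omega>. (\<integral>\<^sup>+r. (SUP n. R n \<zeta> \<omega> r) \<partial>lborel) \<partial>M) \<partial>visits t)"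
  proof (intro nn_integral_cong)
    fix \<zeta> \<omega> assume "\<zeta> \<in> space (visits t)" "\<omega> \<in> space M"
    then have "(\<lambda>r. R n \<zeta> \<omega> r) \<in> borel_measurable lborel" for n
      using measurable_compose[OF measurable_Pair1'[of "(\<zeta>, \<omega>)"] Rm3[of n]]
      by (simp add: space_pair_measure)
    then show "(SUP n. \<integral>\<^sup>+r. R n \<zeta> \<omega> r \<partial>lborel) = (\<integral>\<^sup>+r. (SUP n. R n \<zeta> \<omega> r) \<partial>lborel)"
      by (intro nn_integral_monotone_convergence_SUP[symmetric]) (auto simp: incseq_def le_fun_def incR)
  qed
  finally show ?thesis by (simp only: supR)
qed

lemma visits_support: "AE \<zeta> in visits t. 0 \<le> fst \<zeta> \<and> fst \<zeta> \<le> snd \<zeta>"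
proof -
  define h :: "real \<times> real \<Rightarrow> ennreal" where "h \<zeta> = (if 0 \<le> fst \<zeta> \<and> fst \<zeta> \<le> snd \<zeta> then 0 else 1)" for \<zeta>
  have h [measurable]: "h \<in> borel_measurable borel2" unfolding h_def by measurable
  have "AE p in Q. \<forall>k. h (found k p) = 0"
    using AE_queue_input
  proof eventually_elim
    case (elim p)
    interpret q: queue_input "fst (fst p)" "snd (fst p)" "\<lambda>i. a i (snd p)" "\<lambda>i. s i (snd p)" "\<lambda>i. d i (snd p)"
      by (rule elim)
    show ?case
      using waits_nonneg_le[OF q.s_nonneg] by (simp add: h_def found_def)
  qed
  then have "(\<integral>\<^sup>+p. indicator {..t} (found_time k p) * h (found k p) \<partial>Q) = 0" for k
    by (subst nn_integral_0_iff_AE) auto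
  then have "(\<integral>\<^sup>+\<zeta>. h \<zeta> \<partial>visits t) = 0"
    by (simp add: nn_integral_visits[OF h])
  then have "AE \<zeta> in visits t. h \<zeta> = 0"
    by (subst (asm) nn_integral_0_iff_AE) (auto cong: measurable_cong_sets)
  then show ?thesis by eventually_elim (auto simp: h_def split: if_splits)
qed

text \<open>Over a time horizon equal to the mean interarrival time the expected number of arrivals is 1.\<close>

lemma prob_space_visits: "prob_space (visits (expectation (a 2)))"
proof
  let ?t = "expectation (a 2)"
  have na: "(\<integral>\<^sup>+\<omega>. ennreal (a 2 \<omega>) \<partial>M) = ennreal ?t"
    by (rule nn_integral_eq_integral[OF a_integrable a_nonneg]) simp
  have "ennreal ?t = ennreal ?t * (\<integral>\<^sup>+x. 1 \<partial>\<pi>)" by (simp add: \<pi>.emeasure_space_1)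
  also have "\<dots> = (\<integral>\<^sup>+\<zeta>. (\<integral>\<^sup>+\<omega>. (\<integral>\<^sup>+r. 1 * indicator {0..<a 2 \<omega>} r \<partial>lborel) \<partial>M) \<partial>visits ?t)"
    using a_mean_pos by (intro visits_inversion[where g = "\<lambda>_. 1"]) auto
  also have "\<dots> = (\<integral>\<^sup>+\<zeta>. (\<integral>\<^sup>+\<omega>. ennreal (a 2 \<omega>) \<partial>M) \<partial>visits ?t)"
  proof -
    have "AE \<omega> in M. (\<integral>\<^sup>+r. 1 * indicator {0..<a 2 \<omega>} r \<partial>lborel) = ennreal (a 2 \<omega>)"
      using a_nonneg[OF order_refl] by eventually_elim simp
    then show ?thesis by (simp only: nn_integral_cong_AE)
  qed
  also have "\<dots> = ennreal ?t * emeasure (visits ?t) (space (visits ?t))"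
    by (simp add: na)
  finally have "ennreal ?t * 1 = ennreal ?t * emeasure (visits ?t) (space (visits ?t))" by simp
  then show "emeasure (visits ?t) (space (visits ?t)) = 1"
    using a_mean_pos by (subst (asm) ennreal_mult_cancel_left) auto
qed

end

section \<open>Scaling\<close>

lemma arrival_time_scale: "arrival_time (c * \<tau>) (\<lambda>j. c * a j) i = c * arrival_time \<tau> a i"
  by (simp add: arrival_time_def distrib_left sum_distrib_left)

lemma arrival_count_scale:
  "0 < c \<Longrightarrow> arrival_count (c * \<tau>) (\<lambda>j. c * a j) (c * t) = arrival_count \<tau> a t"
  by (simp add: arrival_count_def arrival_time_scale)

lemma epoch_scale: "epoch (c * \<tau>) (\<lambda>j. c * a j) i = c * epoch \<tau> a i"
  by (simp add: epoch_def arrival_time_scale)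

lemma max_0_scale: "0 < (c::real) \<Longrightarrow> max 0 (c * y) = c * max 0 y"
  by (simp add: max_def zero_le_mult_iff mult_le_0_iff) 

lemma next_wait_scale:
  assumes "0 < c"
  shows "next_wait (c * a) (c * s) (c * d) (c *\<^sub>R \<zeta>) = c *\<^sub>R next_wait a s d \<zeta>"
proof -
  have "c * snd \<zeta> + c * s * b - c * a = c * (snd \<zeta> + s * b - a)" for b
    by (simp add: algebra_simps)
  then show ?thesis
    using assms by (auto simp: next_wait_def Let_def max_0_scale prod_eq_iff)
qed

lemma waits_scale:
  assumes "0 < c"
  shows "waits (c *\<^sub>R x) (\<lambda>j. c * a j) (\<lambda>j. c * s j) (\<lambda>j. c * d j) k = c *\<^sub>R waits x a s d k"
proof (induction k)
  case 0
  have "c * snd x - c * fst x = c * (snd x - fst x)" by (simp add: algebra_simps)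
  then show ?case using assms by (simp add: max_0_scale)
qed (simp add: next_wait_scale[OF assms])

lemma work_after_scale:
  assumes "0 < c"
  shows "work_after (c *\<^sub>R x) (\<lambda>j. c * a j) (\<lambda>j. c * s j) (\<lambda>j. c * d j) k = c * work_after x a s d k"
  using assms by (simp add: work_after_def waits_scale algebra_simps split: nat.split)

lemma explicit_state_scale:
  assumes "0 < c"
  shows "explicit_state (c *\<^sub>R x) (\<lambda>j. c * a j) (\<lambda>j. c * s j) (\<lambda>j. c * d j) (c * t)
    = c *\<^sub>R explicit_state x a s d t"
proof -
  have "max 0 (c * w - (c * t - c * e)) = c * max 0 (w - (t - e))" for w e :: real
    using max_0_scale[OF assms, of "w - (t - e)"] by (simp add: right_diff_distrib)
  then show ?thesis
    using assms
    by (simp add: explicit_state_def remaining_arrival_time_def arrival_time_scale arrival_count_scale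
        epoch_scale work_after_scale right_diff_distrib)
qed

lemma regular_inputs_scale:
  assumes "0 < c" "0 < c'" "regular_inputs a s"
  shows "regular_inputs (\<lambda>j. c * a j) (\<lambda>j. c' * s j)"
proof -
  have "{i. (\<Sum>j=2..i. c * a j) \<le> t} = {i. (\<Sum>j=2..i. a j) \<le> t / c}" for t
    using assms(1) by (auto simp: sum_distrib_left[symmetric] field_simps)
  then show ?thesis using assms by (auto simp: regular_inputs_def)
qed

context abandonment_queues
begin

lemma queue_primitives_scaled:
  assumes n: "1 \<le> n" and c: "0 < ca" "0 < cs"
  shows "queue_primitives M (\<lambda>j \<omega>. ca * u j \<omega>) (\<lambda>j \<omega>. cs * v j \<omega>) (\<lambda>j \<omega>. cd * d n j \<omega>)"
proof
  show "random_variable borel (\<lambda>\<omega>. ca * u i \<omega>)" if "2 \<le> i" for i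
    using u_measurable[OF that] by simp
  show "random_variable borel (\<lambda>\<omega>. cs * v i \<omega>)" if "1 \<le> i" for i
    using v_measurable[OF that] by simp
  show "random_variable borel (\<lambda>\<omega>. cd * d n i \<omega>)" if "1 \<le> i" for i
    using d_measurable[OF n that] by simp
  show "AE \<omega> in M. 0 \<le> ca * u i \<omega>" if "2 \<le> i" for i
    using u_nonneg[OF that] by eventually_elim (use c in simp)
  show "AE \<omega> in M. 0 \<le> cs * v i \<omega>" if "1 \<le> i" for i
    using v_nonneg[OF that] by eventually_elim (use c in simp)
  have scale: "distr M borel (\<lambda>\<omega>. k * X \<omega>) = distr (distr M borel X) borel (\<lambda>y. k * y)"
    if "random_variable borel X" for k and X :: "'a \<Rightarrow> real"
    using that by (simp add: distr_distr comp_def)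
  show "distr M borel (\<lambda>\<omega>. ca * u i \<omega>) = distr M borel (\<lambda>\<omega>. ca * u 2 \<omega>)" if "2 \<le> i" for i
    using u_measurable that by (simp only: scale u_ident[OF that] order_refl)
  show "distr M borel (\<lambda>\<omega>. cs * v i \<omega>) = distr M borel (\<lambda>\<omega>. cs * v 1 \<omega>)" if "1 \<le> i" for i
    using v_measurable that by (simp only: scale v_ident[OF that] order_refl)
  have d_ident: "distr M borel (d n i) = distr M borel (d n 1)" if "1 \<le> i" for i
  proof (rule cdf_unique)
    show "real_distribution (distr M borel (d n i))" "real_distribution (distr M borel (d n 1))"
      using d_measurable[OF n] that
      by (auto simp: real_distribution_def real_distribution_axioms_def intro!: prob_space_distr)
    show "cdf (distr M borel (d n i)) = cdf (distr M borel (d n 1))"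
      using d_cdf[OF n that] d_cdf[OF n order_refl] by simp
  qed
  show "distr M borel (\<lambda>\<omega>. cd * d n i \<omega>) = distr M borel (\<lambda>\<omega>. cd * d n 1 \<omega>)" if "1 \<le> i" for i
    using d_measurable[OF n] that by (simp only: scale d_ident[OF that] order_refl)
  have "indep_vars (\<lambda>_. borel)
      (\<lambda>i \<omega>. case_sum (\<lambda>_. (*) ca) (case_sum (\<lambda>_. (*) cs) (\<lambda>_. (*) cd)) i (case_sum u (case_sum v (d n)) i \<omega>))
      ({2..} <+> {1..} <+> {1..})"
    by (rule indep_vars_compose2[OF indep[OF n]]) (auto split: sum.split)
  then show "indep_vars (\<lambda>_. borel) (case_sum (\<lambda>j \<omega>. ca * u j \<omega>)
      (case_sum (\<lambda>j \<omega>. cs * v j \<omega>) (\<lambda>j \<omega>. cd * d n j \<omega>))) ({2..} <+> {1..} <+> {1..})"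
    by (rule indep_vars_cong[THEN iffD1, rotated -1]) (auto split: sum.split)
  show "integrable M (\<lambda>\<omega>. ca * u 2 \<omega>)" using u_mean by simp
  show "0 < expectation (\<lambda>\<omega>. ca * u 2 \<omega>)" using u_mean c by simp
qed

text \<open>Multiplying time and work by \<open>\<surd>n\<close> commutes with the recursion, so the scaled process is the
  explicit process of a queue with scaled inputs; for almost all inputs the path equation leaves no
  other process.\<close>

lemma stationary_queue_scaled:
  assumes n: "1 \<le> n" and st: "stationary_distribution M (scaled_queue_state u \<Lambda> V n) P"
  shows "stationary_queue M (\<lambda>j \<omega>. sqrt n / \<Lambda> n * u j \<omega>) (\<lambda>j \<omega>. sqrt n / \<mu> n * v j \<omega>)
    (\<lambda>j \<omega>. sqrt n * d n j \<omega>) P"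
proof -
  define c where "c = sqrt (real n)"
  have c: "0 < c" using n by (simp add: c_def)
  have pos: "0 < c / \<Lambda> n" "0 < c / \<mu> n" using c rates_pos[OF n] by auto
  interpret queue_primitives M "\<lambda>j \<omega>. c / \<Lambda> n * u j \<omega>" "\<lambda>j \<omega>. c / \<mu> n * v j \<omega>" "\<lambda>j \<omega>. c * d n j \<omega>"
    by (rule queue_primitives_scaled[OF n pos])
  have P: "prob_space P" "sets P = sets borel" "emeasure P state_space = 1"
    and inv: "\<And>t B. 0 \<le> t \<Longrightarrow> B \<in> sets borel \<Longrightarrow> emeasure P B
      = (\<integral>\<^sup>+x. emeasure M {\<omega> \<in> space M. scaled_queue_state u \<Lambda> V n x t \<omega> \<in> B} \<partial>P)"
    using st unfolding stationary_distribution_def by auto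
  interpret P: prob_space P by (rule P)
  have AEx: "AE x in P. x \<in> state_space"
  proof -
    have "state_space \<in> sets P"
      unfolding P state_space_def borel_prod[symmetric] by (rule pair_measureI) auto
    then show ?thesis using P(3) by (intro P.AE_prob_1) (simp add: P.emeasure_eq_measure)
  qed
  have "stationary_queue_axioms M (\<lambda>j \<omega>. c / \<Lambda> n * u j \<omega>) (\<lambda>j \<omega>. c / \<mu> n * v j \<omega>) (\<lambda>j \<omega>. c * d n j \<omega>) P"
  proof
    show "sets P = sets borel2" unfolding borel_prod by (rule P(2))
    fix t :: real and B :: "(real \<times> real) set" assume t: "0 \<le> t" and B: "B \<in> sets borel2"
    have "emeasure P B = (\<integral>\<^sup>+x. emeasure M {\<omega> \<in> space M. scaled_queue_state u \<Lambda> V n x (t / c) \<omega> \<in> B} \<partial>P)"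
      using t c B[unfolded borel_prod] by (intro inv) auto
    also have "\<dots> = (\<integral>\<^sup>+x. emeasure M {\<omega> \<in> space M. explicit_state x (\<lambda>j. c / \<Lambda> n * u j \<omega>)
        (\<lambda>j. c / \<mu> n * v j \<omega>) (\<lambda>j. c * d n j \<omega>) t \<in> B} \<partial>P)"
    proof (rule nn_integral_cong_AE)
      show "AE x in P. emeasure M {\<omega> \<in> space M. scaled_queue_state u \<Lambda> V n x (t / c) \<omega> \<in> B}
        = emeasure M {\<omega> \<in> space M. explicit_state x (\<lambda>j. c / \<Lambda> n * u j \<omega>)
          (\<lambda>j. c / \<mu> n * v j \<omega>) (\<lambda>j. c * d n j \<omega>) t \<in> B}"
        using AEx
      proof eventually_elim
        case (elim x)
        define y where "y = x /\<^sub>R c"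
        have y: "y \<in> state_space" "c *\<^sub>R y = x" using elim c by (auto simp: y_def state_space_def)
        have tc: "0 \<le> t / c" using t c by simp
        have m1: "(\<lambda>\<omega>. scaled_queue_state u \<Lambda> V n x (t / c) \<omega>) \<in> M \<rightarrow>\<^sub>M borel2"
        proof -
          have [measurable]: "(\<lambda>\<omega>. u i \<omega> / \<Lambda> n) \<in> borel_measurable M" if "2 \<le> i" for i
            using u_measurable[OF that] by simp
          have N: "(\<lambda>\<omega>. arrival_count (fst y) (\<lambda>j. u j \<omega> / \<Lambda> n) (t / c)) \<in> M \<rightarrow>\<^sub>M count_space UNIV"
            by (intro measurable_arrival_count) auto
          have T: "(\<lambda>\<omega>. arrival_time (fst y) (\<lambda>j. u j \<omega> / \<Lambda> n) (k + 1) - t / c) \<in> borel_measurable M" for k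
            by (intro borel_measurable_diff measurable_arrival_time) auto
          have [measurable]: "(\<lambda>\<omega>. remaining_arrival_time (fst y) (\<lambda>j. u j \<omega> / \<Lambda> n) (t / c)) \<in> borel_measurable M"
            unfolding remaining_arrival_time_def by (rule measurable_compose_countable[OF T N])
          have [measurable]: "V n y (t / c) \<in> borel_measurable M" by (rule V_measurable[OF n y(1) tc])
          have "(\<lambda>\<omega>. (c * remaining_arrival_time (fst y) (\<lambda>j. u j \<omega> / \<Lambda> n) (t / c), c * V n y (t / c) \<omega>))
              \<in> M \<rightarrow>\<^sub>M borel2"
            by measurable
          then show ?thesis
            by (simp add: scaled_queue_state_def queue_state_def c_def[symmetric] y_def[symmetric])
        qed
        have m2: "(\<lambda>\<omega>. explicit_state x (\<lambda>j. c / \<Lambda> n * u j \<omega>)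
          (\<lambda>j. c / \<mu> n * v j \<omega>) (\<lambda>j. c * d n j \<omega>) t) \<in> M \<rightarrow>\<^sub>M borel2"
          by (intro measurable_explicit_state a_rv s_rv d_rv measurable_const) (auto simp: space_pair_measure)
        have ae: "AE \<omega> in M. scaled_queue_state u \<Lambda> V n x (t / c) \<omega> = explicit_state x (\<lambda>j. c / \<Lambda> n * u j \<omega>)
          (\<lambda>j. c / \<mu> n * v j \<omega>) (\<lambda>j. c * d n j \<omega>) t"
          using AE_regular_inputs V_path[OF n y(1)]
        proof eventually_elim
          case (elim \<omega>)
          have "regular_inputs (\<lambda>j. 1 / c * (c / \<Lambda> n * u j \<omega>)) (\<lambda>j. 1 / c * (c / \<mu> n * v j \<omega>))"
            using c by (intro regular_inputs_scale elim) auto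
          then have reg: "regular_inputs (\<lambda>j. u j \<omega> / \<Lambda> n) (\<lambda>j. v j \<omega> / \<mu> n)"
            using c by simp
          interpret q: queue_input "fst y" "snd y" "\<lambda>j. u j \<omega> / \<Lambda> n" "\<lambda>j. v j \<omega> / \<mu> n" "\<lambda>j. d n j \<omega>"
            using reg y(1) by (auto simp: queue_input_def state_space_def)
          have V: "V n y (t / c) \<omega> = snd (q.X (t / c))"
            by (rule q.path_eq_explicit[OF elim(2) tc])
          have "scaled_queue_state u \<Lambda> V n x (t / c) \<omega> = c *\<^sub>R q.X (t / c)"
            unfolding scaled_queue_state_def queue_state_def c_def[symmetric] y_def[symmetric] V
            by (simp add: explicit_state_def)
          also have "\<dots> = explicit_state (c *\<^sub>R y) (\<lambda>j. c * (u j \<omega> / \<Lambda> n)) (\<lambda>j. c * (v j \<omega> / \<mu> n))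
              (\<lambda>j. c * d n j \<omega>) (c * (t / c))"
            unfolding prod.collapse by (rule explicit_state_scale[OF c, symmetric])
          finally show ?case using c y by simp
        qed
        show ?case
        proof (rule emeasure_eq_AE)
          show "AE \<omega> in M. \<omega> \<in> {\<omega> \<in> space M. scaled_queue_state u \<Lambda> V n x (t / c) \<omega> \<in> B} \<longleftrightarrow>
            \<omega> \<in> {\<omega> \<in> space M. explicit_state x (\<lambda>j. c / \<Lambda> n * u j \<omega>)
              (\<lambda>j. c / \<mu> n * v j \<omega>) (\<lambda>j. c * d n j \<omega>) t \<in> B}"
            using ae by eventually_elim simp
        qed (use measurable_sets[OF m1 B] measurable_sets[OF m2 B] in \<open>simp_all add: vimage_def Int_def conj_commute\<close>)
      qed
    qed
    finally show "emeasure P B = (\<integral>\<^sup>+x. emeasure M {\<omega> \<in> space M. explicit_state x (\<lambda>j. c / \<Lambda> n * u j \<omega>)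
        (\<lambda>j. c / \<mu> n * v j \<omega>) (\<lambda>j. c * d n j \<omega>) t \<in> B} \<partial>P)" .
  qed (use P in auto)
  then show ?thesis
    unfolding c_def[symmetric] by (intro stationary_queue.intro queue_primitives_axioms)
qed

text \<open>All that the limit theorem uses of the queue: an invariant law of the one-step recursion and the
  inversion formula for the work at an arbitrary time.\<close>

lemma stationary_found_law:
  assumes n: "1 \<le> n" and st: "stationary_distribution M (scaled_queue_state u \<Lambda> V n) P"
  obtains \<nu> where "prob_space \<nu>" "sets \<nu> = sets borel2" "AE \<zeta> in \<nu>. 0 \<le> fst \<zeta> \<and> fst \<zeta> \<le> snd \<zeta>"
    "\<And>h c. h \<in> borel_measurable borel2 \<Longrightarrow> (\<And>\<zeta>. h \<zeta> \<le> c) \<Longrightarrow> c < \<infinity> \<Longrightarrow>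
      (\<integral>\<^sup>+\<zeta>. h \<zeta> \<partial>\<nu>) = (\<integral>\<^sup>+\<zeta>. (\<integral>\<^sup>+\<omega>. h (next_wait (sqrt n / \<Lambda> n * u 2 \<omega>) (sqrt n / \<mu> n * v 1 \<omega>)
        (sqrt n * d n 1 \<omega>) \<zeta>) \<partial>M) \<partial>\<nu>)"
    "\<And>g. g \<in> borel_measurable borel \<Longrightarrow> ennreal (sqrt n / \<Lambda> n) * (\<integral>\<^sup>+x. g (snd x) \<partial>P)
      = (\<integral>\<^sup>+\<zeta>. (\<integral>\<^sup>+\<omega>. (\<integral>\<^sup>+r. g (max 0 (snd \<zeta> + sqrt n / \<mu> n * v 1 \<omega> * of_bool (fst \<zeta> < sqrt n * d n 1 \<omega>) - r))
        * indicator {0..<sqrt n / \<Lambda> n * u 2 \<omega>} r \<partial>lborel) \<partial>M) \<partial>\<nu>)"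
proof -
  interpret S: stationary_queue M "\<lambda>j \<omega>. sqrt n / \<Lambda> n * u j \<omega>" "\<lambda>j \<omega>. sqrt n / \<mu> n * v j \<omega>"
    "\<lambda>j \<omega>. sqrt n * d n j \<omega>" P
    by (rule stationary_queue_scaled[OF n st])
  have t: "expectation (\<lambda>\<omega>. sqrt n / \<Lambda> n * u 2 \<omega>) = sqrt n / \<Lambda> n" using u_mean by simp
  have t0: "0 \<le> sqrt n / \<Lambda> n" using rates_pos[OF n] by simp
  show ?thesis
  proof (rule that)
    show "prob_space (S.visits (sqrt n / \<Lambda> n))" using S.prob_space_visits unfolding t .
    show "sets (S.visits (sqrt n / \<Lambda> n)) = sets borel2" by (rule S.sets_visits)
    show "AE \<zeta> in S.visits (sqrt n / \<Lambda> n). 0 \<le> fst \<zeta> \<and> fst \<zeta> \<le> snd \<zeta>" by (rule S.visits_support)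
  qed (rule S.visits_invariant[OF t0] S.visits_inversion[OF t0]; assumption)+
qed

end

section \<open>Power inequalities\<close>

lemma powr_tangent:
  fixes a b s :: real
  assumes "0 \<le> a" "0 \<le> b" "1 \<le> s"
  shows "a powr s + s * a powr (s - 1) * (b - a) \<le> b powr s"
proof (cases "a = 0")
  case False
  then have a: "0 < a" using assms by simp
  show ?thesis
  proof (cases "b = 0")
    case True
    have "a powr s = a powr (s - 1) * a" using a by (simp add: powr_diff)
    moreover have "0 \<le> (s - 1) * (a powr (s - 1) * a)" using assms a by simp
    ultimately show ?thesis using True by (simp add: algebra_simps)
  next
    case False
    then have b: "0 < b" using assms by simp
    define f where "f t = t powr s - s * a powr (s - 1) * t" for t :: real
    have df: "(f has_real_derivative s * t powr (s - 1) - s * a powr (s - 1)) (at t)" if "0 < t" for t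
      unfolding f_def using that by (auto intro!: derivative_eq_intros)
    have "f a \<le> f b"
    proof (cases "a \<le> b")
      case True
      show ?thesis
      proof (rule DERIV_nonneg_imp_nondecreasing[OF True])
        fix t assume "a \<le> t" "t \<le> b"
        then show "\<exists>y. (f has_real_derivative y) (at t) \<and> 0 \<le> y"
          using df[of t] a assms by (intro exI[of _ "s * t powr (s - 1) - s * a powr (s - 1)"])
            (auto intro!: mult_left_mono powr_mono2)
      qed
    next
      case False
      then have ba: "b \<le> a" by simp
      show ?thesis
      proof (rule DERIV_nonpos_imp_nonincreasing[OF ba])
        fix t assume "b \<le> t" "t \<le> a"
        then show "\<exists>y. (f has_real_derivative y) (at t) \<and> y \<le> 0"
          using df[of t] b assms by (intro exI[of _ "s * t powr (s - 1) - s * a powr (s - 1)"])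
            (auto intro!: mult_left_mono powr_mono2)
      qed
    qed
    then show ?thesis unfolding f_def by (simp add: algebra_simps)
  qed
qed simp

lemma powr_add_le:
  fixes a b r :: real
  assumes "0 \<le> a" "0 \<le> b" "0 \<le> r"
  shows "(a + b) powr r \<le> 2 powr r * (a powr r + b powr r)"
proof -
  have "(a + b) powr r \<le> (2 * max a b) powr r"
    using assms by (intro powr_mono2) auto
  also have "\<dots> = 2 powr r * (max a b) powr r" using assms by (simp add: powr_mult)
  also have "\<dots> \<le> 2 powr r * (a powr r + b powr r)"
    by (intro mult_left_mono) (auto simp: max_def)
  finally show ?thesis .
qed

text \<open>A second-order Taylor bound that holds up to and across the reflection at 0: where \<open>A + x\<close> is
  negative, \<open>\<bar>x\<bar>\<close> exceeds \<open>A\<close> and the last term dominates.\<close>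

lemma powr_Taylor_upper:
  fixes A x r :: real
  assumes A: "0 \<le> A" and r: "2 < r"
  defines "c \<equiv> r + r * (r - 1) * 2 powr r"
  shows "(max 0 (A + x)) powr r
    \<le> A powr r + r * A powr (r - 1) * x + c * (A powr (r - 2) * x\<^sup>2 + \<bar>x\<bar> powr r)"
proof (cases "A + x \<le> 0")
  case True
  have "A powr (r - 1) * \<bar>x\<bar> \<le> \<bar>x\<bar> powr (r - 1) * \<bar>x\<bar>"
    using True A r by (intro mult_right_mono powr_mono2) auto
  also have "\<dots> = \<bar>x\<bar> powr r" by (cases "x = 0") (simp_all add: powr_diff)
  finally have "A powr (r - 1) * \<bar>x\<bar> \<le> \<bar>x\<bar> powr r" .
  then have 1: "r * (A powr (r - 1) * \<bar>x\<bar>) \<le> r * \<bar>x\<bar> powr r" using r by (intro mult_left_mono) auto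
  have 2: "0 \<le> r * (r - 1) * 2 powr r * \<bar>x\<bar> powr r" using r by simp
  have 3: "0 \<le> c * (A powr (r - 2) * x\<^sup>2)" using r by (simp add: c_def)
  have "x = - \<bar>x\<bar>" using True A by simp
  then have 4: "r * A powr (r - 1) * x = - (r * (A powr (r - 1) * \<bar>x\<bar>))" by (metis mult.assoc mult_minus_right)
  have "c * (A powr (r - 2) * x\<^sup>2 + \<bar>x\<bar> powr r)
      = c * (A powr (r - 2) * x\<^sup>2) + r * \<bar>x\<bar> powr r + r * (r - 1) * 2 powr r * \<bar>x\<bar> powr r"
    unfolding c_def by (simp add: algebra_simps)
  moreover have "0 \<le> A powr r" by simp
  moreover have "(max 0 (A + x)) powr r = 0" using True r by simp
  ultimately show ?thesis using 1 2 3 4 by linarith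
next
  case False
  define a where "a = A + x"
  have a: "0 < a" and x: "x = a - A" using False by (auto simp: a_def)
  define m where "m = max a A"
  have m: "0 < m" "m \<le> A + \<bar>x\<bar>" "a \<le> m" "A \<le> m" using a A by (auto simp: m_def a_def)
  have t1: "a powr r \<le> A powr r + r * a powr (r - 1) * x"
    using powr_tangent[of a A r] a A r by (simp add: x algebra_simps)
  have t2: "(a powr (r - 1) - A powr (r - 1)) * x \<le> (r - 1) * m powr (r - 2) * x\<^sup>2"
  proof (cases "A \<le> a")
    case True
    have "a powr (r - 1) - A powr (r - 1) \<le> (r - 1) * a powr (r - 2) * x"
      using powr_tangent[of a A "r - 1"] a A r by (simp add: x algebra_simps)
    then have "(a powr (r - 1) - A powr (r - 1)) * x \<le> (r - 1) * a powr (r - 2) * x * x"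
      using True by (intro mult_right_mono) (auto simp: x)
    then show ?thesis using True by (simp add: m_def power2_eq_square mult.assoc)
  next
    case F: False
    have "A powr (r - 1) - a powr (r - 1) \<le> (r - 1) * A powr (r - 2) * (A - a)"
      using powr_tangent[of A a "r - 1"] a A r by (simp add: algebra_simps)
    then have "(A powr (r - 1) - a powr (r - 1)) * (A - a) \<le> (r - 1) * A powr (r - 2) * (A - a) * (A - a)"
      using F by (intro mult_right_mono) auto
    then show ?thesis using F by (simp add: m_def power2_eq_square x algebra_simps)
  qed
  have m2: "m powr (r - 2) \<le> 2 powr r * (A powr (r - 2) + \<bar>x\<bar> powr (r - 2))"
  proof -
    have "m powr (r - 2) \<le> (A + \<bar>x\<bar>) powr (r - 2)" using m r by (intro powr_mono2) auto
    also have "\<dots> \<le> 2 powr (r - 2) * (A powr (r - 2) + \<bar>x\<bar> powr (r - 2))"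
      using A r by (intro powr_add_le) auto
    also have "\<dots> \<le> 2 powr r * (A powr (r - 2) + \<bar>x\<bar> powr (r - 2))"
      by (intro mult_right_mono powr_mono) auto
    finally show ?thesis .
  qed
  have xr: "\<bar>x\<bar> powr (r - 2) * x\<^sup>2 = \<bar>x\<bar> powr r"
  proof (cases "x = 0")
    case False
    have "\<bar>x\<bar> powr r = \<bar>x\<bar> powr (r - 2) * \<bar>x\<bar> powr 2"
      by (simp only: powr_add[symmetric]) simp
    moreover have "\<bar>x\<bar> powr 2 = x\<^sup>2" using False by simp
    ultimately show ?thesis by (simp only:)
  qed simp
  have "a powr r \<le> A powr r + r * A powr (r - 1) * x + r * ((a powr (r - 1) - A powr (r - 1)) * x)"
    using t1 by (simp add: algebra_simps)
  also have "\<dots> \<le> A powr r + r * A powr (r - 1) * x + r * ((r - 1) * m powr (r - 2) * x\<^sup>2)"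
    using t2 r by (intro add_left_mono mult_left_mono) auto
  also have "\<dots> \<le> A powr r + r * A powr (r - 1) * x
      + r * ((r - 1) * (2 powr r * (A powr (r - 2) + \<bar>x\<bar> powr (r - 2))) * x\<^sup>2)"
    using m2 r by (intro add_left_mono mult_left_mono mult_right_mono) auto
  also have "\<dots> = A powr r + r * A powr (r - 1) * x
      + r * (r - 1) * 2 powr r * (A powr (r - 2) * x\<^sup>2 + \<bar>x\<bar> powr r)"
    by (simp add: xr[symmetric] algebra_simps)
  also have "\<dots> \<le> A powr r + r * A powr (r - 1) * x + c * (A powr (r - 2) * x\<^sup>2 + \<bar>x\<bar> powr r)"
    unfolding c_def using r by (intro add_left_mono mult_right_mono) auto
  finally show ?thesis using a by (simp add: a_def)
qed

section \<open>A sequence of chains in heavy traffic\<close>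

text \<open>The chains of found states for a sequence of scaled queues.  Interarrival time \<open>\<epsilon> U\<close> and service
  time \<open>\<epsilon> \<rho> W\<close> have fixed laws up to the factors, the patience \<open>D n\<close> varies with \<open>n\<close>.  The three
  identities called \<open>patience\<close> are how the independence of \<open>U\<close>, \<open>W\<close> and \<open>D n\<close> enters the mean and
  variance of a step, and \<open>B\<close> is the limit of the drift per \<open>\<epsilon>\<^sup>2\<close>.\<close>

locale found_chains = prob_space M
  for M :: "'a measure" +
  fixes U W :: "'a \<Rightarrow> real" and D :: "nat \<Rightarrow> 'a \<Rightarrow> real" and \<nu> :: "nat \<Rightarrow> (real \<times> real) measure"
    and \<epsilon> \<rho> :: "nat \<Rightarrow> real" and B :: "real \<Rightarrow> real" and p x0 :: real
  assumes U_measurable [measurable]: "random_variable borel U"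
    and W_measurable [measurable]: "random_variable borel W"
    and D_measurable [measurable]: "\<And>n. random_variable borel (D n)"
    and U_nonneg: "AE \<omega> in M. 0 \<le> U \<omega>" and W_nonneg: "AE \<omega> in M. 0 \<le> W \<omega>"
    and p: "2 < p" and U_p: "integrable M (\<lambda>\<omega>. U \<omega> powr p)" and W_p: "integrable M (\<lambda>\<omega>. W \<omega> powr p)"
    and EU: "integrable M U" "expectation U = 1" and EW: "integrable M W" "expectation W = 1"
    and patience: "\<And>n z. expectation (\<lambda>\<omega>. W \<omega> * of_bool (z < D n \<omega>)) = prob {\<omega> \<in> space M. z < D n \<omega>}"
      "\<And>n z. expectation (\<lambda>\<omega>. (W \<omega>)\<^sup>2 * of_bool (z < D n \<omega>))
        = expectation (\<lambda>\<omega>. (W \<omega>)\<^sup>2) * prob {\<omega> \<in> space M. z < D n \<omega>}"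
      "\<And>n z. expectation (\<lambda>\<omega>. U \<omega> * W \<omega> * of_bool (z < D n \<omega>)) = prob {\<omega> \<in> space M. z < D n \<omega>}"
    and prob_\<nu>: "\<And>n. prob_space (\<nu> n)" and sets_\<nu>: "\<And>n. sets (\<nu> n) = sets borel2"
    and support: "\<And>n. AE \<zeta> in \<nu> n. 0 \<le> fst \<zeta> \<and> fst \<zeta> \<le> snd \<zeta>"
    and invariant: "\<And>n h c. h \<in> borel_measurable borel2 \<Longrightarrow> (\<And>\<zeta>. h \<zeta> \<le> c) \<Longrightarrow> c < \<infinity> \<Longrightarrow>
      (\<integral>\<^sup>+\<zeta>. h \<zeta> \<partial>\<nu> n) = (\<integral>\<^sup>+\<zeta>. (\<integral>\<^sup>+\<omega>. h (next_wait (\<epsilon> n * U \<omega>) (\<epsilon> n * \<rho> n * W \<omega>) (D n \<omega>) \<zeta>) \<partial>M) \<partial>\<nu> n)"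
    and \<epsilon>_pos: "\<And>n. 0 < \<epsilon> n" and \<epsilon>_lim: "\<epsilon> \<longlonglongrightarrow> 0"
    and \<rho>_pos: "\<And>n. 0 < \<rho> n" and \<rho>_lim: "\<rho> \<longlonglongrightarrow> 1"
    and drift_lim: "\<And>K e. 0 < K \<Longrightarrow> 0 < e \<Longrightarrow>
      \<forall>\<^sub>F n in sequentially. \<forall>z\<in>{0..K}. \<bar>(\<rho> n * prob {\<omega> \<in> space M. z < D n \<omega>} - 1) / \<epsilon> n - B z\<bar> < e"
    and x0: "0 < x0" "B x0 < 0"
    and B_continuous: "continuous_on UNIV B"
    and B_Lipschitz: "\<And>K. \<exists>L\<ge>0. \<forall>y\<in>{0..K}. \<forall>z\<in>{0..K}. \<bar>B y - B z\<bar> \<le> L * \<bar>y - z\<bar>"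
    and variance_pos: "0 < expectation (\<lambda>\<omega>. (U \<omega>)\<^sup>2) + expectation (\<lambda>\<omega>. (W \<omega>)\<^sup>2) - 2"
begin

declare sets_\<nu> [measurable_cong, simp]

sublocale \<nu>: prob_space "\<nu> n" for n by (rule prob_\<nu>)

abbreviation survival :: "nat \<Rightarrow> real \<Rightarrow> real" where
  "survival n z \<equiv> prob {\<omega> \<in> space M. z < D n \<omega>}"

abbreviation drift :: "nat \<Rightarrow> real \<Rightarrow> real" where
  "drift n z \<equiv> (\<rho> n * survival n z - 1) / \<epsilon> n"

definition increment :: "nat \<Rightarrow> real \<Rightarrow> 'a \<Rightarrow> real" where
  "increment n z \<omega> = \<rho> n * W \<omega> * of_bool (z < D n \<omega>) - U \<omega>"

definition step :: "nat \<Rightarrow> real \<times> real \<Rightarrow> 'a \<Rightarrow> real \<times> real" where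
  "step n \<zeta> \<omega> = next_wait (\<epsilon> n * U \<omega>) (\<epsilon> n * \<rho> n * W \<omega>) (D n \<omega>) \<zeta>"

text \<open>Half of \<open>4 * W\<close> dominates the service part of an increment; the other half absorbs the growth inside
  a batch in the Lyapunov estimate.\<close>

definition envelope :: "'a \<Rightarrow> real" where
  "envelope \<omega> = 4 * W \<omega> + U \<omega>"

lemma step_measurable [measurable]: "(\<lambda>y. step n (fst y) (snd y)) \<in> borel2 \<Otimes>\<^sub>M M \<rightarrow>\<^sub>M borel2"
  unfolding step_def by measurable

lemma step_measurable' [measurable]: "step n \<zeta> \<in> M \<rightarrow>\<^sub>M borel2"
  using measurable_compose[OF measurable_Pair1' step_measurable, of \<zeta> n] by (simp add: space_pair_measure)

lemma increment_measurable [measurable]: "increment n z \<in> borel_measurable M"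
  unfolding increment_def by measurable

lemma envelope_measurable [measurable]: "envelope \<in> borel_measurable M"
  unfolding envelope_def by measurable

lemma snd_step: "snd (step n \<zeta> \<omega>) = max 0 (snd \<zeta> + \<epsilon> n * increment n (fst \<zeta>) \<omega>)"
  by (simp add: step_def next_wait_def Let_def increment_def algebra_simps)

lemma envelope_nonneg: "AE \<omega> in M. 0 \<le> envelope \<omega>"
  using U_nonneg W_nonneg by eventually_elim (simp add: envelope_def)

lemma integrable_powr_le:
  assumes "random_variable borel X" "AE \<omega> in M. 0 \<le> X \<omega>" "integrable M (\<lambda>\<omega>. X \<omega> powr p)" "0 \<le> r" "r \<le> p"
  shows "integrable M (\<lambda>\<omega>. X \<omega> powr r)"
proof (rule Bochner_Integration.integrable_bound[of _ "\<lambda>\<omega>. 1 + X \<omega> powr p"])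
  show "AE \<omega> in M. norm (X \<omega> powr r) \<le> norm (1 + X \<omega> powr p)"
    using assms(2)
  proof eventually_elim
    case (elim \<omega>)
    show ?case
    proof (cases "X \<omega> \<le> 1")
      case True
      then have "X \<omega> powr r \<le> 1 powr r" using elim assms by (intro powr_mono2) auto
      then show ?thesis by (simp add: add_increasing2)
    next
      case False
      then have "X \<omega> powr r \<le> X \<omega> powr p" using assms by (intro powr_mono) auto
      then show ?thesis by simp
    qed
  qed
  show "integrable M (\<lambda>\<omega>. 1 + X \<omega> powr p)" using assms(3) by simp
  show "(\<lambda>\<omega>. X \<omega> powr r) \<in> borel_measurable M" using assms(1) by measurable
qed

lemma envelope_powr_integrable:
  assumes "0 \<le> r" "r \<le> p"
  shows "integrable M (\<lambda>\<omega>. envelope \<omega> powr r)"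
proof (rule Bochner_Integration.integrable_bound)
  have "integrable M (\<lambda>\<omega>. U \<omega> powr r)" "integrable M (\<lambda>\<omega>. W \<omega> powr r)"
    using integrable_powr_le[OF U_measurable U_nonneg U_p assms]
      integrable_powr_le[OF W_measurable W_nonneg W_p assms] .
  then show "integrable M (\<lambda>\<omega>. 2 powr r * (4 powr r * W \<omega> powr r + U \<omega> powr r))"
    by simp
  show "AE \<omega> in M. norm (envelope \<omega> powr r) \<le> norm (2 powr r * (4 powr r * W \<omega> powr r + U \<omega> powr r))"
    using U_nonneg W_nonneg
  proof eventually_elim
    case (elim \<omega>)
    then have "envelope \<omega> powr r \<le> 2 powr r * ((4 * W \<omega>) powr r + U \<omega> powr r)"
      unfolding envelope_def using assms by (intro powr_add_le) auto
    then show ?case using elim by (simp add: powr_mult)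
  qed
qed measurable

lemma envelope_sq_integrable: "integrable M (\<lambda>\<omega>. (envelope \<omega>)\<^sup>2)"
proof -
  have "integrable M (\<lambda>\<omega>. envelope \<omega> powr 2)" using p by (intro envelope_powr_integrable) auto
  then show ?thesis
    by (rule Bochner_Integration.integrable_bound) (use envelope_nonneg in \<open>auto simp: powr_numeral\<close>)
qed

lemma small_\<epsilon>: "0 < e \<Longrightarrow> \<forall>\<^sub>F n in sequentially. \<epsilon> n < e"
  using \<epsilon>_lim by (rule order_tendstoD)

lemma \<rho>_le_2: "\<forall>\<^sub>F n in sequentially. \<rho> n \<le> 2"
  using order_tendstoD(2)[OF \<rho>_lim, of 2] by (auto elim: eventually_mono)

lemma increment_le_envelope:
  assumes "\<rho> n \<le> 2"
  shows "AE \<omega> in M. \<bar>increment n z \<omega>\<bar> \<le> envelope \<omega>"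
  using U_nonneg W_nonneg
proof eventually_elim
  case (elim \<omega>)
  have "0 \<le> \<rho> n * W \<omega>" "\<rho> n * W \<omega> \<le> 2 * W \<omega>"
    using elim \<rho>_pos[of n] assms by (auto intro!: mult_right_mono)
  then show ?case using elim unfolding increment_def envelope_def by (cases "z < D n \<omega>") auto
qed

lemma increment_integrable: "integrable M (increment n z)"
  unfolding increment_def
  by (intro Bochner_Integration.integrable_diff EU Bochner_Integration.integrable_bound[OF integrable_mult_right[OF EW(1), of "\<rho> n"]])
    (auto simp: abs_mult)

lemma expectation_increment: "expectation (increment n z) = \<epsilon> n * drift n z"
proof -
  have i: "integrable M (\<lambda>\<omega>. W \<omega> * of_bool (z < D n \<omega>))"
    by (rule Bochner_Integration.integrable_bound[OF EW(1)]) auto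
  have "expectation (increment n z) = \<rho> n * expectation (\<lambda>\<omega>. W \<omega> * of_bool (z < D n \<omega>)) - 1"
    unfolding increment_def using i EU by (simp add: mult.assoc)
  then show ?thesis using \<epsilon>_pos[of n] by (simp add: patience)
qed

text \<open>Survival decreases, so the drift beyond \<open>x0\<close> is controlled by the drift at \<open>x0\<close>; locally uniform
  convergence of the drift suffices for a bound on the half-line.\<close>

lemma drift_antimono: "z \<le> z' \<Longrightarrow> drift n z' \<le> drift n z"
  using \<epsilon>_pos[of n] \<rho>_pos[of n]
  by (intro divide_right_mono diff_right_mono mult_left_mono finite_measure_mono) auto

subsection \<open>Lyapunov functions\<close>

text \<open>The truncation \<open>min h K\<close> inherits the drift inequality where \<open>h < K\<close> and cannot increase on
  average where it has its maximal value \<open>K\<close>; being bounded, it has a finite integral that cancels by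
  invariance.\<close>

lemma Lyapunov_bound:
  assumes h [measurable]: "h \<in> borel_measurable borel2" and g [measurable]: "g \<in> borel_measurable borel2"
    and le: "\<And>\<zeta>. 0 \<le> fst \<zeta> \<Longrightarrow> fst \<zeta> \<le> snd \<zeta> \<Longrightarrow>
      (\<integral>\<^sup>+\<omega>. ennreal (h (step n \<zeta> \<omega>)) \<partial>M) + g \<zeta> \<le> ennreal (h \<zeta>) + c"
  shows "(\<integral>\<^sup>+\<zeta>. g \<zeta> \<partial>\<nu> n) \<le> c"
proof -
  define hK where "hK K \<zeta> = min (ennreal (h \<zeta>)) (of_nat K)" for K :: nat and \<zeta>
  have hK [measurable]: "hK K \<in> borel_measurable borel2" for K unfolding hK_def by measurable
  define gK where "gK K \<zeta> = g \<zeta> * indicator {..real K} (h \<zeta>)" for K :: nat and \<zeta>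
  have gK [measurable]: "gK K \<in> borel_measurable borel2" for K unfolding gK_def by measurable
  have stm: "(\<lambda>\<zeta>. \<integral>\<^sup>+\<omega>. hK K (step n \<zeta> \<omega>) \<partial>M) \<in> borel_measurable borel2" for K
  proof -
    have "(\<lambda>(\<zeta>, \<omega>). hK K (step n \<zeta> \<omega>)) \<in> borel_measurable (borel2 \<Otimes>\<^sub>M M)"
      unfolding split_beta' by measurable
    then show ?thesis by (rule borel_measurable_nn_integral)
  qed
  have bound: "(\<integral>\<^sup>+\<zeta>. gK K \<zeta> \<partial>\<nu> n) \<le> c" for K
  proof -
    have pw: "(\<integral>\<^sup>+\<omega>. hK K (step n \<zeta> \<omega>) \<partial>M) + gK K \<zeta> \<le> hK K \<zeta> + c"
      if \<zeta>: "0 \<le> fst \<zeta>" "fst \<zeta> \<le> snd \<zeta>" for \<zeta>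
    proof (cases "h \<zeta> \<le> real K")
      case True
      have "(\<integral>\<^sup>+\<omega>. hK K (step n \<zeta> \<omega>) \<partial>M) + gK K \<zeta> \<le> (\<integral>\<^sup>+\<omega>. ennreal (h (step n \<zeta> \<omega>)) \<partial>M) + g \<zeta>"
        using True by (intro add_mono nn_integral_mono) (auto simp: hK_def gK_def)
      also have "\<dots> \<le> ennreal (h \<zeta>) + c" by (rule le[OF \<zeta>])
      also have "ennreal (h \<zeta>) = hK K \<zeta>"
        using True by (simp add: hK_def min_absorb1 ennreal_of_nat_eq_real_of_nat ennreal_leI)
      finally show ?thesis .
    next
      case False
      have "(\<integral>\<^sup>+\<omega>. hK K (step n \<zeta> \<omega>) \<partial>M) \<le> (\<integral>\<^sup>+\<omega>. of_nat K \<partial>M)"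
        by (intro nn_integral_mono) (simp add: hK_def)
      also have "\<dots> = hK K \<zeta>"
        using False by (simp add: hK_def emeasure_space_1 min_absorb2 ennreal_of_nat_eq_real_of_nat ennreal_leI)
      finally show ?thesis using False by (simp add: gK_def add_increasing2)
    qed
    have "(\<integral>\<^sup>+\<zeta>. hK K \<zeta> \<partial>\<nu> n) + (\<integral>\<^sup>+\<zeta>. gK K \<zeta> \<partial>\<nu> n)
        = (\<integral>\<^sup>+\<zeta>. (\<integral>\<^sup>+\<omega>. hK K (step n \<zeta> \<omega>) \<partial>M) \<partial>\<nu> n) + (\<integral>\<^sup>+\<zeta>. gK K \<zeta> \<partial>\<nu> n)"
      using invariant[OF hK, of K "of_nat K" n] by (simp add: hK_def step_def of_nat_less_top)
    also have "\<dots> = (\<integral>\<^sup>+\<zeta>. (\<integral>\<^sup>+\<omega>. hK K (step n \<zeta> \<omega>) \<partial>M) + gK K \<zeta> \<partial>\<nu> n)"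
      using stm by (intro nn_integral_add[symmetric]) (auto cong: measurable_cong_sets)
    also have "\<dots> \<le> (\<integral>\<^sup>+\<zeta>. hK K \<zeta> + c \<partial>\<nu> n)"
    proof (rule nn_integral_mono_AE)
      show "AE \<zeta> in \<nu> n. (\<integral>\<^sup>+\<omega>. hK K (step n \<zeta> \<omega>) \<partial>M) + gK K \<zeta> \<le> hK K \<zeta> + c"
        using support[of n]
      proof eventually_elim
        case (elim \<zeta>)
        then show ?case by (intro pw) auto
      qed
    qed
    also have "\<dots> = (\<integral>\<^sup>+\<zeta>. hK K \<zeta> \<partial>\<nu> n) + c"
      by (subst nn_integral_add) (auto simp: \<nu>.emeasure_space_1)
    finally have "(\<integral>\<^sup>+\<zeta>. hK K \<zeta> \<partial>\<nu> n) + (\<integral>\<^sup>+\<zeta>. gK K \<zeta> \<partial>\<nu> n) \<le> (\<integral>\<^sup>+\<zeta>. hK K \<zeta> \<partial>\<nu> n) + c" .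
    moreover have "(\<integral>\<^sup>+\<zeta>. hK K \<zeta> \<partial>\<nu> n) \<noteq> \<top>"
    proof -
      have "(\<integral>\<^sup>+\<zeta>. hK K \<zeta> \<partial>\<nu> n) \<le> (\<integral>\<^sup>+\<zeta>. of_nat K \<partial>\<nu> n)"
        by (intro nn_integral_mono) (simp add: hK_def)
      then show ?thesis by (auto simp: \<nu>.emeasure_space_1 top_unique)
    qed
    ultimately show ?thesis by (simp add: ennreal_add_left_cancel_le)
  qed
  have sup: "(SUP K. gK K \<zeta>) = g \<zeta>" for \<zeta>
  proof (rule antisym)
    show "(SUP K. gK K \<zeta>) \<le> g \<zeta>" by (rule SUP_least) (auto simp: gK_def indicator_def)
    obtain K :: nat where "h \<zeta> \<le> real K" using real_arch_simple by blast
    then have "g \<zeta> = gK K \<zeta>" by (simp add: gK_def)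
    then show "g \<zeta> \<le> (SUP K. gK K \<zeta>)" using SUP_upper[of K UNIV "\<lambda>K. gK K \<zeta>"] by simp
  qed
  have "(\<integral>\<^sup>+\<zeta>. g \<zeta> \<partial>\<nu> n) = (SUP K. \<integral>\<^sup>+\<zeta>. gK K \<zeta> \<partial>\<nu> n)"
    unfolding sup[symmetric]
    by (rule nn_integral_monotone_convergence_SUP)
      (auto simp: incseq_def le_fun_def gK_def indicator_def cong: measurable_cong_sets)
  also have "\<dots> \<le> c" by (rule SUP_least) (rule bound)
  finally show ?thesis .
qed

lemma prob_U0_less_1: "prob {\<omega> \<in> space M. U \<omega> = 0} < 1"
proof (rule ccontr)
  assume "\<not> prob {\<omega> \<in> space M. U \<omega> = 0} < 1"
  then have "prob {\<omega> \<in> space M. U \<omega> = 0} = 1" by (simp add: not_less measure_le_1 antisym)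
  then have "AE \<omega> in M. U \<omega> = 0" by (subst (asm) prob_Collect_eq_1) auto
  then have "expectation U = 0" by (simp add: integral_eq_zero_AE)
  then show False using EU by simp
qed

text \<open>The difference \<open>y - z\<close> returns to 0 whenever \<open>U > 0\<close> and otherwise grows by at most one service
  time, so it contracts by the factor \<open>P(U = 0) < 1\<close> with an error \<open>O(\<epsilon>)\<close>.\<close>

lemma batch_bound:
  assumes "\<rho> n \<le> 2"
  shows "(\<integral>\<^sup>+\<zeta>. ennreal (snd \<zeta> - fst \<zeta>) \<partial>\<nu> n)
    \<le> ennreal (2 * \<epsilon> n / (1 - prob {\<omega> \<in> space M. U \<omega> = 0}))"
proof -
  define q where "q = prob {\<omega> \<in> space M. U \<omega> = 0}"
  have q: "0 \<le> q" "q < 1" using prob_U0_less_1 by (auto simp: q_def)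
  have "(\<integral>\<^sup>+\<zeta>. ennreal ((1 - q) * (snd \<zeta> - fst \<zeta>)) \<partial>\<nu> n) \<le> ennreal (2 * \<epsilon> n)"
  proof (rule Lyapunov_bound[where h = "\<lambda>\<zeta>. snd \<zeta> - fst \<zeta>"])
    fix \<zeta> :: "real \<times> real" assume \<zeta>: "0 \<le> fst \<zeta>" "fst \<zeta> \<le> snd \<zeta>"
    define R where "R \<omega> = (snd \<zeta> - fst \<zeta>) * indicator {\<omega> \<in> space M. U \<omega> = 0} \<omega> + 2 * \<epsilon> n * W \<omega>" for \<omega>
    have ii: "integrable M (indicat_real {\<omega> \<in> space M. U \<omega> = 0})"
      by (rule integrable_real_indicator) (auto simp: emeasure_eq_measure)
    have iR: "integrable M R"
      unfolding R_def by (rule Bochner_Integration.integrable_add; rule integrable_mult_right; rule ii EW)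
    have "(\<integral>\<^sup>+\<omega>. ennreal (snd (step n \<zeta> \<omega>) - fst (step n \<zeta> \<omega>)) \<partial>M) \<le> (\<integral>\<^sup>+\<omega>. ennreal (R \<omega>) \<partial>M)"
    proof (rule nn_integral_mono_AE)
      show "AE \<omega> in M. ennreal (snd (step n \<zeta> \<omega>) - fst (step n \<zeta> \<omega>)) \<le> ennreal (R \<omega>)"
        using W_nonneg AE_space
      proof eventually_elim
        case (elim \<omega>)
        have "\<epsilon> n * (\<rho> n * W \<omega>) \<le> \<epsilon> n * (2 * W \<omega>)"
          using elim \<epsilon>_pos[of n] assms by (intro mult_left_mono mult_right_mono) auto
        then have s: "0 \<le> \<epsilon> n * \<rho> n * W \<omega>" "\<epsilon> n * \<rho> n * W \<omega> \<le> 2 * \<epsilon> n * W \<omega>"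
          using elim \<epsilon>_pos[of n] \<rho>_pos[of n] by (simp_all add: mult_ac)
        show ?case
          using \<zeta> s elim \<epsilon>_pos[of n] unfolding R_def step_def next_wait_def Let_def
          by (intro ennreal_leI) (auto simp: indicator_def of_bool_def)
      qed
    qed
    also have "\<dots> = ennreal (expectation R)"
    proof (rule nn_integral_eq_integral[OF iR])
      show "AE \<omega> in M. 0 \<le> R \<omega>"
        using W_nonneg by eventually_elim (use \<zeta> \<epsilon>_pos[of n] in \<open>auto simp: R_def indicator_def\<close>)
    qed
    also have "expectation R = (snd \<zeta> - fst \<zeta>) * q + 2 * \<epsilon> n"
      unfolding R_def using EW ii by (simp add: q_def)
    finally have "(\<integral>\<^sup>+\<omega>. ennreal (snd (step n \<zeta> \<omega>) - fst (step n \<zeta> \<omega>)) \<partial>M)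
        \<le> ennreal ((snd \<zeta> - fst \<zeta>) * q + 2 * \<epsilon> n)" .
    then have "(\<integral>\<^sup>+\<omega>. ennreal (snd (step n \<zeta> \<omega>) - fst (step n \<zeta> \<omega>)) \<partial>M) + ennreal ((1 - q) * (snd \<zeta> - fst \<zeta>))
        \<le> ennreal ((snd \<zeta> - fst \<zeta>) * q + 2 * \<epsilon> n) + ennreal ((1 - q) * (snd \<zeta> - fst \<zeta>))"
      by (rule add_right_mono)
    also have "\<dots> = ennreal (((snd \<zeta> - fst \<zeta>) * q + 2 * \<epsilon> n) + (1 - q) * (snd \<zeta> - fst \<zeta>))"
    proof (rule ennreal_plus[symmetric])
      show "0 \<le> (snd \<zeta> - fst \<zeta>) * q + 2 * \<epsilon> n"
        using \<zeta> q \<epsilon>_pos[of n] by (intro add_nonneg_nonneg mult_nonneg_nonneg) auto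
      show "0 \<le> (1 - q) * (snd \<zeta> - fst \<zeta>)"
        using \<zeta> q by (intro mult_nonneg_nonneg) auto
    qed
    also have "\<dots> = ennreal ((snd \<zeta> - fst \<zeta>) + 2 * \<epsilon> n)" by (simp add: algebra_simps)
    also have "\<dots> = ennreal (snd \<zeta> - fst \<zeta>) + ennreal (2 * \<epsilon> n)"
      using \<zeta> \<epsilon>_pos[of n] by (intro ennreal_plus) auto
    finally show "(\<integral>\<^sup>+\<omega>. ennreal (snd (step n \<zeta> \<omega>) - fst (step n \<zeta> \<omega>)) \<partial>M) + ennreal ((1 - q) * (snd \<zeta> - fst \<zeta>))
        \<le> ennreal (snd \<zeta> - fst \<zeta>) + ennreal (2 * \<epsilon> n)" .
  qed measurable
  then have le: "ennreal (1 - q) * (\<integral>\<^sup>+\<zeta>. ennreal (snd \<zeta> - fst \<zeta>) \<partial>\<nu> n) \<le> ennreal (2 * \<epsilon> n)"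
    using q by (simp add: ennreal_mult' nn_integral_cmult)
  have "(\<integral>\<^sup>+\<zeta>. ennreal (snd \<zeta> - fst \<zeta>) \<partial>\<nu> n)
      = ennreal (1 / (1 - q)) * (ennreal (1 - q) * (\<integral>\<^sup>+\<zeta>. ennreal (snd \<zeta> - fst \<zeta>) \<partial>\<nu> n))"
    using q by (simp add: mult.assoc[symmetric] ennreal_mult[symmetric])
  also have "\<dots> \<le> ennreal (1 / (1 - q)) * ennreal (2 * \<epsilon> n)" by (rule mult_left_mono[OF le]) simp
  also have "\<dots> = ennreal (2 * \<epsilon> n / (1 - q))"
    using q \<epsilon>_pos[of n] by (subst ennreal_mult[symmetric]) auto
  finally show ?thesis by (simp add: q_def)
qed

subsection \<open>Uniform moment bounds\<close>

lemma expectation_batch_le: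
  assumes "\<rho> n \<le> 2"
  shows "integrable M (\<lambda>\<omega>. of_bool (U \<omega> = 0) * (\<delta> + \<epsilon> n * (\<rho> n * (W \<omega> * of_bool (z < D n \<omega>)))))"
    and "0 \<le> \<delta> \<Longrightarrow> expectation (\<lambda>\<omega>. of_bool (U \<omega> = 0) * (\<delta> + \<epsilon> n * (\<rho> n * (W \<omega> * of_bool (z < D n \<omega>)))))
      \<le> prob {\<omega> \<in> space M. U \<omega> = 0} * \<delta> + 2 * \<epsilon> n"
proof -
  have i1: "integrable M (\<lambda>\<omega>. of_bool (U \<omega> = 0) * (W \<omega> * of_bool (z < D n \<omega>)))"
    by (rule Bochner_Integration.integrable_bound[OF EW(1)]) auto
  have i2: "integrable M (\<lambda>\<omega>. of_bool (U \<omega> = 0) :: real)"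
    by (rule integrable_const_bound[where B = 1]) auto
  have eq: "(\<lambda>\<omega>. of_bool (U \<omega> = 0) * (\<delta> + \<epsilon> n * (\<rho> n * (W \<omega> * of_bool (z < D n \<omega>)))))
      = (\<lambda>\<omega>. \<delta> * of_bool (U \<omega> = 0) + \<epsilon> n * \<rho> n * (of_bool (U \<omega> = 0) * (W \<omega> * of_bool (z < D n \<omega>))))"
    by (simp add: fun_eq_iff algebra_simps)
  show "integrable M (\<lambda>\<omega>. of_bool (U \<omega> = 0) * (\<delta> + \<epsilon> n * (\<rho> n * (W \<omega> * of_bool (z < D n \<omega>)))))"
    unfolding eq using i1 i2 by simp
  assume \<delta>: "0 \<le> \<delta>"
  have "expectation (\<lambda>\<omega>. of_bool (U \<omega> = 0) * (W \<omega> * of_bool (z < D n \<omega>))) \<le> expectation W"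
    by (rule integral_mono_AE[OF i1 EW(1)])
      (use W_nonneg in \<open>eventually_elim, auto simp: of_bool_def\<close>)
  then have le: "expectation (\<lambda>\<omega>. of_bool (U \<omega> = 0) * (W \<omega> * of_bool (z < D n \<omega>))) \<le> 1"
    using EW by simp
  have q: "expectation (\<lambda>\<omega>. of_bool (U \<omega> = 0) :: real) = prob {\<omega> \<in> space M. U \<omega> = 0}"
  proof -
    have "expectation (\<lambda>\<omega>. of_bool (U \<omega> = 0) :: real) = expectation (indicat_real {\<omega> \<in> space M. U \<omega> = 0})"
      by (intro Bochner_Integration.integral_cong) (auto simp: indicator_def)
    then show ?thesis by simp
  qed
  have "expectation (\<lambda>\<omega>. of_bool (U \<omega> = 0) * (\<delta> + \<epsilon> n * (\<rho> n * (W \<omega> * of_bool (z < D n \<omega>)))))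
      = \<delta> * prob {\<omega> \<in> space M. U \<omega> = 0}
        + \<epsilon> n * \<rho> n * expectation (\<lambda>\<omega>. of_bool (U \<omega> = 0) * (W \<omega> * of_bool (z < D n \<omega>)))"
    unfolding eq using i1 i2 by (simp add: q)
  also have "\<dots> \<le> \<delta> * prob {\<omega> \<in> space M. U \<omega> = 0} + \<epsilon> n * \<rho> n * 1"
    using le \<epsilon>_pos[of n] \<rho>_pos[of n] by (intro add_left_mono mult_left_mono) auto
  also have "\<dots> \<le> \<delta> * prob {\<omega> \<in> space M. U \<omega> = 0} + \<epsilon> n * 2 * 1"
    using assms \<epsilon>_pos[of n] by (intro add_left_mono mult_right_mono mult_left_mono) auto
  finally show "expectation (\<lambda>\<omega>. of_bool (U \<omega> = 0) * (\<delta> + \<epsilon> n * (\<rho> n * (W \<omega> * of_bool (z < D n \<omega>)))))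
      \<le> prob {\<omega> \<in> space M. U \<omega> = 0} * \<delta> + 2 * \<epsilon> n" by (simp add: mult_ac)
qed

text \<open>The drift is governed by the left value \<open>z\<close>, not by the workload \<open>y\<close>.  The correction
  \<open>\<kappa> \<epsilon> (y - z)\<close> in the Lyapunov function supplies a strong negative drift whenever the
  two differ.\<close>

definition Lyapunov_state :: "nat \<Rightarrow> real \<Rightarrow> real \<times> real \<Rightarrow> real" where
  "Lyapunov_state n \<kappa> \<zeta> = snd \<zeta> + \<kappa> * \<epsilon> n * (snd \<zeta> - fst \<zeta>)"

text \<open>The displacement of \<open>Lyapunov_state\<close> is \<open>\<epsilon>\<close> times the increment plus \<open>\<kappa> \<epsilon>\<close> times the change of \<open>y - z\<close>.
  Its mean is \<open>\<epsilon>\<^sup>2 (drift + 2 \<kappa>) - \<kappa> \<epsilon> (1 - q) \<delta>\<close>: the second term is of lower order in \<open>\<epsilon>\<close> than the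
  first and thus outweighs the second-order terms in \<open>\<delta>\<close> as \<open>\<epsilon>\<close> tends to 0.\<close>

lemma Lyapunov_step:
  fixes r \<kappa> :: real and n :: nat and \<zeta> :: "real \<times> real"
  assumes r: "2 < r" "r \<le> p" and \<kappa>: "0 < \<kappa>" and n: "\<rho> n \<le> 2" "\<epsilon> n \<le> 1" "\<kappa> * \<epsilon> n \<le> 1"
    and \<zeta>: "0 \<le> fst \<zeta>" "fst \<zeta> \<le> snd \<zeta>"
  defines "A \<equiv> Lyapunov_state n \<kappa> \<zeta>" and "\<delta> \<equiv> snd \<zeta> - fst \<zeta>"
    and "q \<equiv> prob {\<omega> \<in> space M. U \<omega> = 0}" and "c \<equiv> r + r * (r - 1) * 2 powr r"
    and "E2 \<equiv> expectation (\<lambda>\<omega>. (envelope \<omega>)\<^sup>2)" and "Er \<equiv> expectation (\<lambda>\<omega>. envelope \<omega> powr r)"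
  defines "b \<equiv> A powr r + (\<epsilon> n)\<^sup>2 * (r * A powr (r - 1) * (drift n (fst \<zeta>) + 2 * \<kappa>)
      - (r * \<kappa> * (1 - q) / \<epsilon> n - 2 * c * \<kappa>\<^sup>2 - c * 2 powr r * \<kappa> powr r) * (\<delta> * A powr (r - 1))
      + 2 * c * E2 * A powr (r - 2) + c * 2 powr r * Er)"
  shows "(\<integral>\<^sup>+\<omega>. ennreal (Lyapunov_state n \<kappa> (step n \<zeta> \<omega>) powr r) \<partial>M) \<le> ennreal b" and "0 \<le> b"
proof -
  define e where "e = \<epsilon> n"
  have e: "0 < e" "e \<le> 1" "\<kappa> * e \<le> 1" using \<epsilon>_pos[of n] n by (auto simp: e_def)
  have \<delta>0: "0 \<le> \<delta>" "\<delta> \<le> snd \<zeta>" using \<zeta> by (auto simp: \<delta>_def)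
  have "0 \<le> \<kappa> * e * \<delta>" using \<kappa> e \<delta>0 by simp
  then have "snd \<zeta> \<le> A" by (simp add: A_def Lyapunov_state_def e_def \<delta>_def)
  then have \<delta>: "0 \<le> \<delta>" "\<delta> \<le> A" "0 \<le> A" using \<delta>0 by auto
  have c: "0 \<le> c" using r by (auto simp: c_def intro!: add_nonneg_nonneg mult_nonneg_nonneg)
  define batch where "batch \<omega> = of_bool (U \<omega> = 0) * (\<delta> + e * (\<rho> n * (W \<omega> * of_bool (fst \<zeta> < D n \<omega>))))" for \<omega>
  define \<xi> where "\<xi> \<omega> = e * increment n (fst \<zeta>) \<omega> + \<kappa> * e * (batch \<omega> - \<delta>)" for \<omega>
  define R where "R \<omega> = A powr r + r * A powr (r - 1) * \<xi> \<omega>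
      + c * (A powr (r - 2) * (2 * e\<^sup>2 * ((envelope \<omega>)\<^sup>2 + \<kappa>\<^sup>2 * \<delta>\<^sup>2))
        + 2 powr r * e powr r * (envelope \<omega> powr r + \<kappa> powr r * \<delta> powr r))" for \<omega>
  have ib: "integrable M batch"
    using expectation_batch_le(1)[OF n(1), of \<delta> "fst \<zeta>"] by (simp only: batch_def[abs_def] e_def)
  have Eb: "expectation batch \<le> q * \<delta> + 2 * e"
    using expectation_batch_le(2)[OF n(1) \<delta>(1), of "fst \<zeta>"] by (simp only: batch_def[abs_def] e_def q_def)
  have i\<xi>: "integrable M \<xi>" unfolding \<xi>_def using ib increment_integrable by simp
  have E\<xi>: "expectation \<xi> \<le> e\<^sup>2 * (drift n (fst \<zeta>) + 2 * \<kappa>) - \<kappa> * e * ((1 - q) * \<delta>)"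
  proof -
    have "expectation \<xi> = e * (e * drift n (fst \<zeta>)) + \<kappa> * e * (expectation batch - \<delta>)"
      unfolding \<xi>_def using ib increment_integrable
      by (simp add: expectation_increment e_def prob_space)
    also have "\<dots> \<le> e * (e * drift n (fst \<zeta>)) + \<kappa> * e * (q * \<delta> + 2 * e - \<delta>)"
      using Eb \<kappa> e by (intro add_left_mono mult_left_mono) auto
    also have "\<dots> = e\<^sup>2 * (drift n (fst \<zeta>) + 2 * \<kappa>) - \<kappa> * e * ((1 - q) * \<delta>)"
      by (simp only: power2_eq_square) (simp add: algebra_simps)
    finally show ?thesis .
  qed
  have ir: "integrable M (\<lambda>\<omega>. envelope \<omega> powr r)" using r by (intro envelope_powr_integrable) auto
  have iR: "integrable M R" unfolding R_def using i\<xi> ir envelope_sq_integrable by simp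
  have le: "AE \<omega> in M. Lyapunov_state n \<kappa> (step n \<zeta> \<omega>) powr r \<le> R \<omega>"
    using U_nonneg W_nonneg increment_le_envelope[OF n(1), of "fst \<zeta>"] envelope_nonneg
  proof eventually_elim
    case (elim \<omega>)
    define w where "w = \<rho> n * (W \<omega> * of_bool (fst \<zeta> < D n \<omega>))"
    have w: "0 \<le> w" "w \<le> 2 * W \<omega>"
    proof -
      have "\<rho> n * W \<omega> \<le> 2 * W \<omega>" using elim n by (intro mult_right_mono) auto
      then show "w \<le> 2 * W \<omega>" using elim by (auto simp: w_def)
      show "0 \<le> w" using elim \<rho>_pos[of n] by (auto simp: w_def)
    qed
    have inc: "increment n (fst \<zeta>) \<omega> = w - U \<omega>" by (simp add: increment_def w_def)
    have batch: "batch \<omega> = of_bool (U \<omega> = 0) * (\<delta> + e * w)" by (simp add: batch_def w_def)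
    have fs: "fst (step n \<zeta> \<omega>) = (if U \<omega> = 0 then fst \<zeta> else max 0 (snd \<zeta> + e * (w - U \<omega>)))"
      using e by (simp add: step_def next_wait_def Let_def e_def[symmetric] w_def algebra_simps)
    have ss: "snd (step n \<zeta> \<omega>) = max 0 (snd \<zeta> + e * (w - U \<omega>))"
      by (simp add: snd_step inc e_def)
    have A: "A = snd \<zeta> + \<kappa> * e * \<delta>" by (simp add: A_def Lyapunov_state_def e_def \<delta>_def)
    have "Lyapunov_state n \<kappa> (step n \<zeta> \<omega>) \<le> max 0 (A + \<xi> \<omega>)"
    proof (cases "U \<omega> = 0")
      case True
      have "0 \<le> snd \<zeta> + e * w" using \<zeta> e w by simp
      then have "Lyapunov_state n \<kappa> (step n \<zeta> \<omega>) = A + \<xi> \<omega>"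
        using True unfolding Lyapunov_state_def fs ss e_def[symmetric] A \<xi>_def inc batch \<delta>_def
        by (simp add: algebra_simps)
      then show ?thesis by simp
    next
      case False
      then have "Lyapunov_state n \<kappa> (step n \<zeta> \<omega>) = max 0 (A + \<xi> \<omega>)"
        unfolding Lyapunov_state_def fs ss e_def[symmetric] A \<xi>_def inc batch by simp
      then show ?thesis by simp
    qed
    moreover have "0 \<le> Lyapunov_state n \<kappa> (step n \<zeta> \<omega>)"
    proof -
      have "fst (step n \<zeta> \<omega>) \<le> snd (step n \<zeta> \<omega>)" "0 \<le> snd (step n \<zeta> \<omega>)"
        unfolding fs ss using \<zeta> e w by (auto intro: order_trans[where y = "snd \<zeta>"] simp: max.coboundedI2)
      then show ?thesis using \<kappa> e by (auto simp: Lyapunov_state_def e_def[symmetric])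
    qed
    ultimately have "Lyapunov_state n \<kappa> (step n \<zeta> \<omega>) powr r \<le> max 0 (A + \<xi> \<omega>) powr r"
      using r by (intro powr_mono2) auto
    also have "\<dots> \<le> A powr r + r * A powr (r - 1) * \<xi> \<omega> + c * (A powr (r - 2) * (\<xi> \<omega>)\<^sup>2 + \<bar>\<xi> \<omega>\<bar> powr r)"
      unfolding c_def by (rule powr_Taylor_upper[OF \<delta>(3) r(1)])
    also have "\<dots> \<le> R \<omega>"
    proof -
      have x: "\<bar>\<xi> \<omega>\<bar> \<le> e * (envelope \<omega> + \<kappa> * \<delta>)"
      proof -
        have "\<bar>batch \<omega> - \<delta>\<bar> \<le> \<delta> + e * w"
          unfolding batch using \<delta> e w by (auto simp: of_bool_def)
        then have "\<bar>\<kappa> * e * (batch \<omega> - \<delta>)\<bar> \<le> \<kappa> * e * (\<delta> + e * w)"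
          using \<kappa> e by (simp add: abs_mult mult_left_mono)
        also have "\<dots> = e * (\<kappa> * \<delta>) + e * ((\<kappa> * e) * w)" by (simp add: algebra_simps)
        also have "\<dots> \<le> e * (\<kappa> * \<delta>) + e * (1 * w)"
          using e w by (intro add_left_mono mult_left_mono mult_right_mono) auto
        finally have 1: "\<bar>\<kappa> * e * (batch \<omega> - \<delta>)\<bar> \<le> e * (\<kappa> * \<delta> + w)" by (simp add: algebra_simps)
        have 2: "\<bar>e * increment n (fst \<zeta>) \<omega>\<bar> \<le> e * (w + U \<omega>)"
          unfolding inc using e w elim by (auto simp: abs_mult)
        have "\<bar>\<xi> \<omega>\<bar> \<le> e * (w + U \<omega>) + e * (\<kappa> * \<delta> + w)"
          unfolding \<xi>_def using 1 2 by linarith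
        also have "\<dots> = e * (2 * w + U \<omega> + \<kappa> * \<delta>)" by (simp add: algebra_simps)
        also have "\<dots> \<le> e * (envelope \<omega> + \<kappa> * \<delta>)"
          using w e by (intro mult_left_mono) (auto simp: envelope_def)
        finally show ?thesis .
      qed
      have k\<delta>: "0 \<le> \<kappa> * \<delta>" using \<kappa> \<delta> by simp
      have "(\<xi> \<omega>)\<^sup>2 \<le> (e * (envelope \<omega> + \<kappa> * \<delta>))\<^sup>2"
        using x by (metis abs_le_square_iff abs_ge_self order_trans)
      also have "\<dots> = e\<^sup>2 * (envelope \<omega> + \<kappa> * \<delta>)\<^sup>2" by (simp add: power_mult_distrib)
      also have "\<dots> \<le> e\<^sup>2 * (2 * ((envelope \<omega>)\<^sup>2 + \<kappa>\<^sup>2 * \<delta>\<^sup>2))"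
      proof (rule mult_left_mono)
        have "0 \<le> (envelope \<omega> - \<kappa> * \<delta>)\<^sup>2" by simp
        then show "(envelope \<omega> + \<kappa> * \<delta>)\<^sup>2 \<le> 2 * ((envelope \<omega>)\<^sup>2 + \<kappa>\<^sup>2 * \<delta>\<^sup>2)"
          by (simp add: power2_eq_square algebra_simps)
      qed simp
      finally have sq: "(\<xi> \<omega>)\<^sup>2 \<le> 2 * e\<^sup>2 * ((envelope \<omega>)\<^sup>2 + \<kappa>\<^sup>2 * \<delta>\<^sup>2)" by (simp add: algebra_simps)
      have "\<bar>\<xi> \<omega>\<bar> powr r \<le> (e * (envelope \<omega> + \<kappa> * \<delta>)) powr r"
        using x r by (intro powr_mono2) auto
      also have "\<dots> = e powr r * (envelope \<omega> + \<kappa> * \<delta>) powr r"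
        using e elim k\<delta> by (simp add: powr_mult)
      also have "\<dots> \<le> e powr r * (2 powr r * (envelope \<omega> powr r + (\<kappa> * \<delta>) powr r))"
        using elim k\<delta> r by (intro mult_left_mono powr_add_le) auto
      finally have pr: "\<bar>\<xi> \<omega>\<bar> powr r \<le> 2 powr r * e powr r * (envelope \<omega> powr r + \<kappa> powr r * \<delta> powr r)"
        using \<kappa> \<delta> by (simp add: powr_mult mult_ac)
      show ?thesis
        unfolding R_def using sq pr c
        by (intro add_left_mono mult_left_mono add_mono) auto
    qed
    finally show ?case .
  qed
  have Rnn: "AE \<omega> in M. 0 \<le> R \<omega>"
    using le by eventually_elim (rule order_trans[OF powr_ge_zero])
  have "(\<integral>\<^sup>+\<omega>. ennreal (Lyapunov_state n \<kappa> (step n \<zeta> \<omega>) powr r) \<partial>M) \<le> (\<integral>\<^sup>+\<omega>. ennreal (R \<omega>) \<partial>M)"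
    by (rule nn_integral_mono_AE) (use le in \<open>eventually_elim, auto intro: ennreal_leI\<close>)
  also have "\<dots> = ennreal (expectation R)" by (rule nn_integral_eq_integral[OF iR Rnn])
  finally have R: "(\<integral>\<^sup>+\<omega>. ennreal (Lyapunov_state n \<kappa> (step n \<zeta> \<omega>) powr r) \<partial>M) \<le> ennreal (expectation R)" .
  have R0: "0 \<le> expectation R" by (rule integral_nonneg_AE[OF Rnn])
  have Rb: "expectation R \<le> b"
  proof -
    have er: "e powr r \<le> e\<^sup>2"
    proof -
      have "e powr r \<le> e powr 2" using e r by (intro powr_mono') auto
      then show ?thesis using e by simp
    qed
    have \<delta>2: "A powr (r - 2) * \<delta>\<^sup>2 \<le> \<delta> * A powr (r - 1)"
    proof (cases "A = 0")
      case False
      then have "A powr (r - 1) = A powr (r - 2) * A"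
        using \<delta> powr_add[of A "r - 2" 1] by simp
      moreover have "A powr (r - 2) * (\<delta> * \<delta>) \<le> A powr (r - 2) * (\<delta> * A)"
        using \<delta> by (intro mult_left_mono) auto
      ultimately show ?thesis by (simp add: power2_eq_square mult_ac)
    qed (use \<delta> in simp)
    have \<delta>r: "\<delta> powr r \<le> \<delta> * A powr (r - 1)"
    proof (cases "\<delta> = 0")
      case False
      then have "\<delta> powr r = \<delta> * \<delta> powr (r - 1)" using \<delta> powr_add[of \<delta> 1 "r - 1"] by simp
      also have "\<dots> \<le> \<delta> * A powr (r - 1)" using \<delta> r by (intro mult_left_mono powr_mono2) auto
      finally show ?thesis .
    qed (use r in simp)
    have Er0: "0 \<le> Er" unfolding Er_def by (rule Bochner_Integration.integral_nonneg) simp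
    have "expectation R = A powr r + r * A powr (r - 1) * expectation \<xi>
      + c * (A powr (r - 2) * (2 * e\<^sup>2 * (E2 + \<kappa>\<^sup>2 * \<delta>\<^sup>2))
        + 2 powr r * e powr r * (Er + \<kappa> powr r * \<delta> powr r))"
      unfolding R_def E2_def Er_def using i\<xi> ir envelope_sq_integrable by (simp add: prob_space)
    also have "\<dots> \<le> A powr r + r * A powr (r - 1) * (e\<^sup>2 * (drift n (fst \<zeta>) + 2 * \<kappa>) - \<kappa> * e * ((1 - q) * \<delta>))
      + c * (2 * e\<^sup>2 * E2 * A powr (r - 2) + 2 * e\<^sup>2 * \<kappa>\<^sup>2 * (\<delta> * A powr (r - 1))
        + 2 powr r * e\<^sup>2 * (Er + \<kappa> powr r * (\<delta> * A powr (r - 1))))"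
    proof (intro add_mono mult_left_mono order_refl)
      show "expectation \<xi> \<le> e\<^sup>2 * (drift n (fst \<zeta>) + 2 * \<kappa>) - \<kappa> * e * ((1 - q) * \<delta>)" by (rule E\<xi>)
      have "2 * e\<^sup>2 * \<kappa>\<^sup>2 * (A powr (r - 2) * \<delta>\<^sup>2) \<le> 2 * e\<^sup>2 * \<kappa>\<^sup>2 * (\<delta> * A powr (r - 1))"
        using \<delta>2 by (intro mult_left_mono) auto
      then show "A powr (r - 2) * (2 * e\<^sup>2 * (E2 + \<kappa>\<^sup>2 * \<delta>\<^sup>2))
          \<le> 2 * e\<^sup>2 * E2 * A powr (r - 2) + 2 * e\<^sup>2 * \<kappa>\<^sup>2 * (\<delta> * A powr (r - 1))"
        by (simp add: algebra_simps)
      show "2 powr r * e powr r * (Er + \<kappa> powr r * \<delta> powr r)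
          \<le> 2 powr r * e\<^sup>2 * (Er + \<kappa> powr r * (\<delta> * A powr (r - 1)))"
        using er \<delta>r Er0 by (intro mult_mono add_mono mult_left_mono) auto
    qed (use r c in auto)
    also have "\<dots> = A powr r + e\<^sup>2 * (r * A powr (r - 1) * (drift n (fst \<zeta>) + 2 * \<kappa>)
      - (r * \<kappa> * (1 - q) / e - 2 * c * \<kappa>\<^sup>2 - c * 2 powr r * \<kappa> powr r) * (\<delta> * A powr (r - 1))
      + 2 * c * E2 * A powr (r - 2) + c * 2 powr r * Er)"
      using e by (simp add: field_simps power2_eq_square)
    finally show "expectation R \<le> b" by (simp only: b_def e_def)
  qed
  show "(\<integral>\<^sup>+\<omega>. ennreal (Lyapunov_state n \<kappa> (step n \<zeta> \<omega>) powr r) \<partial>M) \<le> ennreal b"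
    using R ennreal_leI[OF Rb] by (rule order_trans)
  show "0 \<le> b" using R0 Rb by simp
qed

text \<open>With \<open>r = m + 1\<close> the Lyapunov function \<open>A\<^sup>r\<close> decreases on average by a multiple of \<open>\<epsilon>\<^sup>2 A\<^sup>r\<^sup>-\<^sup>1\<close>, up to
  a constant times \<open>\<epsilon>\<^sup>2\<close>.  If \<open>z \<ge> x0\<close>, this is the negative drift.  If \<open>z < x0\<close> while \<open>A\<close> is
  large, then \<open>y - z\<close> is large and the batch correction takes over.\<close>

lemma uniform_moment_bound:
  assumes m: "1 < m" "m < p - 1"
  obtains C where "0 \<le> C" "\<forall>\<^sub>F n in sequentially. (\<integral>\<^sup>+\<zeta>. ennreal (snd \<zeta> powr m) \<partial>\<nu> n) \<le> ennreal C"
proof -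
  define r where "r = m + 1"
  have r: "2 < r" "r \<le> p" using m by (auto simp: r_def)
  define q where "q = prob {\<omega> \<in> space M. U \<omega> = 0}"
  define c where "c = r + r * (r - 1) * 2 powr r"
  define E2 where "E2 = expectation (\<lambda>\<omega>. (envelope \<omega>)\<^sup>2)"
  define Er where "Er = expectation (\<lambda>\<omega>. envelope \<omega> powr r)"
  \<comment> \<open>With this choice the drift beyond \<open>x0\<close> is eventually at most \<open>- 4 \<kappa>\<close>, which leaves
    room for the \<open>2 \<kappa>\<close> that the batch correction costs.\<close>
  define \<kappa> where "\<kappa> = - B x0 / 8"
  define \<beta> where "\<beta> = max 0 (B 0 + 1)"
  define c' where "c' = r * \<kappa> * (1 - q) / 2"
  define k where "k = 2 * c * \<kappa>\<^sup>2 + c * 2 powr r * \<kappa> powr r"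
  define C1 where "C1 = r * (2 * x0) powr (r - 1) * (\<beta> + 4 * \<kappa>) + c * 2 powr r * Er"
  define C2 where "C2 = 2 * c * E2"
  \<comment> \<open>The constant in \<open>C2 A\<^sup>r\<^sup>-\<^sup>2 \<le> \<kappa> r A\<^sup>r\<^sup>-\<^sup>1 + C3\<close>.\<close>
  define C3 where "C3 = C2 * (C2 / (\<kappa> * r)) powr (r - 2)"
  have q: "q < 1" using prob_U0_less_1 by (simp add: q_def)
  have \<kappa>: "0 < \<kappa>" using x0 by (simp add: \<kappa>_def)
  have c: "0 < c" using r by (auto simp: c_def intro!: add_pos_nonneg mult_nonneg_nonneg)
  have c': "0 < c'" using r \<kappa> q by (simp add: c'_def)
  have k: "0 < k" using c \<kappa> by (auto simp: k_def intro!: add_pos_pos)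
  have E20: "0 \<le> E2" "0 \<le> Er" unfolding E2_def Er_def by (auto intro!: Bochner_Integration.integral_nonneg)
  have \<beta>: "0 \<le> \<beta>" by (simp add: \<beta>_def)
  have C0: "0 \<le> C1" "0 \<le> C2" "0 \<le> C3"
    using c r \<kappa> E20 x0 \<beta> by (auto simp: C1_def C2_def C3_def intro!: add_nonneg_nonneg mult_nonneg_nonneg)
  \<comment> \<open>The conditions make the batch term exceed, in turn, the second-order terms in \<open>\<delta>\<close> and the
    worst possible drift when \<open>z < x0\<close> and \<open>A \<ge> 2 x0\<close>.\<close>
  define e0 where "e0 = min (min 1 (1 / \<kappa>)) (min (c' / k) (c' * x0 / (2 * r * (\<beta> + 4 * \<kappa>))))"
  have e0: "0 < e0" using \<kappa> c' k x0 r \<beta> by (auto simp: e0_def intro!: divide_pos_pos mult_pos_pos add_nonneg_pos)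
  have "\<forall>\<^sub>F n in sequentially. \<forall>z\<in>{0..x0}. \<bar>drift n z - B z\<bar> < min 1 (4 * \<kappa>)"
    using x0 \<kappa> by (intro drift_lim) auto
  then have ev: "\<forall>\<^sub>F n in sequentially. \<epsilon> n < e0 \<and> \<rho> n \<le> 2 \<and> (\<forall>z\<in>{0..x0}. \<bar>drift n z - B z\<bar> < min 1 (4 * \<kappa>))"
    using small_\<epsilon>[OF e0] \<rho>_le_2 by eventually_elim simp
  have "\<forall>\<^sub>F n in sequentially. (\<integral>\<^sup>+\<zeta>. ennreal (snd \<zeta> powr m) \<partial>\<nu> n) \<le> ennreal ((C1 + C3) / (\<kappa> * r))"
    using ev
  proof eventually_elim
    case (elim n)
    define e where "e = \<epsilon> n"
    have e: "0 < e" "e \<le> 1" "e \<le> 1 / \<kappa>" "e \<le> c' / k" "e \<le> c' * x0 / (2 * r * (\<beta> + 4 * \<kappa>))"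
      using elim \<epsilon>_pos[of n] by (auto simp: e_def e0_def)
    have n: "\<rho> n \<le> 2" "\<epsilon> n \<le> 1" "\<kappa> * \<epsilon> n \<le> 1"
      using elim e \<kappa> by (auto simp: e_def field_simps)
    have ke: "k \<le> c' / e" using e k by (simp add: field_simps)
    have xe: "r * (\<beta> + 4 * \<kappa>) \<le> c' / e * (x0 / 2)"
    proof -
      have "0 < 2 * r * (\<beta> + 4 * \<kappa>)" using r \<beta> \<kappa> by simp
      then have "e * (2 * r * (\<beta> + 4 * \<kappa>)) \<le> c' * x0" using e(5) by (simp add: pos_le_divide_eq)
      then show ?thesis using e(1) by (simp add: field_simps)
    qed
    have drift0: "drift n z \<le> \<beta>" if "0 \<le> z" for z
    proof -
      have "drift n z \<le> drift n 0" by (rule drift_antimono[OF that])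
      moreover have "\<bar>drift n 0 - B 0\<bar> < 1" using elim x0 by auto
      ultimately show ?thesis by (simp add: \<beta>_def)
    qed
    have drift1: "drift n z \<le> - 4 * \<kappa>" if "x0 \<le> z" for z
    proof -
      have "drift n z \<le> drift n x0" by (rule drift_antimono[OF that])
      moreover have "\<bar>drift n x0 - B x0\<bar> < 4 * \<kappa>" using elim x0 by auto
      moreover have "B x0 = - 8 * \<kappa>" by (simp add: \<kappa>_def)
      ultimately show ?thesis by linarith
    qed
    have "(\<integral>\<^sup>+\<zeta>. ennreal (e\<^sup>2 * (\<kappa> * r * snd \<zeta> powr m)) \<partial>\<nu> n) \<le> ennreal (e\<^sup>2 * (C1 + C3))"
    proof (rule Lyapunov_bound[where h = "\<lambda>\<zeta>. Lyapunov_state n \<kappa> \<zeta> powr r"])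
      show "(\<lambda>\<zeta>. Lyapunov_state n \<kappa> \<zeta> powr r) \<in> borel_measurable borel2"
        unfolding Lyapunov_state_def by measurable
    next
      fix \<zeta> :: "real \<times> real" assume \<zeta>: "0 \<le> fst \<zeta>" "fst \<zeta> \<le> snd \<zeta>"
      define A where "A = Lyapunov_state n \<kappa> \<zeta>"
      define \<delta> where "\<delta> = snd \<zeta> - fst \<zeta>"
      have \<delta>: "0 \<le> \<delta>" using \<zeta> by (simp add: \<delta>_def)
      have A: "A = fst \<zeta> + (1 + \<kappa> * e) * \<delta>"
        by (simp add: A_def Lyapunov_state_def e_def \<delta>_def algebra_simps)
      have "0 \<le> \<kappa> * e * \<delta>" using \<kappa> e \<delta> by simp
      then have yA: "snd \<zeta> \<le> A" by (simp add: A_def Lyapunov_state_def e_def[symmetric] \<delta>_def[symmetric])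
      have A0: "0 \<le> A" using yA \<zeta> by simp
      have Ax: "A \<le> fst \<zeta> + 2 * \<delta>"
      proof -
        have "(1 + \<kappa> * e) * \<delta> \<le> 2 * \<delta>" using n \<delta> by (intro mult_right_mono) (auto simp: e_def)
        then show ?thesis by (simp add: A)
      qed
      define P1 where "P1 = A powr (r - 1)"
      have P1: "0 \<le> P1" by (simp add: P1_def)
      have main: "r * P1 * (drift n (fst \<zeta>) + 2 * \<kappa>) - c' / e * (\<delta> * P1)
          \<le> - 2 * \<kappa> * r * P1 + r * (2 * x0) powr (r - 1) * (\<beta> + 4 * \<kappa>)"
      proof -
        have c'0: "0 \<le> c' / e * (\<delta> * P1)" using c' e \<delta> P1 by simp
        have X0: "0 \<le> r * (2 * x0) powr (r - 1) * (\<beta> + 4 * \<kappa>)" using r \<beta> \<kappa> by simp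
        show ?thesis
        proof (cases "x0 \<le> fst \<zeta>")
          case True
          have "r * P1 * (drift n (fst \<zeta>) + 2 * \<kappa>) \<le> r * P1 * (- 2 * \<kappa>)"
            using drift1[OF True] r P1 by (intro mult_left_mono) auto
          then show ?thesis using c'0 X0 by (simp add: algebra_simps)
        next
          case False
          have d: "r * P1 * (drift n (fst \<zeta>) + 2 * \<kappa>) \<le> r * P1 * (\<beta> + 2 * \<kappa>)"
            using drift0[OF \<zeta>(1)] r P1 by (intro mult_left_mono) auto
          show ?thesis
          proof (cases "A \<le> 2 * x0")
            case True
            have "P1 \<le> (2 * x0) powr (r - 1)"
              unfolding P1_def using True A0 r by (intro powr_mono2) auto
            then have "r * (\<beta> + 4 * \<kappa>) * P1 \<le> r * (\<beta> + 4 * \<kappa>) * (2 * x0) powr (r - 1)"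
              using r \<beta> \<kappa> by (intro mult_left_mono) auto
            then show ?thesis using d c'0 by (simp add: algebra_simps)
          next
            case F: False
            then have "x0 / 2 \<le> \<delta>" using Ax False by simp
            then have "c' / e * (x0 / 2) * P1 \<le> c' / e * \<delta> * P1"
              using c' e P1 by (intro mult_right_mono mult_left_mono) auto
            moreover have "r * (\<beta> + 4 * \<kappa>) * P1 \<le> c' / e * (x0 / 2) * P1"
              using xe P1 by (intro mult_right_mono) auto
            ultimately show ?thesis using d X0 by (simp add: algebra_simps)
          qed
        qed
      qed
      have lower: "C2 * A powr (r - 2) \<le> \<kappa> * r * P1 + C3"
      proof (cases "C2 / (\<kappa> * r) \<le> A")
        case True
        show ?thesis
        proof (cases "A = 0")
          case False
          then have "P1 = A * A powr (r - 2)" unfolding P1_def using A0 powr_add[of A 1 "r - 2"] by simp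
          moreover have "C2 \<le> \<kappa> * r * A" using True \<kappa> r by (simp add: field_simps)
          then have "C2 * A powr (r - 2) \<le> \<kappa> * r * A * A powr (r - 2)" by (intro mult_right_mono) auto
          ultimately show ?thesis using C0 by (simp add: mult_ac)
        qed (use C0 \<kappa> r P1 in simp)
      next
        case False
        then have "A powr (r - 2) \<le> (C2 / (\<kappa> * r)) powr (r - 2)" using A0 r by (intro powr_mono2) auto
        then have "C2 * A powr (r - 2) \<le> C3" unfolding C3_def using C0 by (intro mult_left_mono) auto
        then show ?thesis using \<kappa> r P1 by (simp add: add_increasing)
      qed
      have kk: "c' / e * (\<delta> * P1) \<le> (r * \<kappa> * (1 - q) / e - 2 * c * \<kappa>\<^sup>2 - c * 2 powr r * \<kappa> powr r) * (\<delta> * P1)"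
      proof (rule mult_right_mono)
        have "r * \<kappa> * (1 - q) / e = c' / e + c' / e" by (simp add: c'_def field_simps)
        then show "c' / e \<le> r * \<kappa> * (1 - q) / e - 2 * c * \<kappa>\<^sup>2 - c * 2 powr r * \<kappa> powr r"
          using ke unfolding k_def by linarith
      qed (use \<delta> P1 in simp)
      have ym: "snd \<zeta> powr m \<le> P1"
        unfolding P1_def r_def using yA \<zeta> m by (simp add: powr_mono2)
      have "r * P1 * (drift n (fst \<zeta>) + 2 * \<kappa>)
          - (r * \<kappa> * (1 - q) / e - 2 * c * \<kappa>\<^sup>2 - c * 2 powr r * \<kappa> powr r) * (\<delta> * P1)
          + 2 * c * E2 * A powr (r - 2) + c * 2 powr r * Er \<le> C1 + C3 - \<kappa> * r * P1"
        using main lower kk unfolding C1_def C2_def by linarith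
      also have "\<dots> \<le> C1 + C3 - \<kappa> * r * snd \<zeta> powr m"
        using ym \<kappa> r by (simp add: mult_left_mono)
      finally have step_le: "A powr r + e\<^sup>2 * (r * P1 * (drift n (fst \<zeta>) + 2 * \<kappa>)
          - (r * \<kappa> * (1 - q) / e - 2 * c * \<kappa>\<^sup>2 - c * 2 powr r * \<kappa> powr r) * (\<delta> * P1)
          + 2 * c * E2 * A powr (r - 2) + c * 2 powr r * Er)
          \<le> A powr r + e\<^sup>2 * (C1 + C3 - \<kappa> * r * snd \<zeta> powr m)"
        by (intro add_left_mono mult_left_mono) auto
      note step = Lyapunov_step[OF r \<kappa> n \<zeta>, folded A_def \<delta>_def e_def q_def c_def E2_def Er_def, folded P1_def]
      have nn: "0 \<le> e\<^sup>2 * (\<kappa> * r * snd \<zeta> powr m)" using \<kappa> r by simp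
      have I: "(\<integral>\<^sup>+\<omega>. ennreal (Lyapunov_state n \<kappa> (step n \<zeta> \<omega>) powr r) \<partial>M)
          \<le> ennreal (A powr r + e\<^sup>2 * (C1 + C3) - e\<^sup>2 * (\<kappa> * r * snd \<zeta> powr m))"
        using order_trans[OF step(1) ennreal_leI[OF step_le[folded e_def]]] by (simp only: right_diff_distrib add_diff_eq)
      have "e\<^sup>2 * (\<kappa> * r * snd \<zeta> powr m) \<le> A powr r + e\<^sup>2 * (C1 + C3)"
        using order_trans[OF step(2) step_le[folded e_def]] unfolding right_diff_distrib by linarith
      then have "ennreal (A powr r + e\<^sup>2 * (C1 + C3) - e\<^sup>2 * (\<kappa> * r * snd \<zeta> powr m))
          + ennreal (e\<^sup>2 * (\<kappa> * r * snd \<zeta> powr m)) = ennreal (A powr r + e\<^sup>2 * (C1 + C3))"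
        using nn by (subst ennreal_plus[symmetric]) auto
      also have "\<dots> = ennreal (A powr r) + ennreal (e\<^sup>2 * (C1 + C3))"
        using C0 by (subst ennreal_plus[symmetric]) auto
      finally show "(\<integral>\<^sup>+\<omega>. ennreal (Lyapunov_state n \<kappa> (step n \<zeta> \<omega>) powr r) \<partial>M) + ennreal (e\<^sup>2 * (\<kappa> * r * snd \<zeta> powr m))
          \<le> ennreal (Lyapunov_state n \<kappa> \<zeta> powr r) + ennreal (e\<^sup>2 * (C1 + C3))"
        using add_right_mono[OF I, of "ennreal (e\<^sup>2 * (\<kappa> * r * snd \<zeta> powr m))"]
        by (simp only: A_def)
    qed measurable
    then have "ennreal (e\<^sup>2 * (\<kappa> * r)) * (\<integral>\<^sup>+\<zeta>. ennreal (snd \<zeta> powr m) \<partial>\<nu> n) \<le> ennreal (e\<^sup>2 * (C1 + C3))"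
      using \<kappa> r e by (simp add: ennreal_mult' nn_integral_cmult mult.assoc[symmetric])
    then have "ennreal (1 / (e\<^sup>2 * (\<kappa> * r))) * (ennreal (e\<^sup>2 * (\<kappa> * r)) * (\<integral>\<^sup>+\<zeta>. ennreal (snd \<zeta> powr m) \<partial>\<nu> n))
        \<le> ennreal (1 / (e\<^sup>2 * (\<kappa> * r))) * ennreal (e\<^sup>2 * (C1 + C3))"
      by (rule mult_left_mono) simp
    then show ?case
      using \<kappa> r e C0 by (simp add: mult.assoc[symmetric] ennreal_mult[symmetric])
  qed
  moreover have "0 \<le> (C1 + C3) / (\<kappa> * r)" using C0 \<kappa> r by simp
  ultimately show ?thesis by (rule that[rotated])
qed

end

section \<open>Generator comparison\<close>

text \<open>The \<open>C\<^sup>1\<close> convex function with derivative \<open>max 0 (min t L)\<close>, given in closed form as the supremum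
  over \<open>c \<in> [0, L]\<close> of the lines \<open>c t - c\<^sup>2 / 2\<close>.\<close>

definition clamp_integral :: "real \<Rightarrow> real \<Rightarrow> real" where
  "clamp_integral L t = max 0 (min t L) * t - (max 0 (min t L))\<^sup>2 / 2"

lemma clamp_integral_ge:
  assumes "0 \<le> c" "c \<le> L"
  shows "c * t - c\<^sup>2 / 2 \<le> clamp_integral L t"
proof -
  define m where "m = max 0 (min t L)"
  have "0 \<le> (c - m) * (c - m) / 2 + (c - m) * (m - t)"
  proof -
    consider "0 < t" "t < L" | "t \<le> 0" | "0 < t" "L \<le> t" by linarith
    then show ?thesis
    proof cases
      case 1
      then show ?thesis by (simp add: m_def)
    next
      case 2
      then have "0 \<le> c * (- t)" using assms by (intro mult_nonneg_nonneg) auto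
      moreover have "m = 0" using 2 assms by (simp add: m_def)
      ultimately show ?thesis using add_nonneg_nonneg[of "c * c / 2" "c * (- t)"] by simp
    next
      case 3
      then have "0 \<le> (L - c) * (t - L)" using assms by (intro mult_nonneg_nonneg) auto
      moreover have "m = L" using 3 assms by (simp add: m_def)
      ultimately have "0 \<le> (c - m) * (m - t)" by (simp add: algebra_simps)
      then show ?thesis by (simp add: add_nonneg_nonneg)
    qed
  qed
  then show ?thesis
    unfolding clamp_integral_def m_def[symmetric] by (simp add: power2_eq_square field_simps)
qed

lemma clamp_integral_tangent:
  assumes "0 \<le> L"
  shows "clamp_integral L t + max 0 (min t L) * x \<le> clamp_integral L (t + x)"
  using clamp_integral_ge[of "max 0 (min t L)" L "t + x"] assms
  by (simp add: clamp_integral_def algebra_simps)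

lemma clamp_integral_upper:
  assumes "0 \<le> L"
  shows "clamp_integral L (t + x) \<le> clamp_integral L t + max 0 (min t L) * x + x\<^sup>2"
proof -
  define m where "m = max 0 (min t L)"
  define m' where "m' = max 0 (min (t + x) L)"
  have "m' * t - m'\<^sup>2 / 2 \<le> clamp_integral L t"
    using assms by (intro clamp_integral_ge) (auto simp: m'_def)
  then have "clamp_integral L (t + x) \<le> clamp_integral L t + m' * x"
    by (simp add: clamp_integral_def m'_def[symmetric] algebra_simps)
  moreover have "(m' - m) * x \<le> x\<^sup>2"
  proof -
    have "\<bar>m' - m\<bar> \<le> \<bar>x\<bar>" by (auto simp: m_def m'_def max_def min_def)
    then have "\<bar>m' - m\<bar> * \<bar>x\<bar> \<le> \<bar>x\<bar> * \<bar>x\<bar>" by (intro mult_right_mono) auto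
    moreover have "(m' - m) * x \<le> \<bar>m' - m\<bar> * \<bar>x\<bar>" by (metis abs_ge_self abs_mult)
    ultimately show ?thesis by (simp add: power2_eq_square)
  qed
  ultimately show ?thesis by (simp add: m_def[symmetric] algebra_simps)
qed

lemma clamp_integral_inside:
  assumes "0 \<le> t" "t \<le> L" "0 \<le> t + x" "t + x \<le> L"
  shows "clamp_integral L (t + x) = clamp_integral L t + t * x + x\<^sup>2 / 2"
  using assms by (simp add: clamp_integral_def power2_eq_square field_simps)

context found_chains
begin

lemma distr_step: "distr (\<nu> n \<Otimes>\<^sub>M M) borel2 (\<lambda>y. step n (fst y) (snd y)) = \<nu> n"
proof (rule measure_eqI)
  have sm [measurable]: "(\<lambda>y. step n (fst y) (snd y)) \<in> \<nu> n \<Otimes>\<^sub>M M \<rightarrow>\<^sub>M borel2" by measurable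
  fix X assume "X \<in> sets (distr (\<nu> n \<Otimes>\<^sub>M M) borel2 (\<lambda>y. step n (fst y) (snd y)))"
  then have X [measurable]: "X \<in> sets borel2" by simp
  have "emeasure (distr (\<nu> n \<Otimes>\<^sub>M M) borel2 (\<lambda>y. step n (fst y) (snd y))) X
      = (\<integral>\<^sup>+y. indicator X (step n (fst y) (snd y)) \<partial>(\<nu> n \<Otimes>\<^sub>M M))"
    by (subst nn_integral_indicator[symmetric], simp, subst nn_integral_distr) auto
  also have "\<dots> = (\<integral>\<^sup>+\<zeta>. (\<integral>\<^sup>+\<omega>. indicator X (step n \<zeta> \<omega>) \<partial>M) \<partial>\<nu> n)"
    by (subst nn_integral_fst[symmetric]) simp_all
  also have "\<dots> = (\<integral>\<^sup>+\<zeta>. indicator X \<zeta> \<partial>\<nu> n)"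
    unfolding step_def
    by (rule invariant[of "indicator X" 1 n, symmetric]) (auto simp: indicator_def)
  also have "\<dots> = emeasure (\<nu> n) X" by simp
  finally show "emeasure (distr (\<nu> n \<Otimes>\<^sub>M M) borel2 (\<lambda>y. step n (fst y) (snd y))) X = emeasure (\<nu> n) X" .
qed simp

definition mean_change :: "nat \<Rightarrow> (real \<Rightarrow> real) \<Rightarrow> real \<times> real \<Rightarrow> real" where
  "mean_change n f \<zeta> = (\<integral>\<omega>. f (snd (step n \<zeta> \<omega>)) - f (snd \<zeta>) \<partial>M)"

text \<open>Invariance of \<open>\<nu>\<close>, tested on a bounded function, says that the mean change integrates to 0.\<close>

lemma mean_change_bounded:
  assumes f [measurable]: "f \<in> borel_measurable borel" and C: "\<And>t. \<bar>f t\<bar> \<le> C"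
  shows "integrable (\<nu> n) (mean_change n f)" and "(\<integral>\<zeta>. mean_change n f \<zeta> \<partial>\<nu> n) = 0"
    and "integrable M (\<lambda>\<omega>. f (snd (step n \<zeta> \<omega>)) - f (snd \<zeta>))"
proof -
  interpret P: pair_prob_space "\<nu> n" M ..
  have sm [measurable]: "(\<lambda>y. step n (fst y) (snd y)) \<in> \<nu> n \<Otimes>\<^sub>M M \<rightarrow>\<^sub>M borel2" by measurable
  define F where "F y = f (snd (step n (fst y) (snd y))) - f (snd (fst y))" for y
  have Fm [measurable]: "F \<in> borel_measurable (\<nu> n \<Otimes>\<^sub>M M)" unfolding F_def by measurable
  have i1: "integrable (\<nu> n \<Otimes>\<^sub>M M) (\<lambda>y. f (snd (step n (fst y) (snd y))))"
    by (rule P.P.integrable_const_bound[where B = C]) (use C in \<open>auto\<close>)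
  have i2: "integrable (\<nu> n \<Otimes>\<^sub>M M) (\<lambda>y. f (snd (fst y)))"
    by (rule P.P.integrable_const_bound[where B = C]) (use C in \<open>auto\<close>)
  have iF: "integrable (\<nu> n \<Otimes>\<^sub>M M) F" unfolding F_def using i1 i2 by simp
  have eq: "mean_change n f \<zeta> = (\<integral>\<omega>. F (\<zeta>, \<omega>) \<partial>M)" for \<zeta> by (simp add: mean_change_def F_def)
  show "integrable (\<nu> n) (mean_change n f)"
    using P.integrable_fst'[OF iF] by (simp add: eq[abs_def])
  have "(\<integral>\<zeta>. mean_change n f \<zeta> \<partial>\<nu> n) = integral\<^sup>L (\<nu> n \<Otimes>\<^sub>M M) F"
    using P.integral_fst'[OF iF] by (simp add: eq)
  also have "\<dots> = (\<integral>y. f (snd (step n (fst y) (snd y))) \<partial>(\<nu> n \<Otimes>\<^sub>M M)) - (\<integral>y. f (snd (fst y)) \<partial>(\<nu> n \<Otimes>\<^sub>M M))"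
    unfolding F_def using i1 i2 by simp
  also have "(\<integral>y. f (snd (step n (fst y) (snd y))) \<partial>(\<nu> n \<Otimes>\<^sub>M M))
      = (\<integral>\<zeta>. f (snd \<zeta>) \<partial>distr (\<nu> n \<Otimes>\<^sub>M M) borel2 (\<lambda>y. step n (fst y) (snd y)))"
    by (subst integral_distr) auto
  also have "\<dots> = (\<integral>\<zeta>. f (snd \<zeta>) \<partial>\<nu> n)" by (simp only: distr_step)
  also have "(\<integral>y. f (snd (fst y)) \<partial>(\<nu> n \<Otimes>\<^sub>M M)) = (\<integral>\<zeta>. (\<integral>\<omega>. f (snd \<zeta>) \<partial>M) \<partial>\<nu> n)"
    using P.integral_fst'[OF i2] by simp
  also have "\<dots> = (\<integral>\<zeta>. f (snd \<zeta>) \<partial>\<nu> n)" by (simp add: prob_space)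
  finally show "(\<integral>\<zeta>. mean_change n f \<zeta> \<partial>\<nu> n) = 0" by simp
  have "(\<lambda>\<omega>. f (snd (step n \<zeta> \<omega>)) - f (snd \<zeta>)) \<in> borel_measurable M"
    by measurable
  moreover have "\<bar>f (snd (step n \<zeta> \<omega>)) - f (snd \<zeta>)\<bar> \<le> C + C" for \<omega>
    using C[of "snd (step n \<zeta> \<omega>)"] C[of "snd \<zeta>"] by linarith
  ultimately show "integrable M (\<lambda>\<omega>. f (snd (step n \<zeta> \<omega>)) - f (snd \<zeta>))"
    by (intro integrable_const_bound[where B = "C + C"]) auto
qed

subsection \<open>Second moments of the increments\<close>

abbreviation \<sigma>2 :: real where
  "\<sigma>2 \<equiv> expectation (\<lambda>\<omega>. (U \<omega>)\<^sup>2) + expectation (\<lambda>\<omega>. (W \<omega>)\<^sup>2) - 2"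

lemma squares_integrable: "integrable M (\<lambda>\<omega>. (U \<omega>)\<^sup>2)" "integrable M (\<lambda>\<omega>. (W \<omega>)\<^sup>2)"
proof -
  have "integrable M (\<lambda>\<omega>. U \<omega> powr 2)" "integrable M (\<lambda>\<omega>. W \<omega> powr 2)"
    using integrable_powr_le[OF U_measurable U_nonneg U_p, of 2]
      integrable_powr_le[OF W_measurable W_nonneg W_p, of 2] p by auto
  then show "integrable M (\<lambda>\<omega>. (U \<omega>)\<^sup>2)" "integrable M (\<lambda>\<omega>. (W \<omega>)\<^sup>2)"
    by - (rule Bochner_Integration.integrable_bound, assumption, simp,
      use U_nonneg W_nonneg in \<open>auto simp: powr_numeral\<close>)+
qed

lemma increment_sq:
  shows "integrable M (\<lambda>\<omega>. (increment n z \<omega>)\<^sup>2)"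
    and "expectation (\<lambda>\<omega>. (increment n z \<omega>)\<^sup>2)
      = \<rho> n * (\<rho> n * survival n z) * expectation (\<lambda>\<omega>. (W \<omega>)\<^sup>2) - 2 * (\<rho> n * survival n z)
        + expectation (\<lambda>\<omega>. (U \<omega>)\<^sup>2)"
proof -
  have i1: "integrable M (\<lambda>\<omega>. (W \<omega>)\<^sup>2 * of_bool (z < D n \<omega>))"
    by (rule Bochner_Integration.integrable_bound[OF squares_integrable(2)]) auto
  have i2: "integrable M (\<lambda>\<omega>. U \<omega> * W \<omega> * of_bool (z < D n \<omega>))"
  proof (rule Bochner_Integration.integrable_bound)
    show "integrable M (\<lambda>\<omega>. (U \<omega>)\<^sup>2 + (W \<omega>)\<^sup>2)" using squares_integrable by simp
    have "\<bar>u * w\<bar> \<le> u\<^sup>2 + w\<^sup>2" for u w :: real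
    proof -
      have "2 * \<bar>u\<bar> * \<bar>w\<bar> \<le> \<bar>u\<bar>\<^sup>2 + \<bar>w\<bar>\<^sup>2" by (rule sum_squares_bound)
      moreover have "0 \<le> \<bar>u\<bar> * \<bar>w\<bar>" by simp
      ultimately have "\<bar>u\<bar> * \<bar>w\<bar> \<le> \<bar>u\<bar>\<^sup>2 + \<bar>w\<bar>\<^sup>2" by linarith
      then show ?thesis by (simp add: abs_mult)
    qed
    then show "AE \<omega> in M. norm (U \<omega> * W \<omega> * of_bool (z < D n \<omega>)) \<le> norm ((U \<omega>)\<^sup>2 + (W \<omega>)\<^sup>2)"
      by (auto simp: of_bool_def)
  qed measurable
  have eq: "(\<lambda>\<omega>. (increment n z \<omega>)\<^sup>2) = (\<lambda>\<omega>. (\<rho> n)\<^sup>2 * ((W \<omega>)\<^sup>2 * of_bool (z < D n \<omega>))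
      - 2 * \<rho> n * (U \<omega> * W \<omega> * of_bool (z < D n \<omega>)) + (U \<omega>)\<^sup>2)"
    by (auto simp: increment_def fun_eq_iff of_bool_def power2_eq_square algebra_simps)
  show "integrable M (\<lambda>\<omega>. (increment n z \<omega>)\<^sup>2)" unfolding eq using i1 i2 squares_integrable by simp
  have "expectation (\<lambda>\<omega>. (increment n z \<omega>)\<^sup>2)
      = (\<rho> n)\<^sup>2 * expectation (\<lambda>\<omega>. (W \<omega>)\<^sup>2 * of_bool (z < D n \<omega>))
        - 2 * \<rho> n * expectation (\<lambda>\<omega>. U \<omega> * W \<omega> * of_bool (z < D n \<omega>)) + expectation (\<lambda>\<omega>. (U \<omega>)\<^sup>2)"
    unfolding eq using i1 i2 squares_integrable by simp
  then show "expectation (\<lambda>\<omega>. (increment n z \<omega>)\<^sup>2)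
      = \<rho> n * (\<rho> n * survival n z) * expectation (\<lambda>\<omega>. (W \<omega>)\<^sup>2) - 2 * (\<rho> n * survival n z)
        + expectation (\<lambda>\<omega>. (U \<omega>)\<^sup>2)"
    unfolding patience by (simp add: power2_eq_square[of "\<rho> n"] mult_ac)
qed

lemma B_bound: obtains b where "0 \<le> b" "\<And>z. 0 \<le> z \<Longrightarrow> z \<le> K \<Longrightarrow> \<bar>B z\<bar> \<le> b"
proof -
  obtain L where L: "0 \<le> L" "\<And>y z. y \<in> {0..\<bar>K\<bar>} \<Longrightarrow> z \<in> {0..\<bar>K\<bar>} \<Longrightarrow> \<bar>B y - B z\<bar> \<le> L * \<bar>y - z\<bar>"
    using B_Lipschitz[of "\<bar>K\<bar>"] by blast
  show ?thesis
  proof (rule that)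
    show "0 \<le> \<bar>B 0\<bar> + L * \<bar>K\<bar>" using L by simp
    fix z assume z: "0 \<le> z" "z \<le> K"
    then have "\<bar>B z - B 0\<bar> \<le> L * \<bar>z - 0\<bar>" by (intro L) auto
    also have "\<dots> \<le> L * \<bar>K\<bar>" using z L by (intro mult_left_mono) auto
    finally show "\<bar>B z\<bar> \<le> \<bar>B 0\<bar> + L * \<bar>K\<bar>" by linarith
  qed
qed

text \<open>Convergence of the drift forces \<open>\<rho> n * survival n z\<close> to 1 uniformly on compact sets, so that
  abandonment does not show in the variance.\<close>

lemma increment_sq_lim:
  assumes K: "0 < K" and e: "0 < e"
  shows "\<forall>\<^sub>F n in sequentially. \<forall>z\<in>{0..K}. \<bar>expectation (\<lambda>\<omega>. (increment n z \<omega>)\<^sup>2) - \<sigma>2\<bar> < e"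
proof -
  obtain b where b: "0 \<le> b" "\<And>z. 0 \<le> z \<Longrightarrow> z \<le> K \<Longrightarrow> \<bar>B z\<bar> \<le> b" using B_bound by blast
  define w where "w = expectation (\<lambda>\<omega>. (W \<omega>)\<^sup>2)"
  have w: "0 \<le> w" unfolding w_def by (rule Bochner_Integration.integral_nonneg) simp
  have "(\<lambda>n. (2 * w + 2) * (\<epsilon> n * (b + 1)) + \<bar>\<rho> n - 1\<bar> * w) \<longlonglongrightarrow> (2 * w + 2) * (0 * (b + 1)) + \<bar>1 - 1\<bar> * w"
    by (intro tendsto_intros \<epsilon>_lim \<rho>_lim)
  then have "\<forall>\<^sub>F n in sequentially. (2 * w + 2) * (\<epsilon> n * (b + 1)) + \<bar>\<rho> n - 1\<bar> * w < e"
    using e by (intro order_tendstoD) auto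
  moreover have "\<forall>\<^sub>F n in sequentially. \<forall>z\<in>{0..K}. \<bar>drift n z - B z\<bar> < 1" by (rule drift_lim[OF K]) simp
  ultimately show ?thesis using \<rho>_le_2
  proof eventually_elim
    case (elim n)
    show ?case
    proof
      fix z assume z: "z \<in> {0..K}"
      define t where "t = \<rho> n * survival n z"
      have t: "t - 1 = \<epsilon> n * drift n z" using \<epsilon>_pos[of n] by (simp add: t_def)
      have "\<bar>drift n z\<bar> \<le> b + 1" using elim(2) z b(2)[of z] by force
      then have t1: "\<bar>t - 1\<bar> \<le> \<epsilon> n * (b + 1)"
        unfolding t abs_mult using \<epsilon>_pos[of n] by (intro mult_mono) auto
      have "expectation (\<lambda>\<omega>. (increment n z \<omega>)\<^sup>2) - \<sigma>2 = (\<rho> n * t - 1) * w - 2 * (t - 1)"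
        unfolding increment_sq(2) t_def[symmetric] w_def by (simp add: algebra_simps)
      also have "\<rho> n * t - 1 = \<rho> n * (t - 1) + (\<rho> n - 1)" by (simp add: algebra_simps)
      finally have "\<bar>expectation (\<lambda>\<omega>. (increment n z \<omega>)\<^sup>2) - \<sigma>2\<bar>
          \<le> \<bar>(\<rho> n * (t - 1) + (\<rho> n - 1)) * w\<bar> + \<bar>2 * (t - 1)\<bar>" by linarith
      also have "\<dots> \<le> (2 * \<bar>t - 1\<bar> + \<bar>\<rho> n - 1\<bar>) * w + 2 * \<bar>t - 1\<bar>"
      proof (intro add_mono)
        have "\<bar>\<rho> n * (t - 1)\<bar> \<le> 2 * \<bar>t - 1\<bar>"
          unfolding abs_mult using elim(3) \<rho>_pos[of n] by (intro mult_right_mono) auto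
        then have "\<bar>\<rho> n * (t - 1) + (\<rho> n - 1)\<bar> \<le> 2 * \<bar>t - 1\<bar> + \<bar>\<rho> n - 1\<bar>" by linarith
        then have "\<bar>\<rho> n * (t - 1) + (\<rho> n - 1)\<bar> * w \<le> (2 * \<bar>t - 1\<bar> + \<bar>\<rho> n - 1\<bar>) * w"
          using w by (rule mult_right_mono)
        then show "\<bar>(\<rho> n * (t - 1) + (\<rho> n - 1)) * w\<bar> \<le> (2 * \<bar>t - 1\<bar> + \<bar>\<rho> n - 1\<bar>) * w"
          using w by (simp add: abs_mult)
        show "\<bar>2 * (t - 1)\<bar> \<le> 2 * \<bar>t - 1\<bar>" unfolding abs_mult by (simp only: abs_numeral)
      qed
      also have "\<dots> = (2 * w + 2) * \<bar>t - 1\<bar> + \<bar>\<rho> n - 1\<bar> * w" by (simp add: algebra_simps)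
      also have "\<dots> \<le> (2 * w + 2) * (\<epsilon> n * (b + 1)) + \<bar>\<rho> n - 1\<bar> * w"
        using t1 w by (intro add_mono mult_left_mono) auto
      also have "\<dots> < e" by (rule elim)
      finally show "\<bar>expectation (\<lambda>\<omega>. (increment n z \<omega>)\<^sup>2) - \<sigma>2\<bar> < e" .
    qed
  qed
qed

text \<open>The Lindeberg term: the part of the second moment carried by jumps larger than \<open>\<eta>\<close>.\<close>

definition tail_sq :: "nat \<Rightarrow> real \<Rightarrow> real" where
  "tail_sq n \<eta> = expectation (\<lambda>\<omega>. (envelope \<omega>)\<^sup>2 * of_bool (\<eta> < \<epsilon> n * envelope \<omega>))"

lemma tail_sq_integrable: "integrable M (\<lambda>\<omega>. (envelope \<omega>)\<^sup>2 * of_bool (\<eta> < \<epsilon> n * envelope \<omega>))"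
  by (rule Bochner_Integration.integrable_bound[OF envelope_sq_integrable]) auto

lemma tail_sq_lim:
  assumes "0 < \<eta>"
  shows "(\<lambda>n. tail_sq n \<eta>) \<longlonglongrightarrow> 0"
proof -
  have "(\<lambda>n. \<integral>\<omega>. (envelope \<omega>)\<^sup>2 * of_bool (\<eta> < \<epsilon> n * envelope \<omega>) \<partial>M) \<longlonglongrightarrow> (\<integral>\<omega>. 0 \<partial>M)"
  proof (rule integral_dominated_convergence[where w = "\<lambda>\<omega>. (envelope \<omega>)\<^sup>2"])
    show "AE \<omega> in M. (\<lambda>n. (envelope \<omega>)\<^sup>2 * of_bool (\<eta> < \<epsilon> n * envelope \<omega>)) \<longlonglongrightarrow> 0"
    proof (rule AE_I2)
      fix \<omega>
      have "(\<lambda>n. \<epsilon> n * envelope \<omega>) \<longlonglongrightarrow> 0 * envelope \<omega>" by (intro tendsto_intros \<epsilon>_lim)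
      then have "\<forall>\<^sub>F n in sequentially. \<epsilon> n * envelope \<omega> < \<eta>"
        using assms by (intro order_tendstoD) auto
      then have "\<forall>\<^sub>F n in sequentially. (envelope \<omega>)\<^sup>2 * of_bool (\<eta> < \<epsilon> n * envelope \<omega>) = 0"
        by eventually_elim simp
      then show "(\<lambda>n. (envelope \<omega>)\<^sup>2 * of_bool (\<eta> < \<epsilon> n * envelope \<omega>)) \<longlonglongrightarrow> 0"
        by (rule tendsto_eventually)
    qed
  qed (use envelope_sq_integrable in auto)
  then show ?thesis by (simp add: tail_sq_def)
qed

lemma increment_sq_le: "\<rho> n \<le> 2 \<Longrightarrow> expectation (\<lambda>\<omega>. (increment n z \<omega>)\<^sup>2) \<le> expectation (\<lambda>\<omega>. (envelope \<omega>)\<^sup>2)"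
proof (rule integral_mono_AE[OF increment_sq(1) envelope_sq_integrable])
  assume "\<rho> n \<le> 2"
  from increment_le_envelope[OF this, of z]
  show "AE \<omega> in M. (increment n z \<omega>)\<^sup>2 \<le> (envelope \<omega>)\<^sup>2"
    by eventually_elim (metis abs_le_square_iff abs_ge_self order_trans)
qed

subsection \<open>No mass accumulates at the boundary\<close>

text \<open>The test function is increasing, so that the reflection at 0 can only help; its second
  derivative is 1 on \<open>[0, \<eta>]\<close> and at least \<open>- \<eta>\<close> elsewhere, and its first derivative is at most
  \<open>3 \<eta>\<close> and vanishes beyond 5.\<close>

lemma no_boundary_mass:
  obtains C where "0 \<le> C"
    "\<And>\<eta>. 0 < \<eta> \<Longrightarrow> \<eta> \<le> 1 \<Longrightarrow> \<forall>\<^sub>F n in sequentially. measure (\<nu> n) {\<zeta> \<in> space (\<nu> n). snd \<zeta> \<le> \<eta>} \<le> C * \<eta>"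
proof -
  obtain b where b: "0 \<le> b" "\<And>z. 0 \<le> z \<Longrightarrow> z \<le> 5 \<Longrightarrow> \<bar>B z\<bar> \<le> b" using B_bound by blast
  define E2 where "E2 = expectation (\<lambda>\<omega>. (envelope \<omega>)\<^sup>2)"
  have E2: "0 \<le> E2" unfolding E2_def by (rule Bochner_Integration.integral_nonneg) simp
  \<comment> \<open>The curvature term has a coefficient of at least \<open>\<sigma>2 / 4\<close> once Lindeberg and variance errors of
    \<open>\<sigma>2 / 4\<close> each are subtracted from \<open>\<sigma>2\<close> and the rest is halved; the bracket bounds drift and
    negative curvature, both of order \<open>\<eta>\<close>.\<close>
  define C where "C = 4 / \<sigma>2 * (3 * (b + 1) + E2)"
  have C: "0 \<le> C" using variance_pos b E2 by (simp add: C_def)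
  have "\<forall>\<^sub>F n in sequentially. measure (\<nu> n) {\<zeta> \<in> space (\<nu> n). snd \<zeta> \<le> \<eta>} \<le> C * \<eta>"
    if \<eta>: "0 < \<eta>" "\<eta> \<le> 1" for \<eta>
  proof -
    define \<phi> where "\<phi> t = max 0 (min (t + \<eta>) (3 * \<eta>)) - \<eta> * max 0 (min (t - 2 * \<eta>) 3)" for t
    define f where "f t = clamp_integral (3 * \<eta>) (t + \<eta>) - \<eta> * clamp_integral 3 (t - 2 * \<eta>)" for t
    have f_meas [measurable]: "f \<in> borel_measurable borel" unfolding f_def clamp_integral_def by measurable
    have \<phi>0: "0 \<le> \<phi> t" "\<phi> t \<le> 3 * \<eta>" if "0 \<le> t" for t
    proof -
      show "\<phi> t \<le> 3 * \<eta>"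
      proof -
        have "0 \<le> \<eta> * max 0 (min (t - 2 * \<eta>) 3)" "max 0 (min (t + \<eta>) (3 * \<eta>)) \<le> 3 * \<eta>" using \<eta> by auto
        then show ?thesis unfolding \<phi>_def by linarith
      qed
      show "0 \<le> \<phi> t"
      proof (cases "t \<le> 2 * \<eta>")
        case True then show ?thesis using \<eta> that by (simp add: \<phi>_def)
      next
        case False
        have "\<eta> * max 0 (min (t - 2 * \<eta>) 3) \<le> \<eta> * 3" using \<eta> by (intro mult_left_mono) auto
        then show ?thesis using False \<eta> by (simp add: \<phi>_def)
      qed
    qed
    have \<phi>far: "\<phi> t = 0" if "5 \<le> t" for t
      using that \<eta> by (simp add: \<phi>_def)
    have f_lower: "f t + \<phi> t * x + of_bool (0 \<le> t \<and> t \<le> \<eta> \<and> \<bar>x\<bar> \<le> \<eta>) * x\<^sup>2 / 2 - \<eta> * x\<^sup>2 \<le> f (t + x)" for t x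
    proof -
      have 1: "clamp_integral (3 * \<eta>) (t + \<eta>) + max 0 (min (t + \<eta>) (3 * \<eta>)) * x
          + of_bool (0 \<le> t \<and> t \<le> \<eta> \<and> \<bar>x\<bar> \<le> \<eta>) * x\<^sup>2 / 2 \<le> clamp_integral (3 * \<eta>) (t + \<eta> + x)"
      proof (cases "0 \<le> t \<and> t \<le> \<eta> \<and> \<bar>x\<bar> \<le> \<eta>")
        case True
        then have "clamp_integral (3 * \<eta>) (t + \<eta> + x) = clamp_integral (3 * \<eta>) (t + \<eta>) + (t + \<eta>) * x + x\<^sup>2 / 2"
          by (intro clamp_integral_inside) auto
        moreover have "max 0 (min (t + \<eta>) (3 * \<eta>)) = t + \<eta>" using True \<eta> by auto
        ultimately show ?thesis using True by simp
      next
        case False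
        then have z: "of_bool (0 \<le> t \<and> t \<le> \<eta> \<and> \<bar>x\<bar> \<le> \<eta>) = (0 :: real)" by (simp only: of_bool_eq)
        show ?thesis unfolding z using clamp_integral_tangent[of "3 * \<eta>" "t + \<eta>" x] \<eta> by simp
      qed
      have "\<eta> * clamp_integral 3 (t - 2 * \<eta> + x)
          \<le> \<eta> * (clamp_integral 3 (t - 2 * \<eta>) + max 0 (min (t - 2 * \<eta>) 3) * x + x\<^sup>2)"
        using \<eta> by (intro mult_left_mono clamp_integral_upper) auto
      moreover have "t + \<eta> + x = t + x + \<eta>" "t - 2 * \<eta> + x = t + x - 2 * \<eta>" by simp_all
      ultimately show ?thesis using 1 unfolding f_def \<phi>_def by (simp add: algebra_simps)
    qed
    have f_reflect: "f t \<le> f (max 0 t)" for t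
    proof (cases "0 \<le> t")
      case False
      have "clamp_integral (3 * \<eta>) (t + \<eta>) \<le> clamp_integral (3 * \<eta>) (0 + \<eta>)"
      proof -
        have "clamp_integral (3 * \<eta>) (t + \<eta>) + max 0 (min (t + \<eta>) (3 * \<eta>)) * (- t)
            \<le> clamp_integral (3 * \<eta>) (t + \<eta> + - t)"
          using \<eta> by (intro clamp_integral_tangent) auto
        moreover have "0 \<le> max 0 (min (t + \<eta>) (3 * \<eta>)) * (- t)" using False by (intro mult_nonneg_nonneg) auto
        ultimately show ?thesis by simp
      qed
      then show ?thesis using False \<eta> by (simp add: f_def clamp_integral_def)
    qed simp
    have f_bdd: "\<bar>f t\<bar> \<le> 25" for t
    proof -
      have nn: "0 \<le> clamp_integral L s" if "0 \<le> L" for L s using clamp_integral_ge[of 0 L s] that by simp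
      have up: "clamp_integral L s \<le> L * \<bar>s\<bar>" if "0 \<le> L" for L s
      proof -
        have "clamp_integral L s \<le> max 0 (min s L) * s" by (simp add: clamp_integral_def)
        also have "\<dots> \<le> \<bar>max 0 (min s L) * s\<bar>" by simp
        also have "\<dots> \<le> L * \<bar>s\<bar>" unfolding abs_mult using that by (intro mult_right_mono) auto
        finally show ?thesis .
      qed
      show ?thesis
      proof (cases "5 \<le> t")
        case True
        have c1: "clamp_integral (3 * \<eta>) (t + \<eta>) = 3 * \<eta> * (t + \<eta>) - (3 * \<eta>)\<^sup>2 / 2"
          using True \<eta> by (simp add: clamp_integral_def min_absorb2 max_absorb2)
        have c2: "clamp_integral 3 (t - 2 * \<eta>) = 3 * (t - 2 * \<eta>) - 9 / 2"
          using True \<eta> by (simp add: clamp_integral_def min_absorb2 max_absorb2)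
        have "f t = 9 / 2 * \<eta>\<^sup>2 * (- 1) + 6 * \<eta>\<^sup>2 + 3 * \<eta>\<^sup>2 + 9 / 2 * \<eta>"
          unfolding f_def c1 c2 by (simp add: power2_eq_square algebra_simps)
        moreover have "\<eta>\<^sup>2 \<le> 1" "0 \<le> \<eta>\<^sup>2" using \<eta> by (simp_all add: power_le_one)
        ultimately show ?thesis using \<eta> by (simp add: abs_le_iff)
      next
        case False
        show ?thesis
        proof (cases "t \<le> - \<eta>")
          case True
          then show ?thesis using \<eta> by (simp add: f_def clamp_integral_def)
        next
          case F: False
          have "clamp_integral (3 * \<eta>) (t + \<eta>) \<le> 3 * \<eta> * \<bar>t + \<eta>\<bar>" using \<eta> by (intro up) auto
          also have "\<dots> \<le> 3 * 1 * 6" using F False \<eta> by (intro mult_mono) auto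
          finally have a: "clamp_integral (3 * \<eta>) (t + \<eta>) \<le> 18" by simp
          have "clamp_integral 3 (t - 2 * \<eta>) \<le> 3 * \<bar>t - 2 * \<eta>\<bar>" by (rule up) simp
          also have "\<dots> \<le> 15" using F False \<eta> by (auto simp: abs_if)
          finally have "clamp_integral 3 (t - 2 * \<eta>) \<le> 15" .
          then have "\<eta> * clamp_integral 3 (t - 2 * \<eta>) \<le> 1 * 15" using \<eta> nn[of 3] by (intro mult_mono) auto
          moreover have "0 \<le> \<eta> * clamp_integral 3 (t - 2 * \<eta>)" using \<eta> nn[of 3] by simp
          moreover have "0 \<le> clamp_integral (3 * \<eta>) (t + \<eta>)" using \<eta> nn by simp
          ultimately show ?thesis using a unfolding f_def by linarith
        qed
      qed
    qed
    have "(\<lambda>n. tail_sq n \<eta>) \<longlonglongrightarrow> 0" by (rule tail_sq_lim) fact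
    then have "\<forall>\<^sub>F n in sequentially. tail_sq n \<eta> < \<sigma>2 / 4" using variance_pos by (intro order_tendstoD) auto
    moreover have "\<forall>\<^sub>F n in sequentially. \<forall>z\<in>{0..5}. \<bar>drift n z - B z\<bar> < 1" by (rule drift_lim) auto
    moreover have "\<forall>\<^sub>F n in sequentially. \<forall>z\<in>{0..5}. \<bar>expectation (\<lambda>\<omega>. (increment n z \<omega>)\<^sup>2) - \<sigma>2\<bar> < \<sigma>2 / 4"
      by (rule increment_sq_lim) (use variance_pos in auto)
    ultimately show ?thesis using \<rho>_le_2
    proof eventually_elim
      case (elim n)
      define e where "e = \<epsilon> n"
      have e: "0 < e" using \<epsilon>_pos by (simp add: e_def)
      have pw: "e\<^sup>2 * (\<sigma>2 / 4 * of_bool (snd \<zeta> \<le> \<eta>) - \<eta> * (3 * (b + 1) + E2)) \<le> mean_change n f \<zeta>"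
        if \<zeta>: "0 \<le> fst \<zeta>" "fst \<zeta> \<le> snd \<zeta>" for \<zeta>
      proof -
        define z where "z = fst \<zeta>"
        define y where "y = snd \<zeta>"
        have zy: "0 \<le> z" "z \<le> y" using \<zeta> by (auto simp: z_def y_def)
        define R where "R \<omega> = \<phi> y * (e * increment n z \<omega>)
          + of_bool (y \<le> \<eta>) / 2 * (e\<^sup>2 * ((increment n z \<omega>)\<^sup>2 - (envelope \<omega>)\<^sup>2 * of_bool (\<eta> < e * envelope \<omega>)))
          - \<eta> * (e\<^sup>2 * (increment n z \<omega>)\<^sup>2)" for \<omega>
        have ti: "integrable M (\<lambda>\<omega>. (envelope \<omega>)\<^sup>2 * of_bool (\<eta> < e * envelope \<omega>))"
          unfolding e_def by (rule tail_sq_integrable)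
        have iR: "integrable M R" unfolding R_def using increment_integrable increment_sq(1) ti by simp
        have "expectation R \<le> mean_change n f \<zeta>"
          unfolding mean_change_def
        proof (rule integral_mono_AE[OF iR mean_change_bounded(3)[OF f_meas f_bdd]])
          show "AE \<omega> in M. R \<omega> \<le> f (snd (step n \<zeta> \<omega>)) - f (snd \<zeta>)"
            using increment_le_envelope[OF elim(4), of z]
          proof eventually_elim
            case (elim \<omega>)
            define x where "x = e * increment n z \<omega>"
            have "snd (step n \<zeta> \<omega>) = max 0 (y + x)" by (simp add: snd_step x_def y_def z_def e_def)
            then have "f (y + x) \<le> f (snd (step n \<zeta> \<omega>))" using f_reflect[of "y + x"] by simp
            moreover have "R \<omega> \<le> \<phi> y * x + of_bool (0 \<le> y \<and> y \<le> \<eta> \<and> \<bar>x\<bar> \<le> \<eta>) * x\<^sup>2 / 2 - \<eta> * x\<^sup>2"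
            proof -
              have "e\<^sup>2 * ((increment n z \<omega>)\<^sup>2 - (envelope \<omega>)\<^sup>2 * of_bool (\<eta> < e * envelope \<omega>))
                  \<le> of_bool (\<bar>x\<bar> \<le> \<eta>) * x\<^sup>2"
              proof (cases "\<eta> < e * envelope \<omega>")
                case True
                have "(increment n z \<omega>)\<^sup>2 \<le> (envelope \<omega>)\<^sup>2"
                  using elim by (metis abs_le_square_iff abs_ge_self order_trans)
                then have "e\<^sup>2 * ((increment n z \<omega>)\<^sup>2 - (envelope \<omega>)\<^sup>2) \<le> 0"
                  by (intro mult_nonneg_nonpos) auto
                then show ?thesis using True by (simp add: order_trans[where y = 0])
              next
                case False
                have "\<bar>x\<bar> \<le> e * envelope \<omega>" unfolding x_def abs_mult using elim e by (intro mult_mono) auto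
                then have "\<bar>x\<bar> \<le> \<eta>" using False by simp
                then show ?thesis using False by (simp add: x_def power_mult_distrib)
              qed
              then have l1: "of_bool (y \<le> \<eta>) / 2 * (e\<^sup>2 * ((increment n z \<omega>)\<^sup>2 - (envelope \<omega>)\<^sup>2 * of_bool (\<eta> < e * envelope \<omega>)))
                  \<le> of_bool (y \<le> \<eta>) / 2 * (of_bool (\<bar>x\<bar> \<le> \<eta>) * x\<^sup>2)"
                by (intro mult_left_mono) auto
              have l2: "of_bool (y \<le> \<eta>) / 2 * (of_bool (\<bar>x\<bar> \<le> \<eta>) * x\<^sup>2)
                  = of_bool (0 \<le> y \<and> y \<le> \<eta> \<and> \<bar>x\<bar> \<le> \<eta>) * x\<^sup>2 / 2"
                using zy by (simp add: of_bool_def)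
              have l3: "e\<^sup>2 * (increment n z \<omega>)\<^sup>2 = x\<^sup>2" by (simp add: x_def power_mult_distrib)
              show ?thesis
                unfolding R_def x_def[symmetric] l3
                by (intro diff_right_mono add_left_mono order_trans[OF l1 eq_refl[OF l2]])
            qed
            ultimately show ?case using f_lower[of y x] by (simp add: y_def[symmetric])
          qed
        qed
        moreover have "expectation R = \<phi> y * (e * (e * drift n z))
          + of_bool (y \<le> \<eta>) / 2 * (e\<^sup>2 * (expectation (\<lambda>\<omega>. (increment n z \<omega>)\<^sup>2) - tail_sq n \<eta>))
          - \<eta> * (e\<^sup>2 * expectation (\<lambda>\<omega>. (increment n z \<omega>)\<^sup>2))"
          unfolding R_def using increment_integrable increment_sq(1) ti
          by (simp add: expectation_increment tail_sq_def e_def)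
        moreover have "e\<^sup>2 * (- (3 * \<eta> * (b + 1))) \<le> \<phi> y * (e * (e * drift n z))"
        proof -
          have "- (3 * \<eta> * (b + 1)) \<le> \<phi> y * drift n z"
          proof (cases "5 \<le> y")
            case True
            then show ?thesis using \<phi>far[OF True] \<eta> b by simp
          next
            case False
            then have "\<bar>drift n z\<bar> \<le> b + 1" using elim(2) zy b(2)[of z] by force
            then have "\<bar>\<phi> y * drift n z\<bar> \<le> 3 * \<eta> * (b + 1)"
              unfolding abs_mult using \<phi>0[of y] zy \<eta> by (intro mult_mono) auto
            then show ?thesis by linarith
          qed
          then have "e\<^sup>2 * (- (3 * \<eta> * (b + 1))) \<le> e\<^sup>2 * (\<phi> y * drift n z)" by (intro mult_left_mono) auto
          then show ?thesis by (simp add: power2_eq_square mult_ac)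
        qed
        moreover have "e\<^sup>2 * (\<sigma>2 / 4 * of_bool (y \<le> \<eta>))
            \<le> of_bool (y \<le> \<eta>) / 2 * (e\<^sup>2 * (expectation (\<lambda>\<omega>. (increment n z \<omega>)\<^sup>2) - tail_sq n \<eta>))"
        proof (cases "y \<le> \<eta>")
          case True
          then have z5: "z \<in> {0..5}" using zy \<eta> by auto
          have "\<sigma>2 / 2 \<le> expectation (\<lambda>\<omega>. (increment n z \<omega>)\<^sup>2) - tail_sq n \<eta>"
            using elim(1) bspec[OF elim(3) z5] unfolding abs_less_iff by argo
          then have "e\<^sup>2 * (\<sigma>2 / 2) \<le> e\<^sup>2 * (expectation (\<lambda>\<omega>. (increment n z \<omega>)\<^sup>2) - tail_sq n \<eta>)"
            by (intro mult_left_mono) auto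
          then show ?thesis using True by simp
        qed simp
        moreover have "\<eta> * (e\<^sup>2 * expectation (\<lambda>\<omega>. (increment n z \<omega>)\<^sup>2)) \<le> \<eta> * (e\<^sup>2 * E2)"
          unfolding E2_def using \<eta> increment_sq_le[OF elim(4)] by (intro mult_left_mono) auto
        ultimately show ?thesis unfolding y_def[symmetric]
          by (simp only: right_diff_distrib distrib_left mult_minus_right mult_ac)
      qed
      have meas [measurable]: "{\<zeta> \<in> space (\<nu> n). snd \<zeta> \<le> \<eta>} \<in> sets (\<nu> n)" by measurable
      have i1: "integrable (\<nu> n) (\<lambda>\<zeta>. of_bool (snd \<zeta> \<le> \<eta>) :: real)"
        by (rule \<nu>.integrable_const_bound[where B = 1]) auto
      have "(\<integral>\<zeta>. e\<^sup>2 * (\<sigma>2 / 4 * of_bool (snd \<zeta> \<le> \<eta>) - \<eta> * (3 * (b + 1) + E2)) \<partial>\<nu> n) \<le> (\<integral>\<zeta>. mean_change n f \<zeta> \<partial>\<nu> n)"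
      proof (rule integral_mono_AE)
        show "AE \<zeta> in \<nu> n. e\<^sup>2 * (\<sigma>2 / 4 * of_bool (snd \<zeta> \<le> \<eta>) - \<eta> * (3 * (b + 1) + E2)) \<le> mean_change n f \<zeta>"
          using support[of n] by eventually_elim (use pw in auto)
      qed (use i1 mean_change_bounded(1)[OF f_meas f_bdd] in auto)
      also have "\<dots> = 0" by (rule mean_change_bounded(2)[OF f_meas f_bdd])
      also have "(\<integral>\<zeta>. e\<^sup>2 * (\<sigma>2 / 4 * of_bool (snd \<zeta> \<le> \<eta>) - \<eta> * (3 * (b + 1) + E2)) \<partial>\<nu> n)
          = e\<^sup>2 * (\<sigma>2 / 4 * measure (\<nu> n) {\<zeta> \<in> space (\<nu> n). snd \<zeta> \<le> \<eta>} - \<eta> * (3 * (b + 1) + E2))"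
      proof -
        have "(\<integral>\<zeta>. of_bool (snd \<zeta> \<le> \<eta>) \<partial>\<nu> n) = (\<integral>\<zeta>. indicat_real {\<zeta> \<in> space (\<nu> n). snd \<zeta> \<le> \<eta>} \<zeta> \<partial>\<nu> n)"
          by (intro Bochner_Integration.integral_cong) (auto simp: indicator_def)
        also have "\<dots> = measure (\<nu> n) ({\<zeta> \<in> space (\<nu> n). snd \<zeta> \<le> \<eta>} \<inter> space (\<nu> n))" by simp
        also have "\<dots> = measure (\<nu> n) {\<zeta> \<in> space (\<nu> n). snd \<zeta> \<le> \<eta>}"
          by (rule arg_cong[where f = "measure (\<nu> n)"]) auto
        finally show ?thesis using i1 by (simp add: \<nu>.prob_space)
      qed
      finally have "\<sigma>2 / 4 * measure (\<nu> n) {\<zeta> \<in> space (\<nu> n). snd \<zeta> \<le> \<eta>} \<le> \<eta> * (3 * (b + 1) + E2)"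
        using e by (simp add: mult_le_0_iff)
      then have "4 / \<sigma>2 * (\<sigma>2 / 4 * measure (\<nu> n) {\<zeta> \<in> space (\<nu> n). snd \<zeta> \<le> \<eta>}) \<le> 4 / \<sigma>2 * (\<eta> * (3 * (b + 1) + E2))"
        using variance_pos by (intro mult_left_mono) auto
      then show "measure (\<nu> n) {\<zeta> \<in> space (\<nu> n). snd \<zeta> \<le> \<eta>} \<le> C * \<eta>"
        using variance_pos by (simp add: C_def mult_ac)
    qed
  qed
  with C show ?thesis by (rule that)
qed

end

section \<open>The basic adjoint relation\<close>

lemma compact_support_bounded:
  fixes g :: "real \<Rightarrow> real"
  assumes "continuous_on UNIV g" "\<And>t. t \<le> a \<or> b \<le> t \<Longrightarrow> g t = 0"
  obtains C where "0 \<le> C" "\<And>t. \<bar>g t\<bar> \<le> C"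
proof -
  have "compact (g ` {a..b})"
    by (intro compact_continuous_image continuous_on_subset[OF assms(1)]) auto
  then obtain C where C: "\<And>t. t \<in> {a..b} \<Longrightarrow> \<bar>g t\<bar> \<le> C"
    using compact_imp_bounded bounded_real by (metis image_eqI)
  have "\<bar>g t\<bar> \<le> max 0 C" for t
  proof (cases "t \<in> {a..b}")
    case True then show ?thesis using C[OF True] by simp
  next
    case False then have "g t = 0" using assms(2)[of t] by auto
    then show ?thesis by simp
  qed
  then show ?thesis by (intro that[of "max 0 C"]) auto
qed

lemma compact_support_uniformly_continuous:
  fixes g :: "real \<Rightarrow> real"
  assumes "continuous_on UNIV g" "\<And>t. t \<le> a \<or> b \<le> t \<Longrightarrow> g t = 0" "0 < e"
  obtains \<delta> where "0 < \<delta>" "\<And>s t. \<bar>s - t\<bar> \<le> \<delta> \<Longrightarrow> \<bar>g s - g t\<bar> \<le> e"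
proof -
  have "uniformly_continuous_on {a - 1..b + 1} g"
    by (intro compact_uniformly_continuous continuous_on_subset[OF assms(1)]) auto
  then obtain \<delta> where \<delta>: "0 < \<delta>"
    "\<And>s t. s \<in> {a - 1..b + 1} \<Longrightarrow> t \<in> {a - 1..b + 1} \<Longrightarrow> dist t s < \<delta> \<Longrightarrow> dist (g t) (g s) < e"
    unfolding uniformly_continuous_on_def using assms(3) by metis
  show ?thesis
  proof (rule that)
    show "0 < min (\<delta> / 2) 1" using \<delta> by simp
    fix s t :: real assume st: "\<bar>s - t\<bar> \<le> min (\<delta> / 2) 1"
    show "\<bar>g s - g t\<bar> \<le> e"
    proof (cases "s \<in> {a - 1..b + 1} \<and> t \<in> {a - 1..b + 1}")
      case True
      then have "dist (g s) (g t) < e" using st \<delta>(1) by (intro \<delta>(2)) (auto simp: dist_real_def)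
      then show ?thesis by (simp add: dist_real_def)
    next
      case False
      then have "g s = 0" "g t = 0" using st by (auto intro!: assms(2))
      then show ?thesis using assms(3) by simp
    qed
  qed
qed

lemma Taylor2_bound:
  fixes f \<phi> \<phi>1 :: "real \<Rightarrow> real"
  assumes f: "\<And>t. (f has_real_derivative \<phi> t) (at t)" and \<phi>: "\<And>t. (\<phi> has_real_derivative \<phi>1 t) (at t)"
    and C1: "\<And>t. \<bar>\<phi>1 t\<bar> \<le> C1" and \<delta>: "\<And>s t. \<bar>s - t\<bar> \<le> \<delta> \<Longrightarrow> \<bar>\<phi>1 s - \<phi>1 t\<bar> \<le> e" and e: "0 \<le> e"
  shows "\<bar>f (y + x) - f y - \<phi> y * x - \<phi>1 y / 2 * x\<^sup>2\<bar> \<le> e / 2 * x\<^sup>2 + C1 * (x\<^sup>2 * of_bool (\<delta> < \<bar>x\<bar>))"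
proof (cases "x = 0")
  case False
  define diff where "diff m = (if m = 0 then f else if m = 1 then \<phi> else \<phi>1)" for m :: nat
  define lo where "lo = min y (y + x)"
  define hi where "hi = max y (y + x)"
  have "\<exists>t. (if y + x < y then y + x < t \<and> t < y else y < t \<and> t < y + x) \<and>
      f (y + x) = (\<Sum>m<2. diff m y / fact m * (y + x - y) ^ m) + diff 2 t / fact 2 * (y + x - y) ^ 2"
  proof (rule Taylor[where a = lo and b = hi])
    show "\<forall>m t. m < 2 \<and> lo \<le> t \<and> t \<le> hi \<longrightarrow> DERIV (diff m) t :> diff (Suc m) t"
    proof (intro allI impI)
      fix m t assume "m < (2::nat) \<and> lo \<le> t \<and> t \<le> hi"
      then have "m = 0 \<or> m = 1" by auto
      then show "DERIV (diff m) t :> diff (Suc m) t" using f \<phi> by (auto simp: diff_def)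
    qed
  qed (use False in \<open>auto simp: diff_def lo_def hi_def\<close>)
  then obtain t where t: "if y + x < y then y + x < t \<and> t < y else y < t \<and> t < y + x"
    and eq: "f (y + x) = f y + \<phi> y * x + \<phi>1 t / 2 * x\<^sup>2"
    by (auto simp: diff_def numeral_2_eq_2)
  have ty: "\<bar>t - y\<bar> \<le> \<bar>x\<bar>" using t by (auto split: if_splits)
  have "\<bar>f (y + x) - f y - \<phi> y * x - \<phi>1 y / 2 * x\<^sup>2\<bar> = \<bar>\<phi>1 t - \<phi>1 y\<bar> / 2 * x\<^sup>2"
  proof -
    have "f (y + x) - f y - \<phi> y * x - \<phi>1 y / 2 * x\<^sup>2 = (\<phi>1 t - \<phi>1 y) / 2 * x\<^sup>2"
      unfolding eq by (simp add: field_simps)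
    then show ?thesis by (simp only: abs_mult abs_divide abs_numeral abs_power2)
  qed
  also have "\<dots> \<le> (e + 2 * C1 * of_bool (\<delta> < \<bar>x\<bar>)) / 2 * x\<^sup>2"
  proof (intro mult_right_mono divide_right_mono)
    show "\<bar>\<phi>1 t - \<phi>1 y\<bar> \<le> e + 2 * C1 * of_bool (\<delta> < \<bar>x\<bar>)"
    proof (cases "\<delta> < \<bar>x\<bar>")
      case True
      have "\<bar>\<phi>1 t - \<phi>1 y\<bar> \<le> C1 + C1" using C1[of t] C1[of y] by linarith
      then show ?thesis using True e by simp
    next
      case F: False
      then have "\<bar>\<phi>1 t - \<phi>1 y\<bar> \<le> e" using ty by (intro \<delta>) simp
      then show ?thesis using F by simp
    qed
  qed auto
  also have "\<dots> = e / 2 * x\<^sup>2 + C1 * (x\<^sup>2 * of_bool (\<delta> < \<bar>x\<bar>))" by (simp add: field_simps)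
  finally show ?thesis .
qed simp

context found_chains
begin

lemma batch_integral:
  assumes "\<rho> n \<le> 2"
  shows "integrable (\<nu> n) (\<lambda>\<zeta>. snd \<zeta> - fst \<zeta>)"
    and "(\<integral>\<zeta>. snd \<zeta> - fst \<zeta> \<partial>\<nu> n) \<le> 2 * \<epsilon> n / (1 - prob {\<omega> \<in> space M. U \<omega> = 0})"
proof -
  have nn: "AE \<zeta> in \<nu> n. 0 \<le> snd \<zeta> - fst \<zeta>" using support[of n] by eventually_elim simp
  show i: "integrable (\<nu> n) (\<lambda>\<zeta>. snd \<zeta> - fst \<zeta>)"
  proof (rule integrableI_nonneg[OF _ nn])
    show "(\<integral>\<^sup>+\<zeta>. ennreal (snd \<zeta> - fst \<zeta>) \<partial>\<nu> n) < \<infinity>"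
      using batch_bound[OF assms] by (rule order.strict_trans1) simp
  qed measurable
  have "ennreal (\<integral>\<zeta>. snd \<zeta> - fst \<zeta> \<partial>\<nu> n) \<le> ennreal (2 * \<epsilon> n / (1 - prob {\<omega> \<in> space M. U \<omega> = 0}))"
    using batch_bound[OF assms] nn_integral_eq_integral[OF i nn] by simp
  moreover have "0 \<le> 2 * \<epsilon> n / (1 - prob {\<omega> \<in> space M. U \<omega> = 0})"
    using \<epsilon>_pos[of n] prob_U0_less_1 by simp
  ultimately show "(\<integral>\<zeta>. snd \<zeta> - fst \<zeta> \<partial>\<nu> n) \<le> 2 * \<epsilon> n / (1 - prob {\<omega> \<in> space M. U \<omega> = 0})"
    by (simp add: ennreal_le_iff)
qed

text \<open>A function that vanishes on the negative half-line does not notice the reflection.\<close>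

lemma mean_change_Taylor:
  fixes f \<phi> \<phi>1 :: "real \<Rightarrow> real"
  assumes f: "\<And>t. (f has_real_derivative \<phi> t) (at t)" and \<phi>: "\<And>t. (\<phi> has_real_derivative \<phi>1 t) (at t)"
    and f0: "\<And>t. t \<le> 0 \<Longrightarrow> f t = 0" and f_bdd: "\<And>t. \<bar>f t\<bar> \<le> C"
    and C1: "\<And>t. \<bar>\<phi>1 t\<bar> \<le> C1" and \<delta>: "\<And>s t. \<bar>s - t\<bar> \<le> \<delta> \<Longrightarrow> \<bar>\<phi>1 s - \<phi>1 t\<bar> \<le> e" and e: "0 \<le> e"
    and n: "\<rho> n \<le> 2"
  shows "\<bar>mean_change n f \<zeta> / (\<epsilon> n)\<^sup>2 - (\<phi> (snd \<zeta>) * drift n (fst \<zeta>)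
      + \<phi>1 (snd \<zeta>) / 2 * expectation (\<lambda>\<omega>. (increment n (fst \<zeta>) \<omega>)\<^sup>2))\<bar>
    \<le> e / 2 * expectation (\<lambda>\<omega>. (envelope \<omega>)\<^sup>2) + C1 * tail_sq n \<delta>"
proof -
  define h where "h = \<epsilon> n"
  have h: "0 < h" using \<epsilon>_pos by (simp add: h_def)
  define y where "y = snd \<zeta>"
  define X where "X = increment n (fst \<zeta>)"
  have C10: "0 \<le> C1" using C1[of 0] by simp
  have fm [measurable]: "f \<in> borel_measurable borel"
    by (intro borel_measurable_continuous_onI continuous_at_imp_continuous_on ballI DERIV_isCont[OF f])
  have i1: "integrable M (\<lambda>\<omega>. f (snd (step n \<zeta> \<omega>)) - f (snd \<zeta>))"
    by (rule mean_change_bounded(3)[OF fm f_bdd])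
  have step: "f (snd (step n \<zeta> \<omega>)) = f (y + h * X \<omega>)" for \<omega>
    using f0 by (cases "y + h * X \<omega> \<le> 0") (auto simp: snd_step y_def h_def X_def)
  have iX: "integrable M X" "integrable M (\<lambda>\<omega>. (X \<omega>)\<^sup>2)"
    unfolding X_def by (rule increment_integrable increment_sq(1))+
  define R where "R \<omega> = f (snd (step n \<zeta> \<omega>)) - f (snd \<zeta>) - \<phi> y * (h * X \<omega>) - \<phi>1 y / 2 * (h\<^sup>2 * (X \<omega>)\<^sup>2)" for \<omega>
  have iR: "integrable M R" unfolding R_def using i1 iX by simp
  have ER: "expectation R = mean_change n f \<zeta> - h\<^sup>2 * (\<phi> y * drift n (fst \<zeta>)
      + \<phi>1 y / 2 * expectation (\<lambda>\<omega>. (X \<omega>)\<^sup>2))"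
  proof -
    define F where "F \<omega> = f (snd (step n \<zeta> \<omega>)) - f (snd \<zeta>)" for \<omega>
    have iF: "integrable M F" unfolding F_def by (rule i1)
    define dr where "dr = drift n (fst \<zeta>)"
    have EX: "expectation X = h * dr" unfolding X_def h_def dr_def by (rule expectation_increment)
    have "expectation R = expectation F - \<phi> y * (h * expectation X) - \<phi>1 y / 2 * (h\<^sup>2 * expectation (\<lambda>\<omega>. (X \<omega>)\<^sup>2))"
      unfolding R_def F_def[symmetric] using iF iX by simp
    also have "expectation F = mean_change n f \<zeta>" by (simp add: F_def[abs_def] mean_change_def)
    finally show ?thesis unfolding EX dr_def[symmetric] by (simp add: power2_eq_square algebra_simps)
  qed
  have le: "AE \<omega> in M. \<bar>R \<omega>\<bar> \<le> h\<^sup>2 * (e / 2 * (envelope \<omega>)\<^sup>2 + C1 * ((envelope \<omega>)\<^sup>2 * of_bool (\<delta> < h * envelope \<omega>)))"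
    using increment_le_envelope[OF n, of "fst \<zeta>"]
  proof eventually_elim
    case (elim \<omega>)
    define x where "x = h * X \<omega>"
    have "\<bar>R \<omega>\<bar> \<le> e / 2 * x\<^sup>2 + C1 * (x\<^sup>2 * of_bool (\<delta> < \<bar>x\<bar>))"
    proof -
      have "R \<omega> = f (y + x) - f y - \<phi> y * x - \<phi>1 y / 2 * x\<^sup>2"
        unfolding R_def step y_def[symmetric] x_def power_mult_distrib ..
      then show ?thesis
        by (simp only:) (rule Taylor2_bound[OF f \<phi>, where \<delta> = \<delta>], rule C1, rule \<delta>, assumption, rule e)
    qed
    also have "\<dots> \<le> e / 2 * (h\<^sup>2 * (envelope \<omega>)\<^sup>2) + C1 * ((h\<^sup>2 * (envelope \<omega>)\<^sup>2) * of_bool (\<delta> < h * envelope \<omega>))"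
    proof -
      have "\<bar>x\<bar> \<le> h * envelope \<omega>" unfolding x_def abs_mult using elim h by (intro mult_mono) (auto simp: X_def)
      moreover have "x\<^sup>2 \<le> h\<^sup>2 * (envelope \<omega>)\<^sup>2"
        unfolding power_mult_distrib[symmetric] using \<open>\<bar>x\<bar> \<le> h * envelope \<omega>\<close>
        by (metis abs_le_square_iff abs_ge_self order_trans)
      ultimately show ?thesis
        using e C10 by (intro add_mono mult_left_mono mult_mono) auto
    qed
    also have "\<dots> = h\<^sup>2 * (e / 2 * (envelope \<omega>)\<^sup>2 + C1 * ((envelope \<omega>)\<^sup>2 * of_bool (\<delta> < h * envelope \<omega>)))"
      by (simp add: algebra_simps)
    finally show ?case .
  qed
  have ti: "integrable M (\<lambda>\<omega>. (envelope \<omega>)\<^sup>2 * of_bool (\<delta> < h * envelope \<omega>))"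
    unfolding h_def by (rule tail_sq_integrable)
  have "\<bar>expectation R\<bar> \<le> expectation (\<lambda>\<omega>. \<bar>R \<omega>\<bar>)" by (rule integral_abs_bound)
  also have "\<dots> \<le> expectation (\<lambda>\<omega>. h\<^sup>2 * (e / 2 * (envelope \<omega>)\<^sup>2 + C1 * ((envelope \<omega>)\<^sup>2 * of_bool (\<delta> < h * envelope \<omega>))))"
    by (rule integral_mono_AE[OF _ _ le]) (use iR ti envelope_sq_integrable in auto)
  also have "\<dots> = h\<^sup>2 * (e / 2 * expectation (\<lambda>\<omega>. (envelope \<omega>)\<^sup>2) + C1 * tail_sq n \<delta>)"
    using ti envelope_sq_integrable by (simp add: tail_sq_def h_def)
  finally have "\<bar>expectation R\<bar> / h\<^sup>2 \<le> e / 2 * expectation (\<lambda>\<omega>. (envelope \<omega>)\<^sup>2) + C1 * tail_sq n \<delta>"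
    using h by (simp add: pos_divide_le_eq mult.commute)
  moreover have "expectation R / h\<^sup>2 = mean_change n f \<zeta> / h\<^sup>2 - (\<phi> y * drift n (fst \<zeta>)
      + \<phi>1 y / 2 * expectation (\<lambda>\<omega>. (X \<omega>)\<^sup>2))"
    using h unfolding ER by (simp add: diff_divide_distrib)
  moreover have "\<bar>expectation R\<bar> / h\<^sup>2 = \<bar>expectation R / h\<^sup>2\<bar>" by (simp add: abs_divide)
  ultimately show ?thesis by (simp only: h_def y_def X_def)
qed

text \<open>The stationary equation of the chain becomes, in the limit, the basic adjoint relation
  \<open>E (B f' + \<sigma>2 / 2 * f'') = 0\<close> of the reflected diffusion.\<close>

lemma generator_limit:
  fixes f \<phi> \<phi>1 :: "real \<Rightarrow> real"
  assumes f: "\<And>t. (f has_real_derivative \<phi> t) (at t)" and \<phi>: "\<And>t. (\<phi> has_real_derivative \<phi>1 t) (at t)"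
    and cont: "continuous_on UNIV \<phi>1" and a: "0 < a" "a < b"
    and f0: "\<And>t. t \<le> a \<Longrightarrow> f t = 0"
    and \<phi>_supp: "\<And>t. t \<le> a \<or> b \<le> t \<Longrightarrow> \<phi> t = 0" and \<phi>1_supp: "\<And>t. t \<le> a \<or> b \<le> t \<Longrightarrow> \<phi>1 t = 0"
  shows "(\<lambda>n. \<integral>\<zeta>. \<phi> (snd \<zeta>) * B (snd \<zeta>) + \<phi>1 (snd \<zeta>) / 2 * \<sigma>2 \<partial>\<nu> n) \<longlonglongrightarrow> 0"
proof -
  have f_cont: "continuous_on S f" for S
    by (intro continuous_at_imp_continuous_on ballI DERIV_isCont[OF f])
  have \<phi>_cont: "continuous_on UNIV \<phi>"
    by (intro continuous_at_imp_continuous_on ballI DERIV_isCont[OF \<phi>])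
  obtain Cf where Cf: "\<And>t. \<bar>f t\<bar> \<le> Cf"
  proof -
    have const: "f t = f b" if bt: "b \<le> t" for t
    proof (cases "t = b")
      case False
      then have "b < t" using bt by simp
      then obtain s where "b < s" "f t - f b = (t - b) * \<phi> s"
        using MVT2[of b t f \<phi>] f by blast
      then show ?thesis using \<phi>_supp[of s] by simp
    qed simp
    have "compact (f ` {a..b})" by (intro compact_continuous_image f_cont) auto
    then obtain C where C: "\<And>t. t \<in> {a..b} \<Longrightarrow> \<bar>f t\<bar> \<le> C"
      using compact_imp_bounded bounded_real by (metis image_eqI)
    have "\<bar>f t\<bar> \<le> C" for t
    proof -
      consider "t \<le> a" | "t \<in> {a..b}" | "b \<le> t" by fastforce
      then show ?thesis
      proof cases
        case 1 then show ?thesis using f0[of t] f0[of a] C[of a] a by simp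
      next
        case 3 then show ?thesis using const[of t] C[of b] a by simp
      qed (rule C)
    qed
    then show ?thesis by (rule that)
  qed
  obtain C0 where C0: "0 \<le> C0" "\<And>t. \<bar>\<phi> t\<bar> \<le> C0" using compact_support_bounded[OF \<phi>_cont \<phi>_supp] by blast
  obtain C1 where C1: "0 \<le> C1" "\<And>t. \<bar>\<phi>1 t\<bar> \<le> C1" using compact_support_bounded[OF cont \<phi>1_supp] by blast
  obtain L where L: "0 \<le> L" "\<And>y z. y \<in> {0..b} \<Longrightarrow> z \<in> {0..b} \<Longrightarrow> \<bar>B y - B z\<bar> \<le> L * \<bar>y - z\<bar>"
    using B_Lipschitz[of b] by blast
  define E2 where "E2 = expectation (\<lambda>\<omega>. (envelope \<omega>)\<^sup>2)"
  have E2: "0 \<le> E2" unfolding E2_def by (rule Bochner_Integration.integral_nonneg) simp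
  define q where "q = prob {\<omega> \<in> space M. U \<omega> = 0}"
  define H where "H \<zeta> = \<phi> (snd \<zeta>) * B (snd \<zeta>) + \<phi>1 (snd \<zeta>) / 2 * \<sigma>2" for \<zeta> :: "real \<times> real"
  have [measurable]: "\<phi> \<in> borel_measurable borel" "\<phi>1 \<in> borel_measurable borel" "B \<in> borel_measurable borel"
      "f \<in> borel_measurable borel"
    using \<phi>_cont cont B_continuous f_cont[of UNIV] by (auto intro: borel_measurable_continuous_onI)
  have iH: "integrable (\<nu> n) H" for n
  proof -
    have c: "continuous_on UNIV (\<lambda>t. \<phi> t * B t)" by (intro continuous_intros \<phi>_cont B_continuous)
    have z: "\<phi> t * B t = 0" if "t \<le> a \<or> b \<le> t" for t using \<phi>_supp[OF that] by simp
    obtain C2 where C2: "\<And>t. \<bar>\<phi> t * B t\<bar> \<le> C2" using compact_support_bounded[OF c z] by blast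
    have "integrable (\<nu> n) (\<lambda>\<zeta>. \<phi> (snd \<zeta>) * B (snd \<zeta>))"
      by (rule \<nu>.integrable_const_bound[where B = C2]) (use C2 in auto)
    moreover have "integrable (\<nu> n) (\<lambda>\<zeta>. \<phi>1 (snd \<zeta>))"
      by (rule \<nu>.integrable_const_bound[where B = C1]) (use C1 in auto)
    ultimately show ?thesis unfolding H_def by simp
  qed
  have main: "\<forall>\<^sub>F n in sequentially. \<bar>\<integral>\<zeta>. H \<zeta> \<partial>\<nu> n\<bar>
      \<le> e * (E2 / 2 + C0 + C1 / 2) + C1 * tail_sq n \<delta> + C0 * L * (2 * \<epsilon> n / (1 - q))"
    if e: "0 < e" and \<delta>: "\<And>s t. \<bar>s - t\<bar> \<le> \<delta> \<Longrightarrow> \<bar>\<phi>1 s - \<phi>1 t\<bar> \<le> e" for e \<delta>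
  proof -
    have "\<forall>\<^sub>F n in sequentially. \<forall>z\<in>{0..b}. \<bar>drift n z - B z\<bar> < e" using a e by (intro drift_lim) auto
    moreover have "\<forall>\<^sub>F n in sequentially. \<forall>z\<in>{0..b}. \<bar>expectation (\<lambda>\<omega>. (increment n z \<omega>)\<^sup>2) - \<sigma>2\<bar> < e"
      using a e by (intro increment_sq_lim) auto
    ultimately show ?thesis using \<rho>_le_2
    proof eventually_elim
      case (elim n)
      define R0 where "R0 = e * (E2 / 2 + C0 + C1 / 2) + C1 * tail_sq n \<delta>"
      have pw: "\<bar>H \<zeta> - mean_change n f \<zeta> / (\<epsilon> n)\<^sup>2\<bar> \<le> R0 + C0 * L * (snd \<zeta> - fst \<zeta>)"
        if \<zeta>: "0 \<le> fst \<zeta>" "fst \<zeta> \<le> snd \<zeta>" for \<zeta>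
      proof -
        define y where "y = snd \<zeta>"
        define z where "z = fst \<zeta>"
        define S where "S = expectation (\<lambda>\<omega>. (increment n z \<omega>)\<^sup>2)"
        have T: "\<bar>mean_change n f \<zeta> / (\<epsilon> n)\<^sup>2 - (\<phi> y * drift n z + \<phi>1 y / 2 * S)\<bar> \<le> e / 2 * E2 + C1 * tail_sq n \<delta>"
          unfolding y_def z_def S_def E2_def
          by (rule mean_change_Taylor[OF f \<phi> _ Cf C1(2) \<delta> _ elim(3)]) (use f0 a e in auto)
        have "\<bar>\<phi> y * (drift n z - B y)\<bar> \<le> C0 * (e + L * (y - z))"
        proof (cases "b \<le> y")
          case True
          then show ?thesis using \<phi>_supp[of y] C0 e L \<zeta> by (simp add: y_def z_def)
        next
          case False
          then have zb: "z \<in> {0..b}" "y \<in> {0..b}" using \<zeta> by (auto simp: y_def z_def)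
          have "\<bar>drift n z - B z\<bar> < e" using elim(1) zb by blast
          moreover have "\<bar>B y - B z\<bar> \<le> L * (y - z)" using L(2)[OF zb(2,1)] \<zeta> by (simp add: y_def z_def)
          ultimately have "\<bar>drift n z - B y\<bar> \<le> e + L * (y - z)" by linarith
          then show ?thesis unfolding abs_mult using C0 by (intro mult_mono) auto
        qed
        moreover have "\<bar>\<phi>1 y / 2 * (S - \<sigma>2)\<bar> \<le> C1 / 2 * e"
        proof (cases "b \<le> y")
          case True
          then show ?thesis using \<phi>1_supp[of y] C1 e by simp
        next
          case False
          then have "z \<in> {0..b}" using \<zeta> by (auto simp: y_def z_def)
          then have "\<bar>S - \<sigma>2\<bar> \<le> e" using elim(2) unfolding S_def by (intro less_imp_le) blast
          then show ?thesis unfolding abs_mult using C1(2)[of y] C1(1) by (intro mult_mono) (simp_all add: abs_divide)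
        qed
        moreover have "H \<zeta> - mean_change n f \<zeta> / (\<epsilon> n)\<^sup>2
            = - (mean_change n f \<zeta> / (\<epsilon> n)\<^sup>2 - (\<phi> y * drift n z + \<phi>1 y / 2 * S))
              - \<phi> y * (drift n z - B y) - \<phi>1 y / 2 * (S - \<sigma>2)"
          unfolding H_def y_def[symmetric] by (simp only: right_diff_distrib)
        ultimately have "\<bar>H \<zeta> - mean_change n f \<zeta> / (\<epsilon> n)\<^sup>2\<bar>
            \<le> (e / 2 * E2 + C1 * tail_sq n \<delta>) + C0 * (e + L * (y - z)) + C1 / 2 * e"
          using T by linarith
        also have "\<dots> = R0 + C0 * L * (y - z)" by (simp add: R0_def algebra_simps)
        finally show ?thesis by (simp add: y_def z_def)
      qed
      have im: "integrable (\<nu> n) (mean_change n f)" and zm: "(\<integral>\<zeta>. mean_change n f \<zeta> \<partial>\<nu> n) = 0"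
        using mean_change_bounded[of f Cf n] Cf by auto
      have "(\<integral>\<zeta>. H \<zeta> \<partial>\<nu> n) = (\<integral>\<zeta>. H \<zeta> - mean_change n f \<zeta> / (\<epsilon> n)\<^sup>2 \<partial>\<nu> n)"
        using iH im zm by simp
      also have "\<bar>\<dots>\<bar> \<le> (\<integral>\<zeta>. \<bar>H \<zeta> - mean_change n f \<zeta> / (\<epsilon> n)\<^sup>2\<bar> \<partial>\<nu> n)" by (rule integral_abs_bound)
      also have "\<dots> \<le> (\<integral>\<zeta>. R0 + C0 * L * (snd \<zeta> - fst \<zeta>) \<partial>\<nu> n)"
      proof (rule integral_mono_AE)
        show "AE \<zeta> in \<nu> n. \<bar>H \<zeta> - mean_change n f \<zeta> / (\<epsilon> n)\<^sup>2\<bar> \<le> R0 + C0 * L * (snd \<zeta> - fst \<zeta>)"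
          using support[of n] by eventually_elim (rule pw; simp)
        show "integrable (\<nu> n) (\<lambda>\<zeta>. R0 + C0 * L * (snd \<zeta> - fst \<zeta>))"
          using batch_integral(1)[OF elim(3)] by simp
      qed (use iH im in simp)
      also have "\<dots> = R0 + C0 * L * (\<integral>\<zeta>. snd \<zeta> - fst \<zeta> \<partial>\<nu> n)"
        using batch_integral(1)[OF elim(3)] by (subst Bochner_Integration.integral_add) (simp_all add: \<nu>.prob_space)
      also have "\<dots> \<le> R0 + C0 * L * (2 * \<epsilon> n / (1 - q))"
        unfolding q_def using C0 L batch_integral(2)[OF elim(3)] by (intro add_left_mono mult_left_mono) auto
      finally show ?case by (simp only: R0_def)
    qed
  qed
  show ?thesis
    unfolding H_def[symmetric]
  proof (rule LIMSEQ_I)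
    fix r :: real assume r: "0 < r"
    define K where "K = E2 / 2 + C0 + C1 / 2"
    have K: "0 \<le> K" using E2 C0 C1 by (simp add: K_def)
    define e where "e = r / (2 * (K + 1))"
    have e: "0 < e" "e * K \<le> r / 2" using r K by (auto simp: e_def field_simps)
    obtain \<delta> where \<delta>: "0 < \<delta>" "\<And>s t. \<bar>s - t\<bar> \<le> \<delta> \<Longrightarrow> \<bar>\<phi>1 s - \<phi>1 t\<bar> \<le> e"
      using compact_support_uniformly_continuous[OF cont \<phi>1_supp e(1)] by blast
    have "(\<lambda>n. C1 * tail_sq n \<delta> + C0 * L * (2 * \<epsilon> n / (1 - q))) \<longlonglongrightarrow> C1 * 0 + C0 * L * (2 * 0 / (1 - q))"
      using prob_U0_less_1 by (intro tendsto_intros tail_sq_lim \<delta> \<epsilon>_lim) (auto simp: q_def)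
    then have "\<forall>\<^sub>F n in sequentially. C1 * tail_sq n \<delta> + C0 * L * (2 * \<epsilon> n / (1 - q)) < r / 2"
      using r by (intro order_tendstoD) auto
    moreover have "\<forall>\<^sub>F n in sequentially. \<bar>\<integral>\<zeta>. H \<zeta> \<partial>\<nu> n\<bar>
        \<le> e * K + C1 * tail_sq n \<delta> + C0 * L * (2 * \<epsilon> n / (1 - q))"
      unfolding K_def by (rule main[OF e(1) \<delta>(2)])
    ultimately have "\<forall>\<^sub>F n in sequentially. norm ((\<integral>\<zeta>. H \<zeta> \<partial>\<nu> n) - 0) < r"
    proof eventually_elim
      case (elim n)
      then have "\<bar>\<integral>\<zeta>. H \<zeta> \<partial>\<nu> n\<bar> < r" using e(2) by linarith
      then show ?case by simp
    qed
    then show "\<exists>no. \<forall>n\<ge>no. norm ((\<integral>\<zeta>. H \<zeta> \<partial>\<nu> n) - 0) < r" by (simp add: eventually_sequentially)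
  qed
qed

end

text \<open>The integral from 0 is differentiable on the whole line because the integrand vanishes to the left
  of \<open>a > 0\<close>.\<close>

lemma antiderivative_from_support:
  fixes g :: "real \<Rightarrow> real"
  assumes g: "continuous_on UNIV g" and a: "0 < a" "\<And>t. t \<le> a \<Longrightarrow> g t = 0"
  defines "G \<equiv> \<lambda>t. integral {0..t} g"
  shows "(G has_real_derivative g t) (at t)" and "t \<le> a \<Longrightarrow> G t = 0"
proof -
  show G0: "G t = 0" if "t \<le> a" for t
  proof -
    have "G t = integral {0..t} (\<lambda>_. 0)" unfolding G_def by (rule integral_cong) (use that a in auto)
    then show ?thesis by simp
  qed
  show "(G has_real_derivative g t) (at t)"
  proof (cases "0 < t")
    case True
    have "(G has_real_derivative g t) (at t within {0..t + 1})"
      unfolding G_def by (rule integral_has_real_derivative) (use True in \<open>auto intro: continuous_on_subset[OF g]\<close>)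
    moreover have "at t within {0..t + 1} = at t" using True by (intro at_within_interior) auto
    ultimately show ?thesis by simp
  next
    case False
    have "((\<lambda>_. 0) has_real_derivative 0) (at t)" by simp
    then have "(G has_real_derivative 0) (at t)"
      by (rule has_field_derivative_transform_within_open[where S = "{..<a}"]) (use False a G0 in auto)
    then show ?thesis using False a by simp
  qed
qed

context found_chains
begin

text \<open>Solve \<open>B \<phi> + \<sigma>2 / 2 \<phi>' = \<sigma>2 / 2 k\<close> by \<open>\<phi> = exp (- \<beta>) \<integral> k exp \<beta>\<close>.  The condition \<open>zero\<close> makes \<open>\<phi>\<close>
  vanish beyond \<open>b\<close>, so that its antiderivative \<open>f\<close> is an admissible test function.\<close>

lemma test_function_limit:
  fixes k \<beta> :: "real \<Rightarrow> real"
  assumes k: "continuous_on UNIV k" and a: "0 < a" "a < b" and supp: "\<And>t. t \<le> a \<or> b \<le> t \<Longrightarrow> k t = 0"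
    and \<beta>: "\<And>t. 0 < t \<Longrightarrow> (\<beta> has_real_derivative 2 / \<sigma>2 * B t) (at t)"
    and zero: "integral {a..b} (\<lambda>t. k t * exp (\<beta> t)) = 0"
  shows "(\<lambda>n. \<integral>\<zeta>. k (snd \<zeta>) \<partial>\<nu> n) \<longlonglongrightarrow> 0"
proof -
  define w where "w t = k t * exp (\<beta> t)" for t
  have \<beta>c: "continuous_on {0<..} \<beta>"
    by (intro continuous_at_imp_continuous_on ballI DERIV_isCont[OF \<beta>]) auto
  have "continuous_on ({..<a} \<union> {0<..}) w"
  proof (rule continuous_on_open_Un)
    show "continuous_on {..<a} w"
      by (rule continuous_on_eq[of _ "\<lambda>_. 0"]) (auto simp: w_def supp)
    show "continuous_on {0<..} w"
      unfolding w_def by (intro continuous_intros \<beta>c continuous_on_subset[OF k]) auto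
  qed auto
  moreover have "{..<a} \<union> {0<..} = (UNIV :: real set)" using a by auto
  ultimately have w: "continuous_on UNIV w" by simp
  have wa: "w t = 0" if "t \<le> a" for t using that supp by (simp add: w_def)
  define I where "I t = integral {0..t} w" for t
  have I: "(I has_real_derivative w t) (at t)" for t
    unfolding I_def by (rule antiderivative_from_support(1)[OF w a(1) wa])
  have Ia: "I t = 0" if "t \<le> a" for t
    unfolding I_def by (rule antiderivative_from_support(2)[OF w a(1) wa that])
  have Ib: "I t = 0" if "b \<le> t" for t
  proof -
    have wi: "w integrable_on {s..u}" for s u
      by (intro integrable_continuous_real continuous_on_subset[OF w]) auto
    have 1: "I t = integral {0..a} w + integral {a..t} w"
      unfolding I_def using a that wi by (intro Henstock_Kurzweil_Integration.integral_combine[symmetric]) auto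
    have 2: "integral {a..t} w = integral {a..b} w + integral {b..t} w"
      using a that wi by (intro Henstock_Kurzweil_Integration.integral_combine[symmetric]) auto
    have "integral {b..t} w = integral {b..t} (\<lambda>_. 0)" by (rule integral_cong) (auto simp: w_def supp)
    moreover have "integral {a..b} w = 0" using zero by (simp add: w_def[abs_def])
    ultimately show ?thesis using 1 2 Ia[of a] by (simp add: I_def)
  qed
  define \<phi> where "\<phi> t = exp (- \<beta> t) * I t" for t
  define \<phi>1 where "\<phi>1 t = k t - 2 / \<sigma>2 * B t * \<phi> t" for t
  have \<phi>0: "\<phi> t = 0" if "t \<le> a \<or> b \<le> t" for t using that Ia Ib by (auto simp: \<phi>_def)
  have d\<phi>: "(\<phi> has_real_derivative \<phi>1 t) (at t)" for t
  proof (cases "0 < t")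
    case True
    have "((\<lambda>t. exp (- \<beta> t) * I t) has_real_derivative
        (exp (- \<beta> t) * (- (2 / \<sigma>2 * B t))) * I t + w t * exp (- \<beta> t)) (at t)"
      by (rule DERIV_mult[OF DERIV_fun_exp[OF DERIV_minus[OF \<beta>[OF True]]] I])
    moreover have "(exp (- \<beta> t) * (- (2 / \<sigma>2 * B t))) * I t + w t * exp (- \<beta> t) = \<phi>1 t"
      by (simp add: \<phi>1_def \<phi>_def w_def exp_minus field_simps)
    ultimately show ?thesis by (simp add: \<phi>_def[abs_def])
  next
    case False
    have "((\<lambda>_. 0) has_real_derivative 0) (at t)" by simp
    then have "(\<phi> has_real_derivative 0) (at t)"
      by (rule has_field_derivative_transform_within_open[where S = "{..<a}"]) (use False a \<phi>0 in auto)
    moreover have "\<phi>1 t = 0" using False a supp[of t] \<phi>0[of t] by (simp add: \<phi>1_def)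
    ultimately show ?thesis by simp
  qed
  have \<phi>c: "continuous_on UNIV \<phi>"
    by (intro continuous_at_imp_continuous_on ballI DERIV_isCont[OF d\<phi>])
  have \<phi>1c: "continuous_on UNIV \<phi>1"
    unfolding \<phi>1_def by (intro continuous_intros k B_continuous \<phi>c)
  define f where "f t = integral {0..t} \<phi>" for t
  have df: "(f has_real_derivative \<phi> t) (at t)" for t
    unfolding f_def by (rule antiderivative_from_support(1)[OF \<phi>c a(1)]) (simp add: \<phi>0)
  have fa: "f t = 0" if "t \<le> a" for t
    unfolding f_def by (rule antiderivative_from_support(2)[OF \<phi>c a(1) _ that]) (simp add: \<phi>0)
  have l: "(\<lambda>n. \<integral>\<zeta>. \<phi> (snd \<zeta>) * B (snd \<zeta>) + \<phi>1 (snd \<zeta>) / 2 * \<sigma>2 \<partial>\<nu> n) \<longlonglongrightarrow> 0"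
    by (rule generator_limit[OF df d\<phi> \<phi>1c a fa \<phi>0]) (auto simp: \<phi>1_def supp \<phi>0)
  have eq: "\<phi> t * B t + \<phi>1 t / 2 * \<sigma>2 = \<sigma>2 / 2 * k t" for t
  proof -
    have alg: "p * b + (c - 2 / v * b * p) / 2 * v = v / 2 * c" if "0 < v" for p b c v :: real
      using that by (simp add: field_simps)
    show ?thesis unfolding \<phi>1_def by (rule alg[OF variance_pos])
  qed
  have "(\<lambda>n. \<sigma>2 / 2 * (\<integral>\<zeta>. k (snd \<zeta>) \<partial>\<nu> n)) \<longlonglongrightarrow> 0"
    using l unfolding eq by (simp only: integral_mult_right_zero)
  then have "(\<lambda>n. 2 / \<sigma>2 * (\<sigma>2 / 2 * (\<integral>\<zeta>. k (snd \<zeta>) \<partial>\<nu> n))) \<longlonglongrightarrow> 2 / \<sigma>2 * 0" by (intro tendsto_mult_left)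
  then show ?thesis using variance_pos by simp
qed

end

section \<open>Convergence of the found work\<close>

text \<open>A continuous cutoff, equal to 1 on \<open>[2 / j, j]\<close> and supported in \<open>[1 / j, j + 1]\<close>.\<close>

definition trapezoid :: "nat \<Rightarrow> real \<Rightarrow> real" where
  "trapezoid j t = max 0 (min 1 (min (real j * t - 1) (real j + 1 - t)))"

lemma trapezoid_bounds: "0 \<le> trapezoid j t" "trapezoid j t \<le> 1"
  by (auto simp: trapezoid_def)

lemma trapezoid_continuous: "continuous_on S (trapezoid j)"
  unfolding trapezoid_def by (intro continuous_intros)

lemma trapezoid_measurable [measurable]: "trapezoid j \<in> borel_measurable borel"
  by (intro borel_measurable_continuous_onI trapezoid_continuous)

lemma trapezoid_eq_0:
  assumes "0 < j" "t \<le> 1 / real j \<or> real j + 1 \<le> t"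
  shows "trapezoid j t = 0"
proof -
  have "real j * t \<le> 1 \<or> real j + 1 \<le> t" using assms by (auto simp: field_simps)
  then show ?thesis by (auto simp: trapezoid_def)
qed

lemma trapezoid_eq_1:
  assumes "0 < j" "2 / real j \<le> t" "t \<le> real j"
  shows "trapezoid j t = 1"
proof -
  have "2 \<le> real j * t" using assms by (simp add: field_simps)
  then show ?thesis using assms by (simp add: trapezoid_def)
qed

lemma trapezoid_lim:
  assumes "0 < t"
  shows "(\<lambda>j. trapezoid j t) \<longlonglongrightarrow> 1"
proof (rule tendsto_eventually)
  have "(\<lambda>j. 2 / real j) \<longlonglongrightarrow> 0" by (rule lim_const_over_n)
  then have "\<forall>\<^sub>F j in sequentially. 2 / real j < t" using assms by (rule order_tendstoD)
  moreover have "\<forall>\<^sub>F j in sequentially. t \<le> real j"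
    using filterlim_real_sequentially by (simp add: filterlim_at_top)
  ultimately show "\<forall>\<^sub>F j in sequentially. trapezoid j t = 1"
    using eventually_gt_at_top[of 0] by eventually_elim (auto intro: trapezoid_eq_1)
qed

context found_chains
begin

lemma moment_integral:
  assumes "(\<integral>\<^sup>+\<zeta>. ennreal (snd \<zeta> powr m) \<partial>\<nu> n) \<le> ennreal C" "0 \<le> C"
  shows "integrable (\<nu> n) (\<lambda>\<zeta>. snd \<zeta> powr m)" "(\<integral>\<zeta>. snd \<zeta> powr m \<partial>\<nu> n) \<le> C"
proof -
  show i: "integrable (\<nu> n) (\<lambda>\<zeta>. snd \<zeta> powr m)"
  proof (rule integrableI_nonneg)
    show "(\<integral>\<^sup>+\<zeta>. ennreal (snd \<zeta> powr m) \<partial>\<nu> n) < \<infinity>"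
      using assms(1) by (rule order.strict_trans1) simp
  qed simp_all
  have "ennreal (\<integral>\<zeta>. snd \<zeta> powr m \<partial>\<nu> n) \<le> ennreal C"
    using assms(1) nn_integral_eq_integral[OF i] by simp
  then show "(\<integral>\<zeta>. snd \<zeta> powr m \<partial>\<nu> n) \<le> C" using assms(2) by (simp add: ennreal_le_iff)
qed

lemma trapezoid_mass:
  obtains C where "0 \<le> C"
    "\<And>j. 2 \<le> j \<Longrightarrow> \<forall>\<^sub>F n in sequentially. (\<integral>\<zeta>. 1 - trapezoid j (snd \<zeta>) \<partial>\<nu> n) \<le> C / real j"
proof -
  have m: "1 < p / 2" "p / 2 < p - 1" using p by auto
  obtain C1 where C1: "0 \<le> C1" "\<forall>\<^sub>F n in sequentially. (\<integral>\<^sup>+\<zeta>. ennreal (snd \<zeta> powr (p / 2)) \<partial>\<nu> n) \<le> ennreal C1"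
    using uniform_moment_bound[OF m] by blast
  obtain C2 where C2: "0 \<le> C2" "\<And>\<eta>. 0 < \<eta> \<Longrightarrow> \<eta> \<le> 1 \<Longrightarrow>
      \<forall>\<^sub>F n in sequentially. measure (\<nu> n) {\<zeta> \<in> space (\<nu> n). snd \<zeta> \<le> \<eta>} \<le> C2 * \<eta>"
    using no_boundary_mass by blast
  show ?thesis
  proof (rule that)
    show "0 \<le> 2 * C2 + C1" using C1 C2 by simp
    fix j :: nat assume j: "2 \<le> j"
    have "\<forall>\<^sub>F n in sequentially. measure (\<nu> n) {\<zeta> \<in> space (\<nu> n). snd \<zeta> \<le> 2 / real j} \<le> C2 * (2 / real j)"
      using j by (intro C2) (auto simp: field_simps)
    with C1(2) show "\<forall>\<^sub>F n in sequentially. (\<integral>\<zeta>. 1 - trapezoid j (snd \<zeta>) \<partial>\<nu> n) \<le> (2 * C2 + C1) / real j"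
    proof eventually_elim
      case (elim n)
      let ?S = "{\<zeta> \<in> space (\<nu> n). snd \<zeta> \<le> 2 / real j}"
      have S [measurable]: "?S \<in> sets (\<nu> n)" by measurable
      have i1: "integrable (\<nu> n) (indicat_real ?S)"
        by (rule integrable_real_indicator[OF S]) (simp add: \<nu>.emeasure_eq_measure)
      note i2 = moment_integral[OF elim(1) C1(1)]
      have "(\<integral>\<zeta>. 1 - trapezoid j (snd \<zeta>) \<partial>\<nu> n) \<le> (\<integral>\<zeta>. indicat_real ?S \<zeta> + snd \<zeta> powr (p / 2) / real j \<partial>\<nu> n)"
      proof (rule integral_mono_AE)
        show "integrable (\<nu> n) (\<lambda>\<zeta>. 1 - trapezoid j (snd \<zeta>))"
          by (rule \<nu>.integrable_const_bound[where B = 1]) (use trapezoid_bounds in auto)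
        show "integrable (\<nu> n) (\<lambda>\<zeta>. indicat_real ?S \<zeta> + snd \<zeta> powr (p / 2) / real j)" using i1 i2 by simp
        show "AE \<zeta> in \<nu> n. 1 - trapezoid j (snd \<zeta>) \<le> indicat_real ?S \<zeta> + snd \<zeta> powr (p / 2) / real j"
          using AE_space
        proof eventually_elim
          case (elim \<zeta>)
          consider "snd \<zeta> \<le> 2 / real j" | "2 / real j \<le> snd \<zeta>" "snd \<zeta> \<le> real j" | "real j \<le> snd \<zeta>" by linarith
          then show ?case
          proof cases
            case 1
            then have "indicat_real ?S \<zeta> = 1" using elim by simp
            moreover have "0 \<le> snd \<zeta> powr (p / 2) / real j" by simp
            ultimately show ?thesis using trapezoid_bounds(1)[of j "snd \<zeta>"] by linarith
          next
            case 2
            then have "trapezoid j (snd \<zeta>) = 1" using j by (intro trapezoid_eq_1) auto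
            then show ?thesis by simp
          next
            case 3
            have "real j powr 1 \<le> snd \<zeta> powr 1" using 3 by (intro powr_mono2) auto
            also have "\<dots> \<le> snd \<zeta> powr (p / 2)" using 3 j m by (intro powr_mono) auto
            finally have "1 \<le> snd \<zeta> powr (p / 2) / real j" using j by (simp add: field_simps)
            moreover have "0 \<le> indicat_real ?S \<zeta>" by simp
            ultimately show ?thesis using trapezoid_bounds(1)[of j "snd \<zeta>"] by linarith
          qed
        qed
      qed
      also have "\<dots> = measure (\<nu> n) ?S + (\<integral>\<zeta>. snd \<zeta> powr (p / 2) \<partial>\<nu> n) / real j"
      proof -
        have "?S \<inter> space (\<nu> n) = ?S" by auto
        then show ?thesis using i1 i2 by simp
      qed
      also have "\<dots> \<le> C2 * (2 / real j) + C1 / real j"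
        using elim(2) i2(2) by (intro add_mono divide_right_mono) auto
      finally show ?case by (simp add: add_divide_distrib mult.commute)
    qed
  qed
qed

text \<open>Test functions supported in a compact part of \<open>(0, \<infinity>)\<close> determine the limit up to the factor
  \<open>\<integral> trapezoid\<close>, and this factor is close to 1 because mass escapes neither to infinity nor to 0.\<close>

lemma found_limit:
  fixes \<beta> g r :: "real \<Rightarrow> real" and c G :: real
  assumes \<beta>: "\<And>t. 0 < t \<Longrightarrow> (\<beta> has_real_derivative 2 / \<sigma>2 * B t) (at t)"
    and r [measurable]: "r \<in> borel_measurable borel" and r0: "\<And>t. 0 \<le> r t" "\<And>t. t < 0 \<Longrightarrow> r t = 0"
    and r_eq: "\<And>t. 0 < t \<Longrightarrow> r t = c * exp (\<beta> t)" and c: "0 < c"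
    and P: "P = density lborel (\<lambda>x. ennreal (r x))" "prob_space P"
    and g: "continuous_on UNIV g" "\<And>t. \<bar>g t\<bar> \<le> G"
  shows "(\<lambda>n. \<integral>\<zeta>. g (snd \<zeta>) \<partial>\<nu> n) \<longlonglongrightarrow> (\<integral>x. g x \<partial>P)"
proof -
  interpret P: prob_space P by (rule P)
  have sP [measurable_cong, simp]: "sets P = sets borel" by (simp add: P)
  have G: "0 \<le> G" using g(2)[of 0] by simp
  have gm [measurable]: "g \<in> borel_measurable borel" by (rule borel_measurable_continuous_onI[OF g(1)])
  have ig: "integrable P g" by (rule P.integrable_const_bound[where B = G]) (use g in auto)
  have pos: "AE x in P. 0 < x"
  proof -
    have "AE x in lborel. x \<noteq> (0::real)" by (rule AE_lborel_singleton)
    then have "AE x in lborel. 0 < ennreal (r x) \<longrightarrow> 0 < x"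
    proof eventually_elim
      case (elim x) then show ?case using r0(2)[of x] by (cases "x < 0") auto
    qed
    then show ?thesis unfolding P(1) by (subst AE_density) auto
  qed
  have test: "(\<lambda>n. \<integral>\<zeta>. k (snd \<zeta>) \<partial>\<nu> n) \<longlonglongrightarrow> 0"
    if k: "continuous_on UNIV k" "0 < a" "a < b" "\<And>t. t \<le> a \<or> b \<le> t \<Longrightarrow> k t = 0" and z: "(\<integral>x. k x \<partial>P) = 0" for k :: "real \<Rightarrow> real" and a b
  proof (rule test_function_limit[where k = k and a = a and b = b and \<beta> = \<beta>])
    show "continuous_on UNIV k" "0 < a" "a < b" by (fact k)+
    show "k t = 0" if "t \<le> a \<or> b \<le> t" for t using that by (rule k(4))
    show "(\<beta> has_real_derivative 2 / \<sigma>2 * B t) (at t)" if "0 < t" for t using that by (rule \<beta>)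
    have [measurable]: "k \<in> borel_measurable borel" by (rule borel_measurable_continuous_onI[OF k(1)])
    have "continuous_on {0<..} \<beta>" by (intro continuous_at_imp_continuous_on ballI DERIV_isCont[OF \<beta>]) auto
    then have ke: "continuous_on {a..b} (\<lambda>t. k t * exp (\<beta> t))"
      using k(2) by (intro continuous_intros continuous_on_subset[OF k(1)]) (auto intro: continuous_on_subset)
    have si: "set_integrable lborel {a..b} (\<lambda>t. k t * exp (\<beta> t))"
      by (rule borel_integrable_atLeastAtMost'[OF ke])
    have "0 = (\<integral>x. k x \<partial>P)" using z by simp
    also have "\<dots> = (\<integral>x. r x * k x \<partial>lborel)"
      unfolding P(1) by (subst integral_density) (auto simp: r0)
    also have "\<dots> = (\<integral>x. c * (indicator {a..b} x *\<^sub>R (k x * exp (\<beta> x))) \<partial>lborel)"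
    proof (rule Bochner_Integration.integral_cong[OF refl])
      fix x
      show "r x * k x = c * (indicator {a..b} x *\<^sub>R (k x * exp (\<beta> x)))"
      proof (cases "x \<in> {a..b}")
        case True then show ?thesis using k(2) r_eq[of x] by simp
      next
        case False then have "k x = 0" by (intro k(4)) auto
        then show ?thesis by simp
      qed
    qed
    also have "\<dots> = c * (LINT x:{a..b}|lborel. k x * exp (\<beta> x))"
      by (simp add: set_lebesgue_integral_def)
    also have "\<dots> = c * integral {a..b} (\<lambda>t. k t * exp (\<beta> t))"
      using set_borel_integral_eq_integral(2)[OF si] by simp
    finally show "integral {a..b} (\<lambda>t. k t * exp (\<beta> t)) = 0" using c by simp
  qed
  obtain C where C: "0 \<le> C"
    "\<And>j. 2 \<le> j \<Longrightarrow> \<forall>\<^sub>F n in sequentially. (\<integral>\<zeta>. 1 - trapezoid j (snd \<zeta>) \<partial>\<nu> n) \<le> C / real j"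
    using trapezoid_mass by blast
  have \<chi>lim: "(\<lambda>j. \<integral>x. h x * trapezoid j x \<partial>P) \<longlonglongrightarrow> (\<integral>x. h x \<partial>P)"
    if [measurable]: "h \<in> borel_measurable borel" and h: "\<And>t. \<bar>h t\<bar> \<le> K" for h K
  proof (rule integral_dominated_convergence[where w = "\<lambda>_. K"])
    show "AE x in P. (\<lambda>j. h x * trapezoid j x) \<longlonglongrightarrow> h x"
      using pos
    proof eventually_elim
      case (elim x)
      have "(\<lambda>j. h x * trapezoid j x) \<longlonglongrightarrow> h x * 1" by (intro tendsto_intros trapezoid_lim elim)
      then show ?case by simp
    qed
    show "AE x in P. norm (h x * trapezoid j x) \<le> K" for j
    proof (rule AE_I2)
      fix x
      have "\<bar>h x\<bar> * \<bar>trapezoid j x\<bar> \<le> K * 1"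
        using h[of x] trapezoid_bounds[of j x] by (intro mult_mono) auto
      then show "norm (h x * trapezoid j x) \<le> K" by (simp add: abs_mult)
    qed
  qed auto
  have l1: "(\<lambda>j. \<integral>x. trapezoid j x \<partial>P) \<longlonglongrightarrow> 1"
    using \<chi>lim[of "\<lambda>_. 1" 1] by (simp add: P.prob_space)
  have l2: "(\<lambda>j. \<integral>x. g x * trapezoid j x \<partial>P) \<longlonglongrightarrow> (\<integral>x. g x \<partial>P)" by (rule \<chi>lim[OF gm g(2)])
  \<comment> \<open>For this constant \<open>g * trapezoid j - cj j * trapezoid j\<close> has compact support in \<open>(0, \<infinity>)\<close> and
    integral 0 under \<open>P\<close>, which makes it a test function.\<close>
  define cj where "cj j = (\<integral>x. g x * trapezoid j x \<partial>P) / (\<integral>x. trapezoid j x \<partial>P)" for j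
  have l3: "cj \<longlonglongrightarrow> (\<integral>x. g x \<partial>P)"
    unfolding cj_def using tendsto_divide[OF l2 l1] by simp
  show ?thesis
  proof (rule LIMSEQ_I)
    fix e :: real assume e: "0 < e"
    have "(\<lambda>j. (G + G + e) * C / real j) \<longlonglongrightarrow> 0" by (rule lim_const_over_n)
    then have "\<forall>\<^sub>F j in sequentially. (G + G + e) * C / real j < e / 3" using e by (intro order_tendstoD) auto
    moreover have "\<forall>\<^sub>F j in sequentially. 0 < (\<integral>x. trapezoid j x \<partial>P)" using l1 by (rule order_tendstoD) simp
    moreover have "\<forall>\<^sub>F j in sequentially. \<bar>cj j - (\<integral>x. g x \<partial>P)\<bar> < e / 3"
      using tendstoD[OF l3, of "e / 3"] e by (simp add: dist_real_def)
    ultimately have "\<forall>\<^sub>F j in sequentially. (G + G + e) * C / real j < e / 3 \<and> 0 < (\<integral>x. trapezoid j x \<partial>P)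
        \<and> \<bar>cj j - (\<integral>x. g x \<partial>P)\<bar> < e / 3 \<and> 2 \<le> j"
      using eventually_ge_at_top[of 2] by eventually_elim auto
    then obtain j where j: "(G + G + e) * C / real j < e / 3" "0 < (\<integral>x. trapezoid j x \<partial>P)"
        "\<bar>cj j - (\<integral>x. g x \<partial>P)\<bar> < e / 3" "2 \<le> j"
      using eventually_happens'[OF sequentially_bot] by blast
    let ?\<chi> = "trapezoid j"
    define k where "k t = g t * ?\<chi> t - cj j * ?\<chi> t" for t
    have b\<chi>: "\<bar>g t * ?\<chi> t\<bar> \<le> G" for t
    proof -
      have "\<bar>g t\<bar> * \<bar>?\<chi> t\<bar> \<le> G * 1"
        using g(2)[of t] trapezoid_bounds[of j t] by (intro mult_mono) auto
      then show ?thesis by (simp add: abs_mult)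
    qed
    have iP: "integrable P ?\<chi>" "integrable P (\<lambda>x. g x * ?\<chi> x)"
      by (rule P.integrable_const_bound[where B = 1], use trapezoid_bounds in auto)
        (rule P.integrable_const_bound[where B = G], use b\<chi> in auto)
    have cjG: "\<bar>cj j\<bar> \<le> G"
    proof -
      have "\<bar>\<integral>x. g x * ?\<chi> x \<partial>P\<bar> \<le> (\<integral>x. \<bar>g x * ?\<chi> x\<bar> \<partial>P)" by (rule integral_abs_bound)
      also have "\<dots> \<le> (\<integral>x. G * ?\<chi> x \<partial>P)"
      proof (rule integral_mono)
        show "integrable P (\<lambda>x. \<bar>g x * ?\<chi> x\<bar>)" by (rule integrable_abs[OF iP(2)])
        show "integrable P (\<lambda>x. G * ?\<chi> x)" using iP(1) by simp
        show "\<bar>g x * ?\<chi> x\<bar> \<le> G * ?\<chi> x" for x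
          using g(2)[of x] trapezoid_bounds[of j x] by (simp add: abs_mult mult_right_mono)
      qed
      also have "\<dots> = G * (\<integral>x. ?\<chi> x \<partial>P)" by simp
      finally show ?thesis using j(2) by (simp add: cj_def abs_divide divide_le_eq)
    qed
    have "(\<lambda>n. \<integral>\<zeta>. k (snd \<zeta>) \<partial>\<nu> n) \<longlonglongrightarrow> 0"
    proof (rule test[of k "1 / real j" "real j + 1"])
      show "continuous_on UNIV k" unfolding k_def by (intro continuous_intros g trapezoid_continuous)
      show "0 < 1 / real j" using j(4) by simp
      have "1 / real j < 1" using j(4) by simp
      then show "1 / real j < real j + 1" by simp
      show "k t = 0" if "t \<le> 1 / real j \<or> real j + 1 \<le> t" for t
        using trapezoid_eq_0[of j t] that j(4) by (simp add: k_def)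
      have "(\<integral>x. k x \<partial>P) = (\<integral>x. g x * ?\<chi> x \<partial>P) - cj j * (\<integral>x. ?\<chi> x \<partial>P)"
        unfolding k_def using iP by simp
      then show "(\<integral>x. k x \<partial>P) = 0" using j(2) by (simp add: cj_def)
    qed
    then have "\<forall>\<^sub>F n in sequentially. \<bar>\<integral>\<zeta>. k (snd \<zeta>) \<partial>\<nu> n\<bar> < e / 3"
      using e by (auto dest!: tendstoD[of _ _ _ "e / 3"] simp: dist_real_def)
    with C(2)[OF j(4)] have "\<forall>\<^sub>F n in sequentially. norm ((\<integral>\<zeta>. g (snd \<zeta>) \<partial>\<nu> n) - (\<integral>x. g x \<partial>P)) < e"
    proof eventually_elim
      case (elim n)
      define \<delta> where "\<delta> = (\<integral>\<zeta>. 1 - ?\<chi> (snd \<zeta>) \<partial>\<nu> n)"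
      have i\<chi>: "integrable (\<nu> n) (\<lambda>\<zeta>. ?\<chi> (snd \<zeta>))"
        by (rule \<nu>.integrable_const_bound[where B = 1]) (use trapezoid_bounds in auto)
      have ign: "integrable (\<nu> n) (\<lambda>\<zeta>. g (snd \<zeta>))"
        by (rule \<nu>.integrable_const_bound[where B = G]) (use g in auto)
      have ig\<chi>: "integrable (\<nu> n) (\<lambda>\<zeta>. g (snd \<zeta>) * ?\<chi> (snd \<zeta>))"
        by (rule \<nu>.integrable_const_bound[where B = G]) (use b\<chi> in auto)
      have \<delta>: "\<delta> = 1 - (\<integral>\<zeta>. ?\<chi> (snd \<zeta>) \<partial>\<nu> n)" unfolding \<delta>_def using i\<chi> by (simp add: \<nu>.prob_space)
      have \<delta>0: "0 \<le> \<delta>"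
        unfolding \<delta>_def by (rule Bochner_Integration.integral_nonneg) (simp add: trapezoid_bounds)
      define r1 where "r1 = (\<integral>\<zeta>. g (snd \<zeta>) - g (snd \<zeta>) * ?\<chi> (snd \<zeta>) \<partial>\<nu> n)"
      have "\<bar>r1\<bar> \<le> (\<integral>\<zeta>. \<bar>g (snd \<zeta>) - g (snd \<zeta>) * ?\<chi> (snd \<zeta>)\<bar> \<partial>\<nu> n)" unfolding r1_def by (rule integral_abs_bound)
      also have "\<dots> \<le> (\<integral>\<zeta>. G * (1 - ?\<chi> (snd \<zeta>)) \<partial>\<nu> n)"
      proof (rule integral_mono)
        fix \<zeta> :: "real \<times> real"
        have "g (snd \<zeta>) - g (snd \<zeta>) * ?\<chi> (snd \<zeta>) = g (snd \<zeta>) * (1 - ?\<chi> (snd \<zeta>))" by (simp add: algebra_simps)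
        then show "\<bar>g (snd \<zeta>) - g (snd \<zeta>) * ?\<chi> (snd \<zeta>)\<bar> \<le> G * (1 - ?\<chi> (snd \<zeta>))"
          using g(2) trapezoid_bounds[of j "snd \<zeta>"] by (simp add: abs_mult mult_right_mono)
      qed (use ign ig\<chi> i\<chi> in auto)
      also have "\<dots> = G * \<delta>" unfolding \<delta>_def using i\<chi> by simp
      finally have r1: "\<bar>r1\<bar> \<le> G * \<delta>" .
      have r2: "\<bar>cj j * \<delta>\<bar> \<le> G * \<delta>" unfolding abs_mult using cjG \<delta>0 by (intro mult_mono) auto
      have eq: "(\<integral>\<zeta>. g (snd \<zeta>) \<partial>\<nu> n) - (\<integral>x. g x \<partial>P)
          = r1 + (\<integral>\<zeta>. k (snd \<zeta>) \<partial>\<nu> n) - cj j * \<delta> + (cj j - (\<integral>x. g x \<partial>P))"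
      proof -
        have "(\<integral>\<zeta>. k (snd \<zeta>) \<partial>\<nu> n) = (\<integral>\<zeta>. g (snd \<zeta>) * ?\<chi> (snd \<zeta>) \<partial>\<nu> n) - cj j * (\<integral>\<zeta>. ?\<chi> (snd \<zeta>) \<partial>\<nu> n)"
          unfolding k_def using ig\<chi> i\<chi> by simp
        moreover have "r1 = (\<integral>\<zeta>. g (snd \<zeta>) \<partial>\<nu> n) - (\<integral>\<zeta>. g (snd \<zeta>) * ?\<chi> (snd \<zeta>) \<partial>\<nu> n)"
          unfolding r1_def using ign ig\<chi> by simp
        ultimately show ?thesis unfolding \<delta> by (simp add: algebra_simps)
      qed
      have "G * \<delta> + G * \<delta> < e / 3"
      proof -
        have "(G + G) * \<delta> \<le> (G + G) * (C / real j)"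
          using elim(1) G unfolding \<delta>_def[symmetric] by (intro mult_left_mono) auto
        also have "\<dots> \<le> (G + G + e) * (C / real j)" using e C by (intro mult_right_mono) auto
        also have "\<dots> = (G + G + e) * C / real j" by simp
        also have "\<dots> < e / 3" by (rule j(1))
        finally show ?thesis by (simp only: distrib_right)
      qed
      then have "\<bar>(\<integral>\<zeta>. g (snd \<zeta>) \<partial>\<nu> n) - (\<integral>x. g x \<partial>P)\<bar> < e"
        unfolding eq using r1 r2 elim(2) j(3) by linarith
      then show ?case by simp
    qed
    then show "\<exists>no. \<forall>n\<ge>no. norm ((\<integral>\<zeta>. g (snd \<zeta>) \<partial>\<nu> n) - (\<integral>x. g x \<partial>P)) < e"
      by (simp add: eventually_sequentially)
  qed
qed

section \<open>From arrivals to arbitrary times\<close>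

text \<open>The right-hand side of the Palm inversion formula; it equals \<open>\<epsilon> n\<close> times the mean of \<open>g\<close> under the
  time-stationary law of the work.\<close>

definition inversion_integral :: "nat \<Rightarrow> (real \<Rightarrow> ennreal) \<Rightarrow> ennreal" where
  "inversion_integral n g = (\<integral>\<^sup>+\<zeta>. (\<integral>\<^sup>+\<omega>. (\<integral>\<^sup>+r.
    g (max 0 (snd \<zeta> + \<epsilon> n * \<rho> n * W \<omega> * of_bool (fst \<zeta> < D n \<omega>) - r)) * indicator {0..<\<epsilon> n * U \<omega>} r
      \<partial>lborel) \<partial>M) \<partial>\<nu> n)"

lemma work_between_arrivals:
  assumes "\<rho> n \<le> 2" "0 \<le> y"
  shows "AE \<omega> in M. \<forall>r\<in>{0..<\<epsilon> n * U \<omega>}.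
    \<bar>max 0 (y + \<epsilon> n * \<rho> n * W \<omega> * of_bool (z < D n \<omega>) - r) - y\<bar> \<le> \<epsilon> n * envelope \<omega> \<and> 0 \<le> envelope \<omega>"
  using U_nonneg W_nonneg
proof eventually_elim
  case (elim \<omega>)
  show ?case
  proof (intro ballI conjI)
    fix r assume r: "r \<in> {0..<\<epsilon> n * U \<omega>}"
    show "0 \<le> envelope \<omega>" using elim by (simp add: envelope_def)
    define s where "s = \<epsilon> n * \<rho> n * W \<omega> * of_bool (z < D n \<omega>)"
    have "\<epsilon> n * (\<rho> n * W \<omega>) \<le> \<epsilon> n * (2 * W \<omega>)"
      using elim \<epsilon>_pos[of n] assms by (intro mult_left_mono mult_right_mono) auto
    moreover have "0 \<le> \<epsilon> n * W \<omega>" using elim \<epsilon>_pos[of n] by simp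
    ultimately have s: "0 \<le> s" "s \<le> 2 * (\<epsilon> n * W \<omega>)"
      using elim \<epsilon>_pos[of n] \<rho>_pos[of n] by (auto simp: s_def mult_ac of_bool_def)
    have "\<bar>max 0 (y + s - r) - y\<bar> \<le> s + r" using s r assms by auto
    also have "\<dots> \<le> 4 * (\<epsilon> n * W \<omega>) + \<epsilon> n * U \<omega>" using s r \<open>0 \<le> \<epsilon> n * W \<omega>\<close> by simp
    also have "\<dots> = \<epsilon> n * envelope \<omega>" by (simp add: envelope_def algebra_simps)
    finally show "\<bar>max 0 (y + \<epsilon> n * \<rho> n * W \<omega> * of_bool (z < D n \<omega>) - r) - y\<bar> \<le> \<epsilon> n * envelope \<omega>"
      by (simp add: s_def)
  qed
qed

lemma nn_integral_segment_const:
  assumes [measurable]: "K \<in> borel_measurable M"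
  shows "(\<integral>\<^sup>+\<omega>. (\<integral>\<^sup>+r. (k + K \<omega>) * indicator {0..<\<epsilon> n * U \<omega>} r \<partial>lborel) \<partial>M)
    = ennreal (\<epsilon> n) * (k + (\<integral>\<^sup>+\<omega>. ennreal (U \<omega>) * K \<omega> \<partial>M))"
proof -
  have U1: "(\<integral>\<^sup>+\<omega>. ennreal (U \<omega>) \<partial>M) = 1"
    using nn_integral_eq_integral[OF EU(1) U_nonneg] EU(2) by simp
  have "(\<integral>\<^sup>+\<omega>. (\<integral>\<^sup>+r. (k + K \<omega>) * indicator {0..<\<epsilon> n * U \<omega>} r \<partial>lborel) \<partial>M)
      = (\<integral>\<^sup>+\<omega>. ennreal (\<epsilon> n) * (k * ennreal (U \<omega>) + ennreal (U \<omega>) * K \<omega>) \<partial>M)"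
  proof (rule nn_integral_cong_AE)
    show "AE \<omega> in M. (\<integral>\<^sup>+r. (k + K \<omega>) * indicator {0..<\<epsilon> n * U \<omega>} r \<partial>lborel)
        = ennreal (\<epsilon> n) * (k * ennreal (U \<omega>) + ennreal (U \<omega>) * K \<omega>)"
      using U_nonneg
    proof eventually_elim
      case (elim \<omega>)
      have "(\<integral>\<^sup>+r. (k + K \<omega>) * indicator {0..<\<epsilon> n * U \<omega>} r \<partial>lborel) = (k + K \<omega>) * ennreal (\<epsilon> n * U \<omega>)"
        using elim \<epsilon>_pos[of n] by (subst nn_integral_cmult_indicator) auto
      also have "ennreal (\<epsilon> n * U \<omega>) = ennreal (\<epsilon> n) * ennreal (U \<omega>)"
        using elim \<epsilon>_pos[of n] by (intro ennreal_mult) auto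
      finally show ?case by (simp add: distrib_left distrib_right mult_ac)
    qed
  qed
  also have "\<dots> = ennreal (\<epsilon> n) * (k * (\<integral>\<^sup>+\<omega>. ennreal (U \<omega>) \<partial>M) + (\<integral>\<^sup>+\<omega>. ennreal (U \<omega>) * K \<omega> \<partial>M))"
    by (simp add: nn_integral_cmult nn_integral_add)
  finally show ?thesis by (simp add: U1)
qed

text \<open>On an interarrival segment the work stays within \<open>\<epsilon> n * envelope\<close> of the found work.  The weight
  \<open>U\<close> in the error term is the length of the segment; it costs one power of the moments.\<close>

lemma inversion_upper:
  assumes n: "\<rho> n \<le> 2" and A [measurable]: "A \<in> borel_measurable borel" and K [measurable]: "K \<in> borel_measurable borel"
    and le: "\<And>x y t. 0 \<le> x \<Longrightarrow> 0 \<le> y \<Longrightarrow> 0 \<le> t \<Longrightarrow> \<bar>x - y\<bar> \<le> \<epsilon> n * t \<Longrightarrow> g x \<le> A y + K t"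
  shows "inversion_integral n g \<le> ennreal (\<epsilon> n) * ((\<integral>\<^sup>+\<zeta>. A (snd \<zeta>) \<partial>\<nu> n) + (\<integral>\<^sup>+\<omega>. ennreal (U \<omega>) * K (envelope \<omega>) \<partial>M))"
proof -
  define k where "k = (\<integral>\<^sup>+\<omega>. ennreal (U \<omega>) * K (envelope \<omega>) \<partial>M)"
  have "inversion_integral n g \<le> (\<integral>\<^sup>+\<zeta>. ennreal (\<epsilon> n) * (A (snd \<zeta>) + k) \<partial>\<nu> n)"
    unfolding inversion_integral_def
  proof (rule nn_integral_mono_AE)
    show "AE \<zeta> in \<nu> n. (\<integral>\<^sup>+\<omega>. (\<integral>\<^sup>+r.
      g (max 0 (snd \<zeta> + \<epsilon> n * \<rho> n * W \<omega> * of_bool (fst \<zeta> < D n \<omega>) - r)) * indicator {0..<\<epsilon> n * U \<omega>} r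
        \<partial>lborel) \<partial>M) \<le> ennreal (\<epsilon> n) * (A (snd \<zeta>) + k)"
      using support[of n]
    proof eventually_elim
      case (elim \<zeta>)
      have y: "0 \<le> snd \<zeta>" using elim by simp
      have "(\<integral>\<^sup>+\<omega>. (\<integral>\<^sup>+r.
        g (max 0 (snd \<zeta> + \<epsilon> n * \<rho> n * W \<omega> * of_bool (fst \<zeta> < D n \<omega>) - r)) * indicator {0..<\<epsilon> n * U \<omega>} r
          \<partial>lborel) \<partial>M) \<le> (\<integral>\<^sup>+\<omega>. (\<integral>\<^sup>+r. (A (snd \<zeta>) + K (envelope \<omega>)) * indicator {0..<\<epsilon> n * U \<omega>} r \<partial>lborel) \<partial>M)"
      proof (rule nn_integral_mono_AE)
        show "AE \<omega> in M. (\<integral>\<^sup>+r.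
          g (max 0 (snd \<zeta> + \<epsilon> n * \<rho> n * W \<omega> * of_bool (fst \<zeta> < D n \<omega>) - r)) * indicator {0..<\<epsilon> n * U \<omega>} r
            \<partial>lborel) \<le> (\<integral>\<^sup>+r. (A (snd \<zeta>) + K (envelope \<omega>)) * indicator {0..<\<epsilon> n * U \<omega>} r \<partial>lborel)"
          using work_between_arrivals[OF n y, of "fst \<zeta>"]
        proof eventually_elim
          case (elim \<omega>)
          show ?case
          proof (rule nn_integral_mono)
            fix r
            show "g (max 0 (snd \<zeta> + \<epsilon> n * \<rho> n * W \<omega> * of_bool (fst \<zeta> < D n \<omega>) - r)) * indicator {0..<\<epsilon> n * U \<omega>} r
              \<le> (A (snd \<zeta>) + K (envelope \<omega>)) * indicator {0..<\<epsilon> n * U \<omega>} r"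
            proof (cases "r \<in> {0..<\<epsilon> n * U \<omega>}")
              case True
              have "g (max 0 (snd \<zeta> + \<epsilon> n * \<rho> n * W \<omega> * of_bool (fst \<zeta> < D n \<omega>) - r)) \<le> A (snd \<zeta>) + K (envelope \<omega>)"
                by (rule le) (use bspec[OF elim True] y in auto)
              then show ?thesis using True by simp
            next
              case False then show ?thesis unfolding indicator_simps(2)[OF False] by simp
            qed
          qed
        qed
      qed
      also have "\<dots> = ennreal (\<epsilon> n) * (A (snd \<zeta>) + k)"
        unfolding k_def by (rule nn_integral_segment_const) measurable
      finally show ?case .
    qed
  qed
  also have "\<dots> = ennreal (\<epsilon> n) * ((\<integral>\<^sup>+\<zeta>. A (snd \<zeta>) \<partial>\<nu> n) + k)"
    by (simp add: nn_integral_cmult nn_integral_add \<nu>.emeasure_space_1)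
  finally show ?thesis by (simp only: k_def)
qed

lemma inversion_lower:
  assumes n: "\<rho> n \<le> 2" and A [measurable]: "A \<in> borel_measurable borel" and K [measurable]: "K \<in> borel_measurable borel"
    and g [measurable]: "g \<in> borel_measurable borel"
    and le: "\<And>x y t. 0 \<le> x \<Longrightarrow> 0 \<le> y \<Longrightarrow> 0 \<le> t \<Longrightarrow> \<bar>x - y\<bar> \<le> \<epsilon> n * t \<Longrightarrow> A y \<le> g x + K t"
  shows "ennreal (\<epsilon> n) * (\<integral>\<^sup>+\<zeta>. A (snd \<zeta>) \<partial>\<nu> n)
    \<le> inversion_integral n g + ennreal (\<epsilon> n) * (\<integral>\<^sup>+\<omega>. ennreal (U \<omega>) * K (envelope \<omega>) \<partial>M)"
proof -
  define k where "k = (\<integral>\<^sup>+\<omega>. ennreal (U \<omega>) * K (envelope \<omega>) \<partial>M)"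
  define x where "x \<zeta> \<omega> r = max 0 (snd \<zeta> + \<epsilon> n * \<rho> n * W \<omega> * of_bool (fst \<zeta> < D n \<omega>) - r)"
    for \<zeta> :: "real \<times> real" and \<omega> r
  define J where "J \<zeta> \<omega> = (\<integral>\<^sup>+r. g (x \<zeta> \<omega> r) * indicator {0..<\<epsilon> n * U \<omega>} r \<partial>lborel)" for \<zeta> \<omega>
  have Jm: "(\<lambda>y. J (fst y) (snd y)) \<in> borel_measurable (borel2 \<Otimes>\<^sub>M M)"
  proof -
    have eq: "indicator {0..<z} r = (if 0 \<le> r \<and> r < z then 1 else 0 :: ennreal)" for z r :: real
      by (simp add: indicator_def)
    have "(\<lambda>(y, r). g (x (fst y) (snd y) r) * indicator {0..<\<epsilon> n * U (snd y)} r) \<in> borel_measurable ((borel2 \<Otimes>\<^sub>M M) \<Otimes>\<^sub>M lborel)"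
      unfolding x_def case_prod_beta eq by measurable
    then show ?thesis unfolding J_def by (rule lborel.borel_measurable_nn_integral)
  qed
  have J2: "(\<lambda>\<omega>. J \<zeta> \<omega>) \<in> borel_measurable M" for \<zeta>
    using measurable_compose[OF measurable_Pair1' Jm, of \<zeta>] by (simp add: space_pair_measure)
  have J1: "(\<lambda>\<zeta>. \<integral>\<^sup>+\<omega>. J \<zeta> \<omega> \<partial>M) \<in> borel_measurable borel2"
  proof (rule borel_measurable_nn_integral)
    show "(\<lambda>(\<zeta>, \<omega>). J \<zeta> \<omega>) \<in> borel_measurable (borel2 \<Otimes>\<^sub>M M)" using Jm by (simp only: split_beta')
  qed
  have "ennreal (\<epsilon> n) * (\<integral>\<^sup>+\<zeta>. A (snd \<zeta>) \<partial>\<nu> n) = (\<integral>\<^sup>+\<zeta>. ennreal (\<epsilon> n) * A (snd \<zeta>) \<partial>\<nu> n)"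
    by (simp add: nn_integral_cmult)
  also have "\<dots> \<le> (\<integral>\<^sup>+\<zeta>. (\<integral>\<^sup>+\<omega>. J \<zeta> \<omega> \<partial>M) + ennreal (\<epsilon> n) * k \<partial>\<nu> n)"
  proof (rule nn_integral_mono_AE)
    show "AE \<zeta> in \<nu> n. ennreal (\<epsilon> n) * A (snd \<zeta>) \<le> (\<integral>\<^sup>+\<omega>. J \<zeta> \<omega> \<partial>M) + ennreal (\<epsilon> n) * k"
      using support[of n]
    proof eventually_elim
      case (elim \<zeta>)
      have y: "0 \<le> snd \<zeta>" using elim by simp
      define E where "E \<omega> = (\<integral>\<^sup>+r. (0 + K (envelope \<omega>)) * indicator {0..<\<epsilon> n * U \<omega>} r \<partial>lborel)" for \<omega>
      have Em: "E \<in> borel_measurable M"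
      proof -
        have eq: "indicator {0..<z} r = (if 0 \<le> r \<and> r < z then 1 else 0 :: ennreal)" for z r :: real
          by (simp add: indicator_def)
        have "(\<lambda>(\<omega>, r). (0 + K (envelope \<omega>)) * indicator {0..<\<epsilon> n * U \<omega>} r) \<in> borel_measurable (M \<Otimes>\<^sub>M lborel)"
          unfolding case_prod_beta eq by measurable
        then show ?thesis unfolding E_def[abs_def] by (rule lborel.borel_measurable_nn_integral)
      qed
      have "ennreal (\<epsilon> n) * A (snd \<zeta>) = (\<integral>\<^sup>+\<omega>. (\<integral>\<^sup>+r. (A (snd \<zeta>) + 0) * indicator {0..<\<epsilon> n * U \<omega>} r \<partial>lborel) \<partial>M)"
        by (subst nn_integral_segment_const) simp_all
      also have "\<dots> \<le> (\<integral>\<^sup>+\<omega>. J \<zeta> \<omega> + E \<omega> \<partial>M)"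
      proof (rule nn_integral_mono_AE)
        show "AE \<omega> in M. (\<integral>\<^sup>+r. (A (snd \<zeta>) + 0) * indicator {0..<\<epsilon> n * U \<omega>} r \<partial>lborel) \<le> J \<zeta> \<omega> + E \<omega>"
          using work_between_arrivals[OF n y, of "fst \<zeta>"]
        proof eventually_elim
          case (elim \<omega>)
          have gm: "(\<lambda>r. g (x \<zeta> \<omega> r) * indicator {0..<\<epsilon> n * U \<omega>} r) \<in> borel_measurable lborel"
            unfolding x_def by measurable
          have "(\<integral>\<^sup>+r. (A (snd \<zeta>) + 0) * indicator {0..<\<epsilon> n * U \<omega>} r \<partial>lborel)
            \<le> (\<integral>\<^sup>+r. g (x \<zeta> \<omega> r) * indicator {0..<\<epsilon> n * U \<omega>} r
                + (0 + K (envelope \<omega>)) * indicator {0..<\<epsilon> n * U \<omega>} r \<partial>lborel)"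
          proof (rule nn_integral_mono)
            fix r
            show "(A (snd \<zeta>) + 0) * indicator {0..<\<epsilon> n * U \<omega>} r
              \<le> g (x \<zeta> \<omega> r) * indicator {0..<\<epsilon> n * U \<omega>} r + (0 + K (envelope \<omega>)) * indicator {0..<\<epsilon> n * U \<omega>} r"
            proof (cases "r \<in> {0..<\<epsilon> n * U \<omega>}")
              case True
              have "A (snd \<zeta>) \<le> g (x \<zeta> \<omega> r) + K (envelope \<omega>)"
                unfolding x_def by (rule le) (use bspec[OF elim True] y in auto)
              then show ?thesis using True by simp
            next
              case False then show ?thesis unfolding indicator_simps(2)[OF False] by simp
            qed
          qed
          also have "\<dots> = J \<zeta> \<omega> + E \<omega>"
            unfolding J_def E_def using gm by (intro nn_integral_add) auto
          finally show ?case .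
        qed
      qed
      also have "\<dots> = (\<integral>\<^sup>+\<omega>. J \<zeta> \<omega> \<partial>M) + (\<integral>\<^sup>+\<omega>. E \<omega> \<partial>M)" by (rule nn_integral_add[OF J2 Em])
      also have "(\<integral>\<^sup>+\<omega>. E \<omega> \<partial>M) = ennreal (\<epsilon> n) * (0 + k)"
        unfolding E_def k_def by (rule nn_integral_segment_const) measurable
      finally show ?case by simp
    qed
  qed
  also have "\<dots> = (\<integral>\<^sup>+\<zeta>. (\<integral>\<^sup>+\<omega>. J \<zeta> \<omega> \<partial>M) \<partial>\<nu> n) + ennreal (\<epsilon> n) * k"
    using J1 by (subst nn_integral_add) (auto simp: \<nu>.emeasure_space_1 cong: measurable_cong_sets)
  also have "(\<integral>\<^sup>+\<zeta>. (\<integral>\<^sup>+\<omega>. J \<zeta> \<omega> \<partial>M) \<partial>\<nu> n) = inversion_integral n g"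
    by (simp only: inversion_integral_def J_def x_def)
  finally show ?thesis by (simp only: k_def)
qed

end

section \<open>Weak convergence with bounded moments\<close>

lemma powr_max_0_continuous: "0 < m \<Longrightarrow> continuous_on S (\<lambda>x::real. max 0 x powr m)"
  by (intro continuous_on_powr' continuous_intros) auto

text \<open>Beyond the truncation level the power \<open>m\<close> is smaller than the power \<open>m'\<close> by a factor that tends to 0.\<close>

lemma powr_truncation:
  fixes x m m' K :: real
  assumes "0 < m" "m < m'" "0 < K" "0 \<le> x"
  shows "x powr m - min (x powr m) K \<le> x powr m' * K powr ((m - m') / m)"
proof (cases "x powr m \<le> K")
  case False
  then have x: "0 < x" using assms by (cases "x = 0") auto
  have "x powr m = x powr m' * (x powr m) powr ((m - m') / m)"
    using x assms by (simp add: powr_powr powr_add[symmetric])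
  also have "\<dots> \<le> x powr m' * K powr ((m - m') / m)"
    using False assms by (intro mult_left_mono powr_mono2') (auto simp: divide_nonpos_pos)
  finally show ?thesis using False assms by simp
qed simp

lemma moment_truncation:
  fixes Q :: "real measure"
  assumes "real_distribution Q" and nn: "AE x in Q. 0 \<le> x" and m: "0 < m" "m < m'"
    and C: "(\<integral>\<^sup>+x. ennreal (x powr m') \<partial>Q) \<le> ennreal C" "0 \<le> C" and K: "0 < K"
  shows "integrable Q (\<lambda>x. x powr m)"
    and "\<bar>(\<integral>x. x powr m \<partial>Q) - (\<integral>x. min (max 0 x powr m) K \<partial>Q)\<bar> \<le> C * K powr ((m - m') / m)"
proof -
  interpret real_distribution Q by fact
  have i': "integrable Q (\<lambda>x. x powr m')"
  proof (rule integrableI_nonneg)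
    show "(\<integral>\<^sup>+x. ennreal (x powr m') \<partial>Q) < \<infinity>" using C(1) by (rule order.strict_trans1) simp
  qed simp_all
  have "ennreal (\<integral>x. x powr m' \<partial>Q) \<le> ennreal C"
    using C(1) nn_integral_eq_integral[OF i'] by simp
  then have E': "(\<integral>x. x powr m' \<partial>Q) \<le> C" using C(2) by (simp add: ennreal_le_iff)
  show i: "integrable Q (\<lambda>x. x powr m)"
  proof (rule Bochner_Integration.integrable_bound[of _ "\<lambda>x. 1 + x powr m'"])
    show "AE x in Q. norm (x powr m) \<le> norm (1 + x powr m')"
      using nn
    proof eventually_elim
      case (elim x)
      have "x powr m \<le> 1 + x powr m'"
      proof (cases "x \<le> 1")
        case True
        then have "x powr m \<le> 1 powr m" using elim m by (intro powr_mono2) auto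
        then show ?thesis by (simp add: add_increasing2)
      next
        case False
        then have "x powr m \<le> x powr m'" using m by (intro powr_mono) auto
        then show ?thesis by simp
      qed
      then show ?case by simp
    qed
  qed (use i' in simp_all)
  have im: "integrable Q (\<lambda>x. min (max 0 x powr m) K)"
    by (rule integrable_const_bound[where B = K]) (use K in auto)
  have eq: "(\<integral>x. x powr m \<partial>Q) - (\<integral>x. min (max 0 x powr m) K \<partial>Q)
      = (\<integral>x. x powr m - min (max 0 x powr m) K \<partial>Q)" using i im by simp
  have "0 \<le> (\<integral>x. x powr m - min (max 0 x powr m) K \<partial>Q)"
    by (rule integral_nonneg_AE) (use nn in \<open>auto simp: max_absorb2\<close>)
  moreover have "(\<integral>x. x powr m - min (max 0 x powr m) K \<partial>Q) \<le> (\<integral>x. x powr m' * K powr ((m - m') / m) \<partial>Q)"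
  proof (rule integral_mono_AE)
    show "AE x in Q. x powr m - min (max 0 x powr m) K \<le> x powr m' * K powr ((m - m') / m)"
      using nn
    proof eventually_elim
      case (elim x)
      then show ?case using powr_truncation[OF m K elim] by (simp add: max_absorb2)
    qed
  qed (use i im i' in simp_all)
  moreover have "(\<integral>x. x powr m' * K powr ((m - m') / m) \<partial>Q) \<le> C * K powr ((m - m') / m)"
    using E' by (simp add: mult_right_mono)
  ultimately show "\<bar>(\<integral>x. x powr m \<partial>Q) - (\<integral>x. min (max 0 x powr m) K \<partial>Q)\<bar> \<le> C * K powr ((m - m') / m)"
    unfolding eq by linarith
qed

text \<open>Uniform integrability: truncated moments converge weakly, and truncation costs a uniformly small
  amount because a higher moment is bounded.  The limit inherits that bound by
  monotone convergence.\<close>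

lemma weak_conv_moments:
  fixes Q :: "nat \<Rightarrow> real measure" and P :: "real measure"
  assumes Q: "\<And>n. real_distribution (Q n)" and P: "real_distribution P" and conv: "weak_conv_m Q P"
    and nn: "\<And>n. AE x in Q n. 0 \<le> x" "AE x in P. 0 \<le> x" and m: "0 < m" "m < m'"
    and C: "\<forall>\<^sub>F n in sequentially. (\<integral>\<^sup>+x. ennreal (x powr m') \<partial>Q n) \<le> ennreal C" "0 \<le> C"
  shows "\<forall>\<^sub>F n in sequentially. integrable (Q n) (\<lambda>x. x powr m)" and "integrable P (\<lambda>x. x powr m)"
    and "(\<lambda>n. \<integral>x. x powr m \<partial>Q n) \<longlonglongrightarrow> (\<integral>x. x powr m \<partial>P)"
proof -
  interpret P: real_distribution P by fact
  have lim: "(\<lambda>n. \<integral>x. min (max 0 x powr q) K \<partial>Q n) \<longlonglongrightarrow> (\<integral>x. min (max 0 x powr q) K \<partial>P)"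
    if "0 < q" "0 < K" for q K :: real
  proof (rule weak_conv_imp_integral_bdd_continuous_conv[OF Q P conv])
    have "continuous_on UNIV (\<lambda>x::real. min (max 0 x powr q) K)"
      by (intro continuous_intros powr_max_0_continuous that)
    then show "isCont (\<lambda>x. min (max 0 x powr q) K) x" for x by (simp add: continuous_on_eq_continuous_at)
    show "norm (min (max 0 x powr q) K) \<le> K" for x using that by simp
  qed
  have m'0: "0 < m'" using m by simp
  have CP: "(\<integral>\<^sup>+x. ennreal (x powr m') \<partial>P) \<le> ennreal C"
  proof -
    have le: "(\<integral>\<^sup>+x. ennreal (min (max 0 x powr m') (real (Suc K))) \<partial>P) \<le> ennreal C" for K
    proof -
      have iK: "integrable R (\<lambda>x. min (max 0 x powr m') (real (Suc K)))" if "real_distribution R" for R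
      proof -
        interpret R: real_distribution R by fact
        show ?thesis by (rule R.integrable_const_bound[where B = "real (Suc K)"]) auto
      qed
      have "\<forall>\<^sub>F n in sequentially. (\<integral>x. min (max 0 x powr m') (real (Suc K)) \<partial>Q n) \<le> C"
        using C(1)
      proof eventually_elim
        case (elim n)
        have "ennreal (\<integral>x. min (max 0 x powr m') (real (Suc K)) \<partial>Q n)
            = (\<integral>\<^sup>+x. ennreal (min (max 0 x powr m') (real (Suc K))) \<partial>Q n)"
          by (rule nn_integral_eq_integral[OF iK[OF Q], symmetric]) simp
        also have "\<dots> \<le> (\<integral>\<^sup>+x. ennreal (x powr m') \<partial>Q n)"
        proof (rule nn_integral_mono_AE)
          show "AE x in Q n. ennreal (min (max 0 x powr m') (real (Suc K))) \<le> ennreal (x powr m')"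
            using nn(1)[of n] by eventually_elim (auto intro!: ennreal_leI simp: max_absorb2)
        qed
        also have "\<dots> \<le> ennreal C" by (rule elim)
        finally show ?case using C(2) by (simp add: ennreal_le_iff)
      qed
      then have "(\<integral>x. min (max 0 x powr m') (real (Suc K)) \<partial>P) \<le> C"
        by (intro tendsto_upperbound[OF lim[OF m'0]]) auto
      then show ?thesis
        using nn_integral_eq_integral[OF iK[OF P]] by (simp add: ennreal_leI)
    qed
    have sup: "(SUP K. ennreal (min t (real (Suc K)))) = ennreal t" for t :: real
    proof (rule antisym)
      obtain K :: nat where K: "t \<le> real K" using real_arch_simple by blast
      then have "ennreal t = ennreal (min t (real (Suc K)))" by simp
      also have "\<dots> \<le> (SUP K. ennreal (min t (real (Suc K))))" by (rule SUP_upper) simp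
      finally show "ennreal t \<le> (SUP K. ennreal (min t (real (Suc K))))" .
      show "(SUP K. ennreal (min t (real (Suc K)))) \<le> ennreal t" by (rule SUP_least) (simp add: ennreal_leI)
    qed
    have "(\<integral>\<^sup>+x. ennreal (x powr m') \<partial>P) = (\<integral>\<^sup>+x. (SUP K. ennreal (min (max 0 x powr m') (real (Suc K)))) \<partial>P)"
      unfolding sup by (rule nn_integral_cong_AE) (use nn(2) in \<open>auto simp: max_absorb2\<close>)
    also have "\<dots> = (SUP K. \<integral>\<^sup>+x. ennreal (min (max 0 x powr m') (real (Suc K))) \<partial>P)"
      by (rule nn_integral_monotone_convergence_SUP) (auto simp: incseq_def le_fun_def intro!: ennreal_leI min.mono)
    also have "\<dots> \<le> ennreal C" by (rule SUP_least) (rule le)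
    finally show ?thesis .
  qed
  show "\<forall>\<^sub>F n in sequentially. integrable (Q n) (\<lambda>x. x powr m)"
    using C(1) by eventually_elim (rule moment_truncation(1)[OF Q nn(1) m _ C(2) zero_less_one])
  show "integrable P (\<lambda>x. x powr m)" by (rule moment_truncation(1)[OF P nn(2) m CP C(2) zero_less_one])
  show "(\<lambda>n. \<integral>x. x powr m \<partial>Q n) \<longlonglongrightarrow> (\<integral>x. x powr m \<partial>P)"
  proof (rule LIMSEQ_I)
    fix e :: real assume e: "0 < e"
    have "((\<lambda>K. C * K powr ((m - m') / m)) \<longlongrightarrow> C * 0) at_top"
      using m by (intro tendsto_mult_left tendsto_neg_powr filterlim_ident) (auto simp: divide_neg_pos)
    then have "\<forall>\<^sub>F K in at_top. C * K powr ((m - m') / m) < e / 3" using e by (intro order_tendstoD) auto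
    then have "\<forall>\<^sub>F K in at_top. C * K powr ((m - m') / m) < e / 3 \<and> (0::real) < K"
      using eventually_gt_at_top[of 0] by eventually_elim simp
    then obtain K :: real where K: "C * K powr ((m - m') / m) < e / 3" "0 < K"
      using eventually_happens'[OF trivial_limit_at_top_linorder] by blast
    have "\<forall>\<^sub>F n in sequentially. dist (\<integral>x. min (max 0 x powr m) K \<partial>Q n) (\<integral>x. min (max 0 x powr m) K \<partial>P) < e / 3"
      using e by (intro tendstoD[OF lim[OF m(1) K(2)]]) simp
    then have "\<forall>\<^sub>F n in sequentially. norm ((\<integral>x. x powr m \<partial>Q n) - (\<integral>x. x powr m \<partial>P)) < e"
      using C(1)
    proof eventually_elim
      case (elim n)
      have "\<bar>(\<integral>x. min (max 0 x powr m) K \<partial>Q n) - (\<integral>x. min (max 0 x powr m) K \<partial>P)\<bar> < e / 3"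
        using elim(1) by (simp add: dist_real_def)
      moreover note moment_truncation(2)[OF Q nn(1) m elim(2) C(2) K(2)]
        moment_truncation(2)[OF P nn(2) m CP C(2) K(2)]
      ultimately have "\<bar>(\<integral>x. x powr m \<partial>Q n) - (\<integral>x. x powr m \<partial>P)\<bar> < e" using K(1) by linarith
      then show ?case by simp
    qed
    then show "\<exists>no. \<forall>n\<ge>no. norm ((\<integral>x. x powr m \<partial>Q n) - (\<integral>x. x powr m \<partial>P)) < e"
      by (simp add: eventually_sequentially)
  qed
qed

lemma cts_step_bounds: "x < y \<Longrightarrow> 0 \<le> cts_step x y t \<and> cts_step x y t \<le> 1"
  by (auto simp: cts_step_def field_simps)

lemma cts_step_Lipschitz:
  assumes "x < y"
  shows "\<bar>cts_step x y s - cts_step x y t\<bar> \<le> \<bar>s - t\<bar> / (y - x)"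
proof -
  have eq: "cts_step x y s = max 0 (min 1 ((y - s) / (y - x)))" for s
    using assms by (auto simp: cts_step_def field_simps)
  have "\<bar>max 0 (min 1 a) - max 0 (min 1 b)\<bar> \<le> \<bar>a - b\<bar>" for a b :: real by auto
  then have "\<bar>cts_step x y s - cts_step x y t\<bar> \<le> \<bar>(y - s) / (y - x) - (y - t) / (y - x)\<bar>" unfolding eq .
  also have "(y - s) / (y - x) - (y - t) / (y - x) = (t - s) / (y - x)" by (simp add: diff_divide_distrib[symmetric])
  finally show ?thesis using assms by (simp add: abs_divide abs_minus_commute)
qed

context found_chains
begin

lemma envelope_product_bound:
  assumes "0 \<le> l" "0 \<le> q" "q + 1 \<le> p"
  shows "(\<integral>\<^sup>+\<omega>. ennreal (U \<omega>) * ennreal (l * envelope \<omega> powr q) \<partial>M)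
    \<le> ennreal (l * expectation (\<lambda>\<omega>. envelope \<omega> powr (q + 1)))"
proof -
  have i: "integrable M (\<lambda>\<omega>. l * envelope \<omega> powr (q + 1))"
    using assms by (intro integrable_mult_right envelope_powr_integrable) auto
  have "(\<integral>\<^sup>+\<omega>. ennreal (U \<omega>) * ennreal (l * envelope \<omega> powr q) \<partial>M) \<le> (\<integral>\<^sup>+\<omega>. ennreal (l * envelope \<omega> powr (q + 1)) \<partial>M)"
  proof (rule nn_integral_mono_AE)
    show "AE \<omega> in M. ennreal (U \<omega>) * ennreal (l * envelope \<omega> powr q) \<le> ennreal (l * envelope \<omega> powr (q + 1))"
      using U_nonneg W_nonneg
    proof eventually_elim
      case (elim \<omega>)
      have e: "0 \<le> envelope \<omega>" "U \<omega> \<le> envelope \<omega>" using elim by (auto simp: envelope_def)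
      have "U \<omega> * (l * envelope \<omega> powr q) \<le> envelope \<omega> * (l * envelope \<omega> powr q)"
        using e assms by (intro mult_right_mono) auto
      also have "\<dots> = l * envelope \<omega> powr (q + 1)"
        using e by (cases "envelope \<omega> = 0") (simp_all add: powr_add)
      finally show ?case
        using elim assms by (simp add: ennreal_mult[symmetric] ennreal_leI)
    qed
  qed
  also have "\<dots> = ennreal (l * expectation (\<lambda>\<omega>. envelope \<omega> powr (q + 1)))"
    using assms by (subst nn_integral_eq_integral[OF i]) auto
  finally show ?thesis .
qed

text \<open>Lipschitz step functions suffice for weak convergence, and for them Palm inversion has an error
  \<open>O(\<epsilon>)\<close>.  For the moments, powers of \<open>x\<close> and \<open>y + envelope\<close> are compared for an exponent \<open>m'\<close>
  between \<open>m\<close> and \<open>p - 1\<close>; the segment length raises the moment of the envelope to order \<open>m' + 1 \<le> p\<close>.\<close>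

lemma stationary_limit:
  fixes \<beta> r :: "real \<Rightarrow> real" and c :: real and \<pi>0 :: "nat \<Rightarrow> real measure"
  assumes \<beta>: "\<And>t. 0 < t \<Longrightarrow> (\<beta> has_real_derivative 2 / \<sigma>2 * B t) (at t)"
    and r: "r \<in> borel_measurable borel" "\<And>t. 0 \<le> r t" "\<And>t. t < 0 \<Longrightarrow> r t = 0"
    and r_eq: "\<And>t. 0 < t \<Longrightarrow> r t = c * exp (\<beta> t)" and c: "0 < c"
    and P: "P = density lborel (\<lambda>x. ennreal (r x))" "prob_space P"
    and \<pi>0: "\<And>n. prob_space (\<pi>0 n)" "\<And>n. sets (\<pi>0 n) = sets borel"
    and inversion: "\<And>n g. g \<in> borel_measurable borel \<Longrightarrow>
      ennreal (\<epsilon> n) * (\<integral>\<^sup>+x. g x \<partial>\<pi>0 n) = inversion_integral n g"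
  shows "weak_conv_m \<pi>0 P"
    and "\<And>m. 0 < m \<Longrightarrow> m < p - 1 \<Longrightarrow> (\<forall>\<^sub>F n in sequentially. integrable (\<pi>0 n) (\<lambda>x. x powr m))
      \<and> integrable P (\<lambda>x. x powr m) \<and> (\<lambda>n. \<integral>x. x powr m \<partial>\<pi>0 n) \<longlonglongrightarrow> (\<integral>x. x powr m \<partial>P)"
proof -
  have spaces: "space (\<pi>0 n) = UNIV" for n using sets_eq_imp_space_eq[OF \<pi>0(2)] by simp
  have rd: "real_distribution (\<pi>0 n)" for n
    using \<pi>0 spaces by (simp add: real_distribution_def real_distribution_axioms_def)
  have rdP: "real_distribution P"
    using P by (simp add: real_distribution_def real_distribution_axioms_def)
  interpret \<pi>0: real_distribution "\<pi>0 n" for n by (rule rd)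
  have cancel: "a \<le> b" if "ennreal (\<epsilon> n) * a \<le> ennreal (\<epsilon> n) * b" for n a b
  proof -
    have e1: "ennreal (1 / \<epsilon> n) * (ennreal (\<epsilon> n) * d) = d" for d
      using \<epsilon>_pos[of n] by (simp add: mult.assoc[symmetric] ennreal_mult[symmetric])
    have "ennreal (1 / \<epsilon> n) * (ennreal (\<epsilon> n) * a) \<le> ennreal (1 / \<epsilon> n) * (ennreal (\<epsilon> n) * b)"
      by (rule mult_left_mono[OF that]) simp
    then show ?thesis unfolding e1 .
  qed
  have nn: "AE x in \<pi>0 n. 0 \<le> x" for n
  proof -
    have "ennreal (\<epsilon> n) * (\<integral>\<^sup>+x. indicator {..<0} x \<partial>\<pi>0 n) = 0"
      by (subst inversion) (simp_all add: inversion_integral_def)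
    then have "(\<integral>\<^sup>+x. indicator {..<0} x \<partial>\<pi>0 n) = 0" using \<epsilon>_pos[of n] by simp
    then have "emeasure (\<pi>0 n) {..<0} = 0" by simp
    then have "AE x in \<pi>0 n. x \<notin> {..<0}" by (intro AE_not_in) auto
    then show ?thesis by eventually_elim simp
  qed
  have nnP: "AE x in P. 0 \<le> x"
    unfolding P(1) using r by (subst AE_density) (auto intro!: AE_I2 simp: not_less[symmetric])
  define E2 where "E2 = expectation (\<lambda>\<omega>. envelope \<omega> powr (1 + 1))"
  have E2: "0 \<le> E2" unfolding E2_def by (rule Bochner_Integration.integral_nonneg) simp
  show wc: "weak_conv_m \<pi>0 P"
  proof (rule integral_cts_step_conv_imp_weak_conv[OF rd rdP])
    fix x y :: real assume xy: "x < y"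
    let ?g = "cts_step x y"
    define L where "L = 1 / (y - x)"
    have L: "0 \<le> L" using xy by (simp add: L_def)
    have gL: "\<bar>?g s - ?g t\<bar> \<le> L * \<bar>s - t\<bar>" for s t using cts_step_Lipschitz[OF xy, of s t] by (simp add: L_def)
    have g01: "0 \<le> ?g t" "?g t \<le> 1" for t using cts_step_bounds[OF xy] by auto
    have gc: "continuous_on UNIV ?g"
      using cts_step_uniformly_continuous[OF xy] by (rule uniformly_continuous_imp_continuous)
    have gm [measurable]: "?g \<in> borel_measurable borel" by (rule borel_measurable_continuous_onI[OF gc])
    have l: "(\<lambda>n. \<integral>\<zeta>. ?g (snd \<zeta>) \<partial>\<nu> n) \<longlonglongrightarrow> (\<integral>x. ?g x \<partial>P)"
      by (rule found_limit[OF \<beta> r r_eq c P gc, of 1]) (use g01 in auto)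
    have close: "\<forall>\<^sub>F n in sequentially. \<bar>(\<integral>x. ?g x \<partial>\<pi>0 n) - (\<integral>\<zeta>. ?g (snd \<zeta>) \<partial>\<nu> n)\<bar> \<le> L * \<epsilon> n * E2"
      using \<rho>_le_2
    proof eventually_elim
      case (elim n)
      define K where "K t = ennreal (L * \<epsilon> n * t powr 1)" for t
      have K [measurable]: "K \<in> borel_measurable borel" unfolding K_def by measurable
      have Kle: "(\<integral>\<^sup>+\<omega>. ennreal (U \<omega>) * K (envelope \<omega>) \<partial>M) \<le> ennreal (L * \<epsilon> n * E2)"
        unfolding K_def E2_def using L \<epsilon>_pos[of n] p by (intro envelope_product_bound) auto
      have step: "ennreal (?g s) \<le> ennreal (?g s') + K t" if "0 \<le> t" "\<bar>s - s'\<bar> \<le> \<epsilon> n * t" for s s' t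
      proof -
        have "?g s \<le> ?g s' + L * \<bar>s - s'\<bar>" using gL[of s s'] by linarith
        also have "\<dots> \<le> ?g s' + L * (\<epsilon> n * t)" using that L by (intro add_left_mono mult_left_mono)
        finally have "ennreal (?g s) \<le> ennreal (?g s' + L * (\<epsilon> n * t))" by (rule ennreal_leI)
        also have "\<dots> = ennreal (?g s') + ennreal (L * (\<epsilon> n * t))"
          using g01 L \<epsilon>_pos[of n] that by (intro ennreal_plus) auto
        also have "ennreal (L * (\<epsilon> n * t)) = K t" using that by (simp add: K_def mult.assoc)
        finally show ?thesis .
      qed
      have i1: "integrable (\<pi>0 n) ?g" by (rule \<pi>0.integrable_const_bound[where B = 1]) (use g01 in auto)
      have i2: "integrable (\<nu> n) (\<lambda>\<zeta>. ?g (snd \<zeta>))"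
        by (rule \<nu>.integrable_const_bound[where B = 1]) (use g01 in auto)
      have n1: "(\<integral>\<^sup>+x. ennreal (?g x) \<partial>\<pi>0 n) = ennreal (\<integral>x. ?g x \<partial>\<pi>0 n)"
        by (rule nn_integral_eq_integral[OF i1]) (use g01 in auto)
      have n2: "(\<integral>\<^sup>+\<zeta>. ennreal (?g (snd \<zeta>)) \<partial>\<nu> n) = ennreal (\<integral>\<zeta>. ?g (snd \<zeta>) \<partial>\<nu> n)"
        by (rule nn_integral_eq_integral[OF i2]) (use g01 in auto)
      have p1: "0 \<le> (\<integral>x. ?g x \<partial>\<pi>0 n)" "0 \<le> (\<integral>\<zeta>. ?g (snd \<zeta>) \<partial>\<nu> n)"
        by (rule Bochner_Integration.integral_nonneg, simp add: g01)+
      have p2: "0 \<le> L * \<epsilon> n * E2" using L \<epsilon>_pos[of n] E2 by simp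
      have gm': "(\<lambda>x. ennreal (?g x)) \<in> borel_measurable borel" by measurable
      have "ennreal (\<epsilon> n) * (\<integral>\<^sup>+x. ennreal (?g x) \<partial>\<pi>0 n)
          \<le> ennreal (\<epsilon> n) * ((\<integral>\<^sup>+\<zeta>. ennreal (?g (snd \<zeta>)) \<partial>\<nu> n) + (\<integral>\<^sup>+\<omega>. ennreal (U \<omega>) * K (envelope \<omega>) \<partial>M))"
        unfolding inversion[OF gm']
        by (rule inversion_upper[OF elim, of "\<lambda>x. ennreal (?g x)" K]) (use step in auto)
      then have "(\<integral>\<^sup>+x. ennreal (?g x) \<partial>\<pi>0 n) \<le> (\<integral>\<^sup>+\<zeta>. ennreal (?g (snd \<zeta>)) \<partial>\<nu> n) + ennreal (L * \<epsilon> n * E2)"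
        by (rule order_trans[OF cancel add_left_mono[OF Kle]])
      then have u: "(\<integral>x. ?g x \<partial>\<pi>0 n) \<le> (\<integral>\<zeta>. ?g (snd \<zeta>) \<partial>\<nu> n) + L * \<epsilon> n * E2"
        unfolding n1 n2 using p1 p2 by (simp add: ennreal_plus[symmetric] ennreal_le_iff del: ennreal_plus)
      have "ennreal (\<epsilon> n) * (\<integral>\<^sup>+\<zeta>. ennreal (?g (snd \<zeta>)) \<partial>\<nu> n)
          \<le> ennreal (\<epsilon> n) * (\<integral>\<^sup>+x. ennreal (?g x) \<partial>\<pi>0 n) + ennreal (\<epsilon> n) * (\<integral>\<^sup>+\<omega>. ennreal (U \<omega>) * K (envelope \<omega>) \<partial>M)"
        unfolding inversion[OF gm']
        by (rule inversion_lower[OF elim, of "\<lambda>x. ennreal (?g x)" K])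
          (use step in \<open>auto simp: abs_minus_commute\<close>)
      then have "(\<integral>\<^sup>+\<zeta>. ennreal (?g (snd \<zeta>)) \<partial>\<nu> n) \<le> (\<integral>\<^sup>+x. ennreal (?g x) \<partial>\<pi>0 n) + ennreal (L * \<epsilon> n * E2)"
        unfolding distrib_left[symmetric] by (rule order_trans[OF cancel add_left_mono[OF Kle]])
      then have "(\<integral>\<zeta>. ?g (snd \<zeta>) \<partial>\<nu> n) \<le> (\<integral>x. ?g x \<partial>\<pi>0 n) + L * \<epsilon> n * E2"
        unfolding n1 n2 using p1 p2 by (simp add: ennreal_plus[symmetric] ennreal_le_iff del: ennreal_plus)
      then show ?case using u by linarith
    qed
    have "(\<lambda>n. L * \<epsilon> n * E2) \<longlonglongrightarrow> L * 0 * E2" by (intro tendsto_intros \<epsilon>_lim)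
    then have null: "(\<lambda>n. L * \<epsilon> n * E2) \<longlonglongrightarrow> 0" by simp
    have "(\<lambda>n. (\<integral>x. ?g x \<partial>\<pi>0 n) - (\<integral>\<zeta>. ?g (snd \<zeta>) \<partial>\<nu> n)) \<longlonglongrightarrow> 0"
      by (rule Lim_null_comparison[OF close[folded real_norm_def] null])
    from tendsto_add[OF this l] show "(\<lambda>n. \<integral>x. ?g x \<partial>\<pi>0 n) \<longlonglongrightarrow> (\<integral>x. ?g x \<partial>P)" by simp
  qed
  fix m :: real assume m: "0 < m" "m < p - 1"
  define m' where "m' = (max m 1 + (p - 1)) / 2"
  have m': "m < m'" "1 < m'" "m' < p - 1" using m p by (auto simp: m'_def max_def)
  obtain C1 where C1: "0 \<le> C1" "\<forall>\<^sub>F n in sequentially. (\<integral>\<^sup>+\<zeta>. ennreal (snd \<zeta> powr m') \<partial>\<nu> n) \<le> ennreal C1"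
    using uniform_moment_bound[OF m'(2,3)] by blast
  define E' where "E' = expectation (\<lambda>\<omega>. envelope \<omega> powr (m' + 1))"
  have E': "0 \<le> E'" unfolding E'_def by (rule Bochner_Integration.integral_nonneg) simp
  define C where "C = 2 powr m' * C1 + 2 powr m' * E'"
  have C: "0 \<le> C" using C1 E' by (simp add: C_def)
  have "\<forall>\<^sub>F n in sequentially. (\<integral>\<^sup>+x. ennreal (x powr m') \<partial>\<pi>0 n) \<le> ennreal C"
    using C1(2) \<rho>_le_2 small_\<epsilon>[OF zero_less_one]
  proof eventually_elim
    case (elim n)
    define A where "A y = ennreal (2 powr m' * y powr m')" for y
    define K where "K t = ennreal (2 powr m' * t powr m')" for t
    have [measurable]: "A \<in> borel_measurable borel" "K \<in> borel_measurable borel" unfolding A_def K_def by measurable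
    have gm': "(\<lambda>x. ennreal (x powr m')) \<in> borel_measurable borel" by measurable
    have "ennreal (\<epsilon> n) * (\<integral>\<^sup>+x. ennreal (x powr m') \<partial>\<pi>0 n)
        \<le> ennreal (\<epsilon> n) * ((\<integral>\<^sup>+\<zeta>. A (snd \<zeta>) \<partial>\<nu> n) + (\<integral>\<^sup>+\<omega>. ennreal (U \<omega>) * K (envelope \<omega>) \<partial>M))"
      unfolding inversion[OF gm']
    proof (rule inversion_upper[OF elim(2)])
      fix x y t :: real assume xyt: "0 \<le> x" "0 \<le> y" "0 \<le> t" "\<bar>x - y\<bar> \<le> \<epsilon> n * t"
      have "\<epsilon> n * t \<le> 1 * t" using elim(3) xyt by (intro mult_right_mono) auto
      then have "x \<le> y + t" using xyt by linarith
      then have "x powr m' \<le> (y + t) powr m'" using xyt m' by (intro powr_mono2) auto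
      also have "\<dots> \<le> 2 powr m' * (y powr m' + t powr m')" using xyt m' by (intro powr_add_le) auto
      finally have "ennreal (x powr m') \<le> ennreal (2 powr m' * y powr m' + 2 powr m' * t powr m')"
        by (intro ennreal_leI) (simp add: distrib_left)
      also have "\<dots> = A y + K t" unfolding A_def K_def by (rule ennreal_plus) auto
      finally show "ennreal (x powr m') \<le> A y + K t" .
    qed measurable
    then have "(\<integral>\<^sup>+x. ennreal (x powr m') \<partial>\<pi>0 n) \<le> (\<integral>\<^sup>+\<zeta>. A (snd \<zeta>) \<partial>\<nu> n) + (\<integral>\<^sup>+\<omega>. ennreal (U \<omega>) * K (envelope \<omega>) \<partial>M)"
      by (rule cancel)
    also have "\<dots> \<le> ennreal (2 powr m' * C1) + ennreal (2 powr m' * E')"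
    proof (rule add_mono)
      have "(\<integral>\<^sup>+\<zeta>. A (snd \<zeta>) \<partial>\<nu> n) = ennreal (2 powr m') * (\<integral>\<^sup>+\<zeta>. ennreal (snd \<zeta> powr m') \<partial>\<nu> n)"
        unfolding A_def by (simp add: ennreal_mult nn_integral_cmult)
      also have "\<dots> \<le> ennreal (2 powr m') * ennreal C1" by (rule mult_left_mono[OF elim(1)]) simp
      finally show "(\<integral>\<^sup>+\<zeta>. A (snd \<zeta>) \<partial>\<nu> n) \<le> ennreal (2 powr m' * C1)"
        using C1(1) by (simp add: ennreal_mult)
      show "(\<integral>\<^sup>+\<omega>. ennreal (U \<omega>) * K (envelope \<omega>) \<partial>M) \<le> ennreal (2 powr m' * E')"
        unfolding K_def E'_def using m' by (intro envelope_product_bound) auto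
    qed
    also have "\<dots> = ennreal C" unfolding C_def using C1 E' by (intro ennreal_plus[symmetric]) auto
    finally show ?case .
  qed
  from weak_conv_moments[OF rd rdP wc nn nnP m(1) m'(1) this C]
  show "(\<forall>\<^sub>F n in sequentially. integrable (\<pi>0 n) (\<lambda>x. x powr m))
      \<and> integrable P (\<lambda>x. x powr m) \<and> (\<lambda>n. \<integral>x. x powr m \<partial>\<pi>0 n) \<longlonglongrightarrow> (\<integral>x. x powr m \<partial>P)"
    by blast
qed

end

section \<open>Heavy traffic limit of the stationary laws\<close>

context abandonment_queues
begin

lemma expectation_product:
  fixes f g h :: "real \<Rightarrow> real"
  assumes n: "1 \<le> n" and [measurable]: "f \<in> borel_measurable borel" "g \<in> borel_measurable borel" "h \<in> borel_measurable borel"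
    and i: "integrable M (\<lambda>\<omega>. f (u 2 \<omega>))" "integrable M (\<lambda>\<omega>. g (v 1 \<omega>))" "integrable M (\<lambda>\<omega>. h (d n 1 \<omega>))"
  shows "expectation (\<lambda>\<omega>. f (u 2 \<omega>) * g (v 1 \<omega>) * h (d n 1 \<omega>))
    = expectation (\<lambda>\<omega>. f (u 2 \<omega>)) * expectation (\<lambda>\<omega>. g (v 1 \<omega>)) * expectation (\<lambda>\<omega>. h (d n 1 \<omega>))"
proof -
  let ?X = "case_sum u (case_sum v (d n))"
  let ?F = "case_sum (\<lambda>_. f) (case_sum (\<lambda>_. g) (\<lambda>_. h)) :: nat + nat + nat \<Rightarrow> real \<Rightarrow> real"
  let ?I = "{Inl 2, Inr (Inl 1), Inr (Inr 1)} :: (nat + nat + nat) set"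
  have "indep_vars (\<lambda>_. borel) (\<lambda>i \<omega>. ?F i (?X i \<omega>)) ?I"
    by (rule indep_vars_compose2[where M' = "\<lambda>_. borel", OF indep_vars_subset[OF indep[OF n]]])
      (auto split: sum.split)
  then have "expectation (\<lambda>\<omega>. \<Prod>i\<in>?I. ?F i (?X i \<omega>)) = (\<Prod>i\<in>?I. expectation (\<lambda>\<omega>. ?F i (?X i \<omega>)))"
    by (rule indep_vars_lebesgue_integral[rotated]) (use i in auto)
  then show ?thesis by (simp add: mult.assoc)
qed

text \<open>Variance and moment condition refer to the second service time, the recursion to the first.\<close>

lemma v_transfer:
  fixes f :: "real \<Rightarrow> real"
  assumes [measurable]: "f \<in> borel_measurable borel"
  shows "integrable M (\<lambda>\<omega>. f (v 2 \<omega>)) \<longleftrightarrow> integrable M (\<lambda>\<omega>. f (v 1 \<omega>))"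
    and "expectation (\<lambda>\<omega>. f (v 2 \<omega>)) = expectation (\<lambda>\<omega>. f (v 1 \<omega>))"
proof -
  have m: "random_variable borel (v 1)" "random_variable borel (v 2)" using v_measurable by auto
  have e: "distr M borel (v 2) = distr M borel (v 1)" by (rule v_ident) simp
  show "integrable M (\<lambda>\<omega>. f (v 2 \<omega>)) \<longleftrightarrow> integrable M (\<lambda>\<omega>. f (v 1 \<omega>))"
    using integrable_distr_eq[OF m(2) assms] integrable_distr_eq[OF m(1) assms] e by simp
  show "expectation (\<lambda>\<omega>. f (v 2 \<omega>)) = expectation (\<lambda>\<omega>. f (v 1 \<omega>))"
    using integral_distr[OF m(2) assms] integral_distr[OF m(1) assms] e by simp
qed

lemma patience_tail:
  assumes n: "1 \<le> n" and c: "0 < c"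
  shows "prob {\<omega> \<in> space M. z < c * d n 1 \<omega>} = 1 - F n (z / c)"
proof -
  have m [measurable]: "random_variable borel (d n 1)" using d_measurable[OF n] by simp
  have "F n (z / c) = measure (distr M borel (d n 1)) {..z / c}"
    using d_cdf[OF n order_refl] by (simp add: cdf_def fun_eq_iff)
  also have "\<dots> = prob (d n 1 -` {..z / c} \<inter> space M)" by (rule measure_distr) measurable
  also have "d n 1 -` {..z / c} \<inter> space M = {\<omega> \<in> space M. \<not> z < c * d n 1 \<omega>}"
    using c by (auto simp: not_less field_simps)
  finally have e: "F n (z / c) = prob {\<omega> \<in> space M. \<not> z < c * d n 1 \<omega>}" .
  have "prob {\<omega> \<in> space M. \<not> z < c * d n 1 \<omega>} = 1 - prob {\<omega> \<in> space M. z < c * d n 1 \<omega>}"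
    by (rule prob_neg) measurable
  then show ?thesis by (simp add: e)
qed

end

lemma LBINT_derivative:
  fixes H :: "real \<Rightarrow> real"
  assumes H: "continuous_on {0..} H" and t: "0 < t"
  shows "((\<lambda>x. LBINT s:{0..x}. H s) has_real_derivative H t) (at t)"
proof -
  have Hc: "continuous_on {0..b} H" for b by (rule continuous_on_subset[OF H]) auto
  have eq: "(LBINT s:{0..x}. H s) = integral {0..x} H" for x
    by (rule set_borel_integral_eq_integral(2)) (rule borel_integrable_atLeastAtMost'[OF Hc])
  have "((\<lambda>x. integral {0..x} H) has_real_derivative H t) (at t within {0..t + 1})"
    by (rule integral_has_real_derivative[OF Hc]) (use t in auto)
  moreover have "at t within {0..t + 1} = at t" using t by (intro at_within_interior) auto
  ultimately show ?thesis by (simp add: eq)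
qed

text \<open>The queues with a stationary law fit the abstract sequence of chains after an index shift.  Since
  \<open>\<rho> P(z < D) - 1\<close> is \<open>(\<rho> - 1) - \<rho> F(z / \<surd>n)\<close>, the drift per \<open>\<epsilon>\<^sup>2\<close> is \<open>\<lambda> \<surd>n\<close> times this and tends to
  \<open>\<theta> - \<lambda> H z\<close>.  The exponent of the limit density is the antiderivative of \<open>2 / \<sigma>\<^sup>2\<close> times the
  drift: the chain has variance \<open>var u + var v = \<lambda> \<sigma>\<^sup>2\<close>, which turns the drift into
  \<open>\<theta> / \<lambda> - H\<close>.\<close>

theorem theorem2:
  fixes M :: "'a measure"
    and u v :: "nat \<Rightarrow> 'a \<Rightarrow> real" and d :: "nat \<Rightarrow> nat \<Rightarrow> 'a \<Rightarrow> real"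
    and F :: "nat \<Rightarrow> real \<Rightarrow> real" and \<Lambda> \<mu> :: "nat \<Rightarrow> real"
    and V :: "nat \<Rightarrow> real \<times> real \<Rightarrow> real \<Rightarrow> 'a \<Rightarrow> real"
    and p lam \<theta> \<sigma>2 C :: real and H H' :: "real \<Rightarrow> real" and L :: ereal
    and \<pi> :: "nat \<Rightarrow> (real \<times> real) measure" and \<pi>0 :: "nat \<Rightarrow> real measure"
    and P :: "real measure"
  assumes model: "abandonment_queues M u v d F \<Lambda> \<mu> V"
    and A1: "2 < p" "integrable M (\<lambda>\<omega>. u 2 \<omega> powr p + v 2 \<omega> powr p)"
    and A2: "0 < lam" "\<And>n. 1 \<le> n \<Longrightarrow> \<Lambda> n = real n * lam"
      "(\<lambda>n. \<mu> n / real n) \<longlonglongrightarrow> lam"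
      "(\<lambda>n. sqrt (real n) * (lam - \<mu> n / real n)) \<longlonglongrightarrow> \<theta>"
    and A3: "\<And>n. 1 \<le> n \<Longrightarrow> F n 0 = 0"
      "\<And>x. 0 \<le> x \<Longrightarrow> 0 \<le> H x"
      "\<And>x. 0 \<le> x \<Longrightarrow> (H has_real_derivative H' x) (at x within {0..})"
      "continuous_on {0..} H'"
      "\<And>K. 0 < K \<Longrightarrow>
        (\<lambda>n. SUP x\<in>{0..K}. \<bar>sqrt (real n) * F n (x / sqrt (real n)) - H x\<bar>) \<longlonglongrightarrow> 0"
    and A4: "((\<lambda>x. ereal (H x)) \<longlongrightarrow> L) at_top" "ereal (\<theta> / lam) < L"
    and A5: "\<And>x. 0 < x \<Longrightarrow> 0 < measure M {\<omega> \<in> space M. x \<le> u 2 \<omega>}"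
    and stationary: "\<forall>\<^sub>F n in sequentially.
      stationary_distribution M (scaled_queue_state u \<Lambda> V n) (\<pi> n)"
    and marginal: "\<And>n. \<pi>0 n = distr (\<pi> n) borel snd"
    and \<sigma>2: "\<sigma>2 = (prob_space.variance M (u 2) + prob_space.variance M (v 2)) / lam"
    and C: "0 < C" "(\<integral>\<^sup>+x\<in>{0..}. ennreal (limit_density C \<sigma>2 \<theta> lam H x) \<partial>lborel) = 1"
    and P: "P = density lborel (\<lambda>x. ennreal (limit_density C \<sigma>2 \<theta> lam H x) * indicator {0..} x)"
  shows "weak_conv_m \<pi>0 P
    \<and> (\<forall>m\<in>{0<..<p - 1}.
        (\<forall>\<^sub>F n in sequentially. integrable (\<pi>0 n) (\<lambda>x. x powr m))
        \<and> integrable P (\<lambda>x. x powr m)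
        \<and> (\<lambda>n. \<integral>x. x powr m \<partial>\<pi>0 n) \<longlonglongrightarrow> (\<integral>x. x powr m \<partial>P))"
proof -
  interpret Q: abandonment_queues M u v d F \<Lambda> \<mu> V by (rule model)
  obtain N where N: "1 \<le> N" "\<And>n. N \<le> n \<Longrightarrow> stationary_distribution M (scaled_queue_state u \<Lambda> V n) (\<pi> n)"
    using stationary unfolding eventually_sequentially
  proof (elim exE)
    fix N0 assume "\<forall>n\<ge>N0. stationary_distribution M (scaled_queue_state u \<Lambda> V n) (\<pi> n)"
    then show thesis by (intro that[of "max 1 N0"]) auto
  qed
  \<comment> \<open>Stationary laws are available from \<open>N\<close> on only; a shift by \<open>N\<close> makes all members of the
    sequence chains with an invariant law and affects no limit.\<close>
  define idx where "idx k = k + N" for k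
  have idx1: "1 \<le> idx k" and idxN: "N \<le> idx k" for k using N(1) by (auto simp: idx_def)
  define \<epsilon> where "\<epsilon> k = sqrt (idx k) / \<Lambda> (idx k)" for k
  define \<rho> where "\<rho> k = \<Lambda> (idx k) / \<mu> (idx k)" for k
  define D where "D k \<omega> = sqrt (idx k) * d (idx k) 1 \<omega>" for k \<omega>
  \<comment> \<open>The values of \<open>H\<close> on the negative half-line are arbitrary.  Replacing them by \<open>H 0\<close> makes the
    drift continuous on the whole line.\<close>
  define B where "B z = \<theta> - lam * H (max 0 z)" for z
  have seg: "(\<lambda>k. f (idx k)) \<longlonglongrightarrow> l" if "f \<longlonglongrightarrow> l" for f :: "nat \<Rightarrow> real" and l
    unfolding idx_def using that by (rule LIMSEQ_ignore_initial_segment)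
  have sq: "0 < sqrt (real (idx k))" for k using idx1[of k] by simp
  have \<Lambda>pos: "0 < \<Lambda> (idx k)" "0 < \<mu> (idx k)" for k using Q.rates_pos[OF idx1] by auto
  have \<epsilon>_eq: "\<epsilon> k = 1 / (lam * sqrt (idx k))" for k
    using A2(2)[OF idx1[of k]] A2(1) sq[of k] by (simp add: \<epsilon>_def field_simps real_sqrt_mult_self)
  have \<epsilon>\<rho>: "sqrt (idx k) / \<mu> (idx k) = \<epsilon> k * \<rho> k" for k
    using \<Lambda>pos[of k] by (simp add: \<epsilon>_def \<rho>_def)
  have \<epsilon>lim: "\<epsilon> \<longlonglongrightarrow> 0"
  proof -
    have "filterlim (\<lambda>n. sqrt (real n)) at_top sequentially"
      by (rule filterlim_compose[OF sqrt_at_top filterlim_real_sequentially])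
    then have "filterlim (\<lambda>n. lam * sqrt (real n)) at_top sequentially"
      by (rule filterlim_tendsto_pos_mult_at_top[OF tendsto_const A2(1)])
    then have "(\<lambda>n. 1 / (lam * sqrt (real n))) \<longlonglongrightarrow> 0"
      by (intro real_tendsto_divide_at_top[OF tendsto_const])
    from seg[OF this] show ?thesis by (simp add: \<epsilon>_eq[abs_def])
  qed
  have \<rho>_eq: "\<rho> k = lam / (\<mu> (idx k) / real (idx k))" for k
    using A2(2)[OF idx1[of k]] idx1[of k] by (simp add: \<rho>_def)
  have \<rho>lim: "\<rho> \<longlonglongrightarrow> 1"
  proof -
    have "(\<lambda>n. lam / (\<mu> n / real n)) \<longlonglongrightarrow> lam / lam" using A2 by (intro tendsto_divide tendsto_const) auto
    from seg[OF this] show ?thesis using A2(1) by (simp add: \<rho>_eq[abs_def])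
  qed
  have \<rho>drift: "(\<lambda>k. sqrt (idx k) * (\<rho> k - 1)) \<longlonglongrightarrow> \<theta> / lam"
  proof -
    have "(\<lambda>n. sqrt (real n) * (lam - \<mu> n / real n) / (\<mu> n / real n)) \<longlonglongrightarrow> \<theta> / lam"
      using A2 by (intro tendsto_divide) auto
    from seg[OF this]
    have "(\<lambda>k. sqrt (idx k) * (lam - \<mu> (idx k) / idx k) / (\<mu> (idx k) / idx k)) \<longlonglongrightarrow> \<theta> / lam" .
    moreover have "sqrt (idx k) * (lam - \<mu> (idx k) / idx k) / (\<mu> (idx k) / idx k) = sqrt (idx k) * (\<rho> k - 1)" for k
    proof -
      have "0 < \<mu> (idx k) / idx k" using \<Lambda>pos[of k] idx1[of k] by simp
      moreover have "s * (l - x) / x = s * (l / x - 1)" if "0 < x" for s l x :: real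
        using that by (simp add: field_simps)
      ultimately show ?thesis unfolding \<rho>_eq by blast
    qed
    ultimately show ?thesis by simp
  qed
  have Hc: "continuous_on {0..} H"
    unfolding continuous_on_eq_continuous_within using A3(3) by (auto intro: DERIV_continuous)
  have u_meas: "u 2 \<in> borel_measurable M" using Q.u_measurable by simp
  have v_meas: "v 1 \<in> borel_measurable M" "v 2 \<in> borel_measurable M" using Q.v_measurable by auto
  have u_p: "integrable M (\<lambda>\<omega>. u 2 \<omega> powr p)" and v2_p: "integrable M (\<lambda>\<omega>. v 2 \<omega> powr p)"
    by (rule Bochner_Integration.integrable_bound[OF A1(2)]; use u_meas v_meas in simp)+
  have v_p: "integrable M (\<lambda>\<omega>. v 1 \<omega> powr p)"
    using v2_p Q.v_transfer(1)[of "\<lambda>x. x powr p"] by simp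
  have sq_int: "integrable M (\<lambda>\<omega>. (X \<omega>)\<^sup>2)"
    if X: "X \<in> borel_measurable M" "AE \<omega> in M. 0 \<le> X \<omega>" "integrable M (\<lambda>\<omega>. X \<omega> powr p)" for X
  proof (rule Bochner_Integration.integrable_bound[of _ "\<lambda>\<omega>. 1 + X \<omega> powr p"])
    show "AE \<omega> in M. norm ((X \<omega>)\<^sup>2) \<le> norm (1 + X \<omega> powr p)"
      using X(2)
    proof eventually_elim
      case (elim \<omega>)
      have "(X \<omega>)\<^sup>2 \<le> 1 + X \<omega> powr p"
      proof (cases "X \<omega> \<le> 1")
        case True
        then have "(X \<omega>)\<^sup>2 \<le> 1" using elim by (simp add: power_le_one)
        then show ?thesis by (simp add: add_increasing2)
      next
        case False
        then have "X \<omega> powr 2 \<le> X \<omega> powr p" using A1 by (intro powr_mono) auto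
        then show ?thesis using False by simp
      qed
      then show ?case by simp
    qed
  qed (use X in simp_all)
  have u_sq: "integrable M (\<lambda>\<omega>. (u 2 \<omega>)\<^sup>2)" and v_sq: "integrable M (\<lambda>\<omega>. (v 1 \<omega>)\<^sup>2)"
    using sq_int[OF u_meas _ u_p] sq_int[OF v_meas(1) _ v_p] Q.u_nonneg Q.v_nonneg by auto
  have var_u: "Q.variance (u 2) = Q.expectation (\<lambda>\<omega>. (u 2 \<omega>)\<^sup>2) - 1"
    using Q.variance_eq[OF Q.u_mean(1) u_sq] Q.u_mean(2) by simp
  have var_v: "Q.variance (v 2) = Q.expectation (\<lambda>\<omega>. (v 1 \<omega>)\<^sup>2) - 1"
  proof -
    have "Q.variance (v 2) = Q.variance (v 1)"
      using Q.v_transfer(2)[of "\<lambda>x. x"] Q.v_transfer(2)[of "\<lambda>x. (x - Q.expectation (v 1))\<^sup>2"] by simp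
    then show ?thesis using Q.variance_eq[OF Q.v_mean(1) v_sq] Q.v_mean(2) by simp
  qed
  define s2 where "s2 = Q.expectation (\<lambda>\<omega>. (u 2 \<omega>)\<^sup>2) + Q.expectation (\<lambda>\<omega>. (v 1 \<omega>)\<^sup>2) - 2"
  have s2: "s2 = lam * \<sigma>2" using A2(1) by (simp add: s2_def \<sigma>2 var_u var_v)
  have var_pos: "0 < s2"
  proof -
    have vu: "0 \<le> Q.variance (u 2)" by (rule Q.variance_positive)
    have vv: "0 \<le> Q.variance (v 2)" by (rule Q.variance_positive)
    \<comment> \<open>Unbounded interarrival times cannot be almost surely equal to their mean 1.\<close>
    have "Q.variance (u 2) \<noteq> 0"
    proof
      assume z: "Q.variance (u 2) = 0"
      have i: "integrable M (\<lambda>\<omega>. (u 2 \<omega> - Q.expectation (u 2))\<^sup>2)"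
        using u_sq Q.u_mean by (simp add: power2_diff)
      have "AE \<omega> in M. (u 2 \<omega> - Q.expectation (u 2))\<^sup>2 = 0"
        using z by (subst (asm) integral_nonneg_eq_0_iff_AE[OF i]) auto
      then have "AE \<omega> in M. \<not> 2 \<le> u 2 \<omega>" by eventually_elim (simp add: Q.u_mean)
      then have "measure M {\<omega> \<in> space M. 2 \<le> u 2 \<omega>} = 0"
        using u_meas by (subst Q.prob_eq_0) auto
      then show False using A5[of 2] by simp
    qed
    then have "0 < Q.variance (u 2) + Q.variance (v 2)" using vu vv by linarith
    then show ?thesis by (simp add: s2_def var_u var_v)
  qed
  have tail: "Q.prob {\<omega> \<in> space M. z < D k \<omega>} = 1 - F (idx k) (z / sqrt (idx k))" for k z
    unfolding D_def by (rule Q.patience_tail[OF idx1 sq])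
  have D_meas: "D k \<in> borel_measurable M" for k
    using Q.d_measurable[OF idx1[of k], of 1] unfolding D_def by simp
  have survive: "Q.expectation (\<lambda>\<omega>. f (u 2 \<omega>) * g (v 1 \<omega>) * of_bool (z < D k \<omega>))
      = Q.expectation (\<lambda>\<omega>. f (u 2 \<omega>)) * Q.expectation (\<lambda>\<omega>. g (v 1 \<omega>)) * Q.prob {\<omega> \<in> space M. z < D k \<omega>}"
    if fg: "f \<in> borel_measurable borel" "g \<in> borel_measurable borel"
      "integrable M (\<lambda>\<omega>. f (u 2 \<omega>))" "integrable M (\<lambda>\<omega>. g (v 1 \<omega>))" for f g :: "real \<Rightarrow> real" and z k
  proof -
    define h :: "real \<Rightarrow> real" where "h y = of_bool (z < sqrt (idx k) * y)" for y
    have h [measurable]: "h \<in> borel_measurable borel" unfolding h_def by measurable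
    have dm [measurable]: "d (idx k) 1 \<in> borel_measurable M" by (rule Q.d_measurable[OF idx1 order_refl])
    have hi: "integrable M (\<lambda>\<omega>. h (d (idx k) 1 \<omega>))"
    proof (rule Q.integrable_const_bound[where B = 1])
      show "AE \<omega> in M. norm (h (d (idx k) 1 \<omega>)) \<le> 1" by (simp add: h_def)
    qed (rule measurable_compose[OF dm h])
    have "Q.expectation (\<lambda>\<omega>. h (d (idx k) 1 \<omega>)) = Q.expectation (indicat_real {\<omega> \<in> space M. z < D k \<omega>})"
      by (intro Bochner_Integration.integral_cong) (auto simp: h_def D_def indicator_def)
    also have "\<dots> = Q.prob ({\<omega> \<in> space M. z < D k \<omega>} \<inter> space M)" by simp
    also have "{\<omega> \<in> space M. z < D k \<omega>} \<inter> space M = {\<omega> \<in> space M. z < D k \<omega>}" by auto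
    finally have "Q.expectation (\<lambda>\<omega>. h (d (idx k) 1 \<omega>)) = Q.prob {\<omega> \<in> space M. z < D k \<omega>}" .
    then show ?thesis
      using Q.expectation_product[OF idx1 fg(1,2) h fg(3,4) hi] by (simp add: h_def D_def)
  qed
  have drift: "\<forall>\<^sub>F k in sequentially. \<forall>z\<in>{0..K}. \<bar>(\<rho> k * Q.prob {\<omega> \<in> space M. z < D k \<omega>} - 1) / \<epsilon> k - B z\<bar> < e"
    if K: "0 < K" and e: "0 < e" for K e
  proof -
    have "compact (H ` {0..K})" by (intro compact_continuous_image continuous_on_subset[OF Hc]) auto
    then obtain h where h: "\<And>z. z \<in> {0..K} \<Longrightarrow> \<bar>H z\<bar> \<le> h"
      using compact_imp_bounded bounded_real by (metis image_eqI)
    have h0: "0 \<le> h" using h[of 0] K by fastforce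
    define S where "S n = (SUP x\<in>{0..K}. \<bar>sqrt (real n) * F n (x / sqrt (real n)) - H x\<bar>)" for n
    have S: "(\<lambda>k. S (idx k)) \<longlonglongrightarrow> 0" unfolding S_def using seg[OF A3(5)[OF K]] .
    have Fn: "0 \<le> F (idx k) x" "F (idx k) x \<le> 1" for k x
    proof -
      interpret rd: real_distribution "distr M borel (d (idx k) 1)"
        using Q.d_measurable[OF idx1[of k] order_refl]
        by (auto simp: real_distribution_def real_distribution_axioms_def intro!: Q.prob_space_distr)
      show "0 \<le> F (idx k) x" "F (idx k) x \<le> 1"
        using rd.cdf_nonneg[of x] rd.cdf_bounded_prob[of x] Q.d_cdf[OF idx1[of k] order_refl] by auto
    qed
    have SH: "\<bar>sqrt (idx k) * F (idx k) (z / sqrt (idx k)) - H z\<bar> \<le> S (idx k)" if z: "z \<in> {0..K}" for k z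
      unfolding S_def
    proof (rule cSUP_upper[OF z])
      show "bdd_above ((\<lambda>x. \<bar>sqrt (idx k) * F (idx k) (x / sqrt (idx k)) - H x\<bar>) ` {0..K})"
      proof (rule bdd_aboveI2)
        fix x assume x: "x \<in> {0..K}"
        have "\<bar>sqrt (idx k) * F (idx k) (x / sqrt (idx k))\<bar> \<le> sqrt (idx k) * 1"
          using Fn sq[of k] by (simp add: abs_mult mult_left_le)
        then show "\<bar>sqrt (idx k) * F (idx k) (x / sqrt (idx k)) - H x\<bar> \<le> sqrt (idx k) * 1 + h"
          using h[OF x] by linarith
      qed
    qed
    have "(\<lambda>k. lam * \<bar>sqrt (idx k) * (\<rho> k - 1) - \<theta> / lam\<bar> + lam * (\<bar>\<rho> k\<bar> * S (idx k) + \<bar>\<rho> k - 1\<bar> * h))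
        \<longlonglongrightarrow> lam * \<bar>\<theta> / lam - \<theta> / lam\<bar> + lam * (\<bar>1\<bar> * 0 + \<bar>1 - 1\<bar> * h)"
      by (intro tendsto_intros \<rho>drift \<rho>lim S)
    then have "\<forall>\<^sub>F k in sequentially. lam * \<bar>sqrt (idx k) * (\<rho> k - 1) - \<theta> / lam\<bar>
        + lam * (\<bar>\<rho> k\<bar> * S (idx k) + \<bar>\<rho> k - 1\<bar> * h) < e"
      using e by (intro order_tendstoD) auto
    then show ?thesis
    proof eventually_elim
      case (elim k)
      show ?case
      proof
        fix z assume z: "z \<in> {0..K}"
        have alg: "lam * a - lam * (b * G) - (lam * t - lam * w) = lam * (a - t) - lam * (b * (G - w) + (b - 1) * w)"
          for a b G t w :: real by (simp add: algebra_simps)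
        define G where "G = sqrt (idx k) * F (idx k) (z / sqrt (idx k))"
        have G: "\<bar>G - H z\<bar> \<le> S (idx k)" unfolding G_def by (rule SH[OF z])
        have "(\<rho> k * Q.prob {\<omega> \<in> space M. z < D k \<omega>} - 1) / \<epsilon> k
            = lam * (sqrt (idx k) * (\<rho> k - 1)) - lam * (\<rho> k * G)"
          using A2(1) sq[of k] unfolding tail \<epsilon>_eq G_def by (simp add: algebra_simps)
        moreover have "B z = lam * (\<theta> / lam) - lam * H z" using z A2(1) by (simp add: B_def)
        ultimately have eq: "(\<rho> k * Q.prob {\<omega> \<in> space M. z < D k \<omega>} - 1) / \<epsilon> k - B z
            = lam * (sqrt (idx k) * (\<rho> k - 1) - \<theta> / lam) - lam * (\<rho> k * (G - H z) + (\<rho> k - 1) * H z)"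
          by (simp only: alg)
        have "\<bar>lam * (\<rho> k * (G - H z) + (\<rho> k - 1) * H z)\<bar> \<le> lam * (\<bar>\<rho> k\<bar> * S (idx k) + \<bar>\<rho> k - 1\<bar> * h)"
        proof -
          have "\<bar>\<rho> k * (G - H z) + (\<rho> k - 1) * H z\<bar> \<le> \<bar>\<rho> k * (G - H z)\<bar> + \<bar>(\<rho> k - 1) * H z\<bar>" by linarith
          also have "\<dots> \<le> \<bar>\<rho> k\<bar> * S (idx k) + \<bar>\<rho> k - 1\<bar> * h"
            unfolding abs_mult using G h[OF z] by (intro add_mono mult_left_mono) auto
          finally show ?thesis using A2(1) by (simp add: abs_mult)
        qed
        moreover have "\<bar>lam * (sqrt (idx k) * (\<rho> k - 1) - \<theta> / lam)\<bar> = lam * \<bar>sqrt (idx k) * (\<rho> k - 1) - \<theta> / lam\<bar>"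
          using A2(1) by (simp only: abs_mult abs_of_pos)
        moreover have "\<bar>x - y\<bar> < e" if "\<bar>y\<bar> \<le> b" "\<bar>x\<bar> = a" "a + b < e" for x y a b :: real
          using that by linarith
        ultimately show "\<bar>(\<rho> k * Q.prob {\<omega> \<in> space M. z < D k \<omega>} - 1) / \<epsilon> k - B z\<bar> < e"
          unfolding eq using elim by blast
      qed
    qed
  qed
  obtain x0 where x0: "0 < x0" "B x0 < 0"
  proof -
    have "\<forall>\<^sub>F x in at_top. ereal (\<theta> / lam) < ereal (H x)" using A4 by (rule order_tendstoD)
    then have "\<forall>\<^sub>F x in at_top. \<theta> / lam < H x \<and> (0::real) < x"
      using eventually_gt_at_top[of 0] by eventually_elim simp
    then obtain x where "\<theta> / lam < H x" "0 < x"
      using eventually_happens'[OF trivial_limit_at_top_linorder] by blast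
    then show ?thesis using A2(1) by (intro that[of x]) (auto simp: B_def field_simps)
  qed
  have B_cont: "continuous_on UNIV B"
    unfolding B_def by (intro continuous_intros continuous_on_compose2[OF Hc]) auto
  have B_Lip: "\<exists>l\<ge>0. \<forall>y\<in>{0..K}. \<forall>z\<in>{0..K}. \<bar>B y - B z\<bar> \<le> l * \<bar>y - z\<bar>" for K
  proof -
    have "compact (H' ` {0..K})" by (intro compact_continuous_image continuous_on_subset[OF A3(4)]) auto
    then obtain b where b: "\<And>z. z \<in> {0..K} \<Longrightarrow> \<bar>H' z\<bar> \<le> b"
      using compact_imp_bounded bounded_real by (metis image_eqI)
    have "\<bar>B y - B z\<bar> \<le> lam * max 0 b * \<bar>y - z\<bar>" if yz: "y \<in> {0..K}" "z \<in> {0..K}" for y z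
    proof -
      have "norm (H y - H z) \<le> max 0 b * norm (y - z)"
      proof (rule field_differentiable_bound[of "{0..K}"])
        show "(H has_field_derivative H' x) (at x within {0..K})" if "x \<in> {0..K}" for x
          using A3(3)[of x] that by (auto intro: has_field_derivative_subset)
        show "norm (H' x) \<le> max 0 b" if "x \<in> {0..K}" for x using b[OF that] by simp
      qed (use yz in auto)
      then have "lam * \<bar>H y - H z\<bar> \<le> lam * (max 0 b * \<bar>y - z\<bar>)" using A2(1) by (intro mult_left_mono) auto
      moreover have "\<bar>B y - B z\<bar> = lam * \<bar>H y - H z\<bar>"
      proof -
        have "B y - B z = - (lam * (H y - H z))" using yz by (simp add: B_def right_diff_distrib)
        then have "\<bar>B y - B z\<bar> = \<bar>lam * (H y - H z)\<bar>" by (simp only: abs_minus)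
        then show ?thesis using A2(1) by (simp only: abs_mult abs_of_pos)
      qed
      ultimately show ?thesis by (simp add: mult.assoc)
    qed
    then show ?thesis using A2(1) by (intro exI[of _ "lam * max 0 b"]) auto
  qed
  define \<Phi> where "\<Phi> k \<nu> \<longleftrightarrow> prob_space \<nu> \<and> sets \<nu> = sets borel2 \<and> (AE \<zeta> in \<nu>. 0 \<le> fst \<zeta> \<and> fst \<zeta> \<le> snd \<zeta>) \<and>
      (\<forall>h c. h \<in> borel_measurable borel2 \<longrightarrow> (\<forall>\<zeta>. h \<zeta> \<le> c) \<longrightarrow> c < \<infinity> \<longrightarrow>
        (\<integral>\<^sup>+\<zeta>. h \<zeta> \<partial>\<nu>) = (\<integral>\<^sup>+\<zeta>. (\<integral>\<^sup>+\<omega>. h (next_wait (\<epsilon> k * u 2 \<omega>) (\<epsilon> k * \<rho> k * v 1 \<omega>) (D k \<omega>) \<zeta>) \<partial>M) \<partial>\<nu>)) \<and>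
      (\<forall>g. g \<in> borel_measurable borel \<longrightarrow> ennreal (\<epsilon> k) * (\<integral>\<^sup>+x. g (snd x) \<partial>\<pi> (idx k))
        = (\<integral>\<^sup>+\<zeta>. (\<integral>\<^sup>+\<omega>. (\<integral>\<^sup>+r. g (max 0 (snd \<zeta> + \<epsilon> k * \<rho> k * v 1 \<omega> * of_bool (fst \<zeta> < D k \<omega>) - r))
          * indicator {0..<\<epsilon> k * u 2 \<omega>} r \<partial>lborel) \<partial>M) \<partial>\<nu>))" for k \<nu>
  have "\<exists>\<nu>. \<Phi> k \<nu>" for k
  proof -
    have rates: "sqrt (real (idx k)) / \<Lambda> (idx k) = \<epsilon> k" "sqrt (real (idx k)) / \<mu> (idx k) = \<epsilon> k * \<rho> k"
      by (simp add: \<epsilon>_def, rule \<epsilon>\<rho>)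
    have scaled_patience: "sqrt (real (idx k)) * d (idx k) 1 \<omega> = D k \<omega>" for \<omega> by (simp only: D_def)
    show ?thesis
    proof (rule Q.stationary_found_law[OF idx1[of k] N(2)[OF idxN[of k]], unfolded rates scaled_patience], goal_cases)
      case (1 \<nu>)
      have "\<Phi> k \<nu>" unfolding \<Phi>_def
        by (intro conjI allI impI 1(1-3)) (rule 1(4), assumption, erule spec, assumption, rule 1(5))
      then show ?case by blast
    qed
  qed
  then obtain \<nu> where \<Phi>: "\<And>k. \<Phi> k (\<nu> k)" by metis
  note \<Phi>' = \<Phi>[unfolded \<Phi>_def]
  have \<nu>: "\<And>k. prob_space (\<nu> k)" "\<And>k. sets (\<nu> k) = sets borel2"
    "\<And>k. AE \<zeta> in \<nu> k. 0 \<le> fst \<zeta> \<and> fst \<zeta> \<le> snd \<zeta>"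
    by (rule \<Phi>'[THEN conjunct1], rule \<Phi>'[THEN conjunct2, THEN conjunct1],
        rule \<Phi>'[THEN conjunct2, THEN conjunct2, THEN conjunct1])
  have \<nu>_inv: "\<And>k h c. h \<in> borel_measurable borel2 \<Longrightarrow> (\<And>\<zeta>. h \<zeta> \<le> c) \<Longrightarrow> c < \<infinity> \<Longrightarrow>
      (\<integral>\<^sup>+\<zeta>. h \<zeta> \<partial>\<nu> k) = (\<integral>\<^sup>+\<zeta>. (\<integral>\<^sup>+\<omega>. h (next_wait (\<epsilon> k * u 2 \<omega>) (\<epsilon> k * \<rho> k * v 1 \<omega>) (D k \<omega>) \<zeta>) \<partial>M) \<partial>\<nu> k)"
  proof -
    fix k h and c :: ennreal
    assume a: "h \<in> borel_measurable borel2" "\<And>\<zeta>. h \<zeta> \<le> c" "c < \<infinity>"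
    show "(\<integral>\<^sup>+\<zeta>. h \<zeta> \<partial>\<nu> k)
        = (\<integral>\<^sup>+\<zeta>. (\<integral>\<^sup>+\<omega>. h (next_wait (\<epsilon> k * u 2 \<omega>) (\<epsilon> k * \<rho> k * v 1 \<omega>) (D k \<omega>) \<zeta>) \<partial>M) \<partial>\<nu> k)"
      by (rule \<Phi>'[THEN conjunct2, THEN conjunct2, THEN conjunct2, THEN conjunct1, THEN spec, THEN spec,
            THEN mp, THEN mp, THEN mp, OF a(1) _ a(3)]) (rule allI, rule a(2))
  qed
  have \<nu>_palm: "\<And>k g. g \<in> borel_measurable borel \<Longrightarrow> ennreal (\<epsilon> k) * (\<integral>\<^sup>+x. g (snd x) \<partial>\<pi> (idx k))
      = (\<integral>\<^sup>+\<zeta>. (\<integral>\<^sup>+\<omega>. (\<integral>\<^sup>+r. g (max 0 (snd \<zeta> + \<epsilon> k * \<rho> k * v 1 \<omega> * of_bool (fst \<zeta> < D k \<omega>) - r))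
        * indicator {0..<\<epsilon> k * u 2 \<omega>} r \<partial>lborel) \<partial>M) \<partial>\<nu> k)"
    by (rule \<Phi>'[THEN conjunct2, THEN conjunct2, THEN conjunct2, THEN conjunct2, THEN spec, THEN mp])
  have u_nonneg: "AE \<omega> in M. 0 \<le> u 2 \<omega>" and v_nonneg: "AE \<omega> in M. 0 \<le> v 1 \<omega>"
    by (rule Q.u_nonneg, simp, rule Q.v_nonneg, simp)
  have id_meas: "(\<lambda>x::real. x) \<in> borel_measurable borel" and sq_meas: "(\<lambda>x::real. x\<^sup>2) \<in> borel_measurable borel"
    and const_meas: "(\<lambda>_::real. 1::real) \<in> borel_measurable borel" by measurable
  have one: "integrable M (\<lambda>_. 1::real)" "Q.expectation (\<lambda>_. 1::real) = 1" by (simp_all add: Q.prob_space)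
  have survive_v: "Q.expectation (\<lambda>\<omega>. v 1 \<omega> * of_bool (z < D k \<omega>)) = Q.prob {\<omega> \<in> space M. z < D k \<omega>}" for k z
    using survive[OF const_meas id_meas one(1) Q.v_mean(1), of z k] by (simp only: one(2) Q.v_mean(2) mult_1)
  have survive_v2: "Q.expectation (\<lambda>\<omega>. (v 1 \<omega>)\<^sup>2 * of_bool (z < D k \<omega>))
      = Q.expectation (\<lambda>\<omega>. (v 1 \<omega>)\<^sup>2) * Q.prob {\<omega> \<in> space M. z < D k \<omega>}" for k z
    using survive[OF const_meas sq_meas one(1) v_sq, of z k] by (simp only: one(2) mult_1)
  have survive_uv: "Q.expectation (\<lambda>\<omega>. u 2 \<omega> * v 1 \<omega> * of_bool (z < D k \<omega>))
      = Q.prob {\<omega> \<in> space M. z < D k \<omega>}" for k z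
    using survive[OF id_meas id_meas Q.u_mean(1) Q.v_mean(1), of z k] by (simp only: Q.u_mean(2) Q.v_mean(2) mult_1)
  have pos: "0 < \<epsilon> k" "0 < \<rho> k" for k using \<Lambda>pos[of k] sq[of k] by (simp_all add: \<epsilon>_def \<rho>_def)
  have E: "found_chains_axioms M (u 2) (v 1) D \<nu> \<epsilon> \<rho> B p x0"
    by (rule found_chains_axioms.intro[OF u_meas v_meas(1) D_meas u_nonneg v_nonneg A1(1) u_p v_p
          Q.u_mean Q.v_mean survive_v survive_v2 survive_uv \<nu> \<nu>_inv pos(1) \<epsilon>lim pos(2) \<rho>lim drift
          x0 B_cont B_Lip var_pos[unfolded s2_def]])
  interpret E: found_chains M "u 2" "v 1" D \<nu> \<epsilon> \<rho> B p x0
    by (rule found_chains.intro[OF Q.prob_space_axioms E])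
  define \<beta> where "\<beta> x = 2 / \<sigma>2 * (\<theta> / lam * x - (LBINT s:{0..x}. H s))" for x
  define r where "r x = limit_density C \<sigma>2 \<theta> lam H x * indicator {0..} x" for x
  have \<sigma>2pos: "0 < \<sigma>2" using var_pos A2(1) s2 by (simp add: zero_less_mult_iff)
  have d\<beta>: "(\<beta> has_real_derivative 2 / E.\<sigma>2 * B t) (at t)" if t: "0 < t" for t
  proof -
    have "(\<beta> has_real_derivative 2 / \<sigma>2 * (\<theta> / lam * 1 - H t)) (at t)"
      unfolding \<beta>_def by (intro DERIV_cmult DERIV_diff DERIV_ident LBINT_derivative[OF Hc t])
    moreover have "2 / \<sigma>2 * (\<theta> / lam * 1 - H t) = 2 / s2 * B t"
      using t A2(1) \<sigma>2pos by (simp add: s2 B_def field_simps)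
    ultimately show ?thesis by (simp add: s2_def)
  qed
  have r_eq: "r t = C * exp (\<beta> t)" if "0 < t" for t
    using that by (simp add: r_def limit_density_def \<beta>_def)
  have r_meas: "r \<in> borel_measurable borel"
  proof -
    have "continuous_on {0<..} (\<lambda>t. C * exp (\<beta> t))"
      by (intro continuous_intros continuous_at_imp_continuous_on ballI DERIV_isCont[OF d\<beta>]) auto
    then have m1: "(\<lambda>t. indicator {0<..} t *\<^sub>R (C * exp (\<beta> t))) \<in> borel_measurable borel"
      by (intro borel_measurable_continuous_on_indicator) auto
    have m2: "(\<lambda>t::real. indicator {0} t * r 0) \<in> borel_measurable borel"
      by (intro borel_measurable_times borel_measurable_indicator borel_measurable_const) auto
    \<comment> \<open>The formula for \<open>r\<close> via \<open>\<beta>\<close> is available on the open half-line; the point 0 is split off.\<close>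
    have eq: "r = (\<lambda>t. indicator {0<..} t *\<^sub>R (C * exp (\<beta> t)) + indicator {0} t * r 0)"
      using r_eq by (auto simp: fun_eq_iff indicator_def r_def)
    show ?thesis using borel_measurable_add[OF m1 m2] by (simp only: eq[symmetric])
  qed
  have dens: "ennreal (limit_density C \<sigma>2 \<theta> lam H x) * indicator {0..} x = ennreal (r x)" for x
    by (simp add: r_def indicator_def)
  have P_eq: "P = density lborel (\<lambda>x. ennreal (r x))" unfolding P dens ..
  have P_prob: "prob_space P"
  proof
    have "emeasure P (space P) = (\<integral>\<^sup>+x. ennreal (r x) \<partial>lborel)"
      unfolding P_eq using r_meas by (subst emeasure_density) auto
    then show "emeasure P (space P) = 1" using C(2) by (simp add: dens)
  qed
  define \<pi>1 where "\<pi>1 k = \<pi>0 (idx k)" for k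
  have st: "prob_space (\<pi> (idx k))" "sets (\<pi> (idx k)) = sets borel" for k
    using N(2)[OF idxN[of k]] by (auto simp: stationary_distribution_def)
  have snd_m: "snd \<in> \<pi> (idx k) \<rightarrow>\<^sub>M borel" for k
    using measurable_cong_sets[OF st(2)[of k, folded borel_prod] refl] measurable_snd by blast
  have \<pi>1_prob: "prob_space (\<pi>1 k)" "sets (\<pi>1 k) = sets borel" for k
    unfolding \<pi>1_def marginal using snd_m st by (auto intro: prob_space.prob_space_distr)
  have \<pi>1_inv: "ennreal (\<epsilon> k) * (\<integral>\<^sup>+x. g x \<partial>\<pi>1 k) = E.inversion_integral k g" if g: "g \<in> borel_measurable borel" for k g
  proof -
    have "(\<integral>\<^sup>+x. g x \<partial>\<pi>1 k) = (\<integral>\<^sup>+x. g (snd x) \<partial>\<pi> (idx k))"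
      unfolding \<pi>1_def marginal using snd_m g by (simp add: nn_integral_distr)
    then show ?thesis using \<nu>_palm[OF g, of k] by (simp only: E.inversion_integral_def)
  qed
  have r0: "0 \<le> r t" for t using C(1) by (simp add: r_def limit_density_def)
  have r_neg: "r t = 0" if "t < 0" for t using that by (simp add: r_def)
  note L = E.stationary_limit[OF d\<beta> r_meas r0 r_neg r_eq C(1) P_eq P_prob \<pi>1_prob \<pi>1_inv]
  have "weak_conv_m \<pi>0 P"
    unfolding weak_conv_m_def weak_conv_def
  proof (intro allI impI)
    fix x assume "isCont (cdf P) x"
    then have "(\<lambda>k. cdf (\<pi>0 (k + N)) x) \<longlonglongrightarrow> cdf P x"
      using L(1) by (simp add: weak_conv_m_def weak_conv_def \<pi>1_def idx_def)
    then show "(\<lambda>n. cdf (\<pi>0 n) x) \<longlonglongrightarrow> cdf P x" by (rule LIMSEQ_offset)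
  qed
  moreover have "(\<forall>\<^sub>F n in sequentially. integrable (\<pi>0 n) (\<lambda>x. x powr m))
      \<and> integrable P (\<lambda>x. x powr m) \<and> (\<lambda>n. \<integral>x. x powr m \<partial>\<pi>0 n) \<longlonglongrightarrow> (\<integral>x. x powr m \<partial>P)"
    if m: "m \<in> {0<..<p - 1}" for m
  proof (intro conjI)
    have L2: "\<forall>\<^sub>F k in sequentially. integrable (\<pi>1 k) (\<lambda>x. x powr m)" "integrable P (\<lambda>x. x powr m)"
        "(\<lambda>k. \<integral>x. x powr m \<partial>\<pi>1 k) \<longlonglongrightarrow> (\<integral>x. x powr m \<partial>P)"
      using L(2)[of m] m by auto
    show "\<forall>\<^sub>F n in sequentially. integrable (\<pi>0 n) (\<lambda>x. x powr m)"
      using L2(1) unfolding \<pi>1_def idx_def by (subst (asm) eventually_sequentially_seg)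
    show "integrable P (\<lambda>x. x powr m)" by (rule L2(2))
    show "(\<lambda>n. \<integral>x. x powr m \<partial>\<pi>0 n) \<longlonglongrightarrow> (\<integral>x. x powr m \<partial>P)"
      by (rule LIMSEQ_offset[where k = N]) (use L2(3) in \<open>simp only: \<pi>1_def idx_def\<close>)
  qed
  ultimately show ?thesis by blast
qed

end
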